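(* Let $\Theta$ be a Blaschke product on the unit disc $\mathbb{D}$ with zeros $\{a_k\}$ (listed with multiplicity). Then the following conditions are equivalent: (a) $\Theta\in\mathcal{P}$. (b) The functions $S_t(z)=\sum_{j:\rho(z,a_j)\ge t}(1-\rho(z,a_j))$, $z\in\mathbb{D}$, satisfy $$\lim_{t\to1}\ \sup_{z\in\mathbb{D}}S_t(z)=0.$$ (c) The zeros satisfy $$\lim_{\delta\to0}\ \sup_{\theta\in\mathbb{R},\,h>0}\ \frac1h\sum_{a_k\in Q(\theta,h,\delta)}(1-|a_k|)=0,$$ where $Q(\theta,h,\delta)=\{re^{i\theta'}: 0<1-r<\delta h,\ |\theta'-\theta|<h\}$. (d) Every inner function which divides $\Theta$ in $H^\infty$ satisfies the Sharp Invertibility Property (SIP).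
   Context: $H^\infty$ is the algebra of bounded analytic functions on $\mathbb{D}$ with the sup norm $\|\cdot\|_\infty$; an inner function is an element of $H^\infty$ with radial limits of modulus $1$ a.e. on $\partial\mathbb{D}$. $\rho(z,w)=\left|\frac{z-w}{1-\bar wz}\right|$. A Blaschke product with zeros $\{a_j\}$ (with multiplicity) is Carleson--Newman, written $\in(CN)$, if $\mu=\sum_j(1-|a_j|)\delta_{a_j}$ is a Carleson measure, i.e. there is $C>0$ with $\mu(Q(I))\le C|I|$ for every arc $I\subset\partial\mathbb{D}$, where $Q(I)=\{z\in\mathbb{D}: z/|z|\in I,\ 1-|z|\le|I|\}$. For $a\in\mathbb{D}$, $\varphi_a(w)=\frac{a-w}{1-\bar aw}$. $\mathcal{M}$ is the set of inner functions $\Theta$ with $\varphi_a\circ\Theta\in(CN)$ (up to a unimodular constant) for every $a\in\mathbb{D}\setminus\{0\}$, and $\mathcal{P}=(CN)\cap\mathcal{M}$. SIP for an inner function $\Phi$ with zero set $\mathcal{Z}(\Phi)\subset\mathbb{D}$: for every $\varepsilon>0$ there exists $\delta>0$ such that for every $f\in H^\infty$, the conditions $\|[f]\|\le1$ and $\inf_{\mathcal{Z}(\Phi)}|f|\ge1-\delta$ (vacuous if $\mathcal{Z}(\Phi)=\emptyset$) imply that $[f]$ is invertible in $H^\infty/\Phi H^\infty$ and $\|[f]^{-1}\|\le1+\varepsilon$, where $\|[f]\|=\inf\{\|f+g\Phi\|_\infty:g\in H^\infty\}$. *)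

theory Defs
  imports "HOL-Complex_Analysis.Complex_Analysis"
begin

text \<open>
  Functions on the unit disc are total functions on the complex plane of which only the
  values on the disc matter: every notion below is insensitive to the values elsewhere,
  and equality of functions is always stated pointwise on the disc.
\<close>

abbreviation unit_disc :: "complex set" where
  "unit_disc \<equiv> ball 0 1"

definition Hinf :: "(complex \<Rightarrow> complex) set" where
  "Hinf = {f. f holomorphic_on unit_disc \<and> bounded (f ` unit_disc)}"

definition hnorm :: "(complex \<Rightarrow> complex) \<Rightarrow> real" where
  "hnorm f = (SUP z\<in>unit_disc. cmod (f z))"

text \<open>
  By periodicity, almost everywhere on the unit circle is the same as for almost every
  real angle.
\<close>
definition inner_function :: "(complex \<Rightarrow> complex) \<Rightarrow> bool" where
  "inner_function f \<longleftrightarrow> f \<in> Hinf \<and>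
     (AE t in lborel. \<exists>l. ((\<lambda>r. f (of_real r * cis t)) \<longlongrightarrow> l) (at_left 1) \<and> cmod l = 1)"

definition Hinf_dvd :: "(complex \<Rightarrow> complex) \<Rightarrow> (complex \<Rightarrow> complex) \<Rightarrow> bool" where
  "Hinf_dvd \<Phi> f \<longleftrightarrow> (\<exists>g\<in>Hinf. \<forall>z\<in>unit_disc. f z = \<Phi> z * g z)"

definition rho :: "complex \<Rightarrow> complex \<Rightarrow> real" where
  "rho z w = cmod ((z - w) / (1 - cnj w * z))"

definition disc_aut :: "complex \<Rightarrow> complex \<Rightarrow> complex" where
  "disc_aut a w = (a - w) / (1 - cnj a * w)"


subsection \<open>Blaschke products\<close>

definition blaschke_factor :: "complex \<Rightarrow> complex \<Rightarrow> complex" where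
  "blaschke_factor a z = (if a = 0 then z else of_real (cmod a) / a * ((a - z) / (1 - cnj a * z)))"

text \<open>
  The zeros are listed with multiplicity as the family \<open>(a j)\<close>, \<open>j \<in> J\<close>, for an index
  set \<open>J\<close> of natural numbers which may be finite, or even empty. A Blaschke product is only
  determined by its zeros up to a unimodular constant \<open>c\<close>.
\<close>
definition blaschke_product :: "(complex \<Rightarrow> complex) \<Rightarrow> nat set \<Rightarrow> (nat \<Rightarrow> complex) \<Rightarrow> bool" where
  "blaschke_product \<Theta> J a \<longleftrightarrow>
     (\<forall>j\<in>J. a j \<in> unit_disc) \<and>
     (\<lambda>j. 1 - cmod (a j)) summable_on J \<and>
     (\<exists>c. cmod c = 1 \<and>
        (\<forall>z\<in>unit_disc. \<Theta> z = c * (\<Prod>j. if j \<in> J then blaschke_factor (a j) z else 1)))"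


subsection \<open>Carleson measures and the classes (CN), M and P\<close>

definition circle_arc :: "real \<Rightarrow> real \<Rightarrow> complex set" where
  "circle_arc \<alpha> l = cis ` {\<alpha>..\<alpha> + l}"

text \<open>
  The box over the arc \<open>I\<close> of length \<open>l\<close>. Since \<open>sgn z = z / |z|\<close> and \<open>sgn 0 = 0\<close>, the
  origin belongs to no box.
\<close>
definition carleson_box :: "complex set \<Rightarrow> real \<Rightarrow> complex set" where
  "carleson_box I l = {z \<in> unit_disc. sgn z \<in> I \<and> 1 - cmod z \<le> l}"

definition carleson_measure :: "complex measure \<Rightarrow> bool" where
  "carleson_measure \<mu> \<longleftrightarrow> (\<exists>C>0. \<forall>\<alpha> l. 0 < l \<and> l \<le> 2 * pi \<longrightarrow>
     emeasure \<mu> (carleson_box (circle_arc \<alpha> l) l) \<le> ennreal (C * l))"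

text \<open>
  The measure \<open>\<Sum>j. (1 - |a j|) \<delta>(a j)\<close>, as the image under \<open>a\<close> of the measure on \<open>J\<close> with
  point masses \<open>1 - |a j|\<close>.
\<close>
definition zeros_measure :: "nat set \<Rightarrow> (nat \<Rightarrow> complex) \<Rightarrow> complex measure" where
  "zeros_measure J a = distr (point_measure J (\<lambda>j. ennreal (1 - cmod (a j)))) borel a"

lemma carleson_box_borel: "carleson_box (circle_arc \<alpha> l) h \<in> sets borel"
proof -
  have "closed (circle_arc \<alpha> l)"
    unfolding circle_arc_def
    by (intro compact_imp_closed compact_continuous_image continuous_intros) auto
  hence [measurable]: "circle_arc \<alpha> l \<in> sets borel"
    by simp
  have eq: "sgn = (\<lambda>z::complex. z /\<^sub>R norm z)"
    by (simp add: fun_eq_iff sgn_div_norm)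
  have [measurable]: "(sgn :: complex \<Rightarrow> complex) \<in> borel_measurable borel"
    unfolding eq by measurable
  have "{z \<in> space borel. cmod z < 1 \<and> sgn z \<in> circle_arc \<alpha> l \<and> 1 - cmod z \<le> h} \<in> sets borel"
    by measurable
  thus ?thesis
    by (simp add: carleson_box_def)
qed

lemma emeasure_zeros_measure:
  assumes "A \<in> sets borel"
  shows "emeasure (zeros_measure J a) A =
           (\<Sum>\<^sub>\<infinity>j\<in>{j\<in>J. a j \<in> A}. ennreal (1 - cmod (a j)))"
proof -
  let ?M = "point_measure J (\<lambda>j. ennreal (1 - cmod (a j)))"
  have sp: "space ?M = J" "sets ?M = Pow J"
    by (simp_all add: space_point_measure sets_point_measure)
  have "emeasure (zeros_measure J a) A = emeasure ?M {j\<in>J. a j \<in> A}"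
    unfolding zeros_measure_def using assms sp
    by (subst emeasure_distr) (auto simp: measurable_def intro!: arg_cong2[of _ _ _ _ emeasure])
  also have "\<dots> = (\<integral>\<^sup>+ j. ennreal (1 - cmod (a j)) \<partial>count_space {j\<in>J. a j \<in> A})"
    unfolding point_measure_def
    by (subst emeasure_density)
       (auto simp: nn_integral_count_space_indicator indicator_def
             intro!: nn_integral_cong if_cong split: if_splits)
  also have "\<dots> = (\<integral>\<^sup>+ j. ennreal (1 - cmod (a j)) * indicator {j\<in>J. a j \<in> A} j \<partial>count_space UNIV)"
    by (simp add: nn_integral_count_space_indicator)
  also have "\<dots> = (\<Sum>j. ennreal (1 - cmod (a j)) * indicator {j\<in>J. a j \<in> A} j)"
    by (rule nn_integral_count_space_nat)
  also have "\<dots> = (\<Sum>\<^sub>\<infinity>j. ennreal (1 - cmod (a j)) * indicator {j\<in>J. a j \<in> A} j)"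
    by (intro sums_unique[symmetric] has_sum_imp_sums has_sum_infsum
          nonneg_summable_on_complete) auto
  also have "\<dots> = (\<Sum>\<^sub>\<infinity>j\<in>{j\<in>J. a j \<in> A}. ennreal (1 - cmod (a j)))"
    by (rule infsum_cong_neutral) (auto simp: indicator_def)
  finally show ?thesis .
qed

definition CN :: "(complex \<Rightarrow> complex) set" where
  "CN = {B. \<exists>J a. blaschke_product B J a \<and> carleson_measure (zeros_measure J a)}"

text \<open>
  Membership in \<open>CN\<close> is invariant under multiplication by unimodular constants, so the
  clause ``up to a unimodular constant'' is built in.
\<close>
definition M_class :: "(complex \<Rightarrow> complex) set" where
  "M_class = {\<Theta>. inner_function \<Theta> \<and> (\<forall>a\<in>unit_disc - {0}. disc_aut a \<circ> \<Theta> \<in> CN)}"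

definition P_class :: "(complex \<Rightarrow> complex) set" where
  "P_class = CN \<inter> M_class"


subsection \<open>The Sharp Invertibility Property\<close>

definition quot_eq :: "(complex \<Rightarrow> complex) \<Rightarrow> (complex \<Rightarrow> complex) \<Rightarrow> (complex \<Rightarrow> complex) \<Rightarrow> bool" where
  "quot_eq \<Phi> f g \<longleftrightarrow> Hinf_dvd \<Phi> (\<lambda>z. f z - g z)"

definition quot_norm :: "(complex \<Rightarrow> complex) \<Rightarrow> (complex \<Rightarrow> complex) \<Rightarrow> real" where
  "quot_norm \<Phi> f = (INF g\<in>Hinf. hnorm (\<lambda>z. f z + g z * \<Phi> z))"

text \<open>
  The class of \<open>k\<close> below is the inverse of the class of \<open>f\<close>; inverses in the quotient
  algebra being unique, its norm does not depend on the choice of \<open>k\<close>.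
\<close>
definition SIP :: "(complex \<Rightarrow> complex) \<Rightarrow> bool" where
  "SIP \<Phi> \<longleftrightarrow> (\<forall>\<epsilon>>0. \<exists>\<delta>>0. \<forall>f\<in>Hinf.
     quot_norm \<Phi> f \<le> 1 \<and> (\<forall>z\<in>unit_disc. \<Phi> z = 0 \<longrightarrow> cmod (f z) \<ge> 1 - \<delta>) \<longrightarrow>
     (\<exists>k\<in>Hinf. quot_eq \<Phi> (\<lambda>z. f z * k z) (\<lambda>z. 1) \<and> quot_norm \<Phi> k \<le> 1 + \<epsilon>))"


subsection \<open>The quantities in the geometric conditions\<close>

text \<open>
  The sums are taken in the extended nonnegative reals, since the suprema over them that
  occur in the theorem may be infinite.
\<close>
definition S_sum :: "nat set \<Rightarrow> (nat \<Rightarrow> complex) \<Rightarrow> real \<Rightarrow> complex \<Rightarrow> ennreal" where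
  "S_sum J a t z = (\<Sum>\<^sub>\<infinity>j\<in>{j\<in>J. rho z (a j) \<ge> t}. ennreal (1 - rho z (a j)))"

definition thin_box :: "real \<Rightarrow> real \<Rightarrow> real \<Rightarrow> complex set" where
  "thin_box \<theta> h \<delta> = {of_real r * cis \<theta>' | r \<theta>'. 0 \<le> r \<and> 0 < 1 - r \<and> 1 - r < \<delta> * h \<and> \<bar>\<theta>' - \<theta>\<bar> < h}"

end

theory Submission
  imports Defs
begin

text \<open>
  Write \<open>kap z a = 1 - (rho z a)\<^sup>2\<close>. Both (b) and (c) say that the sums of \<open>kap z (a j)\<close> over the zeros that are
  far from \<open>z\<close> are uniformly small (\<open>bsm\<close>); this is a dyadic decomposition.

  (b) implies (a): outside the discs around the zeros \<open>|\<Theta>|\<close> is close to 1, so \<open>disc_aut \<alpha> \<circ> \<Theta>\<close> cannot be small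
  on a large disc, and an inner function with this property is a Carleson--Newman product.
  (a) implies (b): at points where the far zeros carry almost the extremal mass, \<open>\<Theta>\<close> is nearly a constant \<open>\<alpha> \<noteq> 0\<close>
  on a fixed disc, so that \<open>disc_aut \<alpha> \<circ> \<Theta>\<close> violates the lower bound for Carleson--Newman products.

  (d) implies (b): choose points \<open>z n\<close> and finite groups of zeros far from all of them with mass bounded below. For
  the product \<open>\<Phi>\<close> of these zeros the functions \<open>disc_aut (z n)\<close> have modulus close to 1 on the zeros, but inverses modulo
  \<open>\<Phi>\<close> of norm close to 1 would force \<open>|\<Phi> (z n)|\<close> to be close to 1.
  (b) implies (d): on a separated set the Gram matrix of the kernels weighted by \<open>1 - cnj (f x) * f y\<close> is small
  compared with the Gram matrix itself, because by (b) the kernels may be replaced by differences with kernels at deeper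
  points, which decouple. By Pick interpolation \<open>1 / f\<close> is interpolated with norm close to 1 on a net of the discs
  around the zeros; a small correction and a normal family argument do the rest.
\<close>

text \<open>All conditions on the zeros are stated for finite subsets, so that summability is a
  conclusion and not a side condition. In (b) ==> (d) the obstacle is that Schwarz-Pick bounds
  \<open>1 - cnj (f x) * f y\<close> only by \<open>2 * \<delta> / sqrt (kap x y)\<close>. Against a
  normalised Gram entry, of modulus \<open>sqrt (kap x y)\<close>, this gives the same bound
  \<delta> for near and for far pairs, and such a matrix has no bounded row sums. A second
  difference of kernels has size \<open>kap\<close> to the power 3/2; after weighting,
  \<open>\<delta> * kap\<close> remains, and row sums of \<open>kap\<close> are bounded. The kernels
  introduced for this purpose are small in norm precisely because of (b). The interpolation is
  carried out on a net and not at the zeros, since zeros may be repeated or clustered and the error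
  must be small on whole discs around them. Singular inner factors are excluded by showing that a
  zero-free remainder and its reciprocal are both bounded by 1, with a maximum principle for radial
  limits.\<close>

abbreviation hol :: "(complex \<Rightarrow> complex) \<Rightarrow> bool" where "hol f \<equiv> f holomorphic_on ball 0 1"

abbreviation hol_le :: "real \<Rightarrow> (complex \<Rightarrow> complex) \<Rightarrow> bool" where
 "hol_le M f \<equiv> f holomorphic_on ball 0 1 \<and> (\<forall>z. cmod z < 1 \<longrightarrow> cmod (f z) \<le> M)"

section \<open>The pseudohyperbolic metric\<close>

text \<open>The squared modulus of the inner product of the normalised Szego kernels at
  \<open>z\<close> and \<open>a\<close>. This is why the same quantity governs Blaschke products,
  Carleson measures and Gram matrices below.\<close>

definition kap :: "complex \<Rightarrow> complex \<Rightarrow> real" where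
 "kap z a = (1 - (cmod z)\<^sup>2) * (1 - (cmod a)\<^sup>2) / (cmod (1 - cnj a * z))\<^sup>2"

lemma one_minus_le_norm_den:
 assumes "cmod z \<le> 1"
 shows "1 - cmod a \<le> cmod (1 - cnj a * z)"
proof -
 have "cmod (cnj a * z) \<le> cmod a * 1"
  unfolding norm_mult complex_mod_cnj using assms by (intro mult_left_mono) auto
 then show ?thesis
  using norm_triangle_ineq2[of 1 "cnj a * z"] by simp
qed

lemma one_minus_le_norm_den':
 assumes "cmod a \<le> 1"
 shows "1 - cmod z \<le> cmod (1 - cnj a * z)"
proof -
 have "cmod (cnj a * z) \<le> 1 * cmod z"
  unfolding norm_mult complex_mod_cnj using assms by (intro mult_right_mono) auto
 then show ?thesis
  using norm_triangle_ineq2[of 1 "cnj a * z"] by simp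
qed

lemma den_nonzero:
 assumes "cmod z \<le> 1" "cmod a < 1"
 shows "1 - cnj a * z \<noteq> 0"
 using one_minus_le_norm_den[OF assms(1), of a] assms(2) by auto

lemma norm_den_commute: "cmod (1 - cnj a * z) = cmod (1 - cnj z * a)"
proof -
 have "cnj (1 - cnj a * z) = 1 - cnj z * a" by (simp add: mult.commute)
 then show ?thesis by (metis complex_mod_cnj)
qed

lemma norm_den_sq:
 "(cmod (1 - cnj a * z))\<^sup>2 = (cmod (z - a))\<^sup>2 + (1 - (cmod z)\<^sup>2) * (1 - (cmod a)\<^sup>2)"
 unfolding cmod_power2 by (simp add: algebra_simps power2_eq_square)

lemma kap_sym: "kap z a = kap a z"
 unfolding kap_def norm_den_commute[of a z] by simp

lemma one_minus_sq_bounds: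
 assumes "cmod z < 1"
 shows "1 - cmod z \<le> 1 - (cmod z)\<^sup>2" "1 - (cmod z)\<^sup>2 \<le> 2 * (1 - cmod z)" "0 < 1 - (cmod z)\<^sup>2" "1 - (cmod z)\<^sup>2 \<le> 1"
proof -
 have "(1 - cmod z)\<^sup>2 \<ge> 0" "cmod z * cmod z \<le> cmod z * 1"
  using assms by (simp, intro mult_left_mono) auto
 then show "1 - cmod z \<le> 1 - (cmod z)\<^sup>2" "1 - (cmod z)\<^sup>2 \<le> 2 * (1 - cmod z)"
  by (auto simp: power2_eq_square algebra_simps)
 with assms show "0 < 1 - (cmod z)\<^sup>2" by linarith
qed auto

lemma kap_pos: "cmod z < 1 ==> cmod a < 1 ==> 0 < kap z a"
 unfolding kap_def using one_minus_sq_bounds(3)[of z] one_minus_sq_bounds(3)[of a] den_nonzero[of z a]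
 by (auto intro!: divide_pos_pos mult_pos_pos)

lemma rho_sq:
 assumes "cmod z < 1" "cmod a < 1"
 shows "(rho z a)\<^sup>2 = 1 - kap z a"
proof -
 have "cmod (1 - cnj a * z) \<noteq> 0" using den_nonzero[of z a] assms by simp
 then show ?thesis
  using norm_den_sq[of a z] unfolding rho_def kap_def norm_divide
  by (simp add: power_divide field_simps)
qed

lemma rho_nonneg: "0 \<le> rho z a"
 unfolding rho_def by simp

lemma rho_eq_sqrt: "cmod z < 1 ==> cmod a < 1 ==> rho z a = sqrt (1 - kap z a)"
 by (metis rho_nonneg rho_sq real_sqrt_unique)

lemma kap_le_1: "cmod z < 1 ==> cmod a < 1 ==> kap z a \<le> 1"
 using rho_sq[of z a] zero_le_power2[of "rho z a"] by linarith

lemma rho_sym: "cmod z < 1 ==> cmod a < 1 ==> rho z a = rho a z"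
 by (simp add: rho_eq_sqrt kap_sym)

lemma rho_less_1: "cmod z < 1 ==> cmod a < 1 ==> rho z a < 1"
 using kap_pos[of z a] by (simp add: rho_eq_sqrt)

lemma rho_le_iff_kap:
 assumes "cmod z < 1" "cmod a < 1" "0 \<le> t"
 shows "rho z a \<le> t \<longleftrightarrow> 1 - t\<^sup>2 \<le> kap z a"
 using rho_sq[OF assms(1,2)] power_mono_iff[of "rho z a" t 2] rho_nonneg[of z a] assms(3) by auto

lemma rho_ge_iff_kap:
 assumes "cmod z < 1" "cmod a < 1" "0 \<le> t"
 shows "t \<le> rho z a \<longleftrightarrow> kap z a \<le> 1 - t\<^sup>2"
 using rho_sq[OF assms(1,2)] power_mono_iff[of t "rho z a" 2] rho_nonneg[of z a] assms(3) by auto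

lemma kap_rho_bounds:
 assumes "cmod z < 1" "cmod a < 1"
 shows "1 - rho z a \<le> kap z a" "kap z a \<le> 2 * (1 - rho z a)"
proof -
 have "kap z a = (1 - rho z a) * (1 + rho z a)"
  using rho_sq[OF assms] by (simp add: power2_eq_square algebra_simps)
 moreover have "0 \<le> (1 - rho z a) * rho z a" "0 \<le> (1 - rho z a) * (1 - rho z a)"
  using rho_nonneg[of z a] rho_less_1[OF assms] by auto
 ultimately show "1 - rho z a \<le> kap z a" "kap z a \<le> 2 * (1 - rho z a)"
  by (auto simp: algebra_simps)
qed

lemma kap_0 [simp]: "kap 0 a = 1 - (cmod a)\<^sup>2" "kap a 0 = 1 - (cmod a)\<^sup>2"
 by (simp_all add: kap_def)

lemma kap_refl: "cmod a < 1 ==> kap a a = 1"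
 using rho_sq[of a a] by (simp add: rho_def)

section \<open>Harnack inequality for \<open>kap\<close>\<close>

text \<open>In the quotient of \<open>kap w a\<close> by \<open>kap z a\<close>, comparing
  \<open>1 - (cmod w)\<^sup>2\<close> with \<open>1 - (cmod z)\<^sup>2\<close> costs
  \<open>1 / (1 - s)\<^sup>2\<close>, and comparing the denominators costs
  \<open>((1 + s) / (1 - s))\<^sup>2\<close>. The constant depends on the radius \<open>s\<close>
  only, not on \<open>a\<close>.\<close>

definition hC :: "real \<Rightarrow> real" where
 "hC s = (1 + s)\<^sup>2 / (1 - s) ^ 4"

lemma hC_ge_1: "0 \<le> s ==> s < 1 ==> 1 \<le> hC s"
proof -
 assume s: "0 \<le> s" "s < 1"
 have "(1 - s) ^ 4 \<le> 1" using s by (intro power_le_one) auto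
 moreover have "1 \<le> (1 + s)\<^sup>2" using s by (intro one_le_power) auto
 ultimately have "(1 - s) ^ 4 \<le> (1 + s)\<^sup>2" by linarith
 moreover have "0 < (1 - s) ^ 4" using s by simp
 ultimately show ?thesis unfolding hC_def by (simp add: le_divide_eq)
qed

lemma kap_harnack:
 assumes z: "cmod z < 1" and w: "cmod w < 1" and a: "cmod a < 1"
  and zw: "rho z w \<le> s" and s: "s < 1"
 shows "kap w a \<le> hC s * kap z a"
proof -
 have s0: "0 \<le> s" using zw rho_nonneg[of z w] by linarith
 define E where "E = cmod (1 - cnj w * z)"
 have E: "E > 0" unfolding E_def using den_nonzero[of z w] z w by simp
 have d: "cmod (z - w) \<le> s * E"
  using zw E unfolding rho_def norm_divide E_def by (simp add: divide_simps)
 have E1: "E \<le> (1 - (cmod w)\<^sup>2) + cmod (z - w)"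
 proof -
  have "1 - cnj w * z = of_real (1 - (cmod w)\<^sup>2) - cnj w * (z - w)"
   by (simp only: of_real_diff of_real_1 complex_norm_square) (simp add: algebra_simps)
  then have "E \<le> cmod (of_real (1 - (cmod w)\<^sup>2)) + cmod (cnj w * (z - w))"
   unfolding E_def by (metis norm_triangle_ineq4)
  moreover have "cmod (cnj w * (z - w)) \<le> 1 * cmod (z - w)"
   unfolding norm_mult using w by (intro mult_right_mono) auto
  moreover have "cmod (of_real (1 - (cmod w)\<^sup>2)) = 1 - (cmod w)\<^sup>2"
   using one_minus_sq_bounds(3)[OF w] by (simp add: norm_of_real del: of_real_diff)
  ultimately show ?thesis by linarith
 qed
 have E2: "(1 - s) * E \<le> 1 - (cmod w)\<^sup>2" using E1 d by (simp add: algebra_simps)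
 have Ez: "(1 - s) * E \<le> 1 - (cmod z)\<^sup>2"
 proof -
  have "1 - cnj z * w = of_real (1 - (cmod z)\<^sup>2) - cnj z * (w - z)"
   by (simp only: of_real_diff of_real_1 complex_norm_square) (simp add: algebra_simps)
  then have "cmod (1 - cnj z * w) \<le> cmod (of_real (1 - (cmod z)\<^sup>2)) + cmod (cnj z * (w - z))"
   by (metis norm_triangle_ineq4)
  moreover have "cmod (cnj z * (w - z)) \<le> 1 * cmod (w - z)"
   unfolding norm_mult using z by (intro mult_right_mono) auto
  moreover have "cmod (of_real (1 - (cmod z)\<^sup>2)) = 1 - (cmod z)\<^sup>2"
   using one_minus_sq_bounds(3)[OF z] by (simp add: norm_of_real del: of_real_diff)
  ultimately have "E \<le> (1 - (cmod z)\<^sup>2) + cmod (z - w)"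
   unfolding E_def norm_den_commute[of w z] norm_minus_commute[of z w] by linarith
  with d show ?thesis by (simp add: algebra_simps)
 qed
 define Dz where "Dz = cmod (1 - cnj a * z)"
 define Dw where "Dw = cmod (1 - cnj a * w)"
 have Dpos: "Dz > 0" "Dw > 0" unfolding Dz_def Dw_def
  using den_nonzero[of z a] den_nonzero[of w a] z w a by auto
 have D: "Dz \<le> Dw + cmod (z - w)"
 proof -
  have "1 - cnj a * z = (1 - cnj a * w) - cnj a * (z - w)" by (simp add: algebra_simps)
  then have "Dz \<le> Dw + cmod (cnj a * (z - w))"
   unfolding Dz_def Dw_def by (metis norm_triangle_ineq4)
  moreover have "cmod (cnj a * (z - w)) \<le> 1 * cmod (z - w)"
   unfolding norm_mult using a by (intro mult_right_mono) auto
  ultimately show ?thesis by linarith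
 qed
 have Dw': "1 - (cmod w)\<^sup>2 \<le> 2 * Dw"
  unfolding Dw_def by (rule order_trans[OF one_minus_sq_bounds(2)[OF w]
    mult_left_mono[OF one_minus_le_norm_den'[OF less_imp_le[OF a], of w]]]) simp
 have "(1 - s) * cmod (z - w) \<le> (1 - s) * (s * E)" using d s by (intro mult_left_mono) auto
 also have "\<dots> = s * ((1 - s) * E)" by simp
 also have "\<dots> \<le> s * (2 * Dw)" using E2 Dw' s0 by (intro mult_left_mono) auto
 finally have "(1 - s) * Dz \<le> (1 - s) * Dw + 2 * s * Dw"
  using mult_left_mono[OF D, of "1 - s"] s by (simp add: algebra_simps)
 then have D3: "(1 - s) * Dz \<le> (1 + s) * Dw" by (simp add: algebra_simps)
 \<comment> \<open>\<open>kap z w \<le> 1\<close> bounds the product of the two factors by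
   \<open>E\<^sup>2\<close>, and \<open>Ez\<close> bounds \<open>E\<close> by a multiple of
   \<open>1 - (cmod z)\<^sup>2\<close>; one such factor then cancels.\<close>
 have W: "(1 - s)\<^sup>2 * (1 - (cmod w)\<^sup>2) \<le> 1 - (cmod z)\<^sup>2"
 proof -
  have "kap z w \<le> 1" by (rule kap_le_1[OF z w])
  then have k: "(1 - (cmod z)\<^sup>2) * (1 - (cmod w)\<^sup>2) \<le> E\<^sup>2"
   unfolding kap_def E_def[symmetric] using E by (simp add: divide_simps)
  have "(1 - (cmod z)\<^sup>2) * ((1 - s)\<^sup>2 * (1 - (cmod w)\<^sup>2)) \<le> (1 - s)\<^sup>2 * E\<^sup>2"
   using mult_left_mono[OF k, of "(1 - s)\<^sup>2"] by (simp add: algebra_simps)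
  also have "\<dots> = ((1 - s) * E)\<^sup>2" by (simp add: power_mult_distrib)
  also have "\<dots> \<le> (1 - (cmod z)\<^sup>2)\<^sup>2" using Ez s E by (intro power_mono) auto
  finally show ?thesis using one_minus_sq_bounds(3)[OF z] by (simp add: power2_eq_square)
 qed
 have "((1 - s) * Dz)\<^sup>2 \<le> ((1 + s) * Dw)\<^sup>2" using D3 s Dpos by (intro power_mono) auto
 then have sq: "(1 - s)\<^sup>2 * Dz\<^sup>2 \<le> (1 + s)\<^sup>2 * Dw\<^sup>2" by (simp add: power_mult_distrib)
 have "((1 - s)\<^sup>2 * (1 - (cmod w)\<^sup>2)) * ((1 - s)\<^sup>2 * Dz\<^sup>2) \<le> (1 - (cmod z)\<^sup>2) * ((1 + s)\<^sup>2 * Dw\<^sup>2)"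
  by (rule mult_mono[OF W sq]) (use one_minus_sq_bounds(3)[OF z] in auto)
 then have main: "(1 - (cmod w)\<^sup>2) * (1 - s) ^ 4 * Dz\<^sup>2 \<le> (1 + s)\<^sup>2 * (1 - (cmod z)\<^sup>2) * Dw\<^sup>2"
  by (simp add: algebra_simps power4_eq_xxxx power2_eq_square)
 have "(1 - (cmod w)\<^sup>2) / Dw\<^sup>2 \<le> hC s * ((1 - (cmod z)\<^sup>2) / Dz\<^sup>2)"
  unfolding hC_def using main Dpos s by (simp add: divide_simps mult.commute mult.left_commute)
 from mult_right_mono[OF this, of "1 - (cmod a)\<^sup>2"] one_minus_sq_bounds(3)[OF a]
 show ?thesis unfolding kap_def Dz_def Dw_def by (simp add: mult.commute mult.left_commute)
qed

lemma kap_harnack':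
 assumes "cmod z < 1" "cmod w < 1" "cmod a < 1" "rho z w \<le> s" "s < 1"
 shows "kap z a \<le> hC s * kap w a"
 using kap_harnack[of w z a s] assms rho_sym[of z w] by simp

section \<open>Disc automorphisms and the Schwarz-Pick lemma\<close>

lemma disc_aut_den:
 assumes "cmod z < 1" "cmod x < 1" "cmod y < 1"
 shows "1 - cnj (disc_aut z x) * disc_aut z y =
  of_real (1 - (cmod z)\<^sup>2) * (1 - cnj x * y) / ((1 - z * cnj x) * (1 - cnj z * y))"
proof -
 have n: "1 - cnj z * x \<noteq> 0" "1 - cnj z * y \<noteq> 0"
  using den_nonzero[of x z] den_nonzero[of y z] assms by auto
 have n': "1 - z * cnj x \<noteq> 0" using n(1) by (metis complex_cnj_cancel_iff complex_cnj_cnj complex_cnj_diff complex_cnj_mult complex_cnj_one complex_cnj_zero)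
 have c: "complex_of_real (1 - (cmod z)\<^sup>2) = 1 - z * cnj z"
  by (simp only: of_real_diff of_real_1 complex_norm_square)
 have "1 - cnj (disc_aut z x) * disc_aut z y =
  ((1 - z * cnj x) * (1 - cnj z * y) - (cnj z - cnj x) * (z - y)) / ((1 - z * cnj x) * (1 - cnj z * y))"
  unfolding disc_aut_def using n n' by (simp add: divide_simps)
 also have "(1 - z * cnj x) * (1 - cnj z * y) - (cnj z - cnj x) * (z - y) = (1 - z * cnj z) * (1 - cnj x * y)"
  by (simp add: algebra_simps)
 finally show ?thesis unfolding c by simp
qed

lemma norm_disc_aut: "cmod z < 1 ==> cmod x < 1 ==> cmod (disc_aut z x) = rho z x"
 by (metis disc_aut_def norm_divide norm_minus_commute rho_def rho_sym)

lemma disc_aut_lt_1: "cmod z < 1 ==> cmod x < 1 ==> cmod (disc_aut z x) < 1"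
 using norm_disc_aut rho_less_1 by simp

lemma disc_aut_invol:
 assumes "cmod z < 1" "cmod x < 1"
 shows "disc_aut z (disc_aut z x) = x"
proof -
 have n: "1 - cnj z * x \<noteq> 0" "1 - cnj z * z \<noteq> 0"
  using den_nonzero[of x z] den_nonzero[of z z] assms by auto
 have e1: "z - disc_aut z x = x * (1 - cnj z * z) / (1 - cnj z * x)"
  unfolding disc_aut_def using n by (simp add: divide_simps) (simp add: algebra_simps)
 have e2: "1 - cnj z * disc_aut z x = (1 - cnj z * z) / (1 - cnj z * x)"
  unfolding disc_aut_def using n by (simp add: divide_simps) (simp add: algebra_simps)
 show ?thesis
  unfolding disc_aut_def[of z "disc_aut z x"] e1 e2 using n by simp
qed

lemma disc_aut_0 [simp]: "disc_aut z 0 = z" and disc_aut_self [simp]: "disc_aut z z = 0"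
 by (simp_all add: disc_aut_def)

lemma disc_aut_eq_0_iff: "cmod z < 1 ==> cmod x < 1 ==> disc_aut z x = 0 \<longleftrightarrow> x = z"
 using den_nonzero[of x z] by (auto simp: disc_aut_def)

lemma disc_aut_holomorphic: "cmod z < 1 ==> hol (disc_aut z)"
 unfolding disc_aut_def by (intro holomorphic_intros) (use den_nonzero[of _ z] in auto)

lemma disc_aut_continuous: "cmod z < 1 ==> continuous_on (cball 0 1) (disc_aut z)"
 unfolding disc_aut_def by (intro continuous_intros) (use den_nonzero[of _ z] in auto)

lemma holomorphic_disc_aut_comp:
 assumes "hol f" "cmod z < 1"
 shows "hol (\<lambda>x. f (disc_aut z x))"
 using holomorphic_on_compose_gen[OF disc_aut_holomorphic[OF assms(2)] assms(1)] disc_aut_lt_1[OF assms(2)]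
 by (force simp: o_def)

lemma holomorphic_comp_disc_aut:
 assumes "hol f" "\<And>x. x \<in> ball 0 1 ==> cmod (f x) < 1" "cmod z < 1"
 shows "hol (\<lambda>x. disc_aut z (f x))"
 using holomorphic_on_compose_gen[OF assms(1) disc_aut_holomorphic[OF assms(3)]] assms(2)
 by (force simp: o_def)

lemma kap_disc_aut:
 assumes "cmod z < 1" "cmod x < 1" "cmod y < 1"
 shows "kap (disc_aut z x) (disc_aut z y) = kap x y"
proof -
 have n: "cmod (1 - cnj z * x) \<noteq> 0" "cmod (1 - cnj z * y) \<noteq> 0"
  using den_nonzero[of x z] den_nonzero[of y z] assms by auto
 have nn: "cmod (1 - cnj x * y) \<noteq> 0" using den_nonzero[of y x] assms by auto
 have p: "1 - (cmod z)\<^sup>2 > 0" using one_minus_sq_bounds(3)[OF assms(1)] .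
 have *: "1 - (cmod (disc_aut z u))\<^sup>2 = (1 - (cmod z)\<^sup>2) * (1 - (cmod u)\<^sup>2) / (cmod (1 - cnj z * u))\<^sup>2"
  if "cmod u < 1" for u
  using rho_sq[OF assms(1) that] norm_disc_aut[OF assms(1) that] norm_den_commute[of z u]
  unfolding kap_def by simp
 have m: "cmod (1 - z * cnj x) = cmod (1 - cnj z * x)"
  by (metis mult.commute norm_den_commute)
 have **: "cmod (1 - cnj (disc_aut z x) * disc_aut z y) =
   (1 - (cmod z)\<^sup>2) * cmod (1 - cnj x * y) / (cmod (1 - cnj z * x) * cmod (1 - cnj z * y))"
  unfolding disc_aut_den[OF assms] norm_mult norm_divide norm_of_real m using p by simp
 show ?thesis
  unfolding kap_def norm_den_commute[of "disc_aut z y"] norm_den_commute[of y x]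
  unfolding *[OF assms(2)] *[OF assms(3)] **
  using n nn p by (simp add: power_divide power_mult_distrib power2_eq_square)
qed

lemma rho_disc_aut:
 assumes "cmod z < 1" "cmod x < 1" "cmod y < 1"
 shows "rho (disc_aut z x) (disc_aut z y) = rho x y"
 using assms by (simp add: rho_eq_sqrt kap_disc_aut disc_aut_lt_1)

lemma kap_disc_aut':
 assumes "cmod z < 1" "cmod x < 1" "cmod y < 1"
 shows "kap (disc_aut z x) y = kap x (disc_aut z y)"
 using kap_disc_aut[of z "disc_aut z x" y] assms by (simp add: disc_aut_lt_1 disc_aut_invol)

lemma rho_disc_aut':
 assumes "cmod z < 1" "cmod x < 1" "cmod y < 1"
 shows "rho (disc_aut z x) y = rho x (disc_aut z y)"
 using assms by (simp add: rho_eq_sqrt kap_disc_aut' disc_aut_lt_1)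

lemma schwarz_pick:
 assumes f: "hol f" and b: "\<And>x. x \<in> ball 0 1 ==> cmod (f x) < 1"
  and z: "cmod z < 1" and w: "cmod w < 1"
 shows "rho (f z) (f w) \<le> rho z w"
proof -
 define g where "g x = disc_aut (f w) (f (disc_aut w x))" for x
 have fw: "cmod (f w) < 1" using b w by simp
 have bb: "\<And>x. x \<in> ball 0 1 ==> cmod (f (disc_aut w x)) < 1"
  using b disc_aut_lt_1[OF w] by simp
 have "hol g" unfolding g_def
  by (rule holomorphic_comp_disc_aut[OF holomorphic_disc_aut_comp[OF f w] bb fw])
 moreover have "g 0 = 0" by (simp add: g_def)
 moreover have "cmod (g x) < 1" if "cmod x < 1" for x
  unfolding g_def using bb that by (intro disc_aut_lt_1[OF fw]) auto
 ultimately have "cmod (g (disc_aut w z)) \<le> cmod (disc_aut w z)"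
  using disc_aut_lt_1[OF w z] by (intro Schwarz_Lemma(1)) auto
 moreover have "g (disc_aut w z) = disc_aut (f w) (f z)"
  unfolding g_def by (simp add: disc_aut_invol[OF w z])
 ultimately show ?thesis
  using norm_disc_aut[OF fw, of "f z"] norm_disc_aut[OF w z] b[of z] z fw w rho_sym by simp
qed

lemma schwarz_zero:
 assumes f: "hol f" and b: "\<And>x. x \<in> ball 0 1 ==> cmod (f x) \<le> M"
  and z: "cmod z < 1" and w: "cmod w < 1" and 0: "f w = 0"
 shows "cmod (f z) \<le> M * rho z w"
proof -
 have M0: "0 \<le> M" using order_trans[OF norm_ge_zero b[of 0]] by simp
 \<comment> \<open>\<open>schwarz_pick\<close> needs values in the open disc, hence the division by
   some \<open>M' > M\<close>; afterwards \<open>M'\<close> tends to \<open>M\<close>. This also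
   covers \<open>M = 0\<close>.\<close>
 have *: "cmod (f z) \<le> M' * rho z w" if "M' > M" for M'
 proof -
  have M': "M' > 0" using that M0 by linarith
  have "rho (f z / of_real M') (f w / of_real M') \<le> rho z w"
  proof (rule schwarz_pick[OF _ _ z w])
   show "hol (\<lambda>x. f x / complex_of_real M')"
    using f M' by (intro holomorphic_intros) auto
   fix x :: complex assume "x \<in> ball 0 1"
   then show "cmod (f x / of_real M') < 1" using b[of x] that M' by (simp add: norm_divide)
  qed
  then have "cmod (f z) / M' \<le> rho z w" unfolding 0 using M' by (simp add: rho_def norm_divide)
  then show ?thesis using M' by (simp add: pos_divide_le_eq mult.commute)
 qed
 show ?thesis
 proof (rule tendsto_lowerbound)
  show "((\<lambda>M'. M' * rho z w) \<longlongrightarrow> M * rho z w) (at_right M)"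
   by (intro tendsto_intros)
  show "\<forall>\<^sub>F M' in at_right M. cmod (f z) \<le> M' * rho z w"
   using * by (auto simp: eventually_at_right_field intro!: exI[of _ "M + 1"])
 qed simp
qed

lemma near_constant:
 assumes f: "hol f" and b: "\<And>x. x \<in> ball 0 1 ==> cmod (f x) \<le> M"
  and z: "cmod z < 1" and w: "cmod w < 1"
 shows "cmod (f z - f w) \<le> 2 * M * rho z w"
proof -
 have "cmod ((\<lambda>x. f x - f w) z) \<le> 2 * M * rho z w"
 proof (rule schwarz_zero[OF _ _ z w])
  show "hol (\<lambda>x. f x - f w)" using f by (intro holomorphic_intros)
  fix x :: complex assume "x \<in> ball 0 1"
  then show "cmod (f x - f w) \<le> 2 * M" using b[of x] b[of w] w norm_triangle_ineq4[of "f x" "f w"] by simp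
 qed simp
 then show ?thesis by simp
qed

section \<open>Blaschke products\<close>

abbreviation bf :: "complex \<Rightarrow> complex \<Rightarrow> complex" where "bf \<equiv> blaschke_factor"

lemma bf_altdef: "bf a z = (if a = 0 then z else of_real (cmod a) / a * disc_aut a z)"
 by (simp add: blaschke_factor_def disc_aut_def)

lemma norm_bf: "cmod a < 1 ==> cmod z < 1 ==> cmod (bf a z) = rho z a"
 unfolding bf_altdef
 by (auto simp: norm_mult norm_divide norm_disc_aut rho_sym) (simp add: rho_def)

lemma bf_holomorphic: "cmod a < 1 ==> hol (bf a)"
 unfolding bf_altdef[abs_def] by (cases "a = 0") (auto intro!: holomorphic_intros disc_aut_holomorphic)

lemma bf_continuous: "cmod a < 1 ==> continuous_on (cball 0 1) (bf a)"
 unfolding bf_altdef[abs_def] by (cases "a = 0") (auto intro!: continuous_intros disc_aut_continuous)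

lemma norm_bf_sphere:
 assumes "cmod a < 1" "cmod z = 1"
 shows "cmod (bf a z) = 1"
proof -
 have "cmod (a - z) = cmod (1 - cnj a * z)"
  using norm_den_sq[of a z] assms(2) by (simp add: norm_minus_commute)
 moreover have "cmod (1 - cnj a * z) \<noteq> 0" using den_nonzero[of z a] assms by simp
 ultimately show ?thesis using assms by (simp add: blaschke_factor_def norm_mult norm_divide)
qed

lemma bf_self [simp]: "bf a a = 0" by (simp add: bf_altdef)

lemma bf_eq_0_iff: "cmod a < 1 ==> cmod z < 1 ==> bf a z = 0 \<longleftrightarrow> z = a"
 unfolding bf_altdef using disc_aut_eq_0_iff by auto

text \<open>The estimate behind the convergence of Blaschke products: the numerator of
  \<open>1 - bf a z\<close> factors as \<open>1 - cmod a\<close> times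
  \<open>a + of_real (cmod a) * z\<close>.\<close>

lemma norm_one_minus_bf:
 assumes a: "cmod a < 1" and z: "cmod z < 1"
 shows "cmod (1 - bf a z) \<le> (1 - cmod a) * (2 / (1 - cmod z))"
proof (cases "a = 0")
 case True
 have "cmod (1 - z) \<le> 2" using norm_triangle_ineq4[of 1 z] z by simp
 also have "2 \<le> 2 / (1 - cmod z)" using z by (simp add: divide_simps)
 finally show ?thesis using True by (simp add: bf_altdef)
next
 case False
 have n: "1 - cnj a * z \<noteq> 0" using den_nonzero[of z a] assms by auto
 define c where "c = complex_of_real (cmod a)"
 define d where "d = 1 - cnj a * z"
 have "a * cnj a = c * c"
  unfolding c_def by (metis complex_norm_square power2_eq_square of_real_mult)
 then have "a * (cnj a * z) = c * c * z" by (metis mult.assoc)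
 then have key: "a * d - c * (a - z) = (1 - c) * (a + c * z)"
  unfolding d_def by (auto simp: algebra_simps)
 have "1 - bf a z = 1 - c / a * ((a - z) / d)"
  using False unfolding blaschke_factor_def c_def d_def by simp
 also have "\<dots> = (a * d - c * (a - z)) / (a * d)"
  using False n unfolding d_def[symmetric] by (simp add: diff_divide_distrib right_diff_distrib)
 also have "\<dots> = of_real (1 - cmod a) * ((a + of_real (cmod a) * z) / a) / (1 - cnj a * z)"
  unfolding key unfolding c_def d_def by simp
 finally have "1 - bf a z = of_real (1 - cmod a) * ((a + of_real (cmod a) * z) / a) / (1 - cnj a * z)" .
 then have "cmod (1 - bf a z) = (1 - cmod a) * (cmod (a + of_real (cmod a) * z) / cmod a) / cmod (1 - cnj a * z)"
  using a by (simp add: norm_mult norm_divide del: of_real_diff)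
 also have "\<dots> \<le> (1 - cmod a) * 2 / (1 - cmod z)"
 proof (intro frac_le mult_left_mono)
  have "cmod (a + of_real (cmod a) * z) \<le> cmod a + cmod a * cmod z"
   using norm_triangle_ineq[of a "of_real (cmod a) * z"] by (simp add: norm_mult)
  also have "\<dots> \<le> cmod a + cmod a * 1" using z by (intro add_left_mono mult_left_mono) auto
  finally show "cmod (a + of_real (cmod a) * z) / cmod a \<le> 2" using False by (simp add: divide_simps)
  show "1 - cmod z \<le> cmod (1 - cnj a * z)" using one_minus_le_norm_den'[of a z] a by simp
 qed (use a z in auto)
 finally show ?thesis by simp
qed

text \<open>The quotient of \<open>bf a z\<close> by \<open>z - a\<close> has no zero in the disc,
  so only the removable singularity of \<open>g z / (z - a)\<close> matters.\<close>

lemma bf_factor_out: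
 assumes g: "hol g" and a: "cmod a < 1" and 0: "g a = 0"
 shows "\<exists>h. hol h \<and> (\<forall>z\<in>ball 0 1. g z = bf a z * h z)"
proof -
 define h0 where "h0 z = (if z = a then deriv g a else (g z - g a) / (z - a))" for z
 have h0: "hol h0"
  unfolding h0_def by (rule pole_lemma_open[OF g]) simp
 have gz: "g z = (z - a) * h0 z" for z using 0 by (simp add: h0_def)
 define u where "u z = (if a = 0 then 1 else - of_real (cmod a) / a / (1 - cnj a * z))" for z
 have "cnj a * z \<noteq> 1" if "cmod z < 1" for z
  using den_nonzero[of z a] a that by auto
 then have "hol u" unfolding u_def
  by (cases "a = 0") (auto intro!: holomorphic_intros)
 moreover have u: "u z \<noteq> 0" if "z \<in> ball 0 1" for z
  unfolding u_def using that den_nonzero[of z a] a by auto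
 ultimately have "hol (\<lambda>z. h0 z / u z)"
  using h0 by (intro holomorphic_intros)
 moreover have "bf a z = (z - a) * u z" for z
  unfolding u_def blaschke_factor_def by (auto simp: divide_simps) (auto simp: algebra_simps)
 ultimately show ?thesis using gz u by (intro exI[of _ "\<lambda>z. h0 z / u z"]) auto
qed

lemma max_modulus_disc:
 assumes h: "hol h" and r: "r < 1" and z: "cmod z \<le> r"
  and b: "\<And>w. cmod w = r ==> cmod (h w) \<le> B"
 shows "cmod (h z) \<le> B"
proof (rule maximum_modulus_frontier[of h "cball 0 r"])
 have sub: "cball 0 r \<subseteq> ball (0::complex) 1" using r by auto
 show "h holomorphic_on interior (cball 0 r)"
  using h by (rule holomorphic_on_subset) (use sub interior_subset in blast)
 show "continuous_on (closure (cball 0 r)) h"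
  using holomorphic_on_imp_continuous_on[OF h] by (rule continuous_on_subset) (use sub in simp)
qed (use b z r in auto)

text \<open>On circles close to the unit circle the modulus of \<open>bf a\<close> is close to 1, so
  the maximum principle transfers the bound for the product to \<open>h\<close> with a factor
  tending to 1.\<close>

lemma div_bound_single:
 assumes h: "hol h" and a: "cmod a < 1"
  and b: "\<And>z. cmod z < 1 ==> cmod (bf a z * h z) \<le> M" and z: "cmod z < 1"
 shows "cmod (h z) \<le> M"
proof -
 \<comment> \<open>A lower bound for \<open>rho w a\<close> on the circle of radius
   \<open>r\<close>, from \<open>1 - cmod a \<le> cmod (1 - cnj a * w)\<close>. For small
   \<open>r\<close> the argument of \<open>sqrt\<close> can be negative, and so is then its value;
   hence the case distinction.\<close>
 define m where "m r = sqrt (1 - (1 - r\<^sup>2) / (1 - cmod a)\<^sup>2)" for r :: real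
 have M0: "0 \<le> M" using order_trans[OF norm_ge_zero b[of 0]] by simp
 have *: "m r * cmod (h z) \<le> M" if r: "cmod z < r" "r < 1" for r
 proof (cases "m r \<le> 0")
  case True
  then have "m r * cmod (h z) \<le> 0" by (simp add: mult_nonpos_nonneg)
  then show ?thesis using M0 by linarith
 next
  case False
  have "cmod (h z) \<le> M / m r"
  proof (rule max_modulus_disc[OF h r(2)])
   fix w :: complex assume w: "cmod w = r"
   have w1: "cmod w < 1" using w r by simp
   have "kap w a \<le> (1 - r\<^sup>2) / (1 - cmod a)\<^sup>2"
   proof -
    have "kap w a \<le> (1 - r\<^sup>2) * 1 / (1 - cmod a)\<^sup>2"
     unfolding kap_def w
    proof (intro frac_le mult_left_mono power_mono)
     show "1 - cmod a \<le> cmod (1 - cnj a * w)" using one_minus_le_norm_den[of w a] w1 by simp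
     show "0 \<le> 1 - r\<^sup>2" using one_minus_sq_bounds(3)[OF w1] w by simp
    qed (use one_minus_sq_bounds(3)[OF w1] w a in auto)
    then show ?thesis by simp
   qed
   then have mr: "m r \<le> cmod (bf a w)"
    unfolding m_def norm_bf[OF a w1] rho_eq_sqrt[OF w1 a] by simp
   have "m r * cmod (h w) \<le> cmod (bf a w * h w)"
    unfolding norm_mult using mr by (intro mult_right_mono) auto
   also have "\<dots> \<le> M" by (rule b[OF w1])
   finally show "cmod (h w) \<le> M / m r" using False by (simp add: divide_simps mult.commute)
  qed (use r in auto)
  then show ?thesis using False by (simp add: divide_simps mult.commute)
 qed
 show ?thesis
 proof (rule tendsto_upperbound)
  have "((\<lambda>r. m r * cmod (h z)) \<longlongrightarrow> m 1 * cmod (h z)) (at_left 1)"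
   unfolding m_def using a by (intro tendsto_intros) auto
  then show "((\<lambda>r. m r * cmod (h z)) \<longlongrightarrow> cmod (h z)) (at_left 1)" by (simp add: m_def)
  show "\<forall>\<^sub>F r in at_left 1. m r * cmod (h z) \<le> M"
   using * z by (auto simp: eventually_at_left_field intro!: exI[of _ "cmod z"])
 qed simp
qed

section \<open>Finite Blaschke products\<close>

definition BF :: "nat set \<Rightarrow> (nat \<Rightarrow> complex) \<Rightarrow> complex \<Rightarrow> complex" where
 "BF F a z = (\<Prod>j\<in>F. bf (a j) z)"

lemma BF_empty [simp]: "BF {} a z = 1" by (simp add: BF_def)

lemma BF_insert: "finite F ==> j \<notin> F ==> BF (insert j F) a z = bf (a j) z * BF F a z"
 by (simp add: BF_def)

lemma BF_union: "finite F ==> finite G ==> F \<inter> G = {} ==> BF (F \<union> G) a z = BF F a z * BF G a z"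
 by (simp add: BF_def prod.union_disjoint)

lemma BF_holomorphic: "(\<And>j. j \<in> F ==> cmod (a j) < 1) ==> hol (BF F a)"
 unfolding BF_def[abs_def] by (intro holomorphic_intros bf_holomorphic) auto

lemma BF_continuous: "(\<And>j. j \<in> F ==> cmod (a j) < 1) ==> continuous_on (cball 0 1) (BF F a)"
 unfolding BF_def[abs_def] by (intro continuous_intros bf_continuous) auto

lemma norm_BF_sphere: "(\<And>j. j \<in> F ==> cmod (a j) < 1) ==> cmod z = 1 ==> cmod (BF F a z) = 1"
 unfolding BF_def by (simp add: norm_bf_sphere flip: prod_norm)

lemma norm_BF: "(\<And>j. j \<in> F ==> cmod (a j) < 1) ==> cmod z < 1 ==> cmod (BF F a z) = (\<Prod>j\<in>F. rho z (a j))"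
 unfolding BF_def by (simp add: norm_bf flip: prod_norm)

lemma norm_BF_sq:
 "(\<And>j. j \<in> F ==> cmod (a j) < 1) ==> cmod z < 1 ==> (cmod (BF F a z))\<^sup>2 = (\<Prod>j\<in>F. 1 - kap z (a j))"
 by (simp add: norm_BF prod_power_distrib rho_sq)

lemma norm_BF_le_1: "(\<And>j. j \<in> F ==> cmod (a j) < 1) ==> cmod z \<le> 1 ==> cmod (BF F a z) \<le> 1"
proof -
 assume a: "\<And>j. j \<in> F ==> cmod (a j) < 1" and z: "cmod z \<le> 1"
 show ?thesis
 proof (cases "cmod z < 1")
  case True
  then have "(\<Prod>j\<in>F. rho z (a j)) \<le> 1"
   using a rho_nonneg rho_less_1 by (intro prod_le_1) (auto intro: less_imp_le)
  then show ?thesis using norm_BF[OF a True] by simp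
 qed (use norm_BF_sphere[OF a] z in auto)
qed

lemma BF_eq_0_iff:
 "finite F ==> (\<And>j. j \<in> F ==> cmod (a j) < 1) ==> cmod z < 1 ==> BF F a z = 0 \<longleftrightarrow> (\<exists>j\<in>F. a j = z)"
 unfolding BF_def by (auto simp: bf_eq_0_iff)

lemma norm_BF_sq_le_exp:
 assumes "\<And>j. j \<in> F ==> cmod (a j) < 1" "cmod z < 1"
 shows "(cmod (BF F a z))\<^sup>2 \<le> exp (- (\<Sum>j\<in>F. kap z (a j)))"
proof (cases "finite F")
 case True
 have "(\<Prod>j\<in>F. 1 - kap z (a j)) \<le> (\<Prod>j\<in>F. exp (- kap z (a j)))"
 proof (intro prod_mono conjI)
  fix j assume j: "j \<in> F"
  show "0 \<le> 1 - kap z (a j)" using kap_le_1[of z "a j"] assms j by auto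
  show "1 - kap z (a j) \<le> exp (- kap z (a j))" using exp_ge_add_one_self[of "- kap z (a j)"] by linarith
 qed
 also have "\<dots> = exp (- (\<Sum>j\<in>F. kap z (a j)))"
  using True by (simp add: exp_sum sum_negf[symmetric])
 finally show ?thesis using norm_BF_sq assms by simp
qed (simp add: BF_def)

lemma norm_BF_sq_ge:
 assumes "\<And>j. j \<in> F ==> cmod (a j) < 1" "cmod z < 1"
 shows "1 - (\<Sum>j\<in>F. kap z (a j)) \<le> (cmod (BF F a z))\<^sup>2"
 using Weierstrass_prod_ineq[of F "\<lambda>j. kap z (a j)"] norm_BF_sq assms kap_le_1 kap_pos
 by (auto simp: less_imp_le)

lemma one_minus_ge_exp:
 fixes x :: real
 assumes "0 \<le> x" "x \<le> 1 - q" "0 < q"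
 shows "exp (- x / q) \<le> 1 - x"
proof -
 have "1 - x > 0" using assms by linarith
 have "1 + x / (1 - x) \<le> exp (x / (1 - x))" by (rule exp_ge_add_one_self)
 moreover have "1 + x / (1 - x) = 1 / (1 - x)" using \<open>1 - x > 0\<close> by (simp add: divide_simps)
 ultimately have "exp (- (x / (1 - x))) \<le> 1 - x"
  using \<open>1 - x > 0\<close> by (simp add: exp_minus divide_simps mult.commute)
 moreover have "x / (1 - x) \<le> x / q" using assms \<open>1 - x > 0\<close> by (intro divide_left_mono) auto
 ultimately show ?thesis
  by (smt (verit, best) exp_le_cancel_iff minus_divide_left)
qed

text \<open>Together with \<open>norm_BF_sq_le_exp\<close> this determines the modulus from the sum
  of \<open>kap\<close> alone, up to a factor \<open>1 / q\<close> in the exponent; \<open>q\<close>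
  measures the distance to the zeros.\<close>

lemma norm_BF_sq_ge_exp:
 assumes "\<And>j. j \<in> F ==> cmod (a j) < 1" "cmod z < 1" "0 < q"
  and "\<And>j. j \<in> F ==> kap z (a j) \<le> 1 - q"
 shows "exp (- (\<Sum>j\<in>F. kap z (a j)) / q) \<le> (cmod (BF F a z))\<^sup>2"
proof (cases "finite F")
 case True
 have "exp (- (\<Sum>j\<in>F. kap z (a j)) / q) = (\<Prod>j\<in>F. exp (- kap z (a j) / q))"
  using True by (simp add: exp_sum[symmetric] sum_negf sum_divide_distrib)
 also have "\<dots> \<le> (\<Prod>j\<in>F. 1 - kap z (a j))"
  using assms kap_pos by (intro prod_mono conjI one_minus_ge_exp) (auto simp: less_imp_le)
 finally show ?thesis using norm_BF_sq assms by simp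
qed (simp add: BF_def)

lemma div_bound:
 assumes "finite F" "\<And>j. j \<in> F ==> cmod (a j) < 1" "hol h"
  and "\<And>z. cmod z < 1 ==> cmod (BF F a z * h z) \<le> M" "cmod z < 1"
 shows "cmod (h z) \<le> M"
 using assms
proof (induction F arbitrary: h z rule: finite_induct)
 case (insert j F)
 have hol: "hol (\<lambda>z. BF F a z * h z)"
  using insert by (intro holomorphic_intros BF_holomorphic) auto
 show ?case
 proof (rule insert.IH[of h z])
  fix w :: complex assume w: "cmod w < 1"
  show "cmod (BF F a w * h w) \<le> M"
   by (rule div_bound_single[OF hol _ _ w, of "a j"])
     (use insert in \<open>auto simp: BF_insert mult.assoc\<close>)
 qed (use insert in auto)
qed auto

lemma BF_factor_out:
 assumes "finite F" "\<And>j. j \<in> F ==> cmod (a j) < 1" "inj_on a F" "hol g"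
  "\<And>j. j \<in> F ==> g (a j) = 0"
 shows "\<exists>h. hol h \<and> (\<forall>z\<in>ball 0 1. g z = BF F a z * h z)"
 using assms
proof (induction F rule: finite_induct)
 case (insert j F)
 then obtain h where h: "hol h" "\<And>z. z \<in> ball 0 1 ==> g z = BF F a z * h z"
  by (metis inj_on_insert insertI2)
 have aj: "cmod (a j) < 1" using insert by auto
 \<comment> \<open>By injectivity the factors already removed do not vanish at \<open>a j\<close>,
   so the zero of \<open>g\<close> there is passed on to \<open>h\<close>.\<close>
 have "BF F a (a j) \<noteq> 0"
  using insert.hyps insert.prems aj by (subst BF_eq_0_iff) (auto simp: inj_on_def)
 then have "h (a j) = 0" using h(2)[of "a j"] insert.prems aj by auto
 from bf_factor_out[OF h(1) aj this] obtain k where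
  "hol k" "\<And>z. z \<in> ball 0 1 ==> h z = bf (a j) z * k z" by auto
 then show ?case using h(2) insert.hyps by (intro exI[of _ k]) (auto simp: BF_insert)
qed auto

section \<open>Infinite Blaschke products\<close>

definition bseq :: "nat set \<Rightarrow> (nat \<Rightarrow> complex) \<Rightarrow> bool" where
 "bseq J a \<longleftrightarrow> (\<forall>j\<in>J. cmod (a j) < 1) \<and> (\<lambda>j. 1 - cmod (a j)) summable_on J"

text \<open>Indices outside \<open>J\<close> contribute the factor 1. Finite products, subproducts
  and tails are thus all of the same form, and splitting along subsets of \<open>J\<close> needs no
  reindexing.\<close>

definition BP :: "nat set \<Rightarrow> (nat \<Rightarrow> complex) \<Rightarrow> complex \<Rightarrow> complex" where
 "BP J a z = (\<Prod>j. if j \<in> J then bf (a j) z else 1)"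

lemma bseq_lt_1: "bseq J a ==> j \<in> J ==> cmod (a j) < 1"
 by (simp add: bseq_def)

lemma bseq_subset: "bseq J a ==> K \<subseteq> J ==> bseq K a"
 unfolding bseq_def by (auto intro: summable_on_subset_banach)

lemma bseq_summable:
 assumes "bseq J a"
 shows "summable (\<lambda>j. if j \<in> J then 1 - cmod (a j) else 0)"
proof -
 have "(\<lambda>j. if j \<in> J then 1 - cmod (a j) else 0) summable_on UNIV"
  using assms unfolding bseq_def by (subst summable_on_cong_neutral[where T = J]) auto
 then show ?thesis by (rule summable_on_imp_summable)
qed

lemma BF_lessThan: "BF (J \<inter> {..<n}) a z = (\<Prod>j<n. if j \<in> J then bf (a j) z else 1)"
 unfolding BF_def by (subst prod.inter_restrict[symmetric, of "{..<n}"]) (simp_all add: Int_commute)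

lemma BP_convergent:
 assumes "bseq J a" "cmod z < 1"
 shows "abs_convergent_prod (\<lambda>j. if j \<in> J then bf (a j) z else 1)"
proof (rule summable_imp_abs_convergent_prod)
 show "summable (\<lambda>j. norm ((if j \<in> J then bf (a j) z else 1) - 1))"
 proof (rule summable_comparison_test'[OF summable_mult2[OF bseq_summable[OF assms(1)], of "2 / (1 - cmod z)"]])
  fix n
  show "norm (norm ((if n \<in> J then bf (a n) z else 1) - 1)) \<le> (if n \<in> J then 1 - cmod (a n) else 0) * (2 / (1 - cmod z))"
   using norm_one_minus_bf[OF bseq_lt_1[OF assms(1)] assms(2), of n] by (auto simp: norm_minus_commute)
 qed
qed

lemma BP_LIMSEQ:
 assumes "bseq J a" "cmod z < 1"
 shows "(\<lambda>n. BF (J \<inter> {..<n}) a z) \<longlonglongrightarrow> BP J a z"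
proof -
 have "(\<lambda>n. \<Prod>j\<le>n. if j \<in> J then bf (a j) z else 1) \<longlonglongrightarrow> BP J a z"
  unfolding BP_def by (intro convergent_prod_LIMSEQ abs_convergent_prod_imp_convergent_prod BP_convergent assms)
 then show ?thesis unfolding BF_lessThan using LIMSEQ_lessThan_iff_atMost by blast
qed

lemma BP_uniform_limit:
 assumes "bseq J a" "r < 1"
 shows "uniform_limit (cball 0 r) (\<lambda>n. BF (J \<inter> {..<n}) a) (BP J a) sequentially"
proof -
 let ?f = "\<lambda>j z. if j \<in> J then bf (a j) z else 1"
 have "uniformly_convergent_on (cball 0 r) (\<lambda>N z. \<Prod>n<N. ?f n z)"
 proof (rule uniformly_convergent_on_prod')
  fix n
  have "continuous_on (cball 0 r) (bf (a n))" if "n \<in> J"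
   using bf_continuous[OF bseq_lt_1[OF assms(1) that]]
   by (rule continuous_on_subset) (use assms in auto)
  then show "continuous_on (cball 0 r) (?f n)" by (cases "n \<in> J") auto
 next
  show "uniformly_convergent_on (cball 0 r) (\<lambda>N z. \<Sum>n<N. norm (?f n z - 1))"
  proof (rule Weierstrass_m_test'[where M = "\<lambda>n. (if n \<in> J then 1 - cmod (a n) else 0) * (2 / (1 - r))"])
   show "summable (\<lambda>n. (if n \<in> J then 1 - cmod (a n) else 0) * (2 / (1 - r)))"
    by (intro summable_mult2 bseq_summable assms)
   fix n and z :: complex assume z: "z \<in> cball 0 r"
   show "norm (norm (?f n z - 1)) \<le> (if n \<in> J then 1 - cmod (a n) else 0) * (2 / (1 - r))"
   proof (cases "n \<in> J")
    case True
    have "cmod (1 - bf (a n) z) \<le> (1 - cmod (a n)) * (2 / (1 - cmod z))"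
     by (intro norm_one_minus_bf bseq_lt_1[OF assms(1) True]) (use z assms in auto)
    also have "\<dots> \<le> (1 - cmod (a n)) * (2 / (1 - r))"
     using bseq_lt_1[OF assms(1) True] z assms(2) by (intro mult_left_mono divide_left_mono) auto
    finally show ?thesis using True by (simp add: norm_minus_commute)
   qed auto
  qed
 qed auto
 then obtain g where g: "uniform_limit (cball 0 r) (\<lambda>N z. \<Prod>n<N. ?f n z) g sequentially"
  by (auto simp: uniformly_convergent_on_def)
 have "g z = BP J a z" if "z \<in> cball 0 r" for z
  using tendsto_uniform_limitI[OF g that] BP_LIMSEQ[OF assms(1), of z] that assms(2)
  unfolding BF_lessThan by (intro LIMSEQ_unique) auto
 then have "uniform_limit (cball 0 r) (\<lambda>N z. \<Prod>n<N. ?f n z) (BP J a) sequentially"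
  using g by (subst (asm) uniform_limit_cong') auto
 then show ?thesis unfolding BF_lessThan[abs_def] .
qed

lemma holomorphic_limit_disc:
 assumes "\<And>n. hol (f n)"
  and "\<And>r. r < 1 ==> uniform_limit (cball 0 r) f g sequentially"
 shows "g holomorphic_on ball (0::complex) 1"
proof (rule holomorphic_uniform_sequence[OF open_ball assms(1)])
 fix z :: complex assume z: "z \<in> ball 0 1"
 define d where "d = (1 - cmod z) / 2"
 have d: "d > 0" "cmod z + d < 1" using z by (auto simp: d_def field_simps)
 have sub: "cball z d \<subseteq> cball 0 (cmod z + d)"
  by (auto simp: dist_norm) (smt (verit) norm_minus_commute norm_triangle_sub)
 show "\<exists>d>0. cball z d \<subseteq> ball 0 1 \<and> uniform_limit (cball z d) f g sequentially"
  using d sub assms(2)[OF d(2)] by (intro exI[of _ d]) (auto intro: uniform_limit_on_subset)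
qed

lemma BP_holomorphic:
 assumes "bseq J a"
 shows "hol (BP J a)"
 by (rule holomorphic_limit_disc[OF BF_holomorphic BP_uniform_limit[OF assms]])
   (use bseq_lt_1[OF assms] in auto)

lemma BP_finite: "finite F ==> BP F a z = BF F a z"
 unfolding BP_def BF_def by (subst prodinf_finite[of F]) (auto intro!: prod.cong)

lemma BP_union:
 assumes "bseq J a" "bseq K a" "J \<inter> K = {}" "cmod z < 1"
 shows "BP (J \<union> K) a z = BP J a z * BP K a z"
proof -
 have "BP J a z * BP K a z = (\<Prod>j. (if j \<in> J then bf (a j) z else 1) * (if j \<in> K then bf (a j) z else 1))"
  unfolding BP_def
  by (intro prodinf_mult abs_convergent_prod_imp_convergent_prod BP_convergent assms)
 also have "\<dots> = BP (J \<union> K) a z"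
  unfolding BP_def using assms(3) by (intro prodinf_cong) auto
 finally show ?thesis by simp
qed

lemma BP_split:
 assumes "bseq J a" "K \<subseteq> J" "cmod z < 1"
 shows "BP J a z = BP K a z * BP (J - K) a z"
 using BP_union[of K a "J - K" z] bseq_subset[OF assms(1)] assms(2,3)
 by (simp add: Un_absorb1)

lemma BP_split_finite:
 assumes "bseq J a" "K \<subseteq> J" "finite K" "cmod z < 1"
 shows "BP J a z = BF K a z * BP (J - K) a z"
 using BP_split[OF assms(1,2,4)] BP_finite[OF assms(3)] by simp

lemma norm_BP_le_1:
 assumes "bseq J a" "cmod z < 1"
 shows "cmod (BP J a z) \<le> 1"
 by (rule LIMSEQ_le_const2[OF tendsto_norm[OF BP_LIMSEQ[OF assms]]])
   (use norm_BF_le_1[of "J \<inter> {..<n}" a z for n] bseq_lt_1[OF assms(1)] assms(2) in auto)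

lemma norm_BP_le_BF:
 assumes "bseq J a" "K \<subseteq> J" "finite K" "cmod z < 1"
 shows "cmod (BP J a z) \<le> cmod (BF K a z)"
 unfolding BP_split_finite[OF assms] norm_mult
 using norm_BP_le_1[OF bseq_subset[OF assms(1)], of "J - K" z] assms(4)
 by (intro mult_left_le) auto

lemma norm_BP_sq_ge:
 assumes "bseq J a" "cmod z < 1" "\<And>F. finite F ==> F \<subseteq> J ==> (\<Sum>j\<in>F. kap z (a j)) \<le> S"
 shows "1 - S \<le> (cmod (BP J a z))\<^sup>2"
proof (rule LIMSEQ_le_const[OF tendsto_power[OF tendsto_norm[OF BP_LIMSEQ[OF assms(1,2)]]]])
 show "\<exists>N. \<forall>n\<ge>N. 1 - S \<le> (cmod (BF (J \<inter> {..<n}) a z))\<^sup>2"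
  using norm_BF_sq_ge[of "J \<inter> {..<n}" a z for n] assms(3)[of "J \<inter> {..<n}" for n] bseq_lt_1[OF assms(1)] assms(2)
  by (intro exI[of _ 0] allI impI) (smt (verit, best) IntD1 finite_Int finite_lessThan inf_le1)
qed

lemma norm_BP_sq_ge_exp:
 assumes "bseq J a" "cmod z < 1" "\<And>F. finite F ==> F \<subseteq> J ==> (\<Sum>j\<in>F. kap z (a j)) \<le> S"
  and q: "0 < q" "\<And>j. j \<in> J ==> kap z (a j) \<le> 1 - q"
 shows "exp (- S / q) \<le> (cmod (BP J a z))\<^sup>2"
proof (rule LIMSEQ_le_const[OF tendsto_power[OF tendsto_norm[OF BP_LIMSEQ[OF assms(1,2)]]]])
 have "exp (- S / q) \<le> (cmod (BF (J \<inter> {..<n}) a z))\<^sup>2" for n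
 proof -
  have "exp (- S / q) \<le> exp (- (\<Sum>j\<in>J \<inter> {..<n}. kap z (a j)) / q)"
   using assms(3)[of "J \<inter> {..<n}"] q(1) by (simp add: divide_right_mono)
  also have "\<dots> \<le> (cmod (BF (J \<inter> {..<n}) a z))\<^sup>2"
   by (rule norm_BF_sq_ge_exp) (use q bseq_lt_1[OF assms(1)] assms(2) in auto)
  finally show ?thesis .
 qed
 then show "\<exists>N. \<forall>n\<ge>N. exp (- S / q) \<le> (cmod (BF (J \<inter> {..<n}) a z))\<^sup>2" by blast
qed

lemma BP_eq_0_imp:
 assumes "bseq J a" "cmod z < 1" "BP J a z = 0"
 shows "\<exists>j\<in>J. a j = z"
proof (rule ccontr)
 assume *: "\<not> ?thesis"
 have "BP J a z \<noteq> 0" unfolding BP_def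
  by (rule prodinf_nonzero[OF abs_convergent_prod_imp_convergent_prod[OF BP_convergent[OF assms(1,2)]]])
    (use * bf_eq_0_iff[OF bseq_lt_1[OF assms(1)] assms(2)] in auto)
 with assms show False by simp
qed

lemma BP_zero:
 assumes "bseq J a" "j \<in> J"
 shows "BP J a (a j) = 0"
 using BP_split_finite[OF assms(1), of "{j}" "a j"] assms bseq_lt_1[OF assms] by (simp add: BF_insert)

section \<open>Boundary values\<close>

lemma integrable_on_continuous:
 fixes f :: "real \<Rightarrow> 'a::banach"
 shows "continuous_on UNIV f ==> f integrable_on {a..b}"
 by (rule integrable_continuous_real) (rule continuous_on_subset, auto)

section \<open>Cauchy and Poisson formulas\<close>

text \<open>On the unit circle the conjugated kernel equals \<open>z / (z - b)\<close>, so the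
  Cauchy formula says that \<open>1 / (1 - cnj b * z)\<close> reproduces the value at
  \<open>b\<close> in the inner product of boundary values.\<close>

lemma cauchy_kernel:
 assumes c: "continuous_on (cball 0 1) G" and h: "hol G" and b: "cmod b < 1"
 shows "((\<lambda>t. G (cis t) * cnj (1 / (1 - cnj b * cis t))) has_integral 2 * of_real pi * G b) {-pi..pi}"
proof -
 \<comment> \<open>The contour is parametrised over \<open>{0..2*pi}\<close>. Passing to
   \<open>G (- u)\<close> and shifting the angle by \<open>pi\<close> moves the integral to
   \<open>{-pi..pi}\<close>, the interval used throughout.\<close>
 have c': "continuous_on (cball 0 1) (\<lambda>u. G (- u))"
  by (rule continuous_on_compose2[OF c]) (auto intro!: continuous_intros)
 have h': "hol (\<lambda>u. G (- u))"
  using holomorphic_on_compose_gen[of "\<lambda>u. - u" "ball 0 1" G "ball 0 1"] h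
  by (force simp: o_def intro!: holomorphic_intros)
 have "((\<lambda>u. G (- u) / (u - (- b))) has_contour_integral 2 * of_real pi * \<i> * G (- (- b))) (circlepath 0 1)"
  by (rule Cauchy_integral_circlepath[OF c' h']) (use b in simp)
 then have "((\<lambda>t. G (- cis t) / (cis t + b) * \<i> * cis t) has_integral 2 * of_real pi * \<i> * G b) {0..2*pi}"
  unfolding circlepath_def by (subst (asm) has_contour_integral_part_circlepath_iff) auto
 then have "((\<lambda>t. G (- cis (t + pi)) / (cis (t + pi) + b) * \<i> * cis (t + pi)) has_integral 2 * of_real pi * \<i> * G b) (cbox (0 - pi) (2 * pi - pi))"
  by (intro has_integral_shift_cbox) auto
 moreover have "cis (t + pi) = - cis t" for t by (simp add: complex_eq_iff)
 ultimately have "((\<lambda>t. G (cis t) / (b - cis t) * \<i> * (- cis t)) has_integral 2 * of_real pi * \<i> * G b) {-pi..pi}"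
  by simp
 from has_integral_mult_right[OF this, of "- \<i>"]
 moreover have "- \<i> * (2 * of_real pi * \<i> * G b) = 2 * of_real pi * G b"
  by (simp add: complex_eq_iff)
 ultimately have "((\<lambda>t. - \<i> * (G (cis t) / (b - cis t) * \<i> * (- cis t))) has_integral 2 * of_real pi * G b) {-pi..pi}"
  by (simp only:)
 moreover have "- \<i> * (G (cis t) / (b - cis t) * \<i> * (- cis t)) = G (cis t) * cnj (1 / (1 - cnj b * cis t))" for t
 proof -
  define c where "c = cis t"
  have cc: "c * cnj c = 1" unfolding c_def by (simp add: cis_cnj cis_mult)
  have "c - b = c * (1 - b * cnj c)" using cc by (simp add: algebra_simps)
  then have "cnj (1 / (1 - cnj b * c)) = c / (c - b)" using cc by auto
  moreover have "- \<i> * (G c / (b - c) * \<i> * (- c)) = G c * (c / (c - b))"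
  proof -
   have "- \<i> * (Y * \<i> * (- c)) = - (Y * c)" for Y by (simp add: complex_eq_iff)
   then have "- \<i> * (G c / (b - c) * \<i> * (- c)) = - (G c / (b - c) * c)" .
   also have "\<dots> = G c * (c / (c - b))"
   proof -
    have "c - b = - (b - c)" by simp
    then show ?thesis by (simp only: divide_minus_right) simp
   qed
   finally show ?thesis .
  qed
  ultimately show ?thesis unfolding c_def by simp
 qed
 ultimately show ?thesis by simp
qed

definition pker :: "complex \<Rightarrow> real \<Rightarrow> real" where
 "pker b t = (1 - (cmod b)\<^sup>2) / (cmod (1 - cnj b * cis t))\<^sup>2"

lemma pker_nonneg: "cmod b < 1 ==> 0 \<le> pker b t"
 unfolding pker_def using one_minus_sq_bounds(3)[of b] by auto

lemma pker_continuous: "cmod b < 1 ==> continuous_on UNIV (pker b)"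
 unfolding pker_def[abs_def] using den_nonzero[of "cis t" b for t] by (auto intro!: continuous_intros)

text \<open>\<open>cauchy_kernel\<close> for \<open>G\<close> times
  \<open>(1 - (cmod b)\<^sup>2) / (1 - cnj b * z)\<close>: this factor has the value 1 at
  \<open>b\<close>, and on the circle it completes the conjugated kernel to a squared
  modulus.\<close>

lemma poisson_formula:
 assumes c: "continuous_on (cball 0 1) G" and h: "hol G" and b: "cmod b < 1"
 shows "((\<lambda>t. G (cis t) * of_real (pker b t)) has_integral 2 * of_real pi * G b) {-pi..pi}"
proof -
 let ?k = "\<lambda>z. of_real (1 - (cmod b)\<^sup>2) / (1 - cnj b * z)"
 have nz: "1 - cnj b * z \<noteq> 0" if "cmod z \<le> 1" for z using den_nonzero[OF that b] .
 have b0: "?k b = 1"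
  using nz[of b] b by (simp add: complex_norm_square mult.commute del: of_real_power)
 have "((\<lambda>t. (G (cis t) * ?k (cis t)) * cnj (1 / (1 - cnj b * cis t))) has_integral 2 * of_real pi * (G b * ?k b)) {-pi..pi}"
  using b nz by (intro cauchy_kernel continuous_intros holomorphic_intros c h) auto
 moreover have "(G (cis t) * ?k (cis t)) * cnj (1 / (1 - cnj b * cis t)) = G (cis t) * of_real (pker b t)" for t
 proof -
  have "complex_of_real ((cmod (1 - cnj b * cis t))\<^sup>2) = (1 - cnj b * cis t) * cnj (1 - cnj b * cis t)"
   by (rule complex_norm_square)
  then show ?thesis unfolding pker_def of_real_divide by simp
 qed
 ultimately show ?thesis unfolding b0 by simp
qed

lemma pker_has_integral:
 assumes "cmod b < 1"
 shows "(pker b has_integral 2 * pi) {-pi..pi}"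
proof -
 have "((\<lambda>t. 1 * complex_of_real (pker b t)) has_integral 2 * of_real pi * 1) {-pi..pi}"
  by (rule poisson_formula) (auto intro: assms)
 from has_integral_linear[OF this bounded_linear_Re] show ?thesis by (simp add: o_def)
qed

lemma continuous_on_circle:
 "continuous_on (cball 0 1) G ==> continuous_on UNIV (\<lambda>t. G (cis t))"
 by (rule continuous_on_compose2[of "cball 0 1" G]) (auto intro!: continuous_intros)

lemma poisson_norm_bound:
 assumes c: "continuous_on (cball 0 1) G" and h: "hol G" and b: "cmod b < 1"
 shows "2 * pi * cmod (G b) \<le> integral {-pi..pi} (\<lambda>t. cmod (G (cis t)) * pker b t)"
proof -
 have "cmod (integral {-pi..pi} (\<lambda>t. G (cis t) * of_real (pker b t))) \<le> integral {-pi..pi} (\<lambda>t. cmod (G (cis t)) * pker b t)"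
 proof (rule integral_norm_bound_integral)
  show "(\<lambda>t. G (cis t) * of_real (pker b t)) integrable_on {-pi..pi}"
   using poisson_formula[OF assms] by blast
  show "(\<lambda>t. cmod (G (cis t)) * pker b t) integrable_on {-pi..pi}"
   by (intro integrable_on_continuous continuous_intros continuous_on_circle c pker_continuous b)
  show "cmod (G (cis t) * of_real (pker b t)) \<le> cmod (G (cis t)) * pker b t" for t
   using pker_nonneg[OF b, of t] by (simp add: norm_mult)
 qed
 then show ?thesis
  unfolding integral_unique[OF poisson_formula[OF assms]] by (simp add: norm_mult)
qed

lemma dilate_holomorphic:
 assumes "hol F" "cmod c < 1"
 shows "hol (\<lambda>z. F (c * z))" "continuous_on (cball 0 1) (\<lambda>z. F (c * z))"
proof -
 have *: "cmod (c * z) < 1" if "cmod z \<le> 1" for z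
  using mult_mono[of "cmod c" "cmod c" "cmod z" 1] that assms(2) by (simp add: norm_mult)
 show "hol (\<lambda>z. F (c * z))"
  using holomorphic_on_compose_gen[of "\<lambda>w. c * w" "ball 0 1" F "ball 0 1"] assms *
  by (force simp: o_def intro!: holomorphic_intros)
 show "continuous_on (cball 0 1) (\<lambda>z. F (c * z))"
  by (rule continuous_on_compose2[OF holomorphic_on_imp_continuous_on[OF assms(1)]])
    (use * in \<open>auto intro!: continuous_intros\<close>)
qed

text \<open>The radial maximum principle is all that is needed of the theory of boundary values.\<close>
lemma radial_bound:
 assumes F: "hol F" and B: "\<And>z. cmod z < 1 ==> cmod (F z) \<le> B"
  and ae: "AE t in lborel. \<forall>e>0. eventually (\<lambda>r. cmod (F (of_real r * cis t)) \<le> 1 + e) (at_left 1)"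
  and z: "cmod z < 1"
 shows "cmod (F z) \<le> 1"
proof -
 define r where "r n = 1 - 1 / (real n + 2)" for n
 have r: "0 < r n" "r n < 1" for n by (auto simp: r_def divide_simps)
 have "r \<longlonglongrightarrow> 1 - 0" unfolding r_def
  using LIMSEQ_ignore_initial_segment[OF lim_inverse_n', of 2] by (intro tendsto_intros) (simp add: add.commute)
 then have r_lim: "r \<longlonglongrightarrow> 1" by simp
 then have r_left: "filterlim r (at_left 1) sequentially"
  using r(2)[THEN less_imp_neq] r(2) by (auto simp: filterlim_at intro!: always_eventually)
 \<comment> \<open>The maximum with 1 turns the one-sided hypothesis on the radial behaviour into
   convergence to \<open>pker z t\<close>, as dominated convergence requires.\<close>
 define g where "g n t = max 1 (cmod (F (of_real (r n) * cis t))) * pker z t" for n t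
 have hol: "hol (\<lambda>w. F (of_real (r n) * w))"
  and con: "continuous_on (cball 0 1) (\<lambda>w. F (of_real (r n) * w))" for n
  using dilate_holomorphic[OF F, of "of_real (r n)"] r[of n] by auto
 have gc: "continuous_on UNIV (g n)" for n
  unfolding g_def[abs_def]
  by (intro continuous_intros pker_continuous z continuous_on_circle[OF con])
 have gi: "(LINT t:{-pi..pi}|lborel. g n t) = integral {-pi..pi} (g n)" for n
  by (intro set_borel_integral_eq_integral borel_integrable_atLeastAtMost' continuous_on_subset[OF gc]) auto
 have 1: "2 * pi * cmod (F (of_real (r n) * z)) \<le> (LINT t:{-pi..pi}|lborel. g n t)" for n
 proof -
  have "2 * pi * cmod (F (of_real (r n) * z)) \<le> integral {-pi..pi} (\<lambda>t. cmod (F (of_real (r n) * cis t)) * pker z t)"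
   by (rule poisson_norm_bound[OF con hol z])
  also have "\<dots> \<le> integral {-pi..pi} (g n)"
  proof (rule integral_le)
   show "(\<lambda>t. cmod (F (of_real (r n) * cis t)) * pker z t) integrable_on {-pi..pi}"
    by (intro integrable_on_continuous continuous_intros continuous_on_circle[OF con] pker_continuous z)
   show "g n integrable_on {-pi..pi}"
    by (intro integrable_on_continuous gc)
  qed (use pker_nonneg[OF z] in \<open>auto simp: g_def intro!: mult_right_mono\<close>)
  finally show ?thesis unfolding gi .
 qed
 have pk: "(LINT t:{-pi..pi}|lborel. pker z t) = 2 * pi"
  using pker_has_integral[OF z] pker_continuous[OF z]
  by (subst set_borel_integral_eq_integral)
    (auto intro!: borel_integrable_atLeastAtMost' continuous_on_subset[OF pker_continuous[OF z]] integral_unique)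
 have 2: "(\<lambda>n. LINT t:{-pi..pi}|lborel. g n t) \<longlonglongrightarrow> (LINT t:{-pi..pi}|lborel. pker z t)"
  unfolding set_lebesgue_integral_def
 proof (rule integral_dominated_convergence[where w = "\<lambda>t. indicator {-pi..pi} t *\<^sub>R (max 1 B * pker z t)"])
  show "(\<lambda>t. indicator {-pi..pi} t *\<^sub>R pker z t) \<in> borel_measurable lborel"
   using borel_measurable_continuous_onI[OF pker_continuous[OF z]] by measurable
  show "(\<lambda>t. indicator {-pi..pi} t *\<^sub>R g n t) \<in> borel_measurable lborel" for n
   using borel_measurable_continuous_onI[OF gc[of n]] by measurable
  show "integrable lborel (\<lambda>t. indicator {-pi..pi} t *\<^sub>R (max 1 B * pker z t))"
   by (rule borel_integrable_atLeastAtMost'[unfolded set_integrable_def])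
     (intro continuous_intros continuous_on_subset[OF pker_continuous[OF z]], auto)
  show "AE t in lborel. norm (indicator {-pi..pi} t *\<^sub>R g n t) \<le> indicator {-pi..pi} t *\<^sub>R (max 1 B * pker z t)" for n
  proof (intro AE_I2)
   fix t
   have "cmod (of_real (r n) * cis t) < 1" using r[of n] by (simp add: norm_mult)
   from B[OF this] have "max 1 (cmod (F (of_real (r n) * cis t))) \<le> max 1 B" by auto
   then have "g n t \<le> max 1 B * pker z t" unfolding g_def by (intro mult_right_mono pker_nonneg z)
   moreover have "0 \<le> g n t" unfolding g_def using pker_nonneg[OF z, of t] by simp
   ultimately show "norm (indicator {-pi..pi} t *\<^sub>R g n t) \<le> indicator {-pi..pi} t *\<^sub>R (max 1 B * pker z t)"
    by (auto simp: indicator_def)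
  qed
  show "AE t in lborel. (\<lambda>n. indicator {-pi..pi} t *\<^sub>R g n t) \<longlonglongrightarrow> indicator {-pi..pi} t *\<^sub>R pker z t"
   using ae
  proof eventually_elim
   case (elim t)
   have "(\<lambda>n. max 1 (cmod (F (of_real (r n) * cis t)))) \<longlonglongrightarrow> 1"
   proof (rule order_tendstoI)
    fix x :: real assume x: "1 < x"
    then have "eventually (\<lambda>r. cmod (F (of_real r * cis t)) \<le> 1 + (x - 1) / 2) (at_left 1)"
     using elim by auto
    from eventually_compose_filterlim[OF this r_left]
    show "\<forall>\<^sub>F n in sequentially. max 1 (cmod (F (of_real (r n) * cis t))) < x"
     by eventually_elim (use x in \<open>auto simp: field_simps\<close>)
   qed (auto simp: less_max_iff_disj)
   from tendsto_mult[OF this tendsto_const[of "pker z t"]]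
   show ?case unfolding g_def by (intro tendsto_intros) simp
  qed
 qed
 have "(\<lambda>n. F (of_real (r n) * z)) \<longlonglongrightarrow> F (of_real 1 * z)"
 proof (rule isCont_tendsto_compose[where g = F])
  show "isCont F (of_real 1 * z)"
   using holomorphic_on_imp_continuous_on[OF F] z by (simp add: continuous_on_eq_continuous_at)
  show "(\<lambda>n. of_real (r n) * z) \<longlonglongrightarrow> of_real 1 * z" by (intro tendsto_intros r_lim)
 qed
 then have 3: "(\<lambda>n. 2 * pi * cmod (F (of_real (r n) * z))) \<longlonglongrightarrow> 2 * pi * cmod (F z)"
  by (intro tendsto_intros) simp
 have "2 * pi * cmod (F z) \<le> 2 * pi"
  using LIMSEQ_le[OF 3 2] 1 unfolding pk by auto
 then show ?thesis by simp
qed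

section \<open>Radial maximal functions and a weak-type inequality\<close>

lemma norm_one_minus_cis_ge:
 assumes "\<bar>x\<bar> \<le> pi"
 shows "\<bar>x\<bar> \<le> 2 * cmod (1 - cis x)"
proof -
 have half: "y / 2 \<le> sin y" if "0 \<le> y" "y \<le> pi / 2" for y :: real
 proof -
  have "\<bar>sin y - y\<bar> \<le> \<bar>y\<bar> ^ 3 / 6"
  proof -
   have "(\<Sum>m<3. sin_coeff m * y ^ m) = y"
    unfolding numeral_3_eq_3 by (simp add: sin_coeff_def)
   moreover have "fact 3 = (6::real)" by (simp add: fact_numeral)
   ultimately have "\<bar>sin y - y\<bar> \<le> inverse 6 * \<bar>y\<bar> ^ 3"
    using Maclaurin_sin_bound[where x = y and n = 3] by (simp only:)
   then show ?thesis by simp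
  qed
  then have "y - y ^ 3 / 6 \<le> sin y" using that by (simp add: abs_if split: if_splits)
  moreover have "y * y\<^sup>2 \<le> y * 3"
  proof (rule mult_left_mono)
   have "y\<^sup>2 \<le> (1.6)\<^sup>2" using that pi_approx by (intro power_mono) auto
   then show "y\<^sup>2 \<le> 3" by (simp add: power2_eq_square)
  qed (use that in auto)
  moreover have "y ^ 3 = y * y\<^sup>2" by (simp add: power3_eq_cube power2_eq_square)
  ultimately show ?thesis by linarith
 qed
 have "(cmod (1 - cis x))\<^sup>2 = (2 * sin (\<bar>x\<bar> / 2))\<^sup>2"
 proof -
  have "(cmod (1 - cis x))\<^sup>2 = (1 - cos x)\<^sup>2 + (sin x)\<^sup>2" by (simp add: cmod_power2)
  also have "\<dots> = 2 - 2 * cos x" using sin_cos_squared_add2[of x] by (simp add: power2_eq_square algebra_simps)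
  also have "cos x = cos (2 * (\<bar>x\<bar> / 2))" by (simp add: abs_if)
  also have "2 - 2 * cos (2 * (\<bar>x\<bar> / 2)) = (2 * sin (\<bar>x\<bar> / 2))\<^sup>2"
   unfolding cos_double_sin by (simp add: power_mult_distrib)
  finally show ?thesis .
 qed
 moreover have h: "\<bar>x\<bar> / 2 / 2 \<le> sin (\<bar>x\<bar> / 2)" using half[of "\<bar>x\<bar> / 2"] assms by simp
 ultimately have "cmod (1 - cis x) = 2 * sin (\<bar>x\<bar> / 2)"
  by (smt (verit, best) norm_ge_zero power2_eq_imp_eq abs_ge_zero divide_nonneg_nonneg)
 with h show ?thesis by simp
qed

lemma abs_angle_le:
 assumes "\<bar>x\<bar> \<le> pi" "0 \<le> s" "s \<le> 1"
 shows "\<bar>x\<bar> \<le> 4 * cmod (1 - of_real s * cis x)"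
proof -
 have "cmod (1 - cis x) \<le> cmod (1 - of_real s * cis x) + cmod (of_real (1 - s) * cis x)"
  using norm_triangle_ineq4[of "1 - of_real s * cis x" "of_real (1 - s) * cis x"] by (simp add: algebra_simps)
 moreover have "cmod (of_real (1 - s) * cis x) = 1 - s"
  unfolding norm_mult norm_of_real using assms by simp
 moreover have "1 - s \<le> cmod (1 - of_real s * cis x)"
  using norm_triangle_ineq2[of 1 "of_real s * cis x"] assms by (simp add: norm_mult)
 ultimately show ?thesis using norm_one_minus_cis_ge[OF assms(1)] by linarith
qed

text \<open>Splits the Poisson kernel by dyadic distances from its peak: \<open>k\<close> is the
  least scale whose interval contains \<open>s\<close>, and minimality bounds the denominator from
  below. At scale \<open>K\<close> the interval covers a whole period.\<close>

lemma pker_dyadic: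
 assumes b: "0 \<le> b" "b < 1" and s: "\<bar>s\<bar> \<le> pi" and K: "1 \<le> 2 ^ K * (1 - b)"
 shows "\<exists>k\<le>K. \<bar>s\<bar> \<le> 4 * 2 ^ k * (1 - b) \<and> pker (of_real b) s \<le> 8 / (4 ^ k * (1 - b))"
proof -
 define y where "y = 1 - b"
 have y: "y > 0" using b by (simp add: y_def)
 define D where "D = cmod (1 - of_real b * cis s)"
 have D1: "y \<le> D" unfolding y_def D_def
  using norm_triangle_ineq2[of 1 "of_real b * cis s"] b by (simp add: norm_mult)
 have D2: "\<bar>s\<bar> \<le> 4 * D" unfolding D_def using abs_angle_le[OF s] b by simp
 have "(1 - b) * b \<le> (1 - b) * 1" using b by (intro mult_left_mono) auto
 then have n: "1 - b\<^sup>2 \<le> 2 * y" unfolding y_def by (simp add: power2_eq_square algebra_simps)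
 have P: "pker (of_real b) s \<le> 2 * y / E\<^sup>2" if "0 < E" "E \<le> D" for E
  unfolding pker_def D_def[symmetric] using that n b y
  by (intro frac_le power_mono) (auto simp: D_def)
 define k where "k = (LEAST k. \<bar>s\<bar> \<le> 4 * 2 ^ k * y)"
 have ex: "\<bar>s\<bar> \<le> 4 * 2 ^ K * y"
  using s K pi_less_4 unfolding y_def by linarith
 have k1: "\<bar>s\<bar> \<le> 4 * 2 ^ k * y" unfolding k_def by (rule LeastI) (rule ex)
 have k2: "k \<le> K" unfolding k_def by (rule Least_le) (rule ex)
 have "pker (of_real b) s \<le> 8 / (4 ^ k * y)"
 proof (cases k)
  case 0
  have "pker (of_real b) s \<le> 2 * y / y\<^sup>2" by (rule P[OF y D1])
  also have "\<dots> \<le> 8 / y" using y by (simp add: power2_eq_square divide_simps)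
  finally show ?thesis using 0 by simp
 next
  case (Suc m)
  have "\<not> (\<bar>s\<bar> \<le> 4 * 2 ^ m * y)" using not_less_Least[of m "\<lambda>k. \<bar>s\<bar> \<le> 4 * 2 ^ k * y"] Suc
   unfolding k_def[symmetric] by simp
  then have "2 ^ m * y \<le> D" using D2 by linarith
  then have "pker (of_real b) s \<le> 2 * y / (2 ^ m * y)\<^sup>2" using y by (intro P) auto
  also have "(2 ^ m * y)\<^sup>2 = 4 ^ m * y\<^sup>2"
  proof -
   have "(2 ^ m)\<^sup>2 = (4::real) ^ m" by (simp add: power2_eq_square flip: power_mult_distrib)
   then show ?thesis by (simp add: power_mult_distrib)
  qed
  also have "2 * y / (4 ^ m * y\<^sup>2) = 8 / (4 ^ k * y)"
   unfolding Suc using y by (simp add: power2_eq_square divide_simps)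
  finally show ?thesis .
 qed
 then show ?thesis using k1 k2 unfolding y_def by blast
qed

lemma has_integral_shifted:
 fixes g :: "real \<Rightarrow> 'a::euclidean_space"
 assumes "continuous_on UNIV g"
 shows "((\<lambda>s. g (t + s)) has_integral integral {t + a..t + b} g) {a..b}"
proof -
 have "(g has_integral integral {t + a..t + b} g) (cbox (t + a) (t + b))"
  using integrable_integral[OF integrable_on_continuous[OF assms]] by simp
 from has_integral_shift_cbox[OF this, of t] show ?thesis by (simp add: add.commute)
qed

text \<open>A Poisson average is dominated by a sum of averages over dyadic intervals. Scale
  \<open>k\<close> contributes at most \<open>32 * \<mu> / 2 ^ k\<close>, and these sum to at most
  \<open>64 * \<mu>\<close>.\<close>

lemma local_maximal:
 fixes g :: "real \<Rightarrow> real"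
 assumes g: "continuous_on UNIV g" "\<And>s. 0 \<le> g s" and b: "0 \<le> b" "b < 1" and mu: "0 \<le> \<mu>"
  and H: "\<And>l. 0 < l ==> l \<le> pi ==> integral {t - l..t + l} g \<le> l * \<mu>"
 shows "integral {-pi..pi} (\<lambda>s. g (t + s) * pker (of_real b) s) \<le> 64 * \<mu>"
proof -
 define y where "y = 1 - b"
 have y: "y > 0" using b by (simp add: y_def)
 obtain K where K: "1 / y < 2 ^ K" using real_arch_pow[of 2 "1 / y"] by auto
 then have K': "1 \<le> 2 ^ K * (1 - b)" using y unfolding y_def by (simp add: divide_simps)
 \<comment> \<open>Capped at \<open>pi\<close>, because \<open>H\<close> is available only up to
   half a period.\<close>
 define m where "m k = min (4 * 2 ^ k * y) pi" for k :: nat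
 have m: "0 < m k" "m k \<le> pi" "m k \<le> 4 * 2 ^ k * y" for k using y by (auto simp: m_def)
 define h where "h k s = (if s \<in> {-m k..m k} then g (t + s) else 0)" for k s
 define I where "I k = integral {t + - m k..t + m k} g" for k
 have hI: "(h k has_integral I k) {-pi..pi}" for k
  unfolding h_def[abs_def] I_def
  by (subst has_integral_restrict) (use m[of k] has_integral_shifted[OF g(1), of t "- m k" "m k"] in auto)
 have bb: "cmod (of_real b) < 1" using b by simp
 have gs: "continuous_on UNIV (\<lambda>s. g (t + s))"
  by (rule continuous_on_compose2[OF g(1)]) (auto intro!: continuous_intros)
 have pw: "g (t + s) * pker (of_real b) s \<le> (\<Sum>k\<le>K. 8 / (4 ^ k * y) * h k s)" if s: "s \<in> {-pi..pi}" for s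
 proof -
  have s': "\<bar>s\<bar> \<le> pi" using s by auto
  obtain k where k: "k \<le> K" "\<bar>s\<bar> \<le> 4 * 2 ^ k * y" "pker (of_real b) s \<le> 8 / (4 ^ k * y)"
   using pker_dyadic[OF b s' K'] unfolding y_def by blast
  have hk: "h k s = g (t + s)" unfolding h_def m_def using k(2) s' by auto
  have "g (t + s) * pker (of_real b) s \<le> g (t + s) * (8 / (4 ^ k * y))"
   by (intro mult_left_mono k g)
  also have "\<dots> = 8 / (4 ^ k * y) * h k s" unfolding hk by simp
  also have "\<dots> \<le> (\<Sum>k\<le>K. 8 / (4 ^ k * y) * h k s)"
   using k(1) y g(2) by (intro member_le_sum) (auto simp: h_def)
  finally show ?thesis .
 qed
 have "integral {-pi..pi} (\<lambda>s. g (t + s) * pker (of_real b) s) \<le> (\<Sum>k\<le>K. 8 / (4 ^ k * y) * I k)"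
 proof (rule has_integral_le)
  show "((\<lambda>s. g (t + s) * pker (of_real b) s) has_integral integral {-pi..pi} (\<lambda>s. g (t + s) * pker (of_real b) s)) {-pi..pi}"
   by (intro integrable_integral integrable_on_continuous continuous_intros gs pker_continuous bb)
  show "((\<lambda>s. \<Sum>k\<le>K. 8 / (4 ^ k * y) * h k s) has_integral (\<Sum>k\<le>K. 8 / (4 ^ k * y) * I k)) {-pi..pi}"
   by (intro has_integral_sum has_integral_mult_right hI) auto
 qed (use pw in auto)
 also have "\<dots> \<le> (\<Sum>k\<le>K. 32 * \<mu> * (1 / 2) ^ k)"
 proof (rule sum_mono)
  fix k
  have "I k \<le> m k * \<mu>" unfolding I_def using H[OF m(1,2)[of k]] by simp
  also have "\<dots> \<le> 4 * 2 ^ k * y * \<mu>" by (intro mult_right_mono m mu)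
  finally have "8 / (4 ^ k * y) * I k \<le> 8 / (4 ^ k * y) * (4 * 2 ^ k * y * \<mu>)"
   using y by (intro mult_left_mono) auto
  also have "\<dots> = 32 * \<mu> * (2 ^ k / 4 ^ k)" using y by simp
  also have "2 ^ k / 4 ^ k = (1 / 2 :: real) ^ k" by (simp flip: power_divide)
  finally show "8 / (4 ^ k * y) * I k \<le> 32 * \<mu> * (1 / 2) ^ k" .
 qed
 also have "\<dots> = 32 * \<mu> * (\<Sum>k\<le>K. (1 / 2) ^ k)" by (simp add: sum_distrib_left)
 also have "(\<Sum>k\<le>K. (1 / 2) ^ k) = 2 - (1 / 2 :: real) ^ K" by (induction K) auto
 also have "32 * \<mu> * (2 - (1 / 2) ^ K) \<le> 32 * \<mu> * 2" using mu by (intro mult_left_mono) auto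
 finally show ?thesis by simp
qed

text \<open>The Hardy-Littlewood inequality for radial maxima. Only radii below \<open>R\<close>
  enter, so no boundary values of \<open>F\<close> are involved, and \<open>R\<close> affects the
  bound only through \<open>m\<close>.\<close>

lemma weak_type:
 assumes F: "hol F" and R: "0 < R" "R < 1" and L: "0 < L"
  and m: "\<And>t. integral {-pi..pi} (\<lambda>s. (cmod (F (of_real R * cis (t + s))))\<^sup>2) \<le> m"
 defines "S \<equiv> {t \<in> {0..2*pi}. \<exists>r. 0 \<le> r \<and> r < R \<and> L < (cmod (F (of_real r * cis t)))\<^sup>2}"
 shows "S \<in> sets borel" "emeasure lborel S \<le> ennreal (320 * m / L)"
proof -
 have Fc: "continuous_on UNIV (\<lambda>t. F (of_real r * cis t))" if "0 \<le> r" "r < 1" for r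
  by (rule continuous_on_compose2[OF holomorphic_on_imp_continuous_on[OF F]])
    (use that in \<open>auto intro!: continuous_intros simp: norm_mult\<close>)
 have "open (\<Union>r\<in>{0..<R}. {t. L < (cmod (F (of_real r * cis t)))\<^sup>2})"
  using R by (intro open_UN ballI open_Collect_less continuous_intros Fc) auto
 moreover have "S = {0..2*pi} \<inter> (\<Union>r\<in>{0..<R}. {t. L < (cmod (F (of_real r * cis t)))\<^sup>2})"
  unfolding S_def by auto
 ultimately show S: "S \<in> sets borel" by auto
 define g where "g s = (cmod (F (of_real R * cis s)))\<^sup>2" for s
 have g: "continuous_on UNIV g" "\<And>s. 0 \<le> g s"
  unfolding g_def[abs_def] using R by (auto intro!: continuous_intros Fc)
 \<comment> \<open>If all averages were at most \<open>L / 16\<close>, \<open>local_maximal\<close>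
   would give \<open>2 * pi * cmod (G (of_real b)) \<le> 4 * L\<close>, hence modulus at most
   \<open>L\<close> because \<open>pi \<ge> 2\<close>.\<close>
 have "\<exists>l. 0 < l \<and> l \<le> pi \<and> l * (L / 16) < integral {t - l..t + l} g" if t: "t \<in> S" for t
 proof (rule ccontr)
  assume "\<not> ?thesis"
  then have H: "integral {t - l..t + l} g \<le> l * (L / 16)" if "0 < l" "l \<le> pi" for l
   using that by (meson not_less)
  obtain r where r: "0 \<le> r" "r < R" "L < (cmod (F (of_real r * cis t)))\<^sup>2" using t by (auto simp: S_def)
  define b where "b = r / R"
  have b: "0 \<le> b" "b < 1" using r R by (auto simp: b_def)
  define c where "c = of_real R * cis t"
  have c1: "cmod c < 1" using R by (simp add: c_def norm_mult)
  \<comment> \<open>The square of \<open>F\<close> is holomorphic, so the Poisson formula applies to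
    it and only square means occur.\<close>
  define G where "G z = (F (c * z))\<^sup>2" for z
  have G: "continuous_on (cball 0 1) G" "hol G" unfolding G_def[abs_def]
   by (intro continuous_intros holomorphic_intros dilate_holomorphic[OF F c1])+
  have "2 * pi * cmod (G (of_real b)) \<le> integral {-pi..pi} (\<lambda>s. cmod (G (cis s)) * pker (of_real b) s)"
   using b by (intro poisson_norm_bound G) auto
  also have "(\<lambda>s. cmod (G (cis s)) * pker (of_real b) s) = (\<lambda>s. g (t + s) * pker (of_real b) s)"
   by (simp add: G_def g_def c_def norm_power mult.assoc cis_mult)
  also have "integral {-pi..pi} \<dots> \<le> 64 * (L / 16)"
   by (rule local_maximal[OF g b _ H]) (use L in auto)
  finally have 1: "2 * pi * cmod (G (of_real b)) \<le> 4 * L" by simp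
  have "cmod (G (of_real b)) = (cmod (F (of_real r * cis t)))\<^sup>2"
   using R by (simp add: G_def c_def b_def norm_power mult.commute mult.left_commute)
  then have "L < cmod (G (of_real b))" using r by simp
  moreover from this have "2 * 2 * cmod (G (of_real b)) \<le> 2 * pi * cmod (G (of_real b))"
   using L pi_ge_two by (intro mult_right_mono) auto
  ultimately show False using 1 by linarith
 qed
 then obtain l where l: "\<And>t. t \<in> S ==> 0 < l t \<and> l t \<le> pi \<and> l t * (L / 16) < integral {t - l t..t + l t} g"
  by metis
 have "S \<subseteq> (\<Union>i\<in>S. cball i (l i))" using l by (force simp: less_imp_le)
 moreover have "0 < l i \<and> l i \<le> pi" if "i \<in> S" for i using l[OF that] by blast
 ultimately obtain C where C: "countable C" "C \<subseteq> S"
   "pairwise (\<lambda>i j. disjnt (cball i (l i)) (cball j (l j))) C"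
   "S \<subseteq> (\<Union>i\<in>C. cball i (5 * l i))"
  by (rule Vitali_covering_lemma_cballs)
 define N where "N = density lborel (\<lambda>s. ennreal (g s))"
 have gm: "(\<lambda>s. ennreal (g s)) \<in> borel_measurable lborel"
  using borel_measurable_continuous_onI[OF g(1)] by measurable
 have Nint: "emeasure N {u..v} = ennreal (integral {u..v} g)" for u v
 proof -
  have "emeasure N {u..v} = (\<integral>\<^sup>+x. ennreal (g x) * indicator {u..v} x \<partial>lborel)"
   unfolding N_def by (rule emeasure_density[OF gm]) simp
  also have "\<dots> = (\<integral>\<^sup>+x. ennreal (indicator {u..v} x * g x) \<partial>lborel)"
   by (intro nn_integral_cong) (auto simp: indicator_def)
  also have "\<dots> = ennreal (integral {u..v} g)"
   by (rule nn_integral_has_integral_lebesgue) (use g integrable_on_continuous[OF g(1)] in \<open>auto intro: integrable_integral\<close>)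
  finally show ?thesis .
 qed
 define J where "J = to_nat_on C ` C"
 have J: "from_nat_into C n \<in> C" "to_nat_on C (from_nat_into C n) = n" if "n \<in> J" for n
  using that C(1) by (auto simp: J_def)
 define X where "X n = (if n \<in> J then cball (from_nat_into C n) (5 * l (from_nat_into C n)) else {})" for n
 define Y where "Y n = (if n \<in> J then cball (from_nat_into C n) (l (from_nat_into C n)) else {})" for n
 \<comment> \<open>An interval of half-length \<open>l\<close>, enlarged five times, has length
   \<open>10 * l\<close>, and \<open>l\<close> is less than \<open>16 / L\<close> times the integral
   over the original interval.\<close>
 have XY: "emeasure lborel (X n) \<le> ennreal (160 / L) * emeasure N (Y n)" for n
 proof (cases "n \<in> J")
  case True
  define c where "c = from_nat_into C n"
  have c: "0 < l c" "l c * (L / 16) < integral {c - l c..c + l c} g"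
   using l[of c] J(1)[OF True] C(2) unfolding c_def by auto
  have "emeasure lborel (X n) = ennreal (10 * l c)"
   using True c(1) unfolding X_def c_def[symmetric] by (simp add: cball_eq_atLeastAtMost)
  also have "\<dots> \<le> ennreal (160 / L * integral {c - l c..c + l c} g)"
   using c L by (intro ennreal_leI) (simp add: field_simps)
  also have "\<dots> = ennreal (160 / L) * ennreal (integral {c - l c..c + l c} g)"
   by (rule ennreal_mult') (use L in simp)
  also have "ennreal (integral {c - l c..c + l c} g) = emeasure N (Y n)"
   using True unfolding Y_def c_def[symmetric] by (simp add: cball_eq_atLeastAtMost Nint)
  finally show ?thesis .
 qed (simp add: X_def Y_def)
 have Xm: "range X \<subseteq> sets lborel" and Ym: "range Y \<subseteq> sets N"
  unfolding X_def[abs_def] Y_def[abs_def] N_def by auto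
 have disj: "disjoint_family Y"
  unfolding disjoint_family_on_def
 proof (intro ballI impI)
  fix n k :: nat assume nk: "n \<noteq> k"
  show "Y n \<inter> Y k = {}"
  proof (cases "n \<in> J \<and> k \<in> J")
   case True
   then have "from_nat_into C n \<noteq> from_nat_into C k" using J(2) nk by metis
   then show ?thesis using C(3) J(1) True unfolding Y_def pairwise_def disjnt_def by auto
  qed (auto simp: Y_def)
 qed
 have "S \<subseteq> (\<Union>n. X n)"
 proof
  fix x assume "x \<in> S"
  then obtain c where c: "c \<in> C" "x \<in> cball c (5 * l c)" using C(4) by auto
  then have "x \<in> X (to_nat_on C c)" using C(1) unfolding X_def J_def by auto
  then show "x \<in> (\<Union>n. X n)" by blast
 qed
 then have "emeasure lborel S \<le> emeasure lborel (\<Union>n. X n)"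
  using Xm by (intro emeasure_mono) auto
 also have "\<dots> \<le> (\<Sum>n. emeasure lborel (X n))" by (rule emeasure_subadditive_countably[OF Xm])
 also have "\<dots> \<le> (\<Sum>n. ennreal (160 / L) * emeasure N (Y n))" by (intro suminf_le XY) auto
 also have "\<dots> = ennreal (160 / L) * emeasure N (\<Union>n. Y n)"
  using suminf_emeasure[OF Ym disj] by simp
 \<comment> \<open>The selected disjoint intervals lie in two periods, which turns 160 into
   320.\<close>
 also have "(\<Union>n. Y n) \<subseteq> {-pi..3*pi}"
 proof
  fix x assume "x \<in> (\<Union>n. Y n)"
  then obtain c where c: "c \<in> C" "x \<in> cball c (l c)"
   using J(1) by (auto simp: Y_def split: if_splits)
  then have "c \<in> S" using C by auto
  with l[OF this] have "0 \<le> c" "c \<le> 2 * pi" "l c \<le> pi" by (auto simp: S_def)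
  then show "x \<in> {-pi..3*pi}" using c(2) by (auto simp: cball_eq_atLeastAtMost)
 qed
 then have "emeasure N (\<Union>n. Y n) \<le> emeasure N {-pi..3*pi}" by (intro emeasure_mono) (auto simp: N_def)
 also have "\<dots> \<le> ennreal (2 * m)"
  unfolding Nint
 proof (rule ennreal_leI)
  have "integral {-pi..3*pi} g = integral {-pi..pi} g + integral {pi..3*pi} g"
   by (rule Henstock_Kurzweil_Integration.integral_combine[symmetric]) (auto intro: integrable_on_continuous g)
  also have "integral {-pi..pi} g \<le> m" using m[of 0] by (simp add: g_def[abs_def])
  also have "integral {pi..3*pi} g = integral {2 * pi + (-pi)..2 * pi + pi} g" by (simp add: algebra_simps)
  also have "\<dots> = integral {-pi..pi} (\<lambda>s. g (2 * pi + s))"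
   using has_integral_shifted[OF g(1), of "2 * pi" "-pi" pi] by (rule integral_unique[symmetric])
  also have "\<dots> \<le> m" using m[of "2 * pi"] by (simp add: g_def)
  finally show "integral {-pi..3*pi} g \<le> 2 * m" by simp
 qed
 finally have "emeasure lborel S \<le> ennreal (160 / L) * ennreal (2 * m)"
  by (simp add: mult_left_mono)
 also have "\<dots> = ennreal (320 * m / L)" using L by (simp flip: ennreal_mult')
 finally show "emeasure lborel S \<le> ennreal (320 * m / L)" .
qed

section \<open>Radial limits of Blaschke products\<close>

lemma norm_one_minus_BP:
 assumes K: "bseq K a" and z: "cmod z < 1"
 shows "cmod (1 - BP K a z) \<le> exp ((2 / (1 - cmod z)) * (\<Sum>j. if j \<in> K then 1 - cmod (a j) else 0)) - 1"
proof (rule LIMSEQ_le_const2[OF tendsto_norm[OF tendsto_diff[OF tendsto_const BP_LIMSEQ[OF K z]]]])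
 let ?s = "\<lambda>j. if j \<in> K then 1 - cmod (a j) else 0"
 have "cmod (1 - BF (K \<inter> {..<n}) a z) \<le> exp ((2 / (1 - cmod z)) * suminf ?s) - 1" for n
 proof -
  have "cmod (1 - BF (K \<inter> {..<n}) a z) = cmod ((\<Prod>j\<in>K \<inter> {..<n}. 1 + (bf (a j) z - 1)) - 1)"
   by (simp add: BF_def norm_minus_commute)
  also have "\<dots> \<le> (\<Prod>j\<in>K \<inter> {..<n}. 1 + cmod (bf (a j) z - 1)) - 1"
   by (rule norm_prod_minus1_le_prod_minus1)
  also have "(\<Prod>j\<in>K \<inter> {..<n}. 1 + cmod (bf (a j) z - 1)) \<le> exp (\<Sum>j\<in>K \<inter> {..<n}. cmod (bf (a j) z - 1))"
   by (rule prod_le_exp_sum) auto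
  also have "(\<Sum>j\<in>K \<inter> {..<n}. cmod (bf (a j) z - 1)) \<le> (\<Sum>j\<in>K \<inter> {..<n}. (2 / (1 - cmod z)) * ?s j)"
   using norm_one_minus_bf[OF bseq_lt_1[OF K] z] by (intro sum_mono) (auto simp: norm_minus_commute mult.commute)
  also have "\<dots> = (2 / (1 - cmod z)) * (\<Sum>j\<in>K \<inter> {..<n}. ?s j)" by (simp add: sum_distrib_left)
  also have "\<dots> \<le> (2 / (1 - cmod z)) * suminf ?s"
   using z bseq_lt_1[OF K] by (intro mult_left_mono sum_le_suminf bseq_summable[OF K]) (auto intro: less_imp_le)
  finally show ?thesis by simp
 qed
 then show "\<exists>N. \<forall>n\<ge>N. cmod (1 - BF (K \<inter> {..<n}) a z) \<le> exp ((2 / (1 - cmod z)) * suminf ?s) - 1" by blast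
qed

lemma BP_tail_tendsto:
 assumes J: "bseq J a" and z: "cmod z < 1"
 shows "(\<lambda>n. BP (J \<inter> {n..}) a z) \<longlonglongrightarrow> 1"
proof -
 let ?s = "\<lambda>j. if j \<in> J then 1 - cmod (a j) else 0"
 let ?c = "2 / (1 - cmod z)"
 have e: "(\<Sum>j. if j \<in> J \<inter> {n..} then 1 - cmod (a j) else 0) = (\<Sum>j. ?s (j + n))" for n
 proof -
  have "(\<Sum>j. if j \<in> J \<inter> {n..} then 1 - cmod (a j) else 0) =
   (\<Sum>j. if j + n \<in> J \<inter> {n..} then 1 - cmod (a (j + n)) else 0) + (\<Sum>j<n. if j \<in> J \<inter> {n..} then 1 - cmod (a j) else 0)"
   by (rule suminf_split_initial_segment[OF bseq_summable]) (rule bseq_subset[OF J], auto)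
  then show ?thesis by simp
 qed
 have "(\<lambda>n. cmod (1 - BP (J \<inter> {n..}) a z)) \<longlonglongrightarrow> 0"
 proof (rule real_tendsto_sandwich[where f = "\<lambda>_. 0"])
  show "\<forall>\<^sub>F n in sequentially. cmod (1 - BP (J \<inter> {n..}) a z) \<le> exp (?c * (\<Sum>j. ?s (j + n))) - 1"
   using norm_one_minus_BP[OF bseq_subset[OF J] z, of "J \<inter> {n..}" for n] unfolding e by auto
  have "(\<lambda>n. exp (?c * (\<Sum>j. ?s (j + n))) - 1) \<longlonglongrightarrow> exp (?c * 0) - 1"
   by (intro tendsto_intros suminf_exist_split2 bseq_summable J)
  then show "(\<lambda>n. exp (?c * (\<Sum>j. ?s (j + n))) - 1) \<longlonglongrightarrow> 0" by simp
 qed auto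
 then have "(\<lambda>n. 1 - BP (J \<inter> {n..}) a z) \<longlonglongrightarrow> 0" by (rule tendsto_norm_zero_cancel)
 from tendsto_diff[OF tendsto_const[of 1] this] show ?thesis by simp
qed

text \<open>If \<open>cmod T \<le> 1\<close>, then
  \<open>(cmod (1 - T))\<^sup>2 \<le> 2 * Re (1 - T)\<close>, and the mean of the right side is its
  value at 0. So closeness to 1 at the origin controls the square means on all circles.\<close>

lemma mean_square_defect:
 assumes T: "hol T" "\<And>z. cmod z < 1 ==> cmod (T z) \<le> 1" and c: "cmod c < 1"
 shows "integral {-pi..pi} (\<lambda>s. (cmod (1 - T (c * cis s)))\<^sup>2) \<le> 4 * pi * cmod (1 - T 0)"
proof -
 let ?G = "\<lambda>z. 1 - T (c * z)"
 have G: "continuous_on (cball 0 1) ?G" "hol (?G)"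
  by (intro continuous_intros holomorphic_intros dilate_holomorphic[OF T(1) c])+
 have "((\<lambda>s. ?G (cis s) * of_real (pker 0 s)) has_integral 2 * of_real pi * ?G 0) {-pi..pi}"
  by (rule poisson_formula[OF G]) simp
 then have "((\<lambda>s. ?G (cis s)) has_integral 2 * of_real pi * ?G 0) {-pi..pi}" by (simp add: pker_def)
 from has_integral_mult_right[OF has_integral_linear[OF this bounded_linear_Re], of 2]
 have I: "((\<lambda>s. 2 * Re (?G (cis s))) has_integral 4 * pi * Re (1 - T 0)) {-pi..pi}" by (simp add: o_def mult.assoc)
 have "integral {-pi..pi} (\<lambda>s. (cmod (?G (cis s)))\<^sup>2) \<le> 4 * pi * Re (1 - T 0)"
 proof (rule has_integral_le[OF integrable_integral I])
  show "(\<lambda>s. (cmod (?G (cis s)))\<^sup>2) integrable_on {-pi..pi}"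
   by (intro integrable_on_continuous continuous_intros continuous_on_circle[OF G(1)])
  fix s
  have "cmod (T (c * cis s)) \<le> 1" using T(2) c by (simp add: norm_mult)
  then have "(cmod (T (c * cis s)))\<^sup>2 \<le> 1" by (simp add: power_le_one)
  then show "(cmod (?G (cis s)))\<^sup>2 \<le> 2 * Re (?G (cis s))"
   unfolding cmod_power2 by (simp add: power2_eq_square algebra_simps)
 qed
 also have "\<dots> \<le> 4 * pi * cmod (1 - T 0)" by (intro mult_left_mono complex_Re_le_cmod) auto
 finally show ?thesis .
qed

text \<open>A Cauchy argument: the approximating points \<open>u\<close> converge to the limit, so
  it never has to be named. In the application \<open>u\<close> is the boundary value of a finite
  partial product.\<close>

lemma limit_near_circle:
 fixes f :: "'a \<Rightarrow> complex"
 assumes F: "F \<noteq> bot" and H: "\<And>e. e > 0 ==> \<exists>u. cmod u = 1 \<and> eventually (\<lambda>x. cmod (f x - u) \<le> e) F"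
 shows "\<exists>l. (f \<longlongrightarrow> l) F \<and> cmod l = 1"
proof -
 have "\<forall>n. \<exists>u. cmod u = 1 \<and> eventually (\<lambda>x. cmod (f x - u) \<le> 1 / (real n + 1)) F"
  using H by simp
 then obtain u where u: "\<And>n. cmod (u n) = 1" "\<And>n. eventually (\<lambda>x. cmod (f x - u n) \<le> 1 / (real n + 1)) F"
  by metis
 have d: "cmod (u n - u m) \<le> 1 / (real n + 1) + 1 / (real m + 1)" for n m
 proof -
  obtain x where "cmod (f x - u n) \<le> 1 / (real n + 1)" "cmod (f x - u m) \<le> 1 / (real m + 1)"
   using eventually_happens[OF eventually_conj[OF u(2)[of n] u(2)[of m]]] F by auto
  then show ?thesis using norm_triangle_ineq4[of "f x - u m" "f x - u n"] by simp
 qed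
 have small: "\<exists>N. \<forall>n\<ge>N. 1 / (real n + 1) < e" if e: "e > 0" for e
 proof -
  obtain N where N: "inverse (real (Suc N)) < e" using reals_Archimedean[OF e] by blast
  have "1 / (real n + 1) < e" if "n \<ge> N" for n
  proof -
   have "1 / (real n + 1) \<le> 1 / (real N + 1)" using that by (intro divide_left_mono) auto
   then show ?thesis using N by (simp add: inverse_eq_divide add.commute)
  qed
  then show ?thesis by blast
 qed
 have "Cauchy u"
 proof (rule CauchyI)
  fix e :: real assume e: "e > 0"
  then obtain N where N: "\<And>n. n \<ge> N ==> 1 / (real n + 1) < e / 2" using small[of "e / 2"] by auto
  show "\<exists>M. \<forall>m\<ge>M. \<forall>n\<ge>M. cmod (u m - u n) < e"
  proof (intro exI[of _ N] allI impI)
   fix m n assume "m \<ge> N" "n \<ge> N"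
   then show "cmod (u m - u n) < e" using N[of m] N[of n] d[of m n] by linarith
  qed
 qed
 then obtain l where l: "u \<longlonglongrightarrow> l" using Cauchy_convergent convergent_def by blast
 have "cmod l = 1" using tendsto_norm[OF l] u(1) by (simp add: LIMSEQ_const_iff)
 moreover have "(f \<longlongrightarrow> l) F"
 proof (rule tendstoI)
  fix e :: real assume e: "e > 0"
  from small[of "e / 2"] e obtain N where N: "\<And>n. n \<ge> N ==> 1 / (real n + 1) < e / 2" by auto
  from l e have "eventually (\<lambda>n. dist (u n) l < e / 2) sequentially" by (intro tendstoD) auto
  then obtain M where M: "\<And>n. n \<ge> M ==> dist (u n) l < e / 2" by (auto simp: eventually_sequentially)
  define n where "n = max M N"
  show "eventually (\<lambda>x. dist (f x) l < e) F"
   using u(2)[of n]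
  proof eventually_elim
   case (elim x)
   have "dist (f x) l \<le> dist (f x) (u n) + dist (u n) l" by (rule dist_triangle)
   then show ?case using elim M[of n] N[of n] by (simp add: dist_norm n_def)
  qed
 qed
 ultimately show ?thesis by blast
qed

lemma AE_periodic:
 assumes P: "\<And>t. P (t + 2 * pi) \<longleftrightarrow> P t" and ae: "AE t in lborel. t \<in> {0..2*pi} \<longrightarrow> P t"
 shows "AE t in lborel. P t"
proof -
 obtain N where N: "N \<in> null_sets lborel" "{t. \<not> (t \<in> {0..2*pi} \<longrightarrow> P t)} \<subseteq> N"
  using ae by (auto simp: eventually_ae_filter)
 have shift: "P (t + 2 * pi * real n) \<longleftrightarrow> P t" for t n
 proof (induction n)
  case (Suc n)
  have "t + 2 * pi * real (Suc n) = (t + 2 * pi * real n) + 2 * pi" by (simp add: algebra_simps)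
  then show ?case using P Suc by metis
 qed simp
 have shift': "P (t - 2 * pi * of_int k) \<longleftrightarrow> P t" for t k
 proof (cases "k \<ge> 0")
  case True
  then obtain n where "k = int n" using nonneg_int_cases by blast
  then show ?thesis using shift[of "t - 2 * pi * of_int k" n] by simp
 next
  case False
  then have e: "t - 2 * pi * of_int k = t + 2 * pi * real (nat (- k))" by simp
  show ?thesis unfolding e by (rule shift)
 qed
 have "AE t in lborel. \<forall>k::int. t - 2 * pi * of_int k \<notin> N"
 proof (subst AE_all_countable, intro allI)
  fix k :: int
  show "AE t in lborel. t - 2 * pi * of_int k \<notin> N"
   using AE_not_in[OF null_sets_translation[OF N(1), of "2 * pi * of_int k"]] by simp
 qed
 then show ?thesis
 proof eventually_elim
  case (elim t)
  define k where "k = \<lfloor>t / (2 * pi)\<rfloor>"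
  have "of_int k \<le> t / (2 * pi)" "t / (2 * pi) < of_int k + 1" unfolding k_def by linarith+
  then have "2 * pi * of_int k \<le> t" "t \<le> 2 * pi * of_int k + 2 * pi"
   by (auto simp: field_simps)
  then have "t - 2 * pi * of_int k \<in> {0..2*pi}" by auto
  then have "P (t - 2 * pi * of_int k)" using N(2) elim by blast
  then show ?case using shift' by simp
 qed
qed

text \<open>A finite partial product is continuous and unimodular on the circle. By
  \<open>mean_square_defect\<close> and \<open>weak_type\<close> the remaining tail stays uniformly
  close to 1 along every radius outside a set of angles of small measure.\<close>

theorem BP_radial_limits:
 assumes J: "bseq J a"
 shows "AE t in lborel. \<exists>l. ((\<lambda>r. BP J a (of_real r * cis t)) \<longlongrightarrow> l) (at_left 1) \<and> cmod l = 1"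
proof (rule AE_periodic)
 fix t show "(\<exists>l. ((\<lambda>r. BP J a (of_real r * cis (t + 2 * pi))) \<longlongrightarrow> l) (at_left 1) \<and> cmod l = 1) \<longleftrightarrow>
  (\<exists>l. ((\<lambda>r. BP J a (of_real r * cis t)) \<longlongrightarrow> l) (at_left 1) \<and> cmod l = 1)"
  by (simp add: cis_mult[symmetric])
next
 define T where "T n = BP (J \<inter> {n..}) a" for n
 have Tb: "bseq (J \<inter> {n..}) a" for n by (rule bseq_subset[OF J]) auto
 have T: "hol (T n)" "\<And>z. cmod z < 1 ==> cmod (T n z) \<le> 1" for n
  unfolding T_def using BP_holomorphic[OF Tb] norm_BP_le_1[OF Tb] by auto
 define F where "F n z = 1 - T n z" for n z
 have F: "hol (F n)" for n unfolding F_def[abs_def] by (intro holomorphic_intros T)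
 define m where "m n = 4 * pi * cmod (1 - T n 0)" for n
 define Rk where "Rk i = 1 - 1 / (real i + 2)" for i
 have Rk: "0 < Rk i" "Rk i < 1" for i by (auto simp: Rk_def divide_simps)
 define S where "S n L i = {t \<in> {0..2*pi}. \<exists>r. 0 \<le> r \<and> r < Rk i \<and> L < (cmod (F n (of_real r * cis t)))\<^sup>2}" for n L i
 have S: "S n L i \<in> sets borel" "emeasure lborel (S n L i) \<le> ennreal (320 * m n / L)" if "L > 0" for n L i
 proof -
  have mm: "integral {-pi..pi} (\<lambda>s. (cmod (F n (of_real (Rk i) * cis (t + s))))\<^sup>2) \<le> m n" for t
  proof -
   have "cmod (of_real (Rk i) * cis t) < 1" using Rk[of i] by (simp add: norm_mult)
   from mean_square_defect[OF T this, of n] show ?thesis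
    unfolding F_def m_def by (simp add: cis_mult[symmetric] mult.assoc)
  qed
  show "S n L i \<in> sets borel" "emeasure lborel (S n L i) \<le> ennreal (320 * m n / L)"
   unfolding S_def using weak_type[OF F Rk that mm] by auto
 qed
 define V where "V n L = (\<Union>i. S n L i)" for n L
 have V: "V n L \<in> sets borel" "emeasure lborel (V n L) \<le> ennreal (320 * m n / L)" if "L > 0" for n L
 proof -
  show "V n L \<in> sets borel" unfolding V_def using S(1)[OF that] by auto
  have "incseq (S n L)"
  proof (rule incseq_SucI)
   fix i
   have "Rk i \<le> Rk (Suc i)" unfolding Rk_def by (intro diff_left_mono divide_left_mono) auto
   then show "S n L i \<subseteq> S n L (Suc i)" unfolding S_def by force
  qed
  then have "emeasure lborel (V n L) = (SUP i. emeasure lborel (S n L i))"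
   unfolding V_def using S(1)[OF that] by (intro SUP_emeasure_incseq[symmetric]) auto
  then show "emeasure lborel (V n L) \<le> ennreal (320 * m n / L)"
   using S(2)[OF that] by (auto intro: SUP_least)
 qed
 have m0: "m \<longlonglongrightarrow> 4 * pi * cmod (1 - 1)" unfolding m_def T_def
  by (intro tendsto_intros BP_tail_tendsto J) simp
 \<comment> \<open>An angle in all the sets \<open>V n L\<close> is bad for every tail; their
   measures tend to 0 because \<open>T n 0\<close> tends to 1.\<close>
 have null: "(\<Inter>n. V n L) \<in> null_sets lborel" if L: "L > 0" for L
 proof (rule null_setsI)
  show meas: "(\<Inter>n. V n L) \<in> sets lborel" using V(1)[OF L] by auto
  have "emeasure lborel (\<Inter>n. V n L) \<le> ennreal (320 * m n / L)" for n
   by (rule order_trans[OF emeasure_mono V(2)[OF L, of n]]) (use V(1)[OF L] in auto)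
  moreover have "(\<lambda>n. ennreal (320 * m n / L)) \<longlonglongrightarrow> ennreal (320 * (4 * pi * cmod (1 - 1)) / L)"
   using L by (intro tendsto_ennrealI tendsto_intros m0) auto
  ultimately have "emeasure lborel (\<Inter>n. V n L) \<le> ennreal (320 * (4 * pi * cmod (1 - 1)) / L)"
   by (intro LIMSEQ_le_const) auto
  then show "emeasure lborel (\<Inter>n. V n L) = 0" by simp
 qed
 have "AE t in lborel. \<forall>k::nat. t \<notin> (\<Inter>n. V n (1 / (real k + 1)))"
  by (subst AE_all_countable, intro allI AE_not_in null) simp
 then show "AE t in lborel. t \<in> {0..2*pi} \<longrightarrow> (\<exists>l. ((\<lambda>r. BP J a (of_real r * cis t)) \<longlongrightarrow> l) (at_left 1) \<and> cmod l = 1)"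
 proof eventually_elim
  case (elim t)
  show ?case
  proof (intro impI limit_near_circle)
   assume t: "t \<in> {0..2*pi}"
   fix e :: real assume e: "e > 0"
   obtain k where k: "inverse (real (Suc k)) < (e / 2)\<^sup>2" using reals_Archimedean[of "(e / 2)\<^sup>2"] e by auto
   obtain n where n: "t \<notin> V n (1 / (real k + 1))" using elim by blast
   have small: "cmod (F n (of_real r * cis t)) \<le> e / 2" if r: "0 \<le> r" "r < 1" for r
   proof -
    obtain i where i: "inverse (real (Suc i)) < 1 - r" using reals_Archimedean[of "1 - r"] r by auto
    have "1 / (real i + 2) \<le> 1 / (real i + 1)" by (intro divide_left_mono) auto
    then have "r < Rk i" using i unfolding Rk_def by (simp add: inverse_eq_divide add.commute)
    moreover have "\<not> (\<exists>r. 0 \<le> r \<and> r < Rk i \<and> 1 / (real k + 1) < (cmod (F n (of_real r * cis t)))\<^sup>2)"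
     using n t unfolding V_def S_def by blast
    ultimately have "(cmod (F n (of_real r * cis t)))\<^sup>2 \<le> 1 / (real k + 1)"
     using r(1) by (meson not_less)
    also have "\<dots> \<le> (e / 2)\<^sup>2" using k unfolding inverse_eq_divide of_nat_Suc add.commute[of "1::real"] by simp
    finally show ?thesis using e by (auto dest: power2_le_imp_le)
   qed
   define g where "g = BF (J \<inter> {..<n}) a"
   have gc: "continuous_on (cball 0 1) g" "cmod (g (cis t)) = 1"
    unfolding g_def using bseq_lt_1[OF J] by (auto intro!: BF_continuous norm_BF_sphere)
   have "((\<lambda>r. g (of_real r * cis t)) \<longlongrightarrow> g (of_real 1 * cis t)) (at 1 within {0..1})"
   proof -
    have "continuous_on {0..1} (\<lambda>r::real. g (of_real r * cis t))"
     by (rule continuous_on_compose2[OF gc(1)]) (auto intro!: continuous_intros simp: norm_mult)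
    then have "\<forall>x\<in>{0..1}. ((\<lambda>r. g (of_real r * cis t)) \<longlongrightarrow> g (of_real x * cis t)) (at x within {0..1})"
     unfolding continuous_on_def .
    from bspec[OF this, of 1] show ?thesis by simp
   qed
   then have "((\<lambda>r. g (of_real r * cis t)) \<longlongrightarrow> g (cis t)) (at_left 1)"
    using at_within_Icc_at_left[of 0 "1::real"] by simp
   from tendstoD[OF this, of "e / 2"] e
   have 1: "eventually (\<lambda>r. dist (g (of_real r * cis t)) (g (cis t)) < e / 2) (at_left 1)" by simp
   have 2: "eventually (\<lambda>r. 0 < r \<and> r < (1::real)) (at_left 1)"
    by (auto simp: eventually_at_left_field intro!: exI[of _ 0])
   have "eventually (\<lambda>r. cmod (BP J a (of_real r * cis t) - g (cis t)) \<le> e) (at_left 1)"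
    using 1 2
   proof eventually_elim
    case (elim r)
    define w where "w = of_real r * cis t"
    have w: "cmod w < 1" using elim by (simp add: w_def norm_mult)
    have "J - J \<inter> {..<n} = J \<inter> {n..}" by auto
    then have "BP J a w = g w * T n w"
     using BP_split_finite[OF J, of "J \<inter> {..<n}" w] w unfolding g_def T_def by simp
    then have "BP J a w - g (cis t) = (g w - g (cis t)) - g w * F n w" by (simp add: F_def algebra_simps)
    then have "cmod (BP J a w - g (cis t)) \<le> cmod (g w - g (cis t)) + cmod (g w) * cmod (F n w)"
     by (metis norm_mult norm_triangle_ineq4)
    also have "cmod (g w) * cmod (F n w) \<le> 1 * (e / 2)"
    proof (intro mult_mono)
     show "cmod (g w) \<le> 1" unfolding g_def using bseq_lt_1[OF J] w by (intro norm_BF_le_1) auto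
     show "cmod (F n w) \<le> e / 2" unfolding w_def using elim by (intro small) auto
    qed auto
    finally show ?case using elim unfolding w_def[symmetric] by (simp add: dist_norm)
   qed
   then show "\<exists>u. cmod u = 1 \<and> eventually (\<lambda>r. cmod (BP J a (of_real r * cis t) - u) \<le> e) (at_left 1)"
    using gc(2) by blast
  qed simp
 qed
qed

section \<open>Carleson conditions on the zeros\<close>

text \<open>The conformally invariant form of the Carleson measure condition. Quantifying over
  finite sets avoids infinite sums, and the case \<open>z = 0\<close> already contains the Blaschke
  condition, see \<open>kb_bseq\<close>.\<close>

definition kb :: "real \<Rightarrow> nat set \<Rightarrow> (nat \<Rightarrow> complex) \<Rightarrow> bool" where
 "kb A J a \<longleftrightarrow> (\<forall>z F. cmod z < 1 \<and> finite F \<and> F \<subseteq> J \<longrightarrow> (\<Sum>j\<in>F. kap z (a j)) \<le> A)"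

abbreviation far :: "nat set \<Rightarrow> (nat \<Rightarrow> complex) \<Rightarrow> real \<Rightarrow> complex \<Rightarrow> nat set \<Rightarrow> bool" where
 "far J a \<tau> z F \<equiv> cmod z < 1 \<and> finite F \<and> F \<subseteq> J \<and> (\<forall>j\<in>F. kap z (a j) \<le> \<tau>)"

definition bsm :: "nat set \<Rightarrow> (nat \<Rightarrow> complex) \<Rightarrow> bool" where
 "bsm J a \<longleftrightarrow> (\<forall>\<eta>>0. \<exists>\<tau>>0. \<forall>z F. far J a \<tau> z F
   \<longrightarrow> (\<Sum>j\<in>F. kap z (a j)) \<le> \<eta>)"

definition csm :: "nat set \<Rightarrow> (nat \<Rightarrow> complex) \<Rightarrow> bool" where
 "csm J a \<longleftrightarrow> (\<forall>\<eta>>0. \<exists>\<delta>>0. \<forall>\<theta> h F. 0 < h \<and> finite F \<and> F \<subseteq> J \<and> (\<forall>k\<in>F. a k \<in> thin_box \<theta> h \<delta>)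
   \<longrightarrow> (\<Sum>k\<in>F. 1 - cmod (a k)) \<le> \<eta> * h)"

text \<open>Boxes are replaced by balls of the quasi-distance \<open>cmod (1 - cnj a * z)\<close>.
  Dyadic rings of such balls are exactly what the denominator of \<open>kap\<close> requires, and no
  arguments of complex numbers appear.\<close>

definition carl :: "real \<Rightarrow> nat set \<Rightarrow> (nat \<Rightarrow> complex) \<Rightarrow> bool" where
 "carl A J a \<longleftrightarrow> (\<forall>z y F. cmod z < 1 \<and> 0 < y \<and> finite F \<and> F \<subseteq> J \<and> (\<forall>j\<in>F. cmod (1 - cnj (a j) * z) < y)
   \<longrightarrow> (\<Sum>j\<in>F. 1 - cmod (a j)) \<le> A * y)"

lemma kbD: "kb A J a ==> cmod z < 1 ==> finite F ==> F \<subseteq> J ==> (\<Sum>j\<in>F. kap z (a j)) \<le> A"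
 by (simp add: kb_def)

lemma carlD:
 assumes "carl A J a" "cmod z < 1" "0 < y" "finite F" "F \<subseteq> J"
  and "\<And>j. j \<in> F ==> cmod (1 - cnj (a j) * z) < y"
 shows "(\<Sum>j\<in>F. 1 - cmod (a j)) \<le> A * y"
 using assms unfolding carl_def by blast

lemma kb_nonneg: "kb A J a ==> 0 \<le> A"
 using kbD[of A J a 0 "{}"] by simp

lemma kb_subset: "kb A J a ==> K \<subseteq> J ==> kb A K a"
 unfolding kb_def by blast

section \<open>Box conditions against kernel conditions\<close>

text \<open>Dyadic rings in \<open>D\<close>: the part up to scale \<open>k\<close> has mass at most
  \<open>A * 2 ^ k * Y\<close> and the ring carries weight at most
  \<open>4 / (4 ^ k * Y\<^sup>2)\<close>, so the contributions form a geometric series of ratio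
  1/2.\<close>

lemma ring_sum:
 fixes d D :: "nat \<Rightarrow> real"
 assumes F: "finite F" and d: "\<And>j. j \<in> F ==> 0 \<le> d j" and Y: "0 < Y" and D: "\<And>j. j \<in> F ==> Y \<le> D j"
  and H: "\<And>y. 0 < y ==> (\<Sum>j\<in>{j\<in>F. D j < y}. d j) \<le> A * y" and A: "0 \<le> A"
 shows "(\<Sum>j\<in>F. d j / (D j)\<^sup>2) \<le> 8 * A / Y"
proof -
 obtain N where N: "(\<Sum>j\<in>F. \<bar>D j\<bar>) / Y < 2 ^ N" using real_arch_pow[of 2] by auto
 have DN: "D j < 2 ^ N * Y" if "j \<in> F" for j
 proof -
  have "\<bar>D j\<bar> \<le> (\<Sum>j\<in>F. \<bar>D j\<bar>)" using F that by (intro member_le_sum) auto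
  moreover have "(\<Sum>j\<in>F. \<bar>D j\<bar>) < 2 ^ N * Y" using N Y by (simp add: pos_divide_less_eq)
  ultimately show ?thesis by linarith
 qed
 define e where "e k j = (if D j < 2 ^ k * Y then d j else 0)" for k j
 have pw: "d j / (D j)\<^sup>2 \<le> (\<Sum>k\<le>N. 4 / (4 ^ k * Y\<^sup>2) * e k j)" if j: "j \<in> F" for j
 proof -
  define k where "k = (LEAST k. D j < 2 ^ k * Y)"
  have k1: "D j < 2 ^ k * Y" unfolding k_def by (rule LeastI) (rule DN[OF j])
  have k2: "k \<le> N" unfolding k_def by (rule Least_le) (rule DN[OF j])
  have "k \<noteq> 0" using k1 D[OF j] by (intro notI) simp
  then obtain m where m: "k = Suc m" using not0_implies_Suc by blast
  have "\<not> D j < 2 ^ m * Y" using not_less_Least[of m "\<lambda>k. D j < 2 ^ k * Y"] m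
   unfolding k_def[symmetric] by simp
  then have "(2 ^ m * Y)\<^sup>2 \<le> (D j)\<^sup>2" using Y by (intro power_mono) auto
  moreover have "(2 ^ m * Y)\<^sup>2 = 4 ^ m * Y\<^sup>2"
  proof -
   have "(2 ^ m)\<^sup>2 = (4::real) ^ m" by (simp add: power2_eq_square flip: power_mult_distrib)
   then show ?thesis by (simp add: power_mult_distrib)
  qed
  ultimately have "d j / (D j)\<^sup>2 \<le> d j / (4 ^ m * Y\<^sup>2)"
   using Y d[OF j] D[OF j] by (intro divide_left_mono) auto
  also have "\<dots> = 4 / (4 ^ k * Y\<^sup>2) * e k j" using k1 unfolding e_def m by simp
  also have "\<dots> \<le> (\<Sum>k\<le>N. 4 / (4 ^ k * Y\<^sup>2) * e k j)"
   using k2 d[OF j] Y by (intro member_le_sum) (auto simp: e_def)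
  finally show ?thesis .
 qed
 have "(\<Sum>j\<in>F. d j / (D j)\<^sup>2) \<le> (\<Sum>j\<in>F. \<Sum>k\<le>N. 4 / (4 ^ k * Y\<^sup>2) * e k j)" by (intro sum_mono pw)
 also have "\<dots> = (\<Sum>k\<le>N. 4 / (4 ^ k * Y\<^sup>2) * (\<Sum>j\<in>F. e k j))"
  by (subst sum.swap) (simp add: sum_distrib_left)
 also have "\<dots> \<le> (\<Sum>k\<le>N. 4 * A / Y * (1 / 2) ^ k)"
 proof (rule sum_mono)
  fix k
  have "(\<Sum>j\<in>F. e k j) = (\<Sum>j\<in>{j\<in>F. D j < 2 ^ k * Y}. d j)"
   unfolding e_def using F by (simp add: sum.inter_filter)
  also have "\<dots> \<le> A * (2 ^ k * Y)" using Y by (intro H) auto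
  finally have "4 / (4 ^ k * Y\<^sup>2) * (\<Sum>j\<in>F. e k j) \<le> 4 / (4 ^ k * Y\<^sup>2) * (A * (2 ^ k * Y))"
   using Y by (intro mult_left_mono) auto
  also have "\<dots> = 4 * A / Y * (2 ^ k / 4 ^ k)" using Y by (simp add: power2_eq_square mult.commute)
  also have "2 ^ k / 4 ^ k = (1 / 2 :: real) ^ k" by (simp flip: power_divide)
  finally show "4 / (4 ^ k * Y\<^sup>2) * (\<Sum>j\<in>F. e k j) \<le> 4 * A / Y * (1 / 2) ^ k" .
 qed
 also have "\<dots> = 4 * A / Y * (\<Sum>k\<le>N. (1 / 2) ^ k)" by (simp add: sum_distrib_left)
 also have "(\<Sum>k\<le>N. (1 / 2) ^ k) = 2 - (1 / 2 :: real) ^ N" by (induction N) auto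
 also have "4 * A / Y * (2 - (1 / 2) ^ N) \<le> 4 * A / Y * 2" using A Y by (intro mult_left_mono) auto
 finally show ?thesis by simp
qed

lemma angle_repr:
 assumes z: "cmod z < 1" "z = of_real (cmod z) * cis \<theta>" and a: "cmod a < 1"
 obtains \<phi> where "\<bar>\<phi>\<bar> \<le> pi" "\<bar>\<phi>\<bar> \<le> 4 * cmod (1 - cnj a * z)" "a = of_real (cmod a) * cis (\<theta> + \<phi>)"
proof -
 define \<phi> where "\<phi> = Arg (a * cis (- \<theta>))"
 have p: "\<bar>\<phi>\<bar> \<le> pi" using Arg_bounded[of "a * cis (- \<theta>)"] unfolding \<phi>_def by linarith
 have "a * cis (- \<theta>) = of_real (cmod a) * cis \<phi>"
  using rcis_cmod_Arg[of "a * cis (- \<theta>)"] unfolding rcis_def \<phi>_def[symmetric] by (simp add: norm_mult)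
 then have "a * cis (- \<theta>) * cis \<theta> = of_real (cmod a) * cis \<phi> * cis \<theta>" by simp
 then have ae: "a = of_real (cmod a) * cis (\<theta> + \<phi>)" by (simp add: mult.assoc cis_mult add.commute)
 have "cnj a * z = of_real (cmod a * cmod z) * cis (- \<phi>)"
  by (subst ae, subst z(2)) (simp add: cis_cnj cis_mult algebra_simps)
 then have "\<bar>- \<phi>\<bar> \<le> 4 * cmod (1 - cnj a * z)"
  using abs_angle_le[of "- \<phi>" "cmod a * cmod z"] p a z(1) by (simp add: mult_le_one)
 then show ?thesis using that p ae by simp
qed

lemma thin_boxI:
 assumes "a = of_real (cmod a) * cis (\<theta> + \<phi>)" "\<bar>\<phi>\<bar> < h" "cmod a < 1" "1 - cmod a < \<delta> * h"
 shows "a \<in> thin_box \<theta> h \<delta>"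
 unfolding thin_box_def mem_Collect_eq
 by (rule exI[of _ "cmod a"], rule exI[of _ "\<theta> + \<phi>"]) (intro conjI assms(1,4), use assms(2,3) in auto)

lemma polar_form: obtains \<theta> where "z = of_real (cmod z) * cis \<theta>"
 using rcis_cmod_Arg[of z] unfolding rcis_def by metis

lemma kap_le_ring:
 assumes "cmod z < 1" "cmod a < 1"
 shows "kap z a \<le> 4 * (1 - cmod z) * ((1 - cmod a) / (cmod (1 - cnj a * z))\<^sup>2)"
proof -
 have "(1 - (cmod z)\<^sup>2) * (1 - (cmod a)\<^sup>2) \<le> (2 * (1 - cmod z)) * (2 * (1 - cmod a))"
  using one_minus_sq_bounds[OF assms(1)] one_minus_sq_bounds[OF assms(2)] assms by (intro mult_mono) auto
 then have "kap z a \<le> (2 * (1 - cmod z)) * (2 * (1 - cmod a)) / (cmod (1 - cnj a * z))\<^sup>2"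
  unfolding kap_def by (rule divide_right_mono) simp
 moreover have "(2 * x) * (2 * y) / e = 4 * x * (y / e)" for x y e :: real by simp
 ultimately show ?thesis by metis
qed

lemma carl_kb:
 assumes c: "carl A J a" and J: "\<And>j. j \<in> J ==> cmod (a j) < 1" and A: "0 \<le> A"
 shows "kb (32 * A) J a"
 unfolding kb_def
proof (intro allI impI, elim conjE)
 fix z F assume z: "cmod z < 1" and F: "finite F" "F \<subseteq> J"
 have aj: "cmod (a j) < 1" if "j \<in> F" for j using J F that by auto
 have "(\<Sum>j\<in>F. kap z (a j)) \<le> (\<Sum>j\<in>F. 4 * (1 - cmod z) * ((1 - cmod (a j)) / (cmod (1 - cnj (a j) * z))\<^sup>2))"
  using z aj by (intro sum_mono kap_le_ring) auto
 also have "\<dots> = 4 * (1 - cmod z) * (\<Sum>j\<in>F. (1 - cmod (a j)) / (cmod (1 - cnj (a j) * z))\<^sup>2)"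
  by (simp add: sum_distrib_left)
 also have "(\<Sum>j\<in>F. (1 - cmod (a j)) / (cmod (1 - cnj (a j) * z))\<^sup>2) \<le> 8 * A / (1 - cmod z)"
 proof (rule ring_sum[OF F(1)])
  fix y :: real assume y: "0 < y"
  show "(\<Sum>j\<in>{j \<in> F. cmod (1 - cnj (a j) * z) < y}. 1 - cmod (a j)) \<le> A * y"
   by (rule carlD[OF c z y]) (use F in auto)
 qed (use z aj A in \<open>auto intro: less_imp_le one_minus_le_norm_den'\<close>)
 finally have "(\<Sum>j\<in>F. kap z (a j)) \<le> 4 * (1 - cmod z) * (8 * A / (1 - cmod z))"
  using z by simp
 moreover have "4 * x * (8 * A / x) = 32 * A" if "x \<noteq> 0" for x using that by simp
 ultimately show "(\<Sum>j\<in>F. kap z (a j)) \<le> 32 * A" using z by (metis less_irrefl right_minus_eq)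
qed

lemma csm_carl:
 assumes c: "csm J a" and J: "\<And>j. j \<in> J ==> cmod (a j) < 1"
 shows "\<exists>A\<ge>0. carl A J a"
proof -
 obtain \<delta> where \<delta>: "\<delta> > 0" and H: "\<And>\<theta> h F. 0 < h ==> finite F ==> F \<subseteq> J ==> (\<And>k. k\<in>F ==> a k \<in> thin_box \<theta> h \<delta>)
   ==> (\<Sum>k\<in>F. 1 - cmod (a k)) \<le> 1 * h"
  using c unfolding csm_def by (metis zero_less_one)
 \<comment> \<open>Width: the angle is below \<open>5 * y\<close>. Thickness: the summand
   \<open>2 / \<delta>\<close> makes \<delta> times the width of the box exceed \<open>y\<close>,
   which bounds \<open>1 - cmod (a j)\<close>.\<close>
 have "carl (5 + 2 / \<delta>) J a" unfolding carl_def
 proof (intro allI impI, elim conjE)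
  fix z :: complex and y :: real and F assume z: "cmod z < 1" and y: "0 < y" and F: "finite F" "F \<subseteq> J"
   and D: "\<forall>j\<in>F. cmod (1 - cnj (a j) * z) < y"
  obtain \<theta> where th: "z = of_real (cmod z) * cis \<theta>" by (rule polar_form)
  have h: "0 < (5 + 2 / \<delta>) * y" using y \<delta> by (intro mult_pos_pos add_pos_pos) auto
  have "(\<Sum>k\<in>F. 1 - cmod (a k)) \<le> 1 * ((5 + 2 / \<delta>) * y)"
  proof (rule H[where \<theta> = \<theta>, OF h F])
   fix j assume j: "j \<in> F"
   have aj: "cmod (a j) < 1" using J F j by auto
   obtain \<phi> where \<phi>: "\<bar>\<phi>\<bar> \<le> pi" "\<bar>\<phi>\<bar> \<le> 4 * cmod (1 - cnj (a j) * z)" "a j = of_real (cmod (a j)) * cis (\<theta> + \<phi>)"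
    by (rule angle_repr[OF z th aj])
   have Dj: "cmod (1 - cnj (a j) * z) < y" using D j by auto
   have "1 - cmod (a j) < y" using one_minus_le_norm_den[of z "a j"] z Dj by auto
   also have "y < \<delta> * ((5 + 2 / \<delta>) * y)"
   proof -
    have "\<delta> * ((5 + 2 / \<delta>) * y) = 5 * (\<delta> * y) + 2 * y" using \<delta> by (simp add: field_simps)
    moreover have "0 < \<delta> * y" using \<delta> y by simp
    ultimately show ?thesis using y by linarith
   qed
   finally have 1: "1 - cmod (a j) < \<delta> * ((5 + 2 / \<delta>) * y)" .
   have "\<bar>\<phi>\<bar> < 5 * y" using \<phi>(2) Dj y by linarith
   also have "5 * y \<le> (5 + 2 / \<delta>) * y" using \<delta> y by (intro mult_right_mono) auto
   finally show "a j \<in> thin_box \<theta> ((5 + 2 / \<delta>) * y) \<delta>"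
    using 1 aj \<phi>(3) by (intro thin_boxI[of _ _ \<phi>])
  qed
  then show "(\<Sum>j\<in>F. 1 - cmod (a j)) \<le> (5 + 2 / \<delta>) * y" by simp
 qed
 moreover have "0 \<le> 5 + 2 / \<delta>" using \<delta> by (intro add_nonneg_nonneg) auto
 ultimately show ?thesis by blast
qed

lemma csm_kb:
 assumes "csm J a" "\<And>j. j \<in> J ==> cmod (a j) < 1"
 shows "\<exists>A. kb A J a"
 using csm_carl[OF assms] carl_kb assms(2) by blast

text \<open>Zeros with \<open>D j \<ge> Q * x\<close> contribute little by the Carleson condition
  alone. For the others, smallness of \<open>kap\<close> forces \<open>1 - cmod (a j)\<close> to be
  small against \<open>Q * x\<close>, so that they all lie in one thin box.\<close>

lemma csm_imp_bsm:
 assumes c: "csm J a" and J: "\<And>j. j \<in> J ==> cmod (a j) < 1"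
 shows "bsm J a"
 unfolding bsm_def
proof (intro allI impI)
 fix \<eta> :: real assume \<eta>: "\<eta> > 0"
 obtain A where A: "0 \<le> A" "carl A J a" using csm_carl[OF assms] by blast
 obtain M where M: "64 * (A + 1) / \<eta> < 2 ^ M" using real_arch_pow[of 2] by auto
 define Q :: real where "Q = 2 ^ M"
 have Q: "Q > 0" "32 * A / Q \<le> \<eta> / 2"
 proof -
  show "Q > 0" by (simp add: Q_def)
  have "64 * A \<le> 64 * (A + 1)" by simp
  also have "\<dots> < Q * \<eta>" using M \<eta> unfolding Q_def by (simp add: pos_divide_less_eq)
  finally show "32 * A / Q \<le> \<eta> / 2" using \<open>Q > 0\<close> by (simp add: divide_simps mult.commute)
 qed
 \<comment> \<open>The box used below has width \<open>5 * Q * x\<close>, and each of its zeros has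
   \<open>kap\<close> at most \<open>4 / x * (1 - cmod (a j))\<close>; with the factor 40 the box
   contributes at most half of \<eta>.\<close>
 define \<eta>' where "\<eta>' = \<eta> / (40 * Q)"
 have "\<eta>' > 0" using \<eta> Q by (simp add: \<eta>'_def)
 then obtain \<delta> where \<delta>: "\<delta> > 0" and H: "\<And>\<theta> h F. 0 < h ==> finite F ==> F \<subseteq> J ==> (\<And>k. k\<in>F ==> a k \<in> thin_box \<theta> h \<delta>)
   ==> (\<Sum>k\<in>F. 1 - cmod (a k)) \<le> \<eta>' * h"
  using c unfolding csm_def by metis
 define \<tau> where "\<tau> = \<delta> / Q"
 have \<tau>: "\<tau> > 0" using \<delta> Q by (simp add: \<tau>_def)
 show "\<exists>\<tau>>0. \<forall>z F. far J a \<tau> z F \<longrightarrow> (\<Sum>j\<in>F. kap z (a j)) \<le> \<eta>"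
 proof (intro exI[of _ \<tau>] conjI \<tau> allI impI, elim conjE)
  fix z F assume z: "cmod z < 1" and F: "finite F" "F \<subseteq> J" and k: "\<forall>j\<in>F. kap z (a j) \<le> \<tau>"
  have aj: "cmod (a j) < 1" if "j \<in> F" for j using J F that by auto
  define x where "x = 1 - cmod z"
  have x: "x > 0" using z by (simp add: x_def)
  define D where "D j = cmod (1 - cnj (a j) * z)" for j
  have xD: "x \<le> D j" "0 < D j" if "j \<in> F" for j
   using one_minus_le_norm_den'[of "a j" z] aj[OF that] x unfolding x_def D_def by auto
  obtain \<theta> where th: "z = of_real (cmod z) * cis \<theta>" by (rule polar_form)
  define F1 where "F1 = {j\<in>F. D j < Q * x}"
  define F2 where "F2 = {j\<in>F. \<not> D j < Q * x}"
  have FF: "finite F1" "finite F2" "F1 \<inter> F2 = {}" "F = F1 \<union> F2" "F1 \<subseteq> J" "F2 \<subseteq> J" "F1 \<subseteq> F" "F2 \<subseteq> F"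
   using F unfolding F1_def F2_def by auto
  have kr: "kap z (a j) \<le> 4 * x * ((1 - cmod (a j)) / (D j)\<^sup>2)" if "j \<in> F" for j
   using kap_le_ring[OF z aj[OF that]] unfolding x_def D_def .
  have "(\<Sum>j\<in>F2. kap z (a j)) \<le> (\<Sum>j\<in>F2. 4 * x * ((1 - cmod (a j)) / (D j)\<^sup>2))"
   using FF(8) by (intro sum_mono kr) auto
  also have "\<dots> = 4 * x * (\<Sum>j\<in>F2. (1 - cmod (a j)) / (D j)\<^sup>2)" by (simp add: sum_distrib_left)
  also have "(\<Sum>j\<in>F2. (1 - cmod (a j)) / (D j)\<^sup>2) \<le> 8 * A / (Q * x)"
  proof (rule ring_sum[OF FF(2) _ _ _ _ A(1)])
   fix y :: real assume y: "0 < y"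
   show "(\<Sum>j\<in>{j \<in> F2. D j < y}. 1 - cmod (a j)) \<le> A * y"
    by (rule carlD[OF A(2) z y]) (use FF(2,6) in \<open>auto simp: D_def\<close>)
  qed (use Q x aj FF(8) in \<open>auto simp: F2_def intro: less_imp_le\<close>)
  finally have "(\<Sum>j\<in>F2. kap z (a j)) \<le> 32 * A / Q" using x by simp
  then have s2: "(\<Sum>j\<in>F2. kap z (a j)) \<le> \<eta> / 2" using Q(2) by linarith
  have h: "0 < 5 * Q * x" using Q x by simp
  have "(\<Sum>j\<in>F1. 1 - cmod (a j)) \<le> \<eta>' * (5 * Q * x)"
  proof (rule H[where \<theta> = \<theta>, OF h FF(1) FF(5)])
   fix j assume j: "j \<in> F1"
   then have jF: "j \<in> F" and Dj: "D j < Q * x" by (auto simp: F1_def)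
   obtain \<phi> where \<phi>: "\<bar>\<phi>\<bar> \<le> pi" "\<bar>\<phi>\<bar> \<le> 4 * D j" "a j = of_real (cmod (a j)) * cis (\<theta> + \<phi>)"
    unfolding D_def by (rule angle_repr[OF z th aj[OF jF]])
   have "x * (1 - cmod (a j)) / (D j)\<^sup>2 \<le> kap z (a j)"
    unfolding kap_def D_def x_def
    using one_minus_sq_bounds(1)[OF z] one_minus_sq_bounds(1)[OF aj[OF jF]] z aj[OF jF]
    by (intro divide_right_mono mult_mono) auto
   also have "\<dots> \<le> \<tau>" using k jF by auto
   finally have "x * (1 - cmod (a j)) \<le> \<tau> * (D j)\<^sup>2" using xD(2)[OF jF] by (simp add: pos_divide_le_eq)
   also have "\<dots> \<le> \<tau> * (Q * x)\<^sup>2" using \<tau> Dj xD(2)[OF jF] by (intro mult_left_mono power_mono) auto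
   also have "\<dots> = x * (\<delta> * (Q * x))" unfolding \<tau>_def using Q by (simp add: power2_eq_square)
   finally have "1 - cmod (a j) \<le> \<delta> * (Q * x)" using x by simp
   also have "\<dots> < \<delta> * (5 * Q * x)" using \<delta> Q x by simp
   finally have 1: "1 - cmod (a j) < \<delta> * (5 * Q * x)" .
   have "\<bar>\<phi>\<bar> < 5 * Q * x" using \<phi>(2) Dj Q x by linarith
   then show "a j \<in> thin_box \<theta> (5 * Q * x) \<delta>"
    using 1 aj[OF jF] \<phi>(3) by (intro thin_boxI[of _ _ \<phi>])
  qed
  also have "\<dots> = \<eta> / 8 * x" unfolding \<eta>'_def using Q by simp
  finally have s1: "(\<Sum>j\<in>F1. 1 - cmod (a j)) \<le> \<eta> / 8 * x" .
  have "(\<Sum>j\<in>F1. kap z (a j)) \<le> (\<Sum>j\<in>F1. 4 / x * (1 - cmod (a j)))"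
  proof (rule sum_mono)
   fix j assume "j \<in> F1"
   then have j: "j \<in> F" using FF(7) by auto
   have "4 * x * ((1 - cmod (a j)) / (D j)\<^sup>2) \<le> 4 * x * ((1 - cmod (a j)) / x\<^sup>2)"
    using xD[OF j] x aj[OF j] by (intro mult_left_mono divide_left_mono power_mono mult_pos_pos) auto
   also have "\<dots> = 4 / x * (1 - cmod (a j))" using x by (simp add: power2_eq_square)
   finally show "kap z (a j) \<le> 4 / x * (1 - cmod (a j))" using kr[OF j] by linarith
  qed
  also have "\<dots> = 4 / x * (\<Sum>j\<in>F1. 1 - cmod (a j))" by (simp add: sum_distrib_left)
  also have "\<dots> \<le> 4 / x * (\<eta> / 8 * x)" using x s1 by (intro mult_left_mono) auto
  also have "\<dots> = \<eta> / 2" using x by simp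
  finally have "(\<Sum>j\<in>F1. kap z (a j)) \<le> \<eta> / 2" .
  then show "(\<Sum>j\<in>F. kap z (a j)) \<le> \<eta>"
   using s2 unfolding FF(4) sum.union_disjoint[OF FF(1-3)] by linarith
 qed
qed

lemma norm_den_le:
 assumes "0 \<le> r" "r \<le> 1" "0 \<le> s" "s \<le> 1"
 shows "cmod (1 - cnj (of_real r * cis u) * (of_real s * cis v)) \<le> (1 - r) + (1 - s) + \<bar>v - u\<bar>"
proof -
 have e: "cnj (of_real r * cis u) * (of_real s * cis v) = of_real (r * s) * cis (v - u)"
  by (simp add: cis_cnj cis_mult)
 have X: "1 - of_real (r * s) * cis (v - u) = of_real (1 - r * s) + of_real (r * s) * (1 - cis (v - u))"
  by (simp add: algebra_simps)
 have "cmod (1 - of_real (r * s) * cis (v - u)) \<le> cmod (complex_of_real (1 - r * s)) + cmod (of_real (r * s) * (1 - cis (v - u)))"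
  unfolding X by (rule norm_triangle_ineq)
 also have "cmod (complex_of_real (1 - r * s)) = 1 - r * s"
  unfolding norm_of_real using assms by (simp add: mult_le_one)
 also have "cmod (of_real (r * s) * (1 - cis (v - u))) \<le> 1 * \<bar>v - u\<bar>"
  unfolding norm_mult
 proof (intro mult_mono)
  show "cmod (1 - cis (v - u)) \<le> \<bar>v - u\<bar>"
   unfolding cis_conv_exp using dist_exp_i_1[of "v - u"] abs_sin_x_le_abs_x[of "(v - u) / 2"] by (simp add: norm_minus_commute)
 qed (use assms in \<open>auto simp: norm_mult mult_le_one\<close>)
 also have "1 - r * s \<le> (1 - r) + (1 - s)"
  using mult_nonneg_nonneg[of "1 - r" "1 - s"] assms by (simp add: algebra_simps)
 finally show ?thesis unfolding e by simp
qed

lemma bsmE: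
 assumes "bsm J a" "\<eta> > 0"
 obtains \<tau> where "\<tau> > 0" "\<And>z F. cmod z < 1 ==> finite F ==> F \<subseteq> J ==> (\<And>j. j \<in> F ==> kap z (a j) \<le> \<tau>)
   ==> (\<Sum>j\<in>F. kap z (a j)) \<le> \<eta>"
proof -
 obtain \<tau> where "\<tau> > 0" "\<forall>z F. far J a \<tau> z F
   \<longrightarrow> (\<Sum>j\<in>F. kap z (a j)) \<le> \<eta>"
  using assms unfolding bsm_def by blast
 then show ?thesis by (intro that[of \<tau>]) blast+
qed

lemma real_less_nat_floor: "0 \<le> x ==> x < real (nat \<lfloor>x\<rfloor>) + 1"
 by linarith

text \<open>For \<open>h < 1\<close> the test point at depth \<open>h\<close> below the centre of
  the box sees each of its zeros with \<open>kap\<close> between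
  \<open>(1 - cmod (a j)) / (9 * h)\<close> and \<open>4 * \<delta>\<close>. For larger
  \<open>h\<close> the origin is the test point, and beyond \<open>H1\<close> the total mass
  \<open>T\<close> is itself at most \<open>\<eta> * h\<close>.\<close>

lemma bsm_imp_csm:
 assumes b: "bsm J a" and J: "bseq J a"
 shows "csm J a"
 unfolding csm_def
proof (intro allI impI)
 fix \<eta> :: real assume \<eta>: "\<eta> > 0"
 obtain \<tau> where \<tau>: "\<tau> > 0" and H: "\<And>z F. cmod z < 1 ==> finite F ==> F \<subseteq> J ==> (\<And>j. j \<in> F ==> kap z (a j) \<le> \<tau>)
   ==> (\<Sum>j\<in>F. kap z (a j)) \<le> \<eta> / 9"
  using \<eta> by (auto intro: bsmE[OF b, of "\<eta> / 9"])
 define T where "T = (\<Sum>j. if j \<in> J then 1 - cmod (a j) else 0)"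
 have T: "(\<Sum>j\<in>F. 1 - cmod (a j)) \<le> T" if "finite F" "F \<subseteq> J" for F
 proof -
  have "(\<Sum>j\<in>F. 1 - cmod (a j)) = (\<Sum>j\<in>F. if j \<in> J then 1 - cmod (a j) else 0)"
   using that by (intro sum.cong) auto
  also have "\<dots> \<le> T" unfolding T_def
   by (intro sum_le_suminf bseq_summable J that) (auto intro: less_imp_le bseq_lt_1[OF J])
  finally show ?thesis .
 qed
 have T0: "0 \<le> T" using T[of "{}"] by simp
 define H1 where "H1 = max 1 (T / \<eta>)"
 have H1: "1 \<le> H1" "T \<le> \<eta> * H1" using \<eta> by (auto simp: H1_def max_def field_simps)
 define \<delta> where "\<delta> = min 1 (\<tau> / (4 * H1))"
 have \<delta>: "0 < \<delta>" "\<delta> \<le> 1" "4 * \<delta> * H1 \<le> \<tau>"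
 proof -
  show "0 < \<delta>" "\<delta> \<le> 1" using \<tau> H1 by (auto simp: \<delta>_def)
  have "\<delta> \<le> \<tau> / (4 * H1)" by (simp add: \<delta>_def)
  then show "4 * \<delta> * H1 \<le> \<tau>" using H1 by (simp add: field_simps)
 qed
 have "4 * \<delta> * 1 \<le> 4 * \<delta> * H1" using \<delta> H1 by (intro mult_left_mono) auto
 then have \<delta>4: "4 * \<delta> \<le> \<tau>" using \<delta>(3) by linarith
 show "\<exists>\<delta>>0. \<forall>\<theta> h F. 0 < h \<and> finite F \<and> F \<subseteq> J \<and> (\<forall>k\<in>F. a k \<in> thin_box \<theta> h \<delta>) \<longrightarrow> (\<Sum>k\<in>F. 1 - cmod (a k)) \<le> \<eta> * h"
 proof (intro exI[of _ \<delta>] conjI \<delta>(1) allI impI, elim conjE)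
  fix \<theta> h :: real and F assume h: "0 < h" and F: "finite F" "F \<subseteq> J" and box: "\<forall>k\<in>F. a k \<in> thin_box \<theta> h \<delta>"
  have aj: "cmod (a j) < 1" if "j \<in> F" for j using bseq_lt_1[OF J] F that by auto
  have bx: "\<exists>\<phi>. a j = of_real (cmod (a j)) * cis \<phi> \<and> \<bar>\<phi> - \<theta>\<bar> < h" "1 - cmod (a j) < \<delta> * h" if jF: "j \<in> F" for j
  proof -
   obtain r \<phi> where r: "a j = of_real r * cis \<phi>" "0 \<le> r" "1 - r < \<delta> * h" "\<bar>\<phi> - \<theta>\<bar> < h"
    using bspec[OF box jF] unfolding thin_box_def mem_Collect_eq by (elim exE conjE) (rule that)
   moreover have "cmod (a j) = r" unfolding r(1) using r(2) by (simp add: norm_mult)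
   ultimately show "\<exists>\<phi>. a j = of_real (cmod (a j)) * cis \<phi> \<and> \<bar>\<phi> - \<theta>\<bar> < h" "1 - cmod (a j) < \<delta> * h"
    by auto
  qed
  consider "h < 1" | "1 \<le> h" "h \<le> H1" | "H1 < h" by linarith
  then show "(\<Sum>k\<in>F. 1 - cmod (a k)) \<le> \<eta> * h"
  proof cases
   case 1
   define z where "z = of_real (1 - h) * cis \<theta>"
   have cz: "cmod z = 1 - h" unfolding z_def norm_mult norm_of_real using 1 by simp
   then have z: "cmod z < 1" using h by simp
   have k: "kap z (a j) \<le> \<tau> \<and> 1 - cmod (a j) \<le> 9 * h * kap z (a j)" if j: "j \<in> F" for j
   proof -
    obtain \<phi> where \<phi>: "a j = of_real (cmod (a j)) * cis \<phi>" "\<bar>\<phi> - \<theta>\<bar> < h" using bx(1)[OF j] by blast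
    define D where "D = cmod (1 - cnj (a j) * z)"
    have "D = cmod (1 - cnj (of_real (cmod (a j)) * cis \<phi>) * (of_real (1 - h) * cis \<theta>))"
     unfolding D_def z_def by (subst \<phi>(1)) simp
    also have "\<dots> \<le> (1 - cmod (a j)) + (1 - (1 - h)) + \<bar>\<theta> - \<phi>\<bar>"
     by (rule norm_den_le) (use aj[OF j] h 1 in auto)
    also have "1 - cmod (a j) \<le> h"
     using bx(2)[OF j] mult_right_mono[OF \<delta>(2), of h] h by linarith
    finally have D3: "D \<le> 3 * h" using \<phi>(2) by (simp add: abs_minus_commute)
    have Dh: "h \<le> D" using one_minus_le_norm_den'[of "a j" z] aj[OF j] cz unfolding D_def by simp
    have "kap z (a j) \<le> 4 * (1 - cmod z) * ((1 - cmod (a j)) / D\<^sup>2)"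
     unfolding D_def by (rule kap_le_ring[OF z aj[OF j]])
    also have "\<dots> \<le> 4 * h * ((1 - cmod (a j)) / h\<^sup>2)"
     unfolding cz using Dh h aj[OF j] by (intro mult_mono divide_left_mono power_mono) auto
    also have "\<dots> = 4 * (1 - cmod (a j)) / h" using h by (simp add: power2_eq_square)
    also have "\<dots> \<le> 4 * \<delta>" using bx(2)[OF j] h by (simp add: pos_divide_le_eq)
    finally have k1: "kap z (a j) \<le> \<tau>" using \<delta>4 by linarith
    have "h * (1 - cmod (a j)) \<le> (1 - (cmod z)\<^sup>2) * (1 - (cmod (a j))\<^sup>2)"
     using one_minus_sq_bounds(1)[OF z] one_minus_sq_bounds(1)[OF aj[OF j]] h aj[OF j] cz
     by (intro mult_mono) auto
    then have "h * (1 - cmod (a j)) / (3 * h)\<^sup>2 \<le> kap z (a j)"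
     unfolding kap_def D_def[symmetric] using D3 Dh h aj[OF j]
     one_minus_sq_bounds(3)[OF z] one_minus_sq_bounds(3)[OF aj[OF j]]
     by (intro frac_le power_mono mult_nonneg_nonneg) auto
    moreover have "h * (1 - cmod (a j)) / (3 * h)\<^sup>2 = (1 - cmod (a j)) / (9 * h)"
     using h by (simp add: power2_eq_square)
    ultimately have "(1 - cmod (a j)) / (9 * h) \<le> kap z (a j)" by (simp only:)
   then have "1 - cmod (a j) \<le> 9 * h * kap z (a j)" using h by (simp add: pos_divide_le_eq mult.commute)
    with k1 show ?thesis by blast
   qed
   have "(\<Sum>k\<in>F. 1 - cmod (a k)) \<le> (\<Sum>j\<in>F. 9 * h * kap z (a j))" using k by (intro sum_mono) auto
   also have "\<dots> = 9 * h * (\<Sum>j\<in>F. kap z (a j))" by (simp add: sum_distrib_left)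
   also have "\<dots> \<le> 9 * h * (\<eta> / 9)" using k h by (intro mult_left_mono H z F) auto
   finally show ?thesis by (simp add: mult.commute)
  next
   case 2
   have k: "kap 0 (a j) \<le> \<tau> \<and> 1 - cmod (a j) \<le> kap 0 (a j)" if j: "j \<in> F" for j
   proof -
    have "2 * (1 - cmod (a j)) \<le> 2 * (\<delta> * h)" using bx(2)[OF j] by simp
    with one_minus_sq_bounds(2)[OF aj[OF j]] have "1 - (cmod (a j))\<^sup>2 \<le> 2 * (\<delta> * h)" by (rule order_trans)
    also have "\<dots> \<le> 2 * (\<delta> * H1)" using \<delta> 2 by (intro mult_left_mono) auto
    also have "\<dots> \<le> \<tau>" using \<delta>(3) mult_pos_pos[OF \<delta>(1), of H1] H1 by linarith
    finally show ?thesis using one_minus_sq_bounds(1)[OF aj[OF j]] by simp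
   qed
   have "(\<Sum>k\<in>F. 1 - cmod (a k)) \<le> (\<Sum>j\<in>F. kap 0 (a j))" using k by (intro sum_mono) auto
   also have "\<dots> \<le> \<eta> / 9" using k by (intro H F) auto
   also have "\<dots> \<le> \<eta> * 1" using \<eta> by simp
   also have "\<dots> \<le> \<eta> * h" using \<eta> 2 by (intro mult_left_mono) auto
   finally show ?thesis .
  next
   case 3
   have "\<eta> * H1 \<le> \<eta> * h" using 3 \<eta> by simp
   then show ?thesis using T[OF F] H1 by linarith
  qed
 qed
qed

section \<open>Carleson measures in terms of finite sums\<close>

text \<open>The bridge to the extended sums of the statement: each of them is replaced by a bound on
  all finite partial sums.\<close>

lemma infsum_ennreal_le_iff:
 assumes "\<And>j. j \<in> B ==> 0 \<le> g j" "0 \<le> c"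
 shows "(\<Sum>\<^sub>\<infinity>j\<in>B. ennreal (g j)) \<le> ennreal c \<longleftrightarrow> (\<forall>F. finite F \<and> F \<subseteq> B \<longrightarrow> (\<Sum>j\<in>F. g j) \<le> c)"
proof -
 have e: "(\<Sum>j\<in>F. ennreal (g j)) = ennreal (\<Sum>j\<in>F. g j)" if "F \<subseteq> B" for F
  using that assms by (intro sum_ennreal) auto
 have "(\<Sum>\<^sub>\<infinity>j\<in>B. ennreal (g j)) \<le> ennreal c \<longleftrightarrow> (\<forall>F. finite F \<and> F \<subseteq> B \<longrightarrow> (\<Sum>j\<in>F. ennreal (g j)) \<le> ennreal c)"
  by (subst nonneg_infsum_complete) (auto simp: SUP_le_iff)
 also have "\<dots> \<longleftrightarrow> (\<forall>F. finite F \<and> F \<subseteq> B \<longrightarrow> (\<Sum>j\<in>F. g j) \<le> c)"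
  using assms e by (auto simp: ennreal_le_iff)
 finally show ?thesis .
qed

lemma carleson_box_iff:
 assumes "bseq J a" "0 \<le> c"
 shows "emeasure (zeros_measure J a) (carleson_box (circle_arc \<alpha> l) l) \<le> ennreal c \<longleftrightarrow>
  (\<forall>F. finite F \<and> F \<subseteq> J \<and> (\<forall>j\<in>F. a j \<in> carleson_box (circle_arc \<alpha> l) l) \<longrightarrow> (\<Sum>j\<in>F. 1 - cmod (a j)) \<le> c)"
proof -
 have "emeasure (zeros_measure J a) (carleson_box (circle_arc \<alpha> l) l) \<le> ennreal c \<longleftrightarrow>
  (\<forall>F. finite F \<and> F \<subseteq> {j \<in> J. a j \<in> carleson_box (circle_arc \<alpha> l) l} \<longrightarrow> (\<Sum>j\<in>F. 1 - cmod (a j)) \<le> c)"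
  unfolding emeasure_zeros_measure[OF carleson_box_borel]
  by (rule infsum_ennreal_le_iff) (use bseq_lt_1[OF assms(1)] assms(2) in \<open>auto intro: less_imp_le\<close>)
 then show ?thesis by blast
qed

lemma kb_carleson_measure:
 assumes J: "bseq J a" and k: "kb A J a"
 shows "carleson_measure (zeros_measure J a)"
 unfolding carleson_measure_def
proof (intro exI[of _ "9 * A + 1"] conjI allI impI, goal_cases)
 case 1
 show ?case using kb_nonneg[OF k] by simp
next
 case (2 \<alpha> l)
 have l: "0 < l" "0 \<le> (9 * A + 1) * l" using 2 kb_nonneg[OF k] by auto
 show ?case
  unfolding carleson_box_iff[OF J l(2)]
 proof (intro allI impI, elim conjE)
  fix F assume F: "finite F" "F \<subseteq> J" and box: "\<forall>j\<in>F. a j \<in> carleson_box (circle_arc \<alpha> l) l"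
  have aj: "cmod (a j) < 1" if "j \<in> F" for j using bseq_lt_1[OF J] F that by auto
  \<comment> \<open>For \<open>l \<ge> 1\<close> the depth is capped and the test point becomes the
    origin. Below 1 the constant 9 comes from \<open>D \<le> 3 * l\<close>.\<close>
  define h where "h = min l 1"
  have h: "0 < h" "h \<le> 1" "h \<le> l" using l by (auto simp: h_def)
  define z where "z = of_real (1 - h) * cis (\<alpha> + l / 2)"
  have cz: "cmod z = 1 - h" unfolding z_def norm_mult norm_of_real using h by simp
  then have z: "cmod z < 1" using h by simp
  have "1 - cmod (a j) \<le> 9 * l * kap z (a j)" if j: "j \<in> F" for j
  proof (cases "l < 1")
   case True
   then have hl: "h = l" by (simp add: h_def)
   obtain \<phi> where \<phi>: "sgn (a j) = cis \<phi>" "\<alpha> \<le> \<phi>" "\<phi> \<le> \<alpha> + l" and d: "1 - cmod (a j) \<le> l"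
    using box j unfolding carleson_box_def circle_arc_def by fastforce
   have ae: "a j = of_real (cmod (a j)) * cis \<phi>"
    unfolding \<phi>(1)[symmetric] by (simp add: sgn_eq)
   define D where "D = cmod (1 - cnj (a j) * z)"
   have "D = cmod (1 - cnj (of_real (cmod (a j)) * cis \<phi>) * (of_real (1 - h) * cis (\<alpha> + l / 2)))"
    unfolding D_def z_def by (subst ae) simp
   also have "\<dots> \<le> (1 - cmod (a j)) + (1 - (1 - h)) + \<bar>\<alpha> + l / 2 - \<phi>\<bar>"
    by (rule norm_den_le) (use aj[OF j] h in auto)
   also have "\<bar>\<alpha> + l / 2 - \<phi>\<bar> \<le> l" using \<phi> l by (simp add: abs_le_iff)
   finally have D3: "D \<le> 3 * l" using d hl by simp
   have Dh: "l \<le> D" using one_minus_le_norm_den'[of "a j" z] aj[OF j] cz hl unfolding D_def by simp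
   have "l * (1 - cmod (a j)) \<le> (1 - (cmod z)\<^sup>2) * (1 - (cmod (a j))\<^sup>2)"
    using one_minus_sq_bounds(1)[OF z] one_minus_sq_bounds(1)[OF aj[OF j]] h aj[OF j] cz hl
    by (intro mult_mono) auto
   then have "l * (1 - cmod (a j)) / (3 * l)\<^sup>2 \<le> kap z (a j)"
    unfolding kap_def D_def[symmetric] using D3 Dh l aj[OF j]
     one_minus_sq_bounds(3)[OF z] one_minus_sq_bounds(3)[OF aj[OF j]]
    by (intro frac_le power_mono mult_nonneg_nonneg) auto
   moreover have "l * (1 - cmod (a j)) / (3 * l)\<^sup>2 = (1 - cmod (a j)) / (9 * l)"
    using l by (simp add: power2_eq_square)
   ultimately have "(1 - cmod (a j)) / (9 * l) \<le> kap z (a j)" by (simp only:)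
   then show ?thesis using l by (simp add: pos_divide_le_eq mult.commute)
  next
   case False
   then have "z = 0" unfolding z_def h_def by simp
   have "1 - cmod (a j) \<le> 1 * kap z (a j)" unfolding \<open>z = 0\<close> using one_minus_sq_bounds(1)[OF aj[OF j]] by simp
   also have "\<dots> \<le> 9 * l * kap z (a j)"
    using False kap_pos[OF z aj[OF j]] by (intro mult_right_mono) auto
   finally show ?thesis .
  qed
  then have "(\<Sum>j\<in>F. 1 - cmod (a j)) \<le> (\<Sum>j\<in>F. 9 * l * kap z (a j))" by (rule sum_mono)
  also have "\<dots> = 9 * l * (\<Sum>j\<in>F. kap z (a j))" by (simp add: sum_distrib_left)
  also have "\<dots> \<le> 9 * l * A" using l by (intro mult_left_mono kbD[OF k z F]) auto
  finally show "(\<Sum>j\<in>F. 1 - cmod (a j)) \<le> (9 * A + 1) * l" using l by (simp add: algebra_simps)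
 qed
qed

lemma carleson_measure_carl:
 assumes J: "bseq J a" and c: "carleson_measure (zeros_measure J a)"
 shows "\<exists>A\<ge>0. carl A J a"
proof -
 obtain C where C: "C > 0" and H: "\<And>\<alpha> l. 0 < l ==> l \<le> 2 * pi ==>
   emeasure (zeros_measure J a) (carleson_box (circle_arc \<alpha> l) l) \<le> ennreal (C * l)"
  using c unfolding carleson_measure_def by blast
 define T where "T = (\<Sum>j. if j \<in> J then 1 - cmod (a j) else 0)"
 have T: "(\<Sum>j\<in>F. 1 - cmod (a j)) \<le> T" if "finite F" "F \<subseteq> J" for F
 proof -
  have "(\<Sum>j\<in>F. 1 - cmod (a j)) = (\<Sum>j\<in>F. if j \<in> J then 1 - cmod (a j) else 0)"
   using that by (intro sum.cong) auto
  also have "\<dots> \<le> T" unfolding T_def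
   by (intro sum_le_suminf bseq_summable J that) (auto intro: less_imp_le bseq_lt_1[OF J])
  finally show ?thesis .
 qed
 have T0: "0 \<le> T" using T[of "{}"] by simp
 have "carl (8 * C + 2 * T) J a"
  unfolding carl_def
 proof (intro allI impI, elim conjE)
  fix z :: complex and y :: real and F assume z: "cmod z < 1" and y: "0 < y" and F: "finite F" "F \<subseteq> J"
   and D: "\<forall>j\<in>F. cmod (1 - cnj (a j) * z) < y"
  have aj: "cmod (a j) < 1" if "j \<in> F" for j using bseq_lt_1[OF J] F that by auto
  show "(\<Sum>j\<in>F. 1 - cmod (a j)) \<le> (8 * C + 2 * T) * y"
  proof (cases "y < 1 / 2")
   \<comment> \<open>Here all zeros in question have modulus above 1/2. This matters because the
     origin belongs to no box: \<open>sgn (a j)\<close> has to be a point of the circle.\<close>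
   case True
   obtain \<theta> where th: "z = of_real (cmod z) * cis \<theta>" by (rule polar_form)
   have ly: "0 < 8 * y" "8 * y \<le> 2 * pi" using True y pi_ge_two by auto
   have "0 \<le> C * (8 * y)" using C y by simp
   from carleson_box_iff[OF J this, of "\<theta> - 4 * y" "8 * y"] H[OF ly, of "\<theta> - 4 * y"]
   have HH: "\<And>F. finite F ==> F \<subseteq> J ==> (\<And>j. j\<in>F ==> a j \<in> carleson_box (circle_arc (\<theta> - 4 * y) (8 * y)) (8 * y)) ==> (\<Sum>j\<in>F. 1 - cmod (a j)) \<le> C * (8 * y)"
    by blast
   have "(\<Sum>j\<in>F. 1 - cmod (a j)) \<le> C * (8 * y)"
   proof (rule HH[OF F])
    fix j assume j: "j \<in> F"
    obtain \<phi> where \<phi>: "\<bar>\<phi>\<bar> \<le> pi" "\<bar>\<phi>\<bar> \<le> 4 * cmod (1 - cnj (a j) * z)" "a j = of_real (cmod (a j)) * cis (\<theta> + \<phi>)"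
     by (rule angle_repr[OF z th aj[OF j]])
    have Dj: "cmod (1 - cnj (a j) * z) < y" using D j by auto
    have d: "1 - cmod (a j) < y" using one_minus_le_norm_den[of z "a j"] z Dj by auto
    then have a0: "cmod (a j) > 0" using True by linarith
    have "sgn (a j) = of_real (cmod (a j)) * cis (\<theta> + \<phi>) / of_real (cmod (a j))"
     unfolding sgn_eq by (subst (1) \<phi>(3)) simp
    also have "\<dots> = cis (\<theta> + \<phi>)" using a0 by simp
    finally have s: "sgn (a j) = cis (\<theta> + \<phi>)" .
    have "\<theta> + \<phi> \<in> {\<theta> - 4 * y..\<theta> - 4 * y + 8 * y}" using \<phi>(2) Dj by auto
    then show "a j \<in> carleson_box (circle_arc (\<theta> - 4 * y) (8 * y)) (8 * y)"
     unfolding carleson_box_def circle_arc_def using s d aj[OF j] y by auto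
   qed
   also have "\<dots> \<le> (8 * C + 2 * T) * y" using T0 y by (simp add: algebra_simps)
   finally show ?thesis .
  next
   case False
   have "(\<Sum>j\<in>F. 1 - cmod (a j)) \<le> T" by (rule T[OF F])
   also have "\<dots> \<le> 2 * T * y" using mult_left_mono[of "1 / 2" y "2 * T"] False T0 by simp
   also have "\<dots> \<le> (8 * C + 2 * T) * y" using C y by (simp add: algebra_simps)
   finally show ?thesis .
  qed
 qed
 moreover have "0 \<le> 8 * C + 2 * T" using C T0 by simp
 ultimately show ?thesis by blast
qed

lemma carleson_measure_kb:
 assumes "bseq J a" "carleson_measure (zeros_measure J a)"
 shows "\<exists>A. kb A J a"
 using carleson_measure_carl[OF assms] carl_kb bseq_lt_1[OF assms(1)] by blast

lemma blaschke_product_iff: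
 "blaschke_product \<Theta> J a \<longleftrightarrow> bseq J a \<and> (\<exists>c. cmod c = 1 \<and> (\<forall>z\<in>unit_disc. \<Theta> z = c * BP J a z))"
 unfolding blaschke_product_def bseq_def BP_def by auto

lemma CN_I:
 assumes "bseq J a" "kb A J a" "cmod c = 1" "\<And>z. cmod z < 1 ==> F z = c * BP J a z"
 shows "F \<in> CN"
 unfolding CN_def mem_Collect_eq blaschke_product_iff
 using assms kb_carleson_measure[OF assms(1,2)] by (intro exI[of _ J] exI[of _ a]) auto

lemma CN_E:
 assumes "F \<in> CN"
 obtains J a A c where "bseq J a" "kb A J a" "cmod c = 1" "\<And>z. cmod z < 1 ==> F z = c * BP J a z"
proof -
 obtain J a where "blaschke_product F J a" "carleson_measure (zeros_measure J a)"
  using assms unfolding CN_def by blast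
 moreover from this obtain A where "kb A J a"
  using carleson_measure_kb unfolding blaschke_product_iff by blast
 moreover obtain c where "cmod c = 1" "\<And>z. cmod z < 1 ==> F z = c * BP J a z"
  using \<open>blaschke_product F J a\<close> unfolding blaschke_product_iff by auto
 ultimately show ?thesis using that unfolding blaschke_product_iff by blast
qed

section \<open>Lower bounds for Carleson-Newman products\<close>

lemma card_near_zeros:
 assumes k: "kb A J a" and z: "cmod z < 1" and q: "0 < q"
 shows "finite {j\<in>J. q \<le> kap z (a j)}" "real (card {j\<in>J. q \<le> kap z (a j)}) \<le> A / q"
proof -
 let ?B = "{j\<in>J. q \<le> kap z (a j)}"
 have *: "real (card F) \<le> A / q" if "finite F" "F \<subseteq> ?B" for F
 proof -
  have "real (card F) * q = (\<Sum>j\<in>F. q)" by simp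
  also have "\<dots> \<le> (\<Sum>j\<in>F. kap z (a j))" using that by (intro sum_mono) auto
  also have "\<dots> \<le> A" using that by (intro kbD[OF k z]) auto
  finally show ?thesis using q by (simp add: pos_le_divide_eq)
 qed
 show "finite ?B"
 proof (rule ccontr)
  assume "infinite ?B"
  then obtain F where F: "finite F" "card F = Suc (nat \<lfloor>A / q\<rfloor>)" "F \<subseteq> ?B"
   using infinite_arbitrarily_large by blast
  have "A / q < real (card F)" unfolding F(2) by linarith
  then show False using *[OF F(1,3)] by linarith
 qed
 then show "real (card ?B) \<le> A / q" by (intro *) auto
qed

text \<open>Pigeonhole: few zeros lie near \<open>z\<close>, so one of many well-spread points near \<open>z\<close> avoids them all.\<close>
lemma kb_lower_bound:
 assumes k: "kb A J a" and J: "bseq J a"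
 shows "\<exists>c>0. \<forall>z. cmod z < 1 \<longrightarrow> (\<exists>w. cmod w < 1 \<and> rho z w \<le> 1 / 2 \<and> c \<le> cmod (BP J a w))"
proof -
 \<comment> \<open>The number 7/16 is \<open>1 - (3/4)\<^sup>2\<close>: at most \<open>N\<close>
   zeros lie within distance 3/4 of a point, whereas \<open>N + 1\<close> test points
   \<open>p k\<close> are used, any two at distance at least \<open>4 * s\<close>.\<close>
 define N where "N = nat \<lfloor>A / (7/16)\<rfloor>"
 have N: "A / (7/16) < real N + 1" unfolding N_def using kb_nonneg[OF k] by (intro real_less_nat_floor) simp
 define s where "s = 1 / (8 * (real N + 1))"
 have s: "0 < s" "s \<le> 1 / 8" by (auto simp: s_def)
 define p :: "nat \<Rightarrow> complex" where "p k = of_real (real k / (2 * (real N + 1)))" for k :: nat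
 have p: "cmod (p k) \<le> 1 / 2" if "k \<le> N" for k
  unfolding p_def norm_of_real using that by (simp add: field_simps)
 have pd: "4 * s \<le> cmod (p k - p l)" if "k \<noteq> l" for k l
 proof -
  have "p k - p l = of_real ((real k - real l) / (2 * (real N + 1)))" by (simp add: p_def diff_divide_distrib)
  then have "cmod (p k - p l) = \<bar>real k - real l\<bar> / (2 * (real N + 1))" by (simp only: norm_of_real) simp
  moreover have "1 \<le> \<bar>real k - real l\<bar>" using that by linarith
  ultimately have "1 / (2 * (real N + 1)) \<le> cmod (p k - p l)" by (simp add: divide_right_mono)
  moreover have "4 * s = 1 / (2 * (real N + 1))" by (simp add: s_def field_simps)
  ultimately show ?thesis by simp
 qed
 define c where "c = sqrt (exp (- A / s\<^sup>2))"
 have "\<exists>w. cmod w < 1 \<and> rho z w \<le> 1 / 2 \<and> c \<le> cmod (BP J a w)" if z: "cmod z < 1" for z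
 proof -
  define w where "w k = disc_aut z (p k)" for k
  have p1: "cmod (p k) < 1" if "k \<le> N" for k using p[OF that] by simp
  have w: "cmod (w k) < 1" "rho z (w k) \<le> 1 / 2" if "k \<le> N" for k
   unfolding w_def using disc_aut_lt_1[OF z p1[OF that]] norm_disc_aut[OF z disc_aut_lt_1[OF z p1[OF that]]]
    disc_aut_invol[OF z p1[OF that]] p[OF that] by auto
  let ?B = "{j\<in>J. 7/16 \<le> kap z (a j)}"
  have B: "finite ?B" "real (card ?B) \<le> A / (7/16)" using card_near_zeros[OF k z, of "7/16"] by auto
  have "\<exists>k\<le>N. \<forall>j\<in>J. s \<le> rho (w k) (a j)"
  proof (rule ccontr)
   assume "\<not> ?thesis"
   then have "\<forall>k. \<exists>j. k \<le> N \<longrightarrow> j \<in> J \<and> rho (w k) (a j) < s" unfolding not_le[symmetric] by blast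
   from choice[OF this] obtain jj where "\<forall>k. k \<le> N \<longrightarrow> jj k \<in> J \<and> rho (w k) (a (jj k)) < s" by blast
   then have jj: "\<And>k. k \<le> N ==> jj k \<in> J" "\<And>k. k \<le> N ==> rho (w k) (a (jj k)) < s" by auto
   \<comment> \<open>With \<open>z\<close> moved to the origin, a zero too close to
     \<open>w k\<close> comes within \<open>2 * s\<close> of \<open>p k\<close>. As the test points
     are \<open>4 * s\<close> apart, different test points would use different zeros.\<close>
   have near: "cmod (disc_aut z (a (jj k)) - p k) < 2 * s" if k: "k \<le> N" for k
   proof -
    define b where "b = disc_aut z (a (jj k))"
    have aj: "cmod (a (jj k)) < 1" using bseq_lt_1[OF J jj(1)[OF k]] .
    have b1: "cmod b < 1" unfolding b_def by (rule disc_aut_lt_1[OF z aj])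
    have "rho (p k) b < s" using jj(2)[OF k] rho_disc_aut'[OF z p1[OF k] aj] unfolding w_def b_def by simp
    moreover have "rho (p k) b = cmod (p k - b) / cmod (1 - cnj b * p k)" by (simp add: rho_def norm_divide)
    moreover have "cmod (1 - cnj b * p k) \<le> 2"
     using norm_triangle_ineq4[of 1 "cnj b * p k"] mult_mono[of "cmod b" 1 "cmod (p k)" 1] b1 p1[OF k]
     by (simp add: norm_mult)
    moreover have "cmod (1 - cnj b * p k) > 0" using den_nonzero[of "p k" b] p1[OF k] b1 by simp
    ultimately have "cmod (p k - b) < s * cmod (1 - cnj b * p k)" by (simp add: pos_divide_less_eq)
    also have "\<dots> \<le> s * 2" using s \<open>cmod (1 - cnj b * p k) \<le> 2\<close> by (intro mult_left_mono) auto
    finally show ?thesis unfolding b_def by (simp add: norm_minus_commute)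
   qed
   have "inj_on jj {..N}"
   proof (rule inj_onI)
    fix k l assume kl: "k \<in> {..N}" "l \<in> {..N}" "jj k = jj l"
    show "k = l"
    proof (rule ccontr)
     assume "k \<noteq> l"
     have "cmod (p k - p l) < 4 * s"
      using near[of k] near[of l] kl norm_triangle_ineq4[of "disc_aut z (a (jj k)) - p l" "disc_aut z (a (jj k)) - p k"]
      by simp
     then show False using pd[OF \<open>k \<noteq> l\<close>] by simp
    qed
   qed
   moreover have "jj ` {..N} \<subseteq> ?B"
   proof (safe)
    fix k assume k: "k \<le> N"
    show "jj k \<in> J" by (rule jj(1)[OF k])
    have aj: "cmod (a (jj k)) < 1" using bseq_lt_1[OF J jj(1)[OF k]] .
    have "rho z (a (jj k)) = cmod (disc_aut z (a (jj k)))" using norm_disc_aut[OF z aj] by simp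
    also have "\<dots> \<le> cmod (p k) + cmod (disc_aut z (a (jj k)) - p k)" by (rule norm_triangle_sub)
    also have "\<dots> \<le> 3 / 4" using near[OF k] p[OF k] s by linarith
    finally show "7/16 \<le> kap z (a (jj k))"
     using rho_le_iff_kap[OF z aj, of "3/4"] by (simp add: power2_eq_square)
   qed
   ultimately have "Suc N \<le> card ?B" using card_inj_on_le[of jj "{..N}" ?B] B(1) by simp
   then show False using B(2) N by linarith
  qed
  then obtain k where k: "k \<le> N" "\<And>j. j \<in> J ==> s \<le> rho (w k) (a j)" by blast
  have "exp (- A / s\<^sup>2) \<le> (cmod (BP J a (w k)))\<^sup>2"
  proof (rule norm_BP_sq_ge_exp[OF J w(1)[OF k(1)]])
   show "(\<Sum>j\<in>F. kap (w k) (a j)) \<le> A" if "finite F" "F \<subseteq> J" for F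
    by (rule kbD[OF assms(1) w(1)[OF k(1)] that])
   show "kap (w k) (a j) \<le> 1 - s\<^sup>2" if "j \<in> J" for j
    using k(2)[OF that] rho_ge_iff_kap[OF w(1)[OF k(1)] bseq_lt_1[OF J that], of s] s by simp
  qed (use s in auto)
  then have "c \<le> cmod (BP J a (w k))" unfolding c_def by (simp add: real_le_lsqrt)
  then show ?thesis using w[OF k(1)] by blast
 qed
 moreover have "c > 0" by (simp add: c_def)
 ultimately show ?thesis by blast
qed

lemma CN_lower_bound:
 assumes "F \<in> CN"
 shows "\<exists>c>0. \<forall>z. cmod z < 1 \<longrightarrow> (\<exists>w. cmod w < 1 \<and> rho z w \<le> 1 / 2 \<and> c \<le> cmod (F w))"
proof -
 obtain J a A c where *: "bseq J a" "kb A J a" "cmod c = 1" "\<And>z. cmod z < 1 ==> F z = c * BP J a z"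
  by (rule CN_E[OF assms], rule that)
 obtain c' where c': "c' > 0" "\<And>z. cmod z < 1 ==> \<exists>w. cmod w < 1 \<and> rho z w \<le> 1 / 2 \<and> c' \<le> cmod (BP J a w)"
  using kb_lower_bound[OF *(2,1)] by blast
 have "cmod (F w) = cmod (BP J a w)" if "cmod w < 1" for w using *(3,4) that by (simp add: norm_mult)
 then show ?thesis using c' by (intro exI[of _ c'] conjI allI impI) metis+
qed

text \<open>The logarithm of a lower bound for \<open>F\<close> bounds the sum of \<open>kap\<close>
  at a nearby point, and Harnack carries the bound over to \<open>z\<close>. \<open>F\<close> only
  has to be dominated by finite products, since this is also applied before \<open>F\<close> is
  known to be a Blaschke product.\<close>

lemma kb_from_lower_bound:
 assumes J: "\<And>j. j \<in> J ==> cmod (a j) < 1"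
  and le: "\<And>z K. cmod z < 1 ==> finite K ==> K \<subseteq> J ==> cmod (F z) \<le> cmod (BF K a z)"
  and r: "r < 1" and c: "0 < c" and H: "\<And>z. cmod z < 1 ==> \<exists>w. cmod w < 1 \<and> rho z w \<le> r \<and> c \<le> cmod (F w)"
 shows "kb (hC r * (2 * ln (1 / c))) J a"
 unfolding kb_def
proof (intro allI impI, elim conjE)
 fix z K assume z: "cmod z < 1" and K: "finite K" "K \<subseteq> J"
 obtain w where w: "cmod w < 1" "rho z w \<le> r" "c \<le> cmod (F w)" using H[OF z] by blast
 have aj: "cmod (a j) < 1" if "j \<in> K" for j using J K that by auto
 have r0: "0 \<le> r" using w(2) rho_nonneg[of z w] by linarith
 have "c\<^sup>2 \<le> (cmod (BF K a w))\<^sup>2" using w le[OF w(1) K] c by (intro power_mono) auto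
 also have "\<dots> \<le> exp (- (\<Sum>j\<in>K. kap w (a j)))" by (rule norm_BF_sq_le_exp[OF aj w(1)])
 finally have "ln (c\<^sup>2) \<le> - (\<Sum>j\<in>K. kap w (a j))" using c by (subst (asm) ln_le_cancel_iff[symmetric]) auto
 then have S: "(\<Sum>j\<in>K. kap w (a j)) \<le> 2 * ln (1 / c)" using c by (simp add: ln_div ln_realpow)
 have "(\<Sum>j\<in>K. kap z (a j)) \<le> (\<Sum>j\<in>K. hC r * kap w (a j))"
  using kap_harnack'[OF z w(1) aj w(2) r] by (rule sum_mono)
 also have "\<dots> = hC r * (\<Sum>j\<in>K. kap w (a j))" by (simp add: sum_distrib_left)
 also have "\<dots> \<le> hC r * (2 * ln (1 / c))" using hC_ge_1[OF r0 r] S by (intro mult_left_mono) auto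
 finally show "(\<Sum>j\<in>K. kap z (a j)) \<le> hC r * (2 * ln (1 / c))" .
qed

section \<open>Carleson--Newman products and the class P\<close>

lemma countable_zeros_disc:
 assumes F: "hol F" and nz: "cmod w < 1" "F w \<noteq> 0"
 shows "countable {z. cmod z < 1 \<and> F z = 0}"
proof (cases "F constant_on ball 0 1")
 case True
 then have "{z. cmod z < 1 \<and> F z = 0} = {}" using nz unfolding constant_on_def by auto
 then show ?thesis by (simp only: countable_empty)
next
 case False
 have "finite {z \<in> cball 0 (1 - 1 / (real n + 2)). F z = 0}" for n
 proof (rule holomorphic_compact_finite_zeros[OF F _ _ _ _ False])
  have p: "0 < 1 / (real n + 2)" by simp
  show "cball (0::complex) (1 - 1 / (real n + 2)) \<subseteq> ball 0 1"
  proof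
   fix x :: complex assume "x \<in> cball 0 (1 - 1 / (real n + 2))"
   then have "cmod x \<le> 1 - 1 / (real n + 2)" by simp
   with p have "cmod x < 1" by linarith
   then show "x \<in> ball 0 1" by simp
  qed
 qed auto
 then have "countable (\<Union>n. {z \<in> cball 0 (1 - 1 / (real n + 2)). F z = 0})"
  by (intro countable_UN) (auto intro: countable_finite)
 moreover have "{z. cmod z < 1 \<and> F z = 0} \<subseteq> (\<Union>n. {z \<in> cball 0 (1 - 1 / (real n + 2)). F z = 0})"
 proof
  fix z assume z: "z \<in> {z. cmod z < 1 \<and> F z = 0}"
  obtain n where n: "inverse (real (Suc n)) < 1 - cmod z" using reals_Archimedean[of "1 - cmod z"] z by auto
  have "1 / (real n + 2) \<le> inverse (real (Suc n))"
   unfolding inverse_eq_divide by (intro divide_left_mono) auto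
  then have "cmod z \<le> 1 - 1 / (real n + 2)" using n by linarith
  then show "z \<in> (\<Union>n. {z \<in> cball 0 (1 - 1 / (real n + 2)). F z = 0})" using z by auto
 qed
 ultimately show ?thesis by (rule countable_subset[rotated])
qed

lemma norm_BF_antimono:
 assumes "finite L" "K \<subseteq> L" "\<And>j. j \<in> L ==> cmod (a j) < 1" "cmod z \<le> 1"
 shows "cmod (BF L a z) \<le> cmod (BF K a z)"
proof -
 have "BF L a z = BF K a z * BF (L - K) a z"
  using BF_union[of K "L - K" a z] assms(1,2) by (simp add: finite_subset Un_absorb1)
 moreover have "cmod (BF (L - K) a z) \<le> 1" by (rule norm_BF_le_1) (use assms in auto)
 ultimately show ?thesis by (simp add: norm_mult mult_left_le)
qed

lemma kb_bseq:
 assumes k: "kb A J a" and J: "\<And>j. j \<in> J ==> cmod (a j) < 1"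
 shows "bseq J a"
 unfolding bseq_def
proof (intro conjI ballI J nonneg_bdd_above_summable_on)
 show "bdd_above (sum (\<lambda>j. 1 - cmod (a j)) ` {F. F \<subseteq> J \<and> finite F})"
 proof (rule bdd_aboveI2)
  fix F assume F: "F \<in> {F. F \<subseteq> J \<and> finite F}"
  have "(\<Sum>j\<in>F. 1 - cmod (a j)) \<le> (\<Sum>j\<in>F. kap 0 (a j))"
   using F one_minus_sq_bounds(1)[OF J] by (intro sum_mono) auto
  also have "\<dots> \<le> A" by (rule kbD[OF k]) (use F in auto)
  finally show "(\<Sum>j\<in>F. 1 - cmod (a j)) \<le> A" .
 qed
qed (use J in \<open>auto intro: less_imp_le\<close>)

lemma norm_1_imp_const:
 assumes g: "hol g" and n: "\<And>z. cmod z < 1 ==> cmod (g z) = 1"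
 obtains c where "cmod c = 1" "\<And>z. cmod z < 1 ==> g z = c"
proof -
 have "g constant_on ball 0 1"
  by (rule maximum_modulus_principle[OF g _ _ _ order_refl, of 0]) (use n in auto)
 then obtain c where c: "\<And>z. cmod z < 1 ==> g z = c" unfolding constant_on_def by auto
 then have "cmod c = 1" using n[of 0] by simp
 then show ?thesis using that c by blast
qed

lemma AE_unimodular_imp_bounded:
 assumes F: "hol F" and B: "\<And>z. cmod z < 1 ==> cmod (F z) \<le> B"
  and ae: "AE t in lborel. ((\<lambda>r. cmod (F (of_real r * cis t))) \<longlongrightarrow> 1) (at_left 1)" and z: "cmod z < 1"
 shows "cmod (F z) \<le> 1"
proof (rule radial_bound[OF F B _ z])
 show "AE t in lborel. \<forall>e>0. eventually (\<lambda>r. cmod (F (of_real r * cis t)) \<le> 1 + e) (at_left 1)"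
  using ae
 proof eventually_elim
  case (elim t)
  show ?case
  proof (intro allI impI)
   fix e :: real assume "e > 0"
   then have "eventually (\<lambda>r. cmod (F (of_real r * cis t)) < 1 + e) (at_left 1)"
    using elim by (intro order_tendstoD) auto
   then show "eventually (\<lambda>r. cmod (F (of_real r * cis t)) \<le> 1 + e) (at_left 1)"
    by eventually_elim simp
  qed
 qed
qed

text \<open>Dividing by a function with unimodular boundary values does not increase the norm.\<close>
lemma unimodular_quotient_bounded:
 assumes Q: "hol Q" and B: "\<And>z. cmod z < 1 ==> cmod (Q z) \<le> B"
  and ae: "AE t in lborel. ((\<lambda>r. cmod (F (of_real r * cis t))) \<longlongrightarrow> 1) (at_left 1)"
  and FQ: "\<And>z. cmod z < 1 ==> cmod (F z * Q z) \<le> 1" and z: "cmod z < 1"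
 shows "cmod (Q z) \<le> 1"
proof (rule radial_bound[OF Q B _ z])
 show "AE t in lborel. \<forall>e>0. eventually (\<lambda>r. cmod (Q (of_real r * cis t)) \<le> 1 + e) (at_left 1)"
  using ae
 proof eventually_elim
  case (elim t)
  show ?case
  proof (intro allI impI)
   fix e :: real assume e: "e > 0"
   have "1 / (1 + e) < 1" using e by simp
   then have 1: "eventually (\<lambda>r. 1 / (1 + e) < cmod (F (of_real r * cis t))) (at_left 1)"
    using elim by (intro order_tendstoD) auto
   have 2: "eventually (\<lambda>r. 0 < r \<and> r < (1::real)) (at_left 1)"
    by (auto simp: eventually_at_left_field intro!: exI[of _ 0])
   from 1 2 show "eventually (\<lambda>r. cmod (Q (of_real r * cis t)) \<le> 1 + e) (at_left 1)"
   proof eventually_elim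
    case (elim r)
    define w where "w = of_real r * cis t"
    have "cmod w < 1" using elim by (simp add: w_def norm_mult)
    from FQ[OF this] have "cmod (F w) * cmod (Q w) \<le> 1" by (simp add: norm_mult)
    moreover have "1 / (1 + e) * cmod (Q w) \<le> cmod (F w) * cmod (Q w)"
     using elim unfolding w_def by (intro mult_right_mono) auto
    ultimately have "1 / (1 + e) * cmod (Q w) \<le> 1" by linarith
    then show ?case unfolding w_def[symmetric] using e by (simp add: pos_divide_le_eq)
   qed
  qed
 qed
qed

text \<open>Roots of zero-free functions turn the Schwarz-Pick lemma into a Harnack inequality.\<close>
lemma zero_free_lower_bound:
 assumes r: "0 \<le> r" "r < 1" and c: "0 < c"
 obtains c' where "0 < c'" "\<And>g z w. hol g ==> (\<And>x. cmod x < 1 ==> g x \<noteq> 0) ==>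
  (\<And>x. cmod x < 1 ==> cmod (g x) \<le> 1) ==> cmod z < 1 ==> cmod w < 1 ==> rho z w \<le> r ==> c \<le> cmod (g w)
  ==> c' \<le> cmod (g z)"
proof -
 \<comment> \<open>The integer \<open>m\<close> is so large that the \<open>m\<close>-th root
   \<open>G\<close> of \<open>g / 2\<close> satisfies
   \<open>1 - (cmod (G w))\<^sup>2 \<le> K / m\<close>, which stays at most 1/2 after the loss
   \<open>hC r\<close>. Halving \<open>g\<close> makes the modulus strictly less than 1.\<close>
 define K where "K = 2 * \<bar>ln (c / 2)\<bar> + 1"
 obtain m :: nat where m: "2 * K * hC r < real m" using reals_Archimedean2 by blast
 have h1: "1 \<le> hC r" by (rule hC_ge_1[OF r])
 have K: "K > 0" by (simp add: K_def)
 have m0: "0 < real m" using m K h1 mult_pos_pos[of "2 * K" "hC r"] by linarith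
 define c' where "c' = 2 * (sqrt (1 / 2)) ^ m"
 have main: "c' \<le> cmod (g z)" if g: "hol g" "\<And>x. cmod x < 1 ==> g x \<noteq> 0"
  "\<And>x. cmod x < 1 ==> cmod (g x) \<le> 1" and z: "cmod z < 1" and w: "cmod w < 1" "rho z w \<le> r" "c \<le> cmod (g w)"
 for g z w
 proof -
  obtain L where L: "hol L" "\<And>x. x \<in> ball 0 1 ==> exp (L x) = g x / 2"
   by (rule holomorphic_logarithm_exists[of "ball 0 1" "\<lambda>x. g x / 2" 0])
     (use g in \<open>auto intro!: holomorphic_intros\<close>)
  have ReL: "exp (Re (L x)) = cmod (g x) / 2" if "cmod x < 1" for x
   using L(2)[of x] that by (metis dist_0_norm mem_ball norm_divide norm_exp_eq_Re norm_numeral)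
  define G where "G x = exp (L x / of_nat m)" for x
  have G: "hol G" unfolding G_def[abs_def] by (intro holomorphic_intros L) (use m0 in auto)
  have nG: "cmod (G x) = exp (Re (L x) / real m)" for x unfolding G_def by (simp add: norm_exp_eq_Re)
  have neg: "Re (L x) < 0" if x: "cmod x < 1" for x
  proof -
   have "exp (Re (L x)) < exp 0" using ReL[OF x] g(3)[OF x] unfolding exp_zero by linarith
   then show ?thesis by (simp only: exp_less_cancel_iff)
  qed
  have G1: "cmod (G x) < 1" if "x \<in> ball 0 1" for x
   unfolding nG using neg[of x] that m0 by (simp add: divide_neg_pos)
  have "- K \<le> 2 * Re (L w)"
  proof -
   have "ln (c / 2) \<le> ln (cmod (g w) / 2)" using w c by (subst ln_le_cancel_iff) auto
   also have "\<dots> = Re (L w)" using ReL[OF w(1)] by (metis ln_exp)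
   finally show ?thesis unfolding K_def by linarith
  qed
  then have "- K / real m \<le> 2 * Re (L w) / real m" using m0 by (intro divide_right_mono) auto
  moreover have "1 + (2 * Re (L w) / real m) \<le> exp (2 * Re (L w) / real m)" by (rule exp_ge_add_one_self)
  moreover have "exp (2 * Re (L w) / real m) = (cmod (G w))\<^sup>2"
   unfolding nG by (simp add: power2_eq_square flip: exp_add)
  ultimately have Gw: "1 - (cmod (G w))\<^sup>2 \<le> K / real m" by simp
  have "rho (G w) (G z) \<le> r"
   using schwarz_pick[OF G G1 w(1) z] w(2) rho_sym[OF z w(1)] by simp
  from kap_harnack[OF _ _ _ this r(2), of 0] G1 z w
  have "1 - (cmod (G z))\<^sup>2 \<le> hC r * (1 - (cmod (G w))\<^sup>2)" by simp
  also have "\<dots> \<le> hC r * (K / real m)" using Gw h1 by (intro mult_left_mono) auto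
  also have "\<dots> \<le> 1 / 2" using m m0 by (simp add: pos_divide_le_eq mult.commute mult.left_commute)
  finally have "1 / 2 \<le> (cmod (G z))\<^sup>2" by simp
  then have "sqrt (1 / 2) \<le> cmod (G z)" by (intro real_le_lsqrt) auto
  then have "(sqrt (1 / 2)) ^ m \<le> (cmod (G z)) ^ m" by (intro power_mono) auto
  also have "(cmod (G z)) ^ m = exp (Re (L z))" unfolding nG using m0 by (simp flip: exp_of_nat_mult)
  also have "\<dots> = cmod (g z) / 2" by (rule ReL[OF z])
  finally show ?thesis by (simp add: c'_def)
 qed
 have "0 < c'" by (simp add: c'_def)
 then show ?thesis using that main by blast
qed

text \<open>The lower bound \<open>H\<close> excludes too many zeros, by
  \<open>kb_from_lower_bound\<close>. It also passes to the zero-free remainder \<open>g\<close>,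
  whose reciprocal is therefore bounded; the radial behaviour of \<open>F\<close> improves this
  bound to 1, so \<open>g\<close> is a unimodular constant.\<close>

theorem CN_criterion:
 assumes F: "hol F" and F1: "\<And>z. cmod z < 1 ==> cmod (F z) \<le> 1"
  and ae: "AE t in lborel. ((\<lambda>r. cmod (F (of_real r * cis t))) \<longlongrightarrow> 1) (at_left 1)"
  and r: "0 \<le> r" "r < 1" and c: "0 < c" and H: "\<And>z. cmod z < 1 ==> \<exists>w. cmod w < 1 \<and> rho z w \<le> r \<and> c \<le> cmod (F w)"
 shows "F \<in> CN"
proof -
 obtain w0 where w0: "cmod w0 < 1" "F w0 \<noteq> 0" using H[of 0] c by force
 \<comment> \<open>The origin is inserted so that \<open>Z\<close> is not empty.\<close>
 define Z where "Z = insert 0 {z. cmod z < 1 \<and> F z = 0}"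
 have Z: "countable Z" "Z \<noteq> {}" unfolding Z_def using countable_zeros_disc[OF F w0] by auto
 \<comment> \<open>Through \<open>prod_decode\<close> every element of \<open>Z\<close> is visited
   infinitely often. At each visit one Blaschke factor is split off as long as the current quotient
   vanishes there, so multiplicities need not be known in advance.\<close>
 define p where "p n = from_nat_into Z (fst (prod_decode n))" for n
 have p1: "cmod (p n) < 1" for n
  using from_nat_into[OF Z(2), of "fst (prod_decode n)"] unfolding p_def Z_def by auto
 have inf: "infinite {n. p n = z}" if z: "cmod z < 1" "F z = 0" for z
 proof -
  obtain k where k: "from_nat_into Z k = z" using from_nat_into_surj[OF Z(1), of z] z unfolding Z_def by auto
  have "inj (\<lambda>l. prod_encode (k, l))" by (auto intro!: injI)
  moreover have "range (\<lambda>l. prod_encode (k, l)) \<subseteq> {n. p n = z}" using k by (auto simp: p_def)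
  ultimately show ?thesis using range_inj_infinite infinite_super by metis
 qed
 let ?P = "\<lambda>(n::nat) h. hol h \<and> (n = 0 \<longrightarrow> h = F)"
 let ?Q = "\<lambda>(n::nat) h h'. (h (p n) = 0 \<longrightarrow> (\<forall>z\<in>ball 0 1. h z = bf (p n) z * h' z)) \<and> (h (p n) \<noteq> 0 \<longrightarrow> h' = h)"
 have "\<exists>h. \<forall>n. ?P n (h n) \<and> ?Q n (h n) (h (Suc n))"
 proof (rule dependent_nat_choice)
  show "\<exists>h. ?P 0 h" using F by auto
  fix h n assume "?P n h"
  then show "\<exists>h'. ?P (Suc n) h' \<and> ?Q n h h'"
   using bf_factor_out[of h "p n"] p1 by (cases "h (p n) = 0") auto
 qed
 then obtain h :: "nat \<Rightarrow> complex \<Rightarrow> complex" where hP: "\<forall>n. ?P n (h n) \<and> ?Q n (h n) (h (Suc n))"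
  by blast
 have h1: "hol (h n)" for n using spec[OF hP, of n] by blast
 have h2: "h 0 = F" using spec[OF hP, of 0] by blast
 have h3: "h n z = bf (p n) z * h (Suc n) z" if "h n (p n) = 0" "cmod z < 1" for n z
  using spec[OF hP, of n] that by simp
 have h4: "h (Suc n) = h n" if "h n (p n) \<noteq> 0" for n
  using spec[OF hP, of n] that by simp
 note h = h1 h2 h3 h4
 define J where "J = {n. h n (p n) = 0}"
 have step: "h n z = BF (J \<inter> {n..<n + k}) p z * h (n + k) z" if z: "cmod z < 1" for n k z
 proof (induction k)
  case (Suc k)
  show ?case
  proof (cases "n + k \<in> J")
   case True
   then have "J \<inter> {n..<n + Suc k} = insert (n + k) (J \<inter> {n..<n + k})" by auto
   then have "BF (J \<inter> {n..<n + Suc k}) p z = bf (p (n + k)) z * BF (J \<inter> {n..<n + k}) p z"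
    by (simp add: BF_insert)
   moreover have "h (n + k) z = bf (p (n + k)) z * h (n + Suc k) z"
    using h(3)[of "n + k", OF _ z] True unfolding J_def by simp
   ultimately show ?thesis using Suc by simp
  next
   case False
   then have "J \<inter> {n..<n + Suc k} = J \<inter> {n..<n + k}" by (auto simp: less_Suc_eq)
   moreover have "h (n + Suc k) = h (n + k)" using h(4)[of "n + k"] False unfolding J_def by simp
   ultimately show ?thesis using Suc by simp
  qed
 qed simp
 have F_eq: "F z = BF (J \<inter> {..<n}) p z * h n z" if "cmod z < 1" for n z
  using step[OF that, of 0 n] h(2) by (simp add: lessThan_atLeast0)
 have hb: "cmod (h n z) \<le> 1" if z: "cmod z < 1" for n z
  by (rule div_bound[OF _ _ h(1) _ z, of "J \<inter> {..<n}" p]) (use p1 F_eq F1 in auto)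
 have le: "cmod (F z) \<le> cmod (BF K p z)" if z: "cmod z < 1" and K: "finite K" "K \<subseteq> J" for z K
 proof -
  obtain n where n: "K \<subseteq> {..<n}" using finite_nat_bounded[OF K(1)] by blast
  have "cmod (F z) \<le> cmod (BF (J \<inter> {..<n}) p z) * 1"
   unfolding F_eq[OF z, of n] norm_mult using hb[OF z] by (intro mult_left_mono) auto
  also have "\<dots> \<le> cmod (BF K p z)" using norm_BF_antimono[of "J \<inter> {..<n}" K p z] n K p1 z by auto
  finally show ?thesis .
 qed
 obtain A where k: "kb A J p" using kb_from_lower_bound[OF p1 le r(2) c H] by blast
 have J: "bseq J p" by (rule kb_bseq[OF k p1])
 obtain g s where g: "hol g" "strict_mono (s :: nat \<Rightarrow> nat)"
  "\<And>x. x \<in> ball 0 1 ==> ((\<lambda>n. h (s n) x) \<longlongrightarrow> g x) sequentially"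
 proof (rule Montel[of "ball 0 1" "{h. hol h \<and> (\<forall>z\<in>ball 0 1. cmod (h z) \<le> 1)}" h])
  fix K :: "complex set" assume "compact K" "K \<subseteq> ball 0 1"
  then show "\<exists>B. \<forall>h\<in>{h. hol h \<and> (\<forall>z\<in>ball 0 1. cmod (h z) \<le> 1)}. \<forall>z\<in>K. cmod (h z) \<le> B"
   by (intro exI[of _ 1]) auto
 qed (use h(1) hb in auto)
 have g1: "cmod (g z) \<le> 1" if "cmod z < 1" for z
  by (rule LIMSEQ_le_const2[OF tendsto_norm[OF g(3)]]) (use that hb in auto)
 have hg: "h n z = BP (J \<inter> {n..}) p z * g z" if z: "cmod z < 1" for n z
 proof -
  have "(\<lambda>k. BF ((J \<inter> {n..}) \<inter> {..<s k}) p z * h (s k) z) \<longlonglongrightarrow> BP (J \<inter> {n..}) p z * g z"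
  proof (intro tendsto_mult g)
   have "(\<lambda>k. BF ((J \<inter> {n..}) \<inter> {..<k}) p z) \<longlonglongrightarrow> BP (J \<inter> {n..}) p z"
    by (rule BP_LIMSEQ[OF bseq_subset[OF J] z]) auto
   from LIMSEQ_subseq_LIMSEQ[OF this g(2)]
   show "(\<lambda>k. BF ((J \<inter> {n..}) \<inter> {..<s k}) p z) \<longlonglongrightarrow> BP (J \<inter> {n..}) p z" by (simp add: o_def)
  qed (use z in simp)
  moreover have "eventually (\<lambda>k. h n z = BF ((J \<inter> {n..}) \<inter> {..<s k}) p z * h (s k) z) sequentially"
  proof (rule eventually_sequentiallyI[of n])
   fix k assume "n \<le> k"
   then have sk: "n \<le> s k" using seq_suble[OF g(2), of k] by simp
   have "(J \<inter> {n..}) \<inter> {..<s k} = J \<inter> {n..<n + (s k - n)}" using sk by auto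
   then show "h n z = BF ((J \<inter> {n..}) \<inter> {..<s k}) p z * h (s k) z" using step[OF z, of n "s k - n"] sk by simp
  qed
  ultimately have "(\<lambda>k. h n z) \<longlonglongrightarrow> BP (J \<inter> {n..}) p z * g z" by (rule Lim_transform_eventually[OF _ eventually_mono]) auto
  then show ?thesis by (simp add: LIMSEQ_const_iff)
 qed
 have "J \<inter> {0..} = J" by auto
 then have Fg: "F z = BP J p z * g z" if "cmod z < 1" for z using hg[OF that, of 0] h(2) by simp
 \<comment> \<open>If \<open>g\<close> vanished at \<open>z\<close>, so would every quotient
   \<open>h n\<close>. All of the infinitely many visits to \<open>z\<close> would then belong to
   \<open>J\<close>, against the finiteness in \<open>card_near_zeros\<close>.\<close>
 have gnz: "g z \<noteq> 0" if z: "cmod z < 1" for z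
 proof
  assume gz: "g z = 0"
  then have "F z = 0" using Fg[OF z] by simp
  then have I: "infinite {n. p n = z}" by (rule inf[OF z])
  have "{n. p n = z} \<subseteq> {j \<in> J. 1 \<le> kap z (p j)}"
  proof safe
   fix n assume "z = p n"
   show "n \<in> J" unfolding J_def using hg[of "p n" n] gz z \<open>z = p n\<close> by simp
   show "1 \<le> kap (p n) (p n)" using kap_refl[OF p1] by simp
  qed
  then show False using I card_near_zeros(1)[OF k z, of 1] finite_subset by auto
 qed
 have le_g: "cmod (F z) \<le> cmod (g z)" if "cmod z < 1" for z
  unfolding Fg[OF that] norm_mult using norm_BP_le_1[OF J that] by (intro mult_left_le_one_le) auto
 obtain c' where c': "0 < c'" and c'': "\<And>g z w. hol g ==> (\<And>x. cmod x < 1 ==> g x \<noteq> 0) ==>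
  (\<And>x. cmod x < 1 ==> cmod (g x) \<le> 1) ==> cmod z < 1 ==> cmod w < 1 ==> rho z w \<le> r ==> c \<le> cmod (g w)
  ==> c' \<le> cmod (g z)" using zero_free_lower_bound[OF r c] by metis
 have lower: "c' \<le> cmod (g z)" if z: "cmod z < 1" for z
 proof -
  obtain w where w: "cmod w < 1" "rho z w \<le> r" "c \<le> cmod (F w)" using H[OF z] by blast
  show ?thesis by (rule c''[OF g(1) gnz g1 z w(1,2)]) (use w le_g[OF w(1)] in auto)
 qed
 \<comment> \<open>Since \<open>cmod (F z) \<le> cmod (g z)\<close>, the product of \<open>F\<close>
   with \<open>1 / g\<close> is bounded by 1, and \<open>F\<close> has radial limits of modulus
   1.\<close>
 have "cmod (1 / g z) \<le> 1" if z: "cmod z < 1" for z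
 proof (rule unimodular_quotient_bounded[OF _ _ ae _ z])
  show "hol (\<lambda>z. 1 / g z)" using gnz by (intro holomorphic_intros g) auto
  show "cmod (1 / g z) \<le> 1 / c'" if "cmod z < 1" for z
   unfolding norm_divide using lower[OF that] c' by (intro frac_le) auto
  show "cmod (F z * (1 / g z)) \<le> 1" if "cmod z < 1" for z
   using le_g[OF that] gnz[OF that] by (simp add: norm_divide norm_mult divide_simps)
 qed
 then have "cmod (g z) = 1" if "cmod z < 1" for z
  using that g1[OF that] gnz[OF that] by (force simp: norm_divide divide_simps)
 then obtain d where d: "cmod d = 1" "\<And>z. cmod z < 1 ==> g z = d" using norm_1_imp_const[OF g(1)] by metis
 show ?thesis by (rule CN_I[OF J k d(1)]) (use Fg d(2) in auto)
qed

section \<open>From small far sums to the class P\<close>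

lemma BP_inner:
 assumes J: "bseq J a" and c: "cmod c = 1" and e: "\<And>z. cmod z < 1 ==> \<Theta> z = c * BP J a z"
 shows "inner_function \<Theta>"
 unfolding inner_function_def Hinf_def mem_Collect_eq
proof (intro conjI)
 show "hol \<Theta>"
  by (rule holomorphic_transform[of "\<lambda>z. c * BP J a z"]) (use e in \<open>auto intro!: holomorphic_intros BP_holomorphic J\<close>)
 show "bounded (\<Theta> ` ball 0 1)"
  unfolding bounded_iff using e c norm_BP_le_1[OF J] by (intro exI[of _ 1]) (auto simp: norm_mult)
 show "AE t in lborel. \<exists>l. ((\<lambda>r. \<Theta> (of_real r * cis t)) \<longlongrightarrow> l) (at_left 1) \<and> cmod l = 1"
  using BP_radial_limits[OF J]
 proof eventually_elim
  case (elim t)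
  then obtain l where l: "((\<lambda>r. BP J a (of_real r * cis t)) \<longlongrightarrow> l) (at_left 1)" "cmod l = 1" by blast
  have ev: "eventually (\<lambda>r. 0 < r \<and> r < (1::real)) (at_left 1)"
   by (auto simp: eventually_at_left_field intro!: exI[of _ 0])
  have "((\<lambda>r. c * BP J a (of_real r * cis t)) \<longlongrightarrow> c * l) (at_left 1)" by (intro tendsto_intros l)
  moreover have "eventually (\<lambda>r. c * BP J a (of_real r * cis t) = \<Theta> (of_real r * cis t)) (at_left 1)"
   using ev by eventually_elim (use e in \<open>simp add: norm_mult\<close>)
  ultimately have "((\<lambda>r. \<Theta> (of_real r * cis t)) \<longlongrightarrow> c * l) (at_left 1)" by (rule Lim_transform_eventually)
  then show ?case using l c by (intro exI[of _ "c * l"]) (simp add: norm_mult)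
 qed
qed

lemma norm_disc_aut_le_1:
 assumes "cmod a < 1" "cmod w \<le> 1"
 shows "cmod (disc_aut a w) \<le> 1"
proof -
 have "(cmod (a - w))\<^sup>2 \<le> (cmod (1 - cnj a * w))\<^sup>2"
  unfolding norm_den_sq norm_minus_commute[of a w]
  using one_minus_sq_bounds(3)[OF assms(1)] assms(2) by (simp add: power_le_one)
 then have "cmod (a - w) \<le> cmod (1 - cnj a * w)" by (rule power2_le_imp_le) simp
 then show ?thesis unfolding disc_aut_def norm_divide using den_nonzero[OF assms(2,1)] by (simp add: divide_simps)
qed

text \<open>Let \<open>F\<close> be the composition with \<open>disc_aut \<alpha>\<close>. Where
  \<open>cmod F\<close> is below \<open>cmod \<alpha>\<close>, the modulus of \<Theta> is bounded
  away from 1, so smallness of the far sums forces a zero of \<Theta> nearby, and at that zero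
  \<open>F\<close> has the value \<alpha>. This is the lower bound asked for by
  \<open>CN_criterion\<close>.\<close>

theorem bsm_imp_P_class:
 assumes J: "bseq J a" and b: "bsm J a" and c: "cmod c = 1" and e: "\<And>z. cmod z < 1 ==> \<Theta> z = c * BP J a z"
 shows "\<Theta> \<in> P_class"
proof -
 have aj: "cmod (a j) < 1" if "j \<in> J" for j using bseq_lt_1[OF J that] .
 obtain A where k: "kb A J a" using csm_kb[OF bsm_imp_csm[OF b J] aj] by blast
 have CN: "\<Theta> \<in> CN" by (rule CN_I[OF J k c e])
 have inner: "inner_function \<Theta>" by (rule BP_inner[OF J c e])
 have hol: "hol \<Theta>" using inner unfolding inner_function_def Hinf_def by blast
 have T1: "cmod (\<Theta> z) \<le> 1" if "cmod z < 1" for z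
  using e[OF that] c norm_BP_le_1[OF J that] by (simp add: norm_mult)
 have "disc_aut \<alpha> \<circ> \<Theta> \<in> CN" if \<alpha>: "\<alpha> \<in> ball 0 1 - {0}" for \<alpha>
 proof -
  have \<alpha>1: "cmod \<alpha> < 1" "\<alpha> \<noteq> 0" using \<alpha> by auto
  define F where "F z = disc_aut \<alpha> (\<Theta> z)" for z
  \<comment> \<open>A lower bound for \<open>1 - (cmod (\<Theta> z))\<^sup>2\<close> when
    \<open>cmod (F z) < cmod \<alpha>\<close>: the difference equals
    \<open>kap \<alpha> (F z)\<close>, whose denominator is at most 4.\<close>
  define q where "q = (1 - (cmod \<alpha>)\<^sup>2)\<^sup>2 / 4"
  have q: "q > 0" unfolding q_def using one_minus_sq_bounds(3)[OF \<alpha>1(1)] by simp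
  obtain \<tau>0 where \<tau>0: "\<tau>0 > 0" "\<And>z F. cmod z < 1 ==> finite F ==> F \<subseteq> J ==> (\<And>j. j \<in> F ==> kap z (a j) \<le> \<tau>0)
   ==> (\<Sum>j\<in>F. kap z (a j)) \<le> q / 2" by (rule bsmE[OF b, of "q / 2"]) (use q in auto)
  define \<tau> where "\<tau> = min \<tau>0 (1 / 2)"
  have \<tau>: "\<tau> > 0" "\<tau> \<le> \<tau>0" "\<tau> \<le> 1 / 2" using \<tau>0(1) by (auto simp: \<tau>_def)
  define r where "r = sqrt (1 - \<tau>)"
  have r: "0 \<le> r" "r < 1" "r\<^sup>2 = 1 - \<tau>" using \<tau> by (auto simp: r_def)
  have den: "1 - cnj \<alpha> * \<Theta> z \<noteq> 0" if "cmod z < 1" for z using den_nonzero[OF T1[OF that] \<alpha>1(1)] .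
  have "F \<in> CN"
  proof (rule CN_criterion[OF _ _ _ r(1,2)])
   show "hol F"
    unfolding F_def[abs_def] disc_aut_def using den by (intro holomorphic_intros hol) auto
   show "cmod (F z) \<le> 1" if "cmod z < 1" for z unfolding F_def by (rule norm_disc_aut_le_1[OF \<alpha>1(1) T1[OF that]])
   show "0 < cmod \<alpha>" using \<alpha>1 by simp
   have "AE t in lborel. \<exists>l. ((\<lambda>r. \<Theta> (of_real r * cis t)) \<longlongrightarrow> l) (at_left 1) \<and> cmod l = 1"
    using inner unfolding inner_function_def by blast
   then show "AE t in lborel. ((\<lambda>r. cmod (F (of_real r * cis t))) \<longlongrightarrow> 1) (at_left 1)"
   proof eventually_elim
    case (elim t)
    then obtain l where l: "((\<lambda>r. \<Theta> (of_real r * cis t)) \<longlongrightarrow> l) (at_left 1)" "cmod l = 1" by blast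
    have dl: "1 - cnj \<alpha> * l \<noteq> 0" using den_nonzero[of l \<alpha>] l(2) \<alpha>1 by simp
    have "((\<lambda>r. cmod (F (of_real r * cis t))) \<longlongrightarrow> cmod (disc_aut \<alpha> l)) (at_left 1)"
     unfolding F_def disc_aut_def by (intro tendsto_intros l dl)
    moreover have "cmod (disc_aut \<alpha> l) = 1"
    proof -
     have "cmod (\<alpha> - l) = cmod (1 - cnj \<alpha> * l)"
      using norm_den_sq[of \<alpha> l] l(2) by (simp add: norm_minus_commute)
     then show ?thesis unfolding disc_aut_def norm_divide using dl by simp
    qed
    ultimately show ?case by simp
   qed
   fix z :: complex assume z: "cmod z < 1"
   show "\<exists>w. cmod w < 1 \<and> rho z w \<le> r \<and> cmod \<alpha> \<le> cmod (F w)"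
   proof (cases "cmod \<alpha> \<le> cmod (F z)")
    case True
    then show ?thesis using z r by (intro exI[of _ z]) (auto simp: rho_def)
   next
    case False
    then have Fz: "cmod (F z) < cmod \<alpha>" "cmod (F z) < 1" using \<alpha>1 by auto
    have "cmod (\<Theta> z) < 1"
    proof (rule ccontr)
     assume "\<not> ?thesis"
     then have T: "cmod (\<Theta> z) = 1" using T1[OF z] by simp
     have "cmod (\<alpha> - \<Theta> z) = cmod (1 - cnj \<alpha> * \<Theta> z)"
      using norm_den_sq[of \<alpha> "\<Theta> z"] T by (simp add: norm_minus_commute)
     then show False using Fz den[OF z] unfolding F_def disc_aut_def norm_divide by simp
    qed
    then have "\<Theta> z = disc_aut \<alpha> (F z)" unfolding F_def by (rule disc_aut_invol[OF \<alpha>1(1), symmetric])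
    then have "(cmod (\<Theta> z))\<^sup>2 = 1 - kap \<alpha> (F z)"
     using norm_disc_aut[OF \<alpha>1(1) Fz(2)] rho_sq[OF \<alpha>1(1) Fz(2)] by simp
    moreover have "q \<le> kap \<alpha> (F z)"
    proof -
     have "(1 - (cmod \<alpha>)\<^sup>2) * (1 - (cmod \<alpha>)\<^sup>2) / 2\<^sup>2 \<le> kap \<alpha> (F z)"
      unfolding kap_def
     proof (intro frac_le mult_left_mono power_mono)
      show "1 - (cmod \<alpha>)\<^sup>2 \<le> 1 - (cmod (F z))\<^sup>2" using Fz by (simp add: power_mono)
      show "cmod (1 - cnj (F z) * \<alpha>) \<le> 2"
       using norm_triangle_ineq4[of 1 "cnj (F z) * \<alpha>"] mult_mono[of "cmod (F z)" 1 "cmod \<alpha>" 1] Fz \<alpha>1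
       by (simp add: norm_mult)
     qed (use one_minus_sq_bounds(3)[OF \<alpha>1(1)] one_minus_sq_bounds(3)[OF Fz(2)] den_nonzero[of \<alpha> "F z"] Fz \<alpha>1 in auto)
     then show ?thesis by (simp add: q_def power2_eq_square)
    qed
    ultimately have small: "(cmod (\<Theta> z))\<^sup>2 \<le> 1 - q" by simp
    have "\<exists>j\<in>J. \<tau> < kap z (a j)"
    proof (rule ccontr)
     assume "\<not> ?thesis"
     then have *: "kap z (a j) \<le> \<tau>0" if "j \<in> J" for j using that \<tau>(2) by (force simp: not_less)
     have "1 - q / 2 \<le> (cmod (BP J a z))\<^sup>2"
     proof (rule norm_BP_sq_ge[OF J z])
      show "(\<Sum>j\<in>F. kap z (a j)) \<le> q / 2" if "finite F" "F \<subseteq> J" for F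
       by (rule \<tau>0(2)[OF z that]) (use * that in auto)
     qed
     then show False using small e[OF z] c q by (simp add: norm_mult)
    qed
    then obtain j where j: "j \<in> J" "\<tau> < kap z (a j)" by blast
    have "rho z (a j) \<le> r" using rho_le_iff_kap[OF z aj[OF j(1)] r(1)] j(2) r(3) by simp
    moreover have "F (a j) = \<alpha>" unfolding F_def using e[OF aj[OF j(1)]] BP_zero[OF J j(1)] by simp
    ultimately show ?thesis using aj[OF j(1)] by (intro exI[of _ "a j"]) auto
   qed
  qed
  then show ?thesis by (simp add: F_def[abs_def] o_def)
 qed
 then show ?thesis unfolding P_class_def M_class_def using CN inner by blast
qed

section \<open>From the class P to small far sums\<close>

text \<open>The function \<open>m / G\<close> maps the disc of radius \<open>R'\<close> about
  \<open>z\<close> into the unit disc. If \<open>cmod (G z)\<close> is close to the lower bound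
  \<open>m\<close>, its value at the centre is nearly unimodular, and Schwarz-Pick leaves little
  room for variation on the smaller disc.\<close>

lemma near_constancy:
 assumes G: "hol G" "\<And>x. cmod x < 1 ==> cmod (G x) \<le> 1"
  and z: "cmod z < 1" and R: "0 \<le> R" "R < R'" "R' < 1" and m: "0 < m"
  and low: "\<And>x. cmod x < 1 ==> rho z x < R' ==> m < cmod (G x)"
  and w: "cmod w < 1" "rho z w \<le> R"
 shows "cmod (G w - G z) \<le> (1 - (m / cmod (G z))\<^sup>2) / (m * (1 - R / R'))"
proof -
 have R': "0 < R'" using R by linarith
 define u where "u \<zeta> = disc_aut z (of_real R' * \<zeta>)" for \<zeta>
 have RR: "cmod (of_real R' * \<zeta>) < R'" if "cmod \<zeta> < 1" for \<zeta>
  using that R' by (simp add: norm_mult)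
 have u1: "cmod (u \<zeta>) < 1" and u2: "rho z (u \<zeta>) < R'" if "cmod \<zeta> < 1" for \<zeta>
 proof -
  have a: "cmod (of_real R' * \<zeta>) < 1" using RR[OF that] R by linarith
  show "cmod (u \<zeta>) < 1" unfolding u_def by (rule disc_aut_lt_1[OF z a])
  have "rho z (u \<zeta>) = cmod (disc_aut z (u \<zeta>))" using norm_disc_aut[OF z] disc_aut_lt_1[OF z a] by (simp add: u_def)
  also have "\<dots> = cmod (of_real R' * \<zeta>)" unfolding u_def disc_aut_invol[OF z a] ..
  finally show "rho z (u \<zeta>) < R'" using RR[OF that] by simp
 qed
 have uh: "hol u"
  unfolding u_def[abs_def] using dilate_holomorphic(1)[OF disc_aut_holomorphic[OF z], of "of_real R'"] R R' by simp
 define H where "H \<zeta> = of_real m / G (u \<zeta>)" for \<zeta>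
 have Gu: "m < cmod (G (u \<zeta>))" if "cmod \<zeta> < 1" for \<zeta> by (rule low[OF u1[OF that] u2[OF that]])
 have Gu_hol: "hol (\<lambda>\<zeta>. G (u \<zeta>))"
  using holomorphic_on_compose_gen[OF uh G(1)] u1 by (force simp: o_def)
 have Hh: "hol H" unfolding H_def[abs_def]
  using Gu m by (intro holomorphic_intros Gu_hol) force
 have H1: "cmod (H \<zeta>) < 1" if "cmod \<zeta> < 1" for \<zeta>
 proof -
  have "0 < cmod (G (u \<zeta>))" using Gu[OF that] m by linarith
  then show ?thesis unfolding H_def using Gu[OF that] m by (simp add: norm_divide)
 qed
 define \<zeta> where "\<zeta> = disc_aut z w / of_real R'"
 have nz: "cmod \<zeta> = rho z w / R'" unfolding \<zeta>_def norm_divide using norm_disc_aut[OF z w(1)] R' by simp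
 have \<zeta>R: "cmod \<zeta> \<le> R / R'" unfolding nz using w R' by (intro divide_right_mono) auto
 have RR1: "R / R' < 1" using R R' by simp
 then have \<zeta>1: "cmod \<zeta> < 1" using \<zeta>R by linarith
 have u\<zeta>: "u \<zeta> = w" unfolding u_def \<zeta>_def using R' disc_aut_invol[OF z w(1)] by simp
 have u0: "u 0 = z" by (simp add: u_def)
 define t where "t = cmod \<zeta>"
 have t: "0 \<le> t" "t < 1" "t \<le> R / R'" unfolding t_def using \<zeta>1 \<zeta>R by auto
 have H0: "cmod (H 0) = m / cmod (G z)" unfolding H_def u0 norm_divide using m by simp
 have "rho (H \<zeta>) (H 0) \<le> rho \<zeta> 0" by (rule schwarz_pick[OF Hh H1 \<zeta>1]) auto
 then have "cmod (H \<zeta> - H 0) / cmod (1 - cnj (H 0) * H \<zeta>) \<le> t" by (simp add: rho_def norm_divide t_def)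
 moreover have "cmod (1 - cnj (H 0) * H \<zeta>) > 0" using den_nonzero[of "H \<zeta>" "H 0"] H1[of 0] H1[OF \<zeta>1] by simp
 ultimately have 1: "cmod (H \<zeta> - H 0) \<le> t * cmod (1 - cnj (H 0) * H \<zeta>)" by (simp add: pos_divide_le_eq)
 have 2: "cmod (1 - cnj (H 0) * H \<zeta>) \<le> (1 - (cmod (H 0))\<^sup>2) + cmod (H \<zeta> - H 0)"
 proof -
  have X: "1 - cnj (H 0) * H \<zeta> = of_real (1 - (cmod (H 0))\<^sup>2) - cnj (H 0) * (H \<zeta> - H 0)"
   by (simp only: of_real_diff of_real_1 complex_norm_square) (simp add: algebra_simps)
  have "cmod (1 - cnj (H 0) * H \<zeta>) \<le> cmod (of_real (1 - (cmod (H 0))\<^sup>2)) + cmod (cnj (H 0) * (H \<zeta> - H 0))"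
   unfolding X by (rule norm_triangle_ineq4)
  moreover have "cmod (cnj (H 0) * (H \<zeta> - H 0)) \<le> 1 * cmod (H \<zeta> - H 0)"
   unfolding norm_mult using H1[of 0] by (intro mult_right_mono) auto
  moreover have "cmod (of_real (1 - (cmod (H 0))\<^sup>2)) = 1 - (cmod (H 0))\<^sup>2"
   using one_minus_sq_bounds(3)[of "H 0"] H1[of 0] by (simp add: norm_of_real del: of_real_diff)
  ultimately show ?thesis by linarith
 qed
 have h0: "0 \<le> 1 - (cmod (H 0))\<^sup>2" using one_minus_sq_bounds(3)[of "H 0"] H1[of 0] by simp
 have M: "t * cmod (1 - cnj (H 0) * H \<zeta>) \<le> t * (1 - (cmod (H 0))\<^sup>2) + t * cmod (H \<zeta> - H 0)"
  using mult_left_mono[OF 2 t(1)] by (simp add: distrib_left)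
 have M1: "t * (1 - (cmod (H 0))\<^sup>2) \<le> 1 * (1 - (cmod (H 0))\<^sup>2)" using t h0 by (intro mult_right_mono) auto
 have M2: "t * cmod (H \<zeta> - H 0) \<le> R / R' * cmod (H \<zeta> - H 0)" using t by (intro mult_right_mono) auto
 have "cmod (H \<zeta> - H 0) \<le> 1 * (1 - (cmod (H 0))\<^sup>2) + R / R' * cmod (H \<zeta> - H 0)"
  by (rule order_trans[OF 1 order_trans[OF M add_mono[OF M1 M2]]])
 moreover have "x * (1 - q) \<le> h" if "x \<le> 1 * h + q * x" for x q h :: real
  using that by (simp add: algebra_simps)
 ultimately have "cmod (H \<zeta> - H 0) * (1 - R / R') \<le> 1 - (cmod (H 0))\<^sup>2" by blast
 then have 3: "cmod (H \<zeta> - H 0) \<le> (1 - (cmod (H 0))\<^sup>2) / (1 - R / R')" using RR1 by (simp add: pos_le_divide_eq)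
 have Gnz: "G w \<noteq> 0" "G z \<noteq> 0" using Gu[OF \<zeta>1] Gu[of 0] m unfolding u\<zeta> u0 by auto
 have "G w - G z = G w * G z * (H 0 - H \<zeta>) / of_real m"
  unfolding H_def u\<zeta> u0 using Gnz m by (simp add: divide_simps) (simp add: algebra_simps)
 then have "cmod (G w - G z) = cmod (G w) * cmod (G z) * cmod (H \<zeta> - H 0) / m"
  using m by (simp add: norm_mult norm_divide norm_minus_commute)
 also have "\<dots> \<le> 1 * 1 * ((1 - (cmod (H 0))\<^sup>2) / (1 - R / R')) / m"
  using G(2) w z m 3 h0 RR1 by (intro divide_right_mono mult_mono) auto
 also have "\<dots> = (1 - (m / cmod (G z))\<^sup>2) / (m * (1 - R / R'))" unfolding H0 by simp
 finally show ?thesis .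
qed

text \<open>The layer \<open>k\<close> consists of about \<open>s / (2 * q ^ k)\<close> equally
  spaced points with \<open>1 - (cmod g)\<^sup>2 = q ^ k\<close>. Each layer adds at least
  \<open>s / 4\<close> to the sum, so the sum is unbounded while the points stay separated.\<close>

lemma separated_grid:
 assumes s: "0 < s" "s \<le> 1"
 shows "\<exists>(I :: (nat \<times> nat) set) g. finite I \<and> (\<forall>i\<in>I. cmod (g i) < 1) \<and>
  (\<forall>i\<in>I. \<forall>i'\<in>I. i \<noteq> i' \<longrightarrow> kap (g i) (g i') \<le> s\<^sup>2) \<and> M < (\<Sum>i\<in>I. 1 - (cmod (g i))\<^sup>2)"
proof -
 \<comment> \<open>For points in different layers \<open>kap\<close> is at most
   \<open>4 * q\<close>, hence at most \<open>s\<^sup>2\<close>. Within a layer it is at most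
   \<open>(2 * (N k * y k))\<^sup>2\<close>, and \<open>N\<close> below is chosen with
   \<open>N k * y k \<le> s / 2\<close>.\<close>
 define q where "q = s\<^sup>2 / 8"
 have s2: "s\<^sup>2 \<le> s" using s by (simp add: power2_eq_square mult_left_le)
 have q: "0 < q" "q \<le> s / 8" "q < 1" using s s2 by (auto simp: q_def)
 define y where "y k = q ^ k" for k :: nat
 have y: "0 < y k" for k using q by (simp add: y_def)
 have yle: "y k' \<le> q * y k" if "k < k'" for k k'
 proof -
  have "q ^ k' \<le> q ^ Suc k" using that q by (intro power_decreasing) auto
  then show ?thesis by (simp add: y_def)
 qed
 have yq: "y k \<le> q" if "1 \<le> k" for k
  unfolding y_def using power_decreasing[of 1 k q] that q by simp
 define N where "N k = nat \<lfloor>s / (2 * y k)\<rfloor>" for k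
 have N: "real (N k) * y k \<le> s / 2" "s / 4 \<le> real (N k) * y k" if k: "1 \<le> k" for k
 proof -
  define x where "x = s / (2 * y k)"
  have "2 * y k \<le> s" using yq[OF k] q(2) s by linarith
  then have x: "1 \<le> x" unfolding x_def using y[of k] by (simp add: pos_le_divide_eq)
  have xy: "x * y k = s / 2" unfolding x_def using y[of k] by simp
  have "real (N k) = of_int \<lfloor>x\<rfloor>" unfolding N_def x_def[symmetric] using x by simp
  moreover have "of_int \<lfloor>x\<rfloor> \<le> x" "x < of_int \<lfloor>x\<rfloor> + 1" using floor_correct[of x] by auto
  moreover have "1 \<le> \<lfloor>x\<rfloor>" using x by (simp add: le_floor_iff)
  then have "1 \<le> real_of_int \<lfloor>x\<rfloor>" by simp
  ultimately have n: "real (N k) \<le> x" "x / 2 \<le> real (N k)" by linarith+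
  show "real (N k) * y k \<le> s / 2" using mult_right_mono[OF n(1), of "y k"] y[of k] xy by simp
  show "s / 4 \<le> real (N k) * y k" using mult_right_mono[OF n(2), of "y k"] y[of k] xy by simp
 qed
 obtain K :: nat where K: "4 * M / s < real K" using reals_Archimedean2 by blast
 define I where "I = (SIGMA k:{1..K}. {..<N k})"
 define g where "g i = (case i of (k, l) \<Rightarrow> of_real (sqrt (1 - y k)) * cis (pi * real l / real (N k)))" for i
 have y1: "y k < 1" if "1 \<le> k" for k using yq[OF that] q by linarith
 have ng: "(cmod (g (k, l)))\<^sup>2 = 1 - y k" if "1 \<le> k" for k l
  using y1[OF that] by (simp add: g_def norm_mult)
 have ng1: "cmod (g (k, l)) < 1" if "1 \<le> k" for k l
 proof -
  have "(cmod (g (k, l)))\<^sup>2 < 1\<^sup>2" using ng[OF that, of l] y[of k] by simp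
  then show ?thesis by (rule power2_less_imp_less) simp
 qed
 have diff: "kap (g (k, l)) (g (k', l')) \<le> s\<^sup>2" if k: "1 \<le> k" "k < k'" for k k' l l'
 proof -
  have k': "1 \<le> k'" using k by simp
  define D where "D = cmod (1 - cnj (g (k', l')) * g (k, l))"
  have "y k \<le> 2 * (1 - cmod (g (k, l)))" using one_minus_sq_bounds(2)[OF ng1[OF k(1), of l]] ng[OF k(1), of l] by simp
  also have "\<dots> \<le> 2 * D" unfolding D_def
   by (intro mult_left_mono one_minus_le_norm_den' less_imp_le ng1 k') auto
  finally have D: "y k / 2 \<le> D" by simp
  have "kap (g (k, l)) (g (k', l')) = y k * y k' / D\<^sup>2"
   unfolding kap_def D_def ng[OF k(1)] ng[OF k'] by simp
  also have "\<dots> \<le> y k * (q * y k) / (y k / 2)\<^sup>2"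
   using D y[of k] y[of k'] yle[OF k(2)] q by (intro frac_le mult_left_mono power_mono) auto
  also have "\<dots> = 4 * q" using y[of k] by (simp add: power2_eq_square)
  also have "\<dots> \<le> s\<^sup>2" by (simp add: q_def)
  finally show ?thesis .
 qed
 have same: "kap (g (k, l)) (g (k, l')) \<le> s\<^sup>2" if k: "1 \<le> k" and l: "l < N k" "l' < N k" "l \<noteq> l'" for k l l'
 proof -
  define D where "D = cmod (1 - cnj (g (k, l')) * g (k, l))"
  define x where "x = pi * (real l - real l') / real (N k)"
  have Np: "0 < real (N k)" using l by simp
  have ab: "\<bar>x\<bar> = pi * \<bar>real l - real l'\<bar> / real (N k)" unfolding x_def by (simp add: abs_mult)
  have "\<bar>real l - real l'\<bar> \<le> real (N k)" using l by linarith
  then have "pi * \<bar>real l - real l'\<bar> \<le> pi * real (N k)" by (intro mult_left_mono) auto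
  then have x1: "\<bar>x\<bar> \<le> pi" unfolding ab using Np by (simp add: pos_divide_le_eq)
  have "1 \<le> \<bar>real l - real l'\<bar>" using l by linarith
  then have "2 * 1 \<le> pi * \<bar>real l - real l'\<bar>" using pi_ge_two by (intro mult_mono) auto
  then have x2: "2 / real (N k) \<le> \<bar>x\<bar>" unfolding ab using Np by (intro divide_right_mono) auto
  have "cnj (g (k, l')) * g (k, l) = (of_real (sqrt (1 - y k)) * of_real (sqrt (1 - y k))) * (cis (- (pi * real l' / real (N k))) * cis (pi * real l / real (N k)))"
   by (simp add: g_def cis_cnj)
  also have "complex_of_real (sqrt (1 - y k)) * of_real (sqrt (1 - y k)) = of_real (1 - y k)"
  proof -
   have "sqrt (1 - y k) * sqrt (1 - y k) = 1 - y k" using y1[OF k] by simp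
   then show ?thesis unfolding of_real_mult[symmetric] by (rule arg_cong)
  qed
  also have "cis (- (pi * real l' / real (N k))) * cis (pi * real l / real (N k)) = cis x"
   unfolding cis_mult x_def by (simp add: right_diff_distrib diff_divide_distrib)
  finally have "D = cmod (1 - of_real (1 - y k) * cis x)" unfolding D_def by simp
  then have "\<bar>x\<bar> \<le> 4 * D" using abs_angle_le[OF x1, of "1 - y k"] y[of k] y1[OF k] by simp
  then have D: "1 / (2 * real (N k)) \<le> D" using x2 by (simp add: field_simps)
  have "kap (g (k, l)) (g (k, l')) = y k * y k / D\<^sup>2"
   unfolding kap_def D_def ng[OF k] by simp
  also have "\<dots> \<le> y k * y k / (1 / (2 * real (N k)))\<^sup>2"
   using D y[of k] Np by (intro divide_left_mono power_mono mult_pos_pos) auto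
  also have "\<dots> = (2 * (real (N k) * y k))\<^sup>2" using Np by (simp add: power2_eq_square)
  also have "\<dots> \<le> s\<^sup>2" using N(1)[OF k] y[of k] by (intro power_mono) auto
  finally show ?thesis .
 qed
 have sep: "kap (g i) (g i') \<le> s\<^sup>2" if i: "i \<in> I" "i' \<in> I" "i \<noteq> i'" for i i'
 proof -
  obtain k l k' l' where e: "i = (k, l)" "i' = (k', l')" by (metis surj_pair)
  consider "k < k'" | "k' < k" | "k = k'" "l \<noteq> l'" using i(3) e by fastforce
  then show ?thesis
  proof cases
   case 1 then show ?thesis using i diff unfolding e I_def by auto
  next
   case 2 then show ?thesis using i diff kap_sym unfolding e I_def by auto
  next
   case 3 then show ?thesis using i same unfolding e I_def by auto
  qed
 qed
 have "(\<Sum>i\<in>I. 1 - (cmod (g i))\<^sup>2) = (\<Sum>k\<in>{1..K}. \<Sum>l<N k. 1 - (cmod (g (k, l)))\<^sup>2)"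
  unfolding I_def by (subst sum.Sigma) (auto simp: case_prod_unfold)
 also have "\<dots> = (\<Sum>k\<in>{1..K}. real (N k) * y k)"
  by (intro sum.cong refl) (simp add: ng)
 also have "\<dots> \<ge> (\<Sum>k\<in>{1..K}. s / 4)" by (intro sum_mono N(2)) simp
 finally have "real K * (s / 4) \<le> (\<Sum>i\<in>I. 1 - (cmod (g i))\<^sup>2)" by simp
 moreover have "M < real K * (s / 4)" using K s by (simp add: pos_divide_less_eq)
 ultimately have "M < (\<Sum>i\<in>I. 1 - (cmod (g i))\<^sup>2)" by linarith
 moreover have "finite I" unfolding I_def by simp
 moreover have "\<forall>i\<in>I. cmod (g i) < 1" using ng1 unfolding I_def by auto
 ultimately show ?thesis using sep by blast
qed

text \<open>A separated grid of large mass is placed around \<open>z\<close>. If each grid point had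
  a zero near it, these zeros would be distinct, and by Harnack their \<open>kap\<close> sum at
  \<open>z\<close> would exceed \<open>A\<close>. The grid is fixed before \<open>z\<close>, which
  makes \<open>R\<close> uniform.\<close>

lemma zero_free_disc:
 assumes k: "kb A J a" and J: "\<And>j. j \<in> J ==> cmod (a j) < 1" and \<tau>: "0 < \<tau>" "\<tau> < 1"
 shows "\<exists>R. 0 \<le> R \<and> R < 1 \<and> (\<forall>z. cmod z < 1 \<longrightarrow> (\<exists>w. cmod w < 1 \<and> rho z w \<le> R \<and> (\<forall>j\<in>J. kap w (a j) \<le> \<tau>)))"
proof -
 define p where "p = sqrt (1 - \<tau>)"
 have p: "0 \<le> p" "p < 1" "1 - p\<^sup>2 = \<tau>" using \<tau> by (auto simp: p_def)
 define C where "C = hC p"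
 have C: "1 \<le> C" unfolding C_def by (rule hC_ge_1[OF p(1,2)])
 \<comment> \<open>Two grid points sharing a zero would satisfy
   \<open>\<tau> < C * kap (g i) (g i')\<close>, while this choice makes the right side at most
   \<open>\<tau> / 2\<close>.\<close>
 define s where "s = sqrt (\<tau> / (2 * C))"
 have s: "0 < s" "s \<le> 1" "s\<^sup>2 = \<tau> / (2 * C)" using \<tau> C by (auto simp: s_def divide_simps)
 obtain I :: "(nat \<times> nat) set" and g where I: "finite I" and g1: "\<And>i. i \<in> I ==> cmod (g i) < 1"
  and sep: "\<And>i i'. i \<in> I ==> i' \<in> I ==> i \<noteq> i' ==> kap (g i) (g i') \<le> s\<^sup>2" and M: "A * C < (\<Sum>i\<in>I. 1 - (cmod (g i))\<^sup>2)"
 proof -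
  have "\<exists>(I :: (nat \<times> nat) set) g. finite I \<and> (\<forall>i\<in>I. cmod (g i) < 1) \<and>
   (\<forall>i\<in>I. \<forall>i'\<in>I. i \<noteq> i' \<longrightarrow> kap (g i) (g i') \<le> s\<^sup>2) \<and> A * C < (\<Sum>i\<in>I. 1 - (cmod (g i))\<^sup>2)"
   by (rule separated_grid[OF s(1,2)])
  then obtain I :: "(nat \<times> nat) set" and g where "finite I" "\<forall>i\<in>I. cmod (g i) < 1"
   "\<forall>i\<in>I. \<forall>i'\<in>I. i \<noteq> i' \<longrightarrow> kap (g i) (g i') \<le> s\<^sup>2" "A * C < (\<Sum>i\<in>I. 1 - (cmod (g i))\<^sup>2)" by (elim exE conjE)
  then show ?thesis by (intro that[of I g]) simp_all
 qed
 define R where "R = Max (insert 0 (cmod ` g ` I))"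
 have R: "0 \<le> R" "R < 1" "\<And>i. i \<in> I ==> cmod (g i) \<le> R"
  unfolding R_def using I g1 by auto
 have "\<exists>w. cmod w < 1 \<and> rho z w \<le> R \<and> (\<forall>j\<in>J. kap w (a j) \<le> \<tau>)" if z: "cmod z < 1" for z
 proof (rule ccontr)
  assume no: "\<not> ?thesis"
  define w where "w i = disc_aut z (g i)" for i
  have w1: "cmod (w i) < 1" if "i \<in> I" for i unfolding w_def by (rule disc_aut_lt_1[OF z g1[OF that]])
  have zw: "kap z (w i) = 1 - (cmod (g i))\<^sup>2" if i: "i \<in> I" for i
   using kap_disc_aut[OF z _ g1[OF i], of 0] by (simp add: w_def)
  have "rho z (w i) \<le> R" if i: "i \<in> I" for i
  proof -
   have "rho z (w i) = cmod (g i)"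
    using norm_disc_aut[OF z w1[OF i]] disc_aut_invol[OF z g1[OF i]] by (simp add: w_def)
   then show ?thesis using R(3)[OF i] by simp
  qed
  then have "\<not> (\<forall>j\<in>J. kap (w i) (a j) \<le> \<tau>)" if "i \<in> I" for i
   using no w1 that by blast
  then have "\<forall>i\<in>I. \<exists>j. j \<in> J \<and> \<tau> < kap (w i) (a j)" by (simp add: not_le) blast
  from bchoice[OF this] obtain jj where jj': "\<forall>i\<in>I. jj i \<in> J \<and> \<tau> < kap (w i) (a (jj i))" ..
  then have jj: "jj i \<in> J" "\<tau> < kap (w i) (a (jj i))" if "i \<in> I" for i using that by auto
  have aj: "cmod (a (jj i)) < 1" if "i \<in> I" for i by (rule J[OF jj(1)[OF that]])
  have rj: "rho (w i) (a (jj i)) \<le> p" if i: "i \<in> I" for i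
   using rho_le_iff_kap[OF w1[OF i] aj[OF i] p(1)] jj(2)[OF i] p(3) by simp
  have inj: "inj_on jj I"
  proof (rule inj_onI)
   fix i i' assume i: "i \<in> I" "i' \<in> I" "jj i = jj i'"
   show "i = i'"
   proof (rule ccontr)
    assume "i \<noteq> i'"
    have "\<tau> < kap (a (jj i)) (w i')" using jj(2)[OF i(2)] unfolding i(3)[symmetric] by (simp only: kap_sym[of "w i'"])
    also have "\<dots> \<le> C * kap (w i) (w i')" unfolding C_def
     by (rule kap_harnack[OF w1[OF i(1)] aj[OF i(1)] w1[OF i(2)] rj[OF i(1)] p(2)])
    also have "kap (w i) (w i') = kap (g i) (g i')" unfolding w_def by (rule kap_disc_aut[OF z g1[OF i(1)] g1[OF i(2)]])
    also have "C * kap (g i) (g i') \<le> C * s\<^sup>2" using sep[OF i(1,2) \<open>i \<noteq> i'\<close>] C by (intro mult_left_mono) auto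
    also have "\<dots> \<le> \<tau>" unfolding s(3) using C \<tau> by simp
    finally show False by simp
   qed
  qed
  have "(\<Sum>i\<in>I. 1 - (cmod (g i))\<^sup>2) \<le> (\<Sum>i\<in>I. C * kap z (a (jj i)))"
  proof (rule sum_mono)
   fix i assume i: "i \<in> I"
   have "1 - (cmod (g i))\<^sup>2 = kap (w i) z" using zw[OF i] by (simp only: kap_sym[of "w i"])
   also have "\<dots> \<le> C * kap (a (jj i)) z" unfolding C_def
    by (rule kap_harnack'[OF w1[OF i] aj[OF i] z rj[OF i] p(2)])
   finally show "1 - (cmod (g i))\<^sup>2 \<le> C * kap z (a (jj i))" by (simp only: kap_sym[of z])
  qed
  also have "\<dots> = C * (\<Sum>j\<in>jj ` I. kap z (a j))" by (simp add: sum_distrib_left sum.reindex[OF inj] o_def)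
  also have "\<dots> \<le> C * A" using C I jj(1) by (intro mult_left_mono kbD[OF k z]) auto
  finally show False using M by (simp add: mult.commute)
 qed
 then show ?thesis using R by blast
qed

lemma not_bsmE:
 assumes nb: "\<not> bsm J a"
 obtains \<eta> where "\<eta> > 0" "\<And>\<tau>. \<tau> > 0 ==> \<exists>z F. far J a \<tau> z F \<and> \<eta> < (\<Sum>j\<in>F. kap z (a j))"
proof -
 from nb obtain \<eta> where \<eta>: "\<eta> > 0" and n: "\<not> (\<exists>\<tau>>0. \<forall>z F. far J a \<tau> z F
  \<longrightarrow> (\<Sum>j\<in>F. kap z (a j)) \<le> \<eta>)" unfolding bsm_def not_all not_imp by (elim exE conjE)
 show ?thesis
 proof (rule that[OF \<eta>], rule ccontr)
  fix \<tau> :: real assume t: "\<tau> > 0" and no: "\<not> (\<exists>z F. far J a \<tau> z F \<and> \<eta> < (\<Sum>j\<in>F. kap z (a j)))"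
  have "(\<Sum>j\<in>F. kap z (a j)) \<le> \<eta>" if "far J a \<tau> z F" for z F
   using no that by (meson not_le)
  then show False using n t by blast
 qed
qed

text \<open>The number \<Lambda> is the limit, as the threshold \<tau> decreases to 0, of the
  largest sum over far zeros. It is finite by \<open>kb\<close> and positive because
  \<open>bsm\<close> fails; the flat discs below are built from near-extremal pairs
  \<open>z\<close>, \<open>F\<close>.\<close>

lemma not_bsm_extremal:
 assumes k: "kb A J a" and J: "\<And>j. j \<in> J ==> cmod (a j) < 1" and nb: "\<not> bsm J a"
 obtains \<Lambda> where "0 < \<Lambda>"
  "\<And>e. e > 0 ==> \<exists>\<tau>>0. \<forall>z F. far J a \<tau> z F \<longrightarrow> (\<Sum>j\<in>F. kap z (a j)) \<le> \<Lambda> + e"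
  "\<And>\<tau> e. \<tau> > 0 ==> e > 0 ==> \<exists>z F. far J a \<tau> z F \<and> \<Lambda> - e < (\<Sum>j\<in>F. kap z (a j))"
proof -
 define X where "X \<tau> = {(\<Sum>j\<in>F. kap z (a j)) | z F. far J a \<tau> z F}" for \<tau>
 have X: "x \<le> A" if "x \<in> X \<tau>" for x \<tau> using that kbD[OF k] unfolding X_def by blast
 have X0: "0 \<in> X \<tau>" for \<tau> unfolding X_def by (rule CollectI, rule exI[of _ 0], rule exI[of _ "{}"]) simp
 have bdd: "bdd_above (X \<tau>)" for \<tau> using X by (rule bdd_aboveI)
 define \<sigma> where "\<sigma> \<tau> = Sup (X \<tau>)" for \<tau>
 have \<sigma>: "x \<le> \<sigma> \<tau>" if "x \<in> X \<tau>" for x \<tau> unfolding \<sigma>_def by (rule cSup_upper[OF that bdd])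
 define \<Lambda> where "\<Lambda> = Inf (\<sigma> ` {0<..})"
 have bb: "bdd_below (\<sigma> ` {0<..})" using \<sigma>[OF X0] by (intro bdd_belowI[of _ 0]) auto
 obtain \<eta> where \<eta>: "\<eta> > 0" "\<And>\<tau>. \<tau> > 0 ==> \<exists>z F. far J a \<tau> z F \<and> \<eta> < (\<Sum>j\<in>F. kap z (a j))"
  by (rule not_bsmE[OF nb], rule that)
 have "\<eta> \<le> \<Lambda>" unfolding \<Lambda>_def
 proof (rule cInf_greatest)
  fix x assume "x \<in> \<sigma> ` {0<..}"
  then obtain \<tau> where \<tau>: "\<tau> > 0" "x = \<sigma> \<tau>" by auto
  obtain z F where zF: "cmod z < 1" "finite F" "F \<subseteq> J" "\<forall>j\<in>F. kap z (a j) \<le> \<tau>" "\<eta> < (\<Sum>j\<in>F. kap z (a j))"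
   using \<eta>(2)[OF \<tau>(1)] by blast
  then have "(\<Sum>j\<in>F. kap z (a j)) \<in> X \<tau>" unfolding X_def by blast
  from \<sigma>[OF this] show "\<eta> \<le> x" using zF(5) \<tau>(2) by linarith
 qed auto
 then have L: "0 < \<Lambda>" using \<eta>(1) by linarith
 have 1: "\<exists>\<tau>>0. \<forall>z F. far J a \<tau> z F \<longrightarrow> (\<Sum>j\<in>F. kap z (a j)) \<le> \<Lambda> + e" if "e > 0" for e
 proof -
  have "Inf (\<sigma> ` {0<..}) < \<Lambda> + e" unfolding \<Lambda>_def[symmetric] using that by simp
  then obtain x where "x \<in> \<sigma> ` {0<..}" "x < \<Lambda> + e" using cInf_less_iff[OF _ bb] by auto
  then obtain \<tau> where \<tau>: "\<tau> > 0" "\<sigma> \<tau> < \<Lambda> + e" by auto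
  have "(\<Sum>j\<in>F. kap z (a j)) \<le> \<Lambda> + e" if "far J a \<tau> z F" for z F
  proof -
   have "(\<Sum>j\<in>F. kap z (a j)) \<in> X \<tau>" unfolding X_def using that by blast
   from \<sigma>[OF this] show ?thesis using \<tau> by linarith
  qed
  then show ?thesis using \<tau>(1) by blast
 qed
 have 2: "\<exists>z F. far J a \<tau> z F \<and> \<Lambda> - e < (\<Sum>j\<in>F. kap z (a j))" if "\<tau> > 0" "e > 0" for \<tau> e
 proof -
  have "\<Lambda> \<le> \<sigma> \<tau>" unfolding \<Lambda>_def using that(1) by (intro cInf_lower[OF _ bb]) auto
  then have "\<Lambda> - e < Sup (X \<tau>)" using that(2) unfolding \<sigma>_def by linarith
  then obtain x where x: "x \<in> X \<tau>" "\<Lambda> - e < x" using less_cSup_iff[OF _ bdd] X0 by (metis empty_iff)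
  then show ?thesis unfolding X_def by blast
 qed
 show ?thesis by (rule that[OF L 1 2])
qed

text \<open>Where the far zeros carry almost the extremal mass \<open>\<Lambda>\<close>, the modulus is pinned near \<open>exp (- \<Lambda> / 2)\<close>.\<close>
lemma not_bsm_flat_discs:
 assumes J: "bseq J a" and k: "kb A J a" and nb: "\<not> bsm J a"
 obtains E where "0 < E" "E < 1"
  "\<And>e. e > 0 ==> \<exists>w. cmod w < 1 \<and> cmod (BP J a w) \<le> E + e \<and> (\<forall>x. cmod x < 1 \<and> rho w x \<le> 3 / 4 \<longrightarrow> E - e < cmod (BP J a x))"
proof -
 have aj: "cmod (a j) < 1" if "j \<in> J" for j by (rule bseq_lt_1[OF J that])
 obtain \<Lambda> where L: "0 < \<Lambda>"
  and U: "\<And>e. e > 0 ==> \<exists>\<tau>>0. \<forall>z F. far J a \<tau> z F \<longrightarrow> (\<Sum>j\<in>F. kap z (a j)) \<le> \<Lambda> + e"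
  and Lw: "\<And>\<tau> e. \<tau> > 0 ==> e > 0 ==> \<exists>z F. far J a \<tau> z F \<and> \<Lambda> - e < (\<Sum>j\<in>F. kap z (a j))"
  by (rule not_bsm_extremal[OF k _ nb], rule aj, assumption, rule that)
 define E where "E = exp (- \<Lambda> / 2)"
 have E: "0 < E" "E < 1" unfolding E_def using L by auto
 \<comment> \<open>Zeros far enough from \<open>x\<close> have total \<open>kap\<close> at most
   \<open>\<Lambda> + u\<close> and single values at most \<open>u\<close>, so
   \<open>norm_BF_sq_ge_exp\<close> with \<open>q = 1 - u\<close> gives a lower bound tending to
   \<open>E\<close>.\<close>
 have V: "\<exists>\<tau>>0. \<forall>x F. cmod x < 1 \<and> finite F \<and> F \<subseteq> J \<and> (\<forall>j\<in>F. kap x (a j) \<le> \<tau>) \<longrightarrow> E - e < cmod (BF F a x)" if e: "e > 0" for e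
 proof -
  have "((\<lambda>u. exp (- (\<Lambda> + u) / (1 - u) / 2)) \<longlongrightarrow> exp (- (\<Lambda> + 0) / (1 - 0) / 2)) (at_right 0)"
   by (intro tendsto_intros) auto
  then have "((\<lambda>u. exp (- (\<Lambda> + u) / (1 - u) / 2)) \<longlongrightarrow> E) (at_right 0)" by (simp add: E_def)
  then have "eventually (\<lambda>u. E - e < exp (- (\<Lambda> + u) / (1 - u) / 2)) (at_right 0)"
   using e by (intro order_tendstoD) auto
  moreover have "eventually (\<lambda>u. 0 < u \<and> u < (1::real)) (at_right 0)"
   by (auto simp: eventually_at_right_field intro!: exI[of _ 1])
  ultimately have "eventually (\<lambda>u. E - e < exp (- (\<Lambda> + u) / (1 - u) / 2) \<and> 0 < u \<and> u < (1::real)) (at_right 0)"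
   by (rule eventually_conj)
  then obtain u :: real where u: "E - e < exp (- (\<Lambda> + u) / (1 - u) / 2)" "0 < u" "u < 1"
   using eventually_happens trivial_limit_at_right_real by blast
  from U[OF u(2)] obtain \<tau> where \<tau>0: "\<tau> > 0" "\<forall>z F. far J a \<tau> z F \<longrightarrow> (\<Sum>j\<in>F. kap z (a j)) \<le> \<Lambda> + u"
   by (elim exE conjE)
  note \<tau> = \<tau>0(1) spec[OF spec[OF \<tau>0(2)], rule_format]
  have "E - e < cmod (BF F a x)" if x: "cmod x < 1" and F: "finite F" "F \<subseteq> J" "\<forall>j\<in>F. kap x (a j) \<le> min \<tau> u" for x F
  proof -
   have S: "(\<Sum>j\<in>F. kap x (a j)) \<le> \<Lambda> + u" using F x by (intro \<tau>(2)) auto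
   have "exp (- (\<Lambda> + u) / (1 - u)) \<le> exp (- (\<Sum>j\<in>F. kap x (a j)) / (1 - u))"
    unfolding exp_le_cancel_iff using S u by (intro divide_right_mono) auto
   also have "\<dots> \<le> (cmod (BF F a x))\<^sup>2"
    by (rule norm_BF_sq_ge_exp) (use F aj x u in auto)
   finally have "exp (- (\<Lambda> + u) / (1 - u)) \<le> (cmod (BF F a x))\<^sup>2" .
   moreover have sq: "(exp (y / 2))\<^sup>2 = exp y" for y :: real by (simp add: exp_double[symmetric])
   ultimately have "(exp (- (\<Lambda> + u) / (1 - u) / 2))\<^sup>2 \<le> (cmod (BF F a x))\<^sup>2" unfolding sq by simp
   then have "exp (- (\<Lambda> + u) / (1 - u) / 2) \<le> cmod (BF F a x)" by (rule power2_le_imp_le) simp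
   then show ?thesis using u(1) by linarith
  qed
  then show ?thesis using \<tau>(1) u(2) by (intro exI[of _ "min \<tau> u"]) auto
 qed
 have main: "\<exists>w. cmod w < 1 \<and> cmod (BP J a w) \<le> E + e \<and> (\<forall>x. cmod x < 1 \<and> rho w x \<le> 3 / 4 \<longrightarrow> E - e < cmod (BP J a x))"
  if e: "e > 0" for e
 proof -
  \<comment> \<open>The order of choices matters: \<tau>1 for the lower bound, \<tau>2 so that
    Harnack preserves it on the disc of radius 3/4, then \<open>R\<close> from
    \<open>zero_free_disc\<close>, and only then \<open>u\<close> and \<tau>3, which may depend on
    \<open>R\<close>.\<close>
  have "e / 2 > 0" using e by simp
  from V[OF this] obtain \<tau>1 where \<tau>1': "\<tau>1 > 0" "\<forall>x F. cmod x < 1 \<and> finite F \<and> F \<subseteq> J \<and> (\<forall>j\<in>F. kap x (a j) \<le> \<tau>1) \<longrightarrow> E - e / 2 < cmod (BF F a x)"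
   by (elim exE conjE)
  have \<tau>1: "\<tau>1 > 0" "E - e / 2 < cmod (BF F a x)" if "cmod x < 1" "finite F" "F \<subseteq> J" "\<And>j. j\<in>F ==> kap x (a j) \<le> \<tau>1" for x F
   using \<tau>1'(1) spec[OF spec[OF \<tau>1'(2), of x], of F] that by auto
  define C where "C = hC (3 / 4)"
  have C: "1 \<le> C" unfolding C_def by (rule hC_ge_1) auto
  define \<tau>2 where "\<tau>2 = min (1 / 2) (\<tau>1 / C)"
  have \<tau>2: "0 < \<tau>2" "\<tau>2 < 1" "C * \<tau>2 \<le> \<tau>1"
  proof -
   show "0 < \<tau>2" "\<tau>2 < 1" using \<tau>1'(1) C by (auto simp: \<tau>2_def)
   have "\<tau>2 \<le> \<tau>1 / C" by (simp add: \<tau>2_def)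
   then show "C * \<tau>2 \<le> \<tau>1" using C by (simp add: pos_le_divide_eq mult.commute)
  qed
  obtain R where R: "0 \<le> R" "R < 1" "\<And>z. cmod z < 1 ==> \<exists>w. cmod w < 1 \<and> rho z w \<le> R \<and> (\<forall>j\<in>J. kap w (a j) \<le> \<tau>2)"
  proof -
   have "\<exists>R. 0 \<le> R \<and> R < 1 \<and> (\<forall>z. cmod z < 1 \<longrightarrow> (\<exists>w. cmod w < 1 \<and> rho z w \<le> R \<and> (\<forall>j\<in>J. kap w (a j) \<le> \<tau>2)))"
    by (rule zero_free_disc[OF k _ \<tau>2(1,2)], rule aj)
   then obtain R where R0: "0 \<le> R" "R < 1" "\<forall>z. cmod z < 1 \<longrightarrow> (\<exists>w. cmod w < 1 \<and> rho z w \<le> R \<and> (\<forall>j\<in>J. kap w (a j) \<le> \<tau>2))"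
    by (elim exE conjE)
   show ?thesis by (rule that[OF R0(1,2) R0(3)[rule_format]])
  qed
  define R' where "R' = (1 + R) / 2"
  have R': "R < R'" "R' < 1" "0 < R'" "R / R' < 1" using R by (auto simp: R'_def)
  \<comment> \<open>An upper bound for the modulus at \<open>w\<close>: the bound at
    \<open>z\<close> plus the oscillation allowed by \<open>near_constancy\<close>. It tends to
    \<open>E\<close> as \<open>u\<close> tends to 0.\<close>
  let ?\<Xi> = "\<lambda>u. E * exp (u / 2) + (1 - ((E - u) / (E * exp (u / 2)))\<^sup>2) / ((E - u) * (1 - R / R'))"
  have "(?\<Xi> \<longlongrightarrow> E * exp (0 / 2) + (1 - ((E - 0) / (E * exp (0 / 2)))\<^sup>2) / ((E - 0) * (1 - R / R'))) (at_right 0)"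
   by (intro tendsto_intros) (use E R' in auto)
  then have "(?\<Xi> \<longlongrightarrow> E) (at_right 0)" using E by simp
  then have "eventually (\<lambda>u. ?\<Xi> u < E + e) (at_right 0)" using e by (intro order_tendstoD) auto
  moreover have "eventually (\<lambda>u. 0 < u \<and> u < E) (at_right 0)"
   using E by (auto simp: eventually_at_right_field intro!: exI[of _ E])
  ultimately have "eventually (\<lambda>u. ?\<Xi> u < E + e \<and> 0 < u \<and> u < E) (at_right 0)" by (rule eventually_conj)
  then obtain u :: real where u: "?\<Xi> u < E + e" "0 < u" "u < E"
   using eventually_happens trivial_limit_at_right_real by blast
  from V[OF u(2)] obtain \<tau>3 where \<tau>3': "\<tau>3 > 0" "\<forall>x F. cmod x < 1 \<and> finite F \<and> F \<subseteq> J \<and> (\<forall>j\<in>F. kap x (a j) \<le> \<tau>3) \<longrightarrow> E - u < cmod (BF F a x)"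
   by (elim exE conjE)
  have \<tau>3: "\<tau>3 > 0" "E - u < cmod (BF F a x)" if "cmod x < 1" "finite F" "F \<subseteq> J" "\<And>j. j\<in>F ==> kap x (a j) \<le> \<tau>3" for x F
   using \<tau>3'(1) spec[OF spec[OF \<tau>3'(2), of x], of F] that by auto
  define C' where "C' = hC R'"
  have C': "1 \<le> C'" unfolding C'_def by (rule hC_ge_1) (use R' in auto)
  have "\<tau>3 / C' > 0" using \<tau>3'(1) C' by simp
  from Lw[OF this u(2)] obtain z F where z: "cmod z < 1" and F: "finite F" "F \<subseteq> J"
   and kF': "\<forall>j\<in>F. kap z (a j) \<le> \<tau>3 / C'" and SF: "\<Lambda> - u < (\<Sum>j\<in>F. kap z (a j))" by (elim exE conjE)
  note kF = bspec[OF kF']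
  have ajF: "cmod (a j) < 1" if "j \<in> F" for j using aj F that by auto
  \<comment> \<open>The zeros in \<open>F\<close> are far from \<open>z\<close>, but other zeros may
    be close to it. The point \<open>w\<close> is far from all zeros and still within the reach of
    \<open>near_constancy\<close>.\<close>
  obtain w where w: "cmod w < 1" "rho z w \<le> R" "\<And>j. j \<in> J ==> kap w (a j) \<le> \<tau>2"
  proof -
   from R(3)[OF z] obtain w where "cmod w < 1" "rho z w \<le> R" "\<forall>j\<in>J. kap w (a j) \<le> \<tau>2" by (elim exE conjE)
   then show ?thesis by (intro that[of w]) auto
  qed
  have low: "E - u < cmod (BF F a x)" if x: "cmod x < 1" "rho z x < R'" for x
  proof (rule \<tau>3(2)[OF x(1) F])
   fix j assume j: "j \<in> F"
   have "kap x (a j) \<le> C' * kap z (a j)" unfolding C'_def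
    by (rule kap_harnack[OF z x(1) ajF[OF j] less_imp_le[OF x(2)] R'(2)])
   also have "\<dots> \<le> C' * (\<tau>3 / C')" using kF[OF j] C' by (intro mult_left_mono) auto
   finally show "kap x (a j) \<le> \<tau>3" using C' by simp
  qed
  have "(cmod (BF F a z))\<^sup>2 \<le> exp (- (\<Sum>j\<in>F. kap z (a j)))" by (rule norm_BF_sq_le_exp[OF ajF z])
  also have "\<dots> \<le> exp (- (\<Lambda> - u))" using SF by simp
  also have "\<dots> = (E * exp (u / 2))\<^sup>2" unfolding E_def by (simp add: power2_eq_square flip: exp_add)
  finally have Bz: "cmod (BF F a z) \<le> E * exp (u / 2)" by (rule power2_le_imp_le) (use E in simp)
  have "E - u < cmod (BF F a z)" by (rule low[OF z]) (use R' in \<open>simp add: rho_def\<close>)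
  then have Bz0: "0 < cmod (BF F a z)" using u(3) by linarith
  have "cmod (BF F a w - BF F a z) \<le> (1 - ((E - u) / cmod (BF F a z))\<^sup>2) / ((E - u) * (1 - R / R'))"
   by (rule near_constancy[OF BF_holomorphic _ z R(1) R'(1,2) _ low w(1,2)])
     (use ajF u in \<open>auto intro!: norm_BF_le_1\<close>)
  also have "\<dots> \<le> (1 - ((E - u) / (E * exp (u / 2)))\<^sup>2) / ((E - u) * (1 - R / R'))"
   using Bz Bz0 u R' by (intro divide_right_mono diff_left_mono power_mono divide_left_mono mult_nonneg_nonneg) auto
  finally have "cmod (BF F a w) \<le> ?\<Xi> u" using Bz norm_triangle_sub[of "BF F a w" "BF F a z"] by linarith
  then have up: "cmod (BP J a w) \<le> E + e" using u(1) norm_BP_le_BF[OF J F(2,1) w(1)] by linarith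
  have "E - e < cmod (BP J a x)" if x: "cmod x < 1" "rho w x \<le> 3 / 4" for x
  proof -
   have kx: "kap x (a j) \<le> \<tau>1" if j: "j \<in> J" for j
   proof -
    have "kap x (a j) \<le> C * kap w (a j)" unfolding C_def by (rule kap_harnack[OF w(1) x(1) aj[OF j] x(2)]) simp
    also have "\<dots> \<le> C * \<tau>2" using w(3)[OF j] C by (intro mult_left_mono) auto
    finally show ?thesis using \<tau>2(3) by linarith
   qed
   have "E - e / 2 \<le> cmod (BP J a x)"
   proof (rule LIMSEQ_le_const[OF tendsto_norm[OF BP_LIMSEQ[OF J x(1)]]])
    show "\<exists>N. \<forall>n\<ge>N. E - e / 2 \<le> cmod (BF (J \<inter> {..<n}) a x)"
     using \<tau>1(2)[OF x(1), of "J \<inter> {..<n}" for n] kx by (auto intro!: exI[of _ 0] less_imp_le)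
   qed
   then show ?thesis using e by linarith
  qed
  then show ?thesis using up w(1) by blast
 qed
 show ?thesis by (rule that[OF E main])
qed

text \<open>The constant \<alpha> is a limit of values of \<Theta> at the centres of ever flatter
  discs, and its modulus is \<open>E\<close>, strictly between 0 and 1. There
  \<open>disc_aut \<alpha> \<circ> \<Theta>\<close> tends to 0 on discs of radius 1/2, against
  \<open>CN_lower_bound\<close>. The flat radius 3/4 is larger, as \<open>near_constancy\<close>
  requires.\<close>

theorem P_class_imp_bsm:
 assumes J: "bseq J a" and c: "cmod c = 1" and e: "\<And>z. cmod z < 1 ==> \<Theta> z = c * BP J a z"
  and P: "\<Theta> \<in> P_class"
 shows "bsm J a"
proof (rule ccontr)
 assume nb: "\<not> bsm J a"
 have aj: "cmod (a j) < 1" if "j \<in> J" for j by (rule bseq_lt_1[OF J that])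
 have nT: "cmod (\<Theta> z) = cmod (BP J a z)" if "cmod z < 1" for z using e[OF that] c by (simp add: norm_mult)
 have "\<Theta> \<in> CN" using P by (simp add: P_class_def)
 then obtain c0 where c0: "c0 > 0" "\<And>z. cmod z < 1 ==> \<exists>w. cmod w < 1 \<and> rho z w \<le> 1 / 2 \<and> c0 \<le> cmod (\<Theta> w)"
  using CN_lower_bound by blast
 obtain A where k: "kb A J a"
 proof -
  have "kb (hC (1 / 2) * (2 * ln (1 / c0))) J a"
   by (rule kb_from_lower_bound[OF _ _ _ c0, of J a]) (use aj nT norm_BP_le_BF[OF J] in auto)
  then show ?thesis by (rule that)
 qed
 obtain E where E: "0 < E" "E < 1" and flat: "\<And>e. e > 0 ==> \<exists>w. cmod w < 1 \<and> cmod (BP J a w) \<le> E + e \<and>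
   (\<forall>x. cmod x < 1 \<and> rho w x \<le> 3 / 4 \<longrightarrow> E - e < cmod (BP J a x))"
  by (rule not_bsm_flat_discs[OF J k nb], rule that)
 \<comment> \<open>At most \<open>E / 2\<close>, so that \<open>E - d n\<close> stays
   positive.\<close>
 define d where "d n = E / (2 * (real n + 1))" for n
 have d0: "0 < d n" "d n \<le> E / 2" for n
 proof -
  show "0 < d n" unfolding d_def using E by (intro divide_pos_pos) auto
  show "d n \<le> E / 2" unfolding d_def using E by (intro divide_left_mono) auto
 qed
 have dlim: "d \<longlonglongrightarrow> 0"
 proof -
  have "(\<lambda>n. (E / 2) * inverse (real (Suc n))) \<longlonglongrightarrow> (E / 2) * 0" by (intro tendsto_intros LIMSEQ_inverse_real_of_nat)
  moreover have "d = (\<lambda>n. (E / 2) * inverse (real (Suc n)))" by (rule ext) (simp add: d_def field_simps)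
  ultimately show ?thesis by simp
 qed
 have "\<forall>n. \<exists>w. cmod w < 1 \<and> cmod (BP J a w) \<le> E + d n \<and> (\<forall>x. cmod x < 1 \<and> rho w x \<le> 3 / 4 \<longrightarrow> E - d n < cmod (BP J a x))"
  using flat d0 by blast
 from choice[OF this] obtain w where w: "\<And>n. cmod (w n) < 1" "\<And>n. cmod (BP J a (w n)) \<le> E + d n"
  "\<And>n x. cmod x < 1 ==> rho (w n) x \<le> 3 / 4 ==> E - d n < cmod (BP J a x)" by blast
 have Tw: "cmod (\<Theta> (w n)) \<le> 1" for n using nT[OF w(1)] norm_BP_le_1[OF J w(1)] by simp
 have "bounded (range (\<lambda>n. \<Theta> (w n)))" unfolding bounded_iff using Tw by auto
 then obtain \<alpha> r where r: "strict_mono (r :: nat \<Rightarrow> nat)" "((\<lambda>n. \<Theta> (w n)) \<circ> r) \<longlonglongrightarrow> \<alpha>"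
  using bounded_imp_convergent_subsequence by blast
 have dr: "(\<lambda>n. d (r n)) \<longlonglongrightarrow> 0" using LIMSEQ_subseq_LIMSEQ[OF dlim r(1)] by (simp add: o_def)
 have rr: "rho (w n) (w n) \<le> 3 / 4" for n by (simp add: rho_def)
 have "(\<lambda>n. cmod (\<Theta> (w (r n)))) \<longlonglongrightarrow> cmod \<alpha>" using tendsto_norm[OF r(2)] by (simp add: o_def)
 moreover have "(\<lambda>n. cmod (\<Theta> (w (r n)))) \<longlonglongrightarrow> E"
 proof (rule real_tendsto_sandwich)
  show "eventually (\<lambda>n. E - d (r n) \<le> cmod (\<Theta> (w (r n)))) sequentially"
   by (intro always_eventually allI) (use w(3)[OF w(1) rr] nT[OF w(1)] in \<open>simp add: less_imp_le\<close>)
  show "eventually (\<lambda>n. cmod (\<Theta> (w (r n))) \<le> E + d (r n)) sequentially"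
   by (intro always_eventually allI) (use w(2) nT[OF w(1)] in simp)
  show "(\<lambda>n. E - d (r n)) \<longlonglongrightarrow> E" using tendsto_diff[OF tendsto_const[of E] dr] by simp
  show "(\<lambda>n. E + d (r n)) \<longlonglongrightarrow> E" using tendsto_add[OF tendsto_const[of E] dr] by simp
 qed
 ultimately have n\<alpha>: "cmod \<alpha> = E" by (rule LIMSEQ_unique)
 have "disc_aut \<alpha> \<circ> \<Theta> \<in> CN" using P E n\<alpha> unfolding P_class_def M_class_def by auto
 then obtain c1 where c1: "c1 > 0" "\<And>z. cmod z < 1 ==> \<exists>w. cmod w < 1 \<and> rho z w \<le> 1 / 2 \<and> c1 \<le> cmod (disc_aut \<alpha> (\<Theta> w))"
  using CN_lower_bound unfolding comp_apply by blast
 let ?b = "\<lambda>n. ((1 - ((E - d n) / (E + d n))\<^sup>2) / ((E - d n) * (1 - (1 / 2) / (3 / 4))) + cmod (\<Theta> (w n) - \<alpha>)) / (1 - E)"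
 have ub: "c1 \<le> ?b n" for n
 proof -
  obtain x where x: "cmod x < 1" "rho (w n) x \<le> 1 / 2" "c1 \<le> cmod (disc_aut \<alpha> (\<Theta> x))" using c1(2)[OF w(1)] by blast
  have Ed: "0 < E - d n" using d0[of n] E by linarith
  have B0: "E - d n < cmod (BP J a (w n))" by (rule w(3)[OF w(1) rr])
  have "cmod (BP J a x - BP J a (w n)) \<le> (1 - ((E - d n) / cmod (BP J a (w n)))\<^sup>2) / ((E - d n) * (1 - (1 / 2) / (3 / 4)))"
   by (rule near_constancy[OF BP_holomorphic[OF J] _ w(1) _ _ _ Ed _ x(1,2)])
     (auto intro!: norm_BP_le_1[OF J] w(3))
  also have "\<dots> \<le> (1 - ((E - d n) / (E + d n))\<^sup>2) / ((E - d n) * (1 - (1 / 2) / (3 / 4)))"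
  proof -
   have "0 < cmod (BP J a (w n))" using Ed B0 by linarith
   then have "(E - d n) / (E + d n) \<le> (E - d n) / cmod (BP J a (w n))" using Ed w(2)[of n] by (intro frac_le) auto
   then show ?thesis using Ed E d0[of n] by (intro divide_right_mono diff_left_mono power_mono) auto
  qed
  finally have 1: "cmod (BP J a x - BP J a (w n)) \<le> (1 - ((E - d n) / (E + d n))\<^sup>2) / ((E - d n) * (1 - (1 / 2) / (3 / 4)))" .
  have "\<Theta> x - \<Theta> (w n) = c * (BP J a x - BP J a (w n))" using e[OF x(1)] e[OF w(1)] by (simp add: right_diff_distrib)
  then have 2: "cmod (\<Theta> x - \<Theta> (w n)) = cmod (BP J a x - BP J a (w n))" using c by (simp add: norm_mult)
  have "cmod (disc_aut \<alpha> (\<Theta> x)) = cmod (\<Theta> x - \<alpha>) / cmod (1 - cnj \<alpha> * \<Theta> x)"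
   by (simp add: disc_aut_def norm_divide norm_minus_commute)
  also have "\<dots> \<le> (cmod (\<Theta> x - \<Theta> (w n)) + cmod (\<Theta> (w n) - \<alpha>)) / (1 - E)"
  proof (rule frac_le)
   show "cmod (\<Theta> x - \<alpha>) \<le> cmod (\<Theta> x - \<Theta> (w n)) + cmod (\<Theta> (w n) - \<alpha>)"
    using norm_triangle_ineq[of "\<Theta> x - \<Theta> (w n)" "\<Theta> (w n) - \<alpha>"] by simp
   show "1 - E \<le> cmod (1 - cnj \<alpha> * \<Theta> x)"
    using one_minus_le_norm_den[of "\<Theta> x" \<alpha>] nT[OF x(1)] norm_BP_le_1[OF J x(1)] n\<alpha> by simp
  qed (use E in auto)
  also have "\<dots> \<le> ?b n" using 1 E unfolding 2 by (intro divide_right_mono add_right_mono) auto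
  finally show ?thesis using x(3) by linarith
 qed
 have "(\<lambda>n. \<Theta> (w (r n))) \<longlonglongrightarrow> \<alpha>" using r(2) by (simp add: o_def)
 from tendsto_norm[OF tendsto_diff[OF this tendsto_const[of \<alpha>]]]
 have Ta: "(\<lambda>n. cmod (\<Theta> (w (r n)) - \<alpha>)) \<longlonglongrightarrow> cmod (\<alpha> - \<alpha>)" by simp
 have "(\<lambda>n. ?b (r n)) \<longlonglongrightarrow> ((1 - ((E - 0) / (E + 0))\<^sup>2) / ((E - 0) * (1 - (1 / 2) / (3 / 4))) + cmod (\<alpha> - \<alpha>)) / (1 - E)"
  by (intro tendsto_intros dr Ta) (use E in auto)
 then have "(\<lambda>n. ?b (r n)) \<longlonglongrightarrow> 0" using E by simp
 from LIMSEQ_le_const[OF this, of c1] ub have "c1 \<le> 0" by blast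
 then show False using c1(1) by simp
qed

section \<open>Necessity of the condition for the Sharp Invertibility Property\<close>

lemma kap_le_div:
 assumes "cmod z < 1" "cmod a < 1"
 shows "kap z a \<le> 4 * (1 - cmod a) / (1 - cmod z)"
proof -
 have D: "1 - cmod z \<le> cmod (1 - cnj a * z)" by (rule one_minus_le_norm_den') (use assms in simp)
 have "kap z a \<le> (2 * (1 - cmod z)) * (2 * (1 - cmod a)) / (1 - cmod z)\<^sup>2"
  unfolding kap_def using D assms one_minus_sq_bounds[of z] one_minus_sq_bounds[of a]
  by (intro frac_le mult_mono power_mono mult_nonneg_nonneg) auto
 also have "\<dots> = 4 * (1 - cmod a) / (1 - cmod z)"
 proof -
  have "(2 * x) * (2 * y) / x\<^sup>2 = 4 * y / x" if "x > 0" for x y :: real using that by (simp add: power2_eq_square)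
  from this[of "1 - cmod z" "1 - cmod a"] show ?thesis using assms by simp
 qed
 finally show ?thesis .
qed

lemma bseq_small_tail:
 assumes J: "bseq J a" and e: "e > 0"
 obtains N where "\<And>F. finite F ==> F \<subseteq> J ==> F \<subseteq> {N..} ==> (\<Sum>j\<in>F. 1 - cmod (a j)) \<le> e"
proof -
 let ?f = "\<lambda>j. if j \<in> J then 1 - cmod (a j) else 0"
 have f0: "0 \<le> ?f j" for j using bseq_lt_1[OF J, of j] by auto
 obtain N where N: "\<And>m n. m \<ge> N ==> norm (sum ?f {m..<n}) < e"
  using bseq_summable[OF J] e unfolding summable_Cauchy by blast
 show ?thesis
 proof (rule that)
  fix F assume F: "finite F" "F \<subseteq> J" "F \<subseteq> {N..}"
  obtain n where n: "F \<subseteq> {..<n}" using F(1) finite_nat_iff_bounded by blast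
  have "(\<Sum>j\<in>F. 1 - cmod (a j)) = sum ?f F" using F(2) by (intro sum.cong) auto
  also have "\<dots> \<le> sum ?f {N..<n}"
  proof (rule sum_mono2)
   show "F \<subseteq> {N..<n}" using F(3) n by auto
  qed (use f0 in auto)
  also have "\<dots> \<le> e" using N[of N n] by simp
  finally show "(\<Sum>j\<in>F. 1 - cmod (a j)) \<le> e" .
 qed
qed

text \<open>The first \<open>N\<close> zeros are discarded at a cost of at most half of \<eta>. The
  remaining ones are close to the circle, hence far from the finite set \<open>Z\<close>. They can
  carry mass at \<open>z\<close> only if \<open>z\<close> is itself close to the circle, hence far
  from the finite set \<open>U\<close>.\<close>

lemma far_cluster:
 assumes J: "bseq J a" and \<eta>: "\<eta> > 0"
  and nb: "\<And>\<tau>. \<tau> > 0 ==> \<exists>z F. far J a \<tau> z F \<and> \<eta> < (\<Sum>j\<in>F. kap z (a j))"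
  and Z: "finite Z" "\<And>z. z \<in> Z ==> cmod z < 1" and U: "finite U" "U \<subseteq> J" and e: "0 < e"
 obtains z F where "cmod z < 1" "finite F" "F \<subseteq> J" "\<eta> / 2 \<le> (\<Sum>j\<in>F. kap z (a j))"
  "\<And>j. j \<in> F \<union> U ==> kap z (a j) \<le> e" "\<And>j z'. j \<in> F ==> z' \<in> Z ==> kap z' (a j) \<le> e"
proof -
 have aj: "cmod (a j) < 1" if "j \<in> J" for j by (rule bseq_lt_1[OF J that])
 define m where "m = Min (insert 1 ((\<lambda>j. 1 - cmod (a j)) ` U))"
 have "m \<in> insert 1 ((\<lambda>j. 1 - cmod (a j)) ` U)" unfolding m_def using U by (intro Min_in) auto
 then have m: "0 < m" "\<And>j. j \<in> U ==> m \<le> 1 - cmod (a j)" using aj U by (auto simp: m_def)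
 define r where "r = 1 - min (1/2) (e * m / 4)"
 have r: "0 < r" "r < 1" "4 * (1 - r) \<le> e * m" using m e by (auto simp: r_def)
 define s where "s = Min (insert 1 ((\<lambda>z. 1 - cmod z) ` Z))"
 have "s \<in> insert 1 ((\<lambda>z. 1 - cmod z) ` Z)" unfolding s_def using Z by (intro Min_in) auto
 then have s: "0 < s" "\<And>z. z \<in> Z ==> s \<le> 1 - cmod z" using Z by (auto simp: s_def)
 define e2 where "e2 = min (e * s / 4) (\<eta> * (1 - r) / 16)"
 have e2: "0 < e2" "4 * e2 \<le> e * s" "16 * e2 \<le> \<eta> * (1 - r)" using e s r \<eta> by (auto simp: e2_def)
 obtain N where N: "\<And>F. finite F ==> F \<subseteq> J ==> F \<subseteq> {N..} ==> (\<Sum>j\<in>F. 1 - cmod (a j)) \<le> e2"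
  by (rule bseq_small_tail[OF J e2(1)], rule that)
 define \<tau> where "\<tau> = min e (\<eta> / (2 * (real N + 1)))"
 have \<tau>: "0 < \<tau>" "\<tau> \<le> e" "real N * \<tau> \<le> \<eta> / 2"
 proof -
  show "0 < \<tau>" "\<tau> \<le> e" using e \<eta> by (auto simp: \<tau>_def)
  have "real N * \<tau> \<le> real N * (\<eta> / (2 * (real N + 1)))" by (intro mult_left_mono) (auto simp: \<tau>_def)
  also have "\<dots> \<le> \<eta> / 2" using \<eta> by (simp add: divide_simps)
  finally show "real N * \<tau> \<le> \<eta> / 2" .
 qed
 obtain z F where zF: "cmod z < 1" "finite F" "F \<subseteq> J" "\<And>j. j \<in> F ==> kap z (a j) \<le> \<tau>" "\<eta> < (\<Sum>j\<in>F. kap z (a j))"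
  using nb[OF \<tau>(1)] by blast
 define F' where "F' = F - {..<N}"
 have F': "finite F'" "F' \<subseteq> J" "F' \<subseteq> {N..}" "F' \<subseteq> F" using zF by (auto simp: F'_def)
 have "(\<Sum>j\<in>F. kap z (a j)) = (\<Sum>j\<in>F'. kap z (a j)) + (\<Sum>j\<in>F \<inter> {..<N}. kap z (a j))"
  unfolding F'_def using zF(2) by (metis sum.Int_Diff add.commute)
 moreover have "(\<Sum>j\<in>F \<inter> {..<N}. kap z (a j)) \<le> real (card (F \<inter> {..<N})) * \<tau>"
  using zF(4) by (intro sum_bounded_above) auto
 moreover have "card (F \<inter> {..<N}) \<le> N" using card_mono[of "{..<N}" "F \<inter> {..<N}"] by simp
 then have "real (card (F \<inter> {..<N})) * \<tau> \<le> real N * \<tau>" using \<tau> by (intro mult_right_mono) auto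
 ultimately have S: "\<eta> / 2 \<le> (\<Sum>j\<in>F'. kap z (a j))" using zF(5) \<tau>(3) by linarith
 have "r < cmod z"
 proof (rule ccontr)
  assume "\<not> r < cmod z"
  then have zr: "1 - r \<le> 1 - cmod z" by simp
  have "(\<Sum>j\<in>F'. kap z (a j)) \<le> (\<Sum>j\<in>F'. 4 / (1 - r) * (1 - cmod (a j)))"
  proof (rule sum_mono)
   fix j assume "j \<in> F'"
   then have "cmod (a j) < 1" using F' aj by auto
   then have "kap z (a j) \<le> 4 * (1 - cmod (a j)) / (1 - cmod z)" by (rule kap_le_div[OF zF(1)])
   also have "\<dots> \<le> 4 * (1 - cmod (a j)) / (1 - r)" using zr r \<open>cmod (a j) < 1\<close> by (intro divide_left_mono) auto
   finally show "kap z (a j) \<le> 4 / (1 - r) * (1 - cmod (a j))" by simp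
  qed
  also have "\<dots> \<le> 4 / (1 - r) * e2" unfolding sum_distrib_left[symmetric]
   using r by (intro mult_left_mono N F') auto
  also have "\<dots> \<le> \<eta> / 4" using e2(3) r by (simp add: divide_simps)
  finally show False using S \<eta> by linarith
 qed
 have 1: "kap z (a j) \<le> e" if "j \<in> F' \<union> U" for j
 proof (cases "j \<in> F'")
  case True then show ?thesis using zF(4)[of j] F' \<tau>(2) by force
 next
  case False
  then have j: "j \<in> U" using that by simp
  have "kap z (a j) \<le> 4 * (1 - cmod z) / (1 - cmod (a j))"
   using kap_le_div[of "a j" z] aj j U zF(1) kap_sym[of z] by auto
  also have "\<dots> \<le> 4 * (1 - r) / m" using \<open>r < cmod z\<close> m(2)[OF j] m(1) r by (intro frac_le) auto
  also have "\<dots> \<le> e" using r(3) m(1) by (simp add: pos_divide_le_eq)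
  finally show ?thesis .
 qed
 have 2: "kap z' (a j) \<le> e" if "j \<in> F'" "z' \<in> Z" for j z'
 proof -
  have j1: "cmod (a j) < 1" using that F' aj by auto
  have k: "kap z' (a j) \<le> 4 * (1 - cmod (a j)) / (1 - cmod z')" by (rule kap_le_div[OF Z(2)[OF that(2)] j1])
  have "1 - cmod (a j) \<le> e2" using N[of "{j}"] that(1) F'(2,3) by auto
  then have "4 * (1 - cmod (a j)) / (1 - cmod z') \<le> 4 * e2 / s" using s(2)[OF that(2)] s(1) e2(1) by (intro frac_le) auto
  moreover have "4 * e2 / s \<le> e" using e2(2) s(1) by (simp add: pos_divide_le_eq)
  ultimately show ?thesis using k by linarith
 qed
 show ?thesis by (rule that[OF zF(1) F'(1,2) S 1 2])
qed

text \<open>The state of the recursion keeps all points and all zeros chosen so far. Each new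
  cluster is far from the old points and each new point is far from the old zeros, so the whole
  union of clusters is far from every \<open>z n\<close>, with \<open>kap\<close> tending to
  0.\<close>

lemma sparse_subsequence:
 assumes J: "bseq J a" and \<eta>: "\<eta> > 0"
  and nb: "\<And>\<tau>. \<tau> > 0 ==> \<exists>z F. far J a \<tau> z F \<and> \<eta> < (\<Sum>j\<in>F. kap z (a j))"
 obtains K z F where "K \<subseteq> J" "\<And>n::nat. cmod (z n) < 1" "\<And>n. finite (F n)" "\<And>n. F n \<subseteq> K" "\<And>n. \<eta> / 2 \<le> (\<Sum>j\<in>F n. kap (z n) (a j))"
  "\<And>n j. j \<in> K ==> kap (z n) (a j) \<le> 1 / (real n + 1)"
proof -
 define P where "P n S = (case S of (z, F, Z, U) \<Rightarrow> cmod z < 1 \<and> finite F \<and> F \<subseteq> U \<and> finite Z \<and> z \<in> Z \<and> Z \<subseteq> ball 0 1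
   \<and> finite U \<and> U \<subseteq> J \<and> \<eta> / 2 \<le> (\<Sum>j\<in>F. kap z (a j)) \<and> (\<forall>j\<in>U. kap z (a j) \<le> 1 / (real n + 1)))"
  for n :: nat and S :: "complex \<times> nat set \<times> complex set \<times> nat set"
 define Q where "Q n S S' = (case S of (z, F, Z, U) \<Rightarrow> case S' of (z', F', Z', U') \<Rightarrow> Z \<subseteq> Z' \<and> U \<subseteq> U' \<and>
   (\<forall>j\<in>F'. \<forall>w\<in>Z. kap w (a j) \<le> 1 / (real (Suc n) + 1)))"
  for n :: nat and S S' :: "complex \<times> nat set \<times> complex set \<times> nat set"
 have 1: "\<exists>S. P 0 S"
 proof -
  obtain z F where
   "cmod z < 1" "finite F" "F \<subseteq> J" "\<eta> / 2 \<le> (\<Sum>j\<in>F. kap z (a j))" "\<And>j. j \<in> F \<union> {} ==> kap z (a j) \<le> 1 / (real 0 + 1)"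
   "\<And>j z'. j \<in> F ==> z' \<in> {} ==> kap z' (a j) \<le> 1 / (real 0 + 1)"
   by (rule far_cluster[OF J \<eta>, of "{}" "{}" "1 / (real 0 + 1)"], rule nb, assumption, simp, simp, simp, simp, simp, rule that)
  then have "P 0 (z, F, {z}, F)" unfolding P_def by auto
  then show ?thesis ..
 qed
 have 2: "\<exists>S'. P (Suc n) S' \<and> Q n S S'" if P: "P n S" for n S
 proof -
  obtain z F Z U where S: "S = (z, F, Z, U)" by (cases S) auto
  have p: "finite Z" "Z \<subseteq> ball 0 1" "finite U" "U \<subseteq> J" using P unfolding P_def S by auto
  then have Z1: "cmod w < 1" if "w \<in> Z" for w using that by auto
  obtain z' F' where
   *: "cmod z' < 1" "finite F'" "F' \<subseteq> J" "\<eta> / 2 \<le> (\<Sum>j\<in>F'. kap z' (a j))" "\<And>j. j \<in> F' \<union> U ==> kap z' (a j) \<le> 1 / (real (Suc n) + 1)"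
   "\<And>j z''. j \<in> F' ==> z'' \<in> Z ==> kap z'' (a j) \<le> 1 / (real (Suc n) + 1)"
   by (rule far_cluster[OF J \<eta>, of Z U "1 / (real (Suc n) + 1)"], rule nb, assumption, rule p, rule Z1, assumption, rule p, rule p, simp, rule that)
  have "P (Suc n) (z', F', insert z' Z, U \<union> F')" unfolding P_def using * p by auto
  moreover have "Q n S (z', F', insert z' Z, U \<union> F')" unfolding Q_def S using * by auto
  ultimately show ?thesis by blast
 qed
 obtain S where S: "\<And>n. P n (S n)" "\<And>n. Q n (S n) (S (Suc n))"
  using dependent_nat_choice[of P Q, OF 1 2] by blast
 define z F Z U where d: "z n = fst (S n)" "F n = fst (snd (S n))" "Z n = fst (snd (snd (S n)))" "U n = snd (snd (snd (S n)))" for n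
 have e: "S n = (z n, F n, Z n, U n)" for n by (simp add: d)
 have p: "cmod (z n) < 1" "finite (F n)" "F n \<subseteq> U n" "z n \<in> Z n" "U n \<subseteq> J" "\<eta> / 2 \<le> (\<Sum>j\<in>F n. kap (z n) (a j))"
  "\<And>j. j \<in> U n ==> kap (z n) (a j) \<le> 1 / (real n + 1)" for n
  using S(1)[of n] unfolding P_def e by auto
 have q: "Z n \<subseteq> Z (Suc n)" "U n \<subseteq> U (Suc n)" "\<And>j w. j \<in> F (Suc n) ==> w \<in> Z n ==> kap w (a j) \<le> 1 / (real (Suc n) + 1)" for n
  using S(2)[of n] unfolding Q_def e by auto
 have mono: "Z m \<subseteq> Z n" "U m \<subseteq> U n" if "m \<le> n" for m n
  using lift_Suc_mono_le[of Z m n, OF q(1) that] lift_Suc_mono_le[of U m n, OF q(2) that] by auto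
 show ?thesis
 proof (rule that[of "\<Union>n. F n" z F])
  fix n j assume "j \<in> (\<Union>n. F n)"
  then obtain m where m: "j \<in> F m" by auto
  show "kap (z n) (a j) \<le> 1 / (real n + 1)"
  proof (cases "m \<le> n")
   case True
   then show ?thesis using p(7)[of j n] p(3)[of m] mono(2)[OF True] m by blast
  next
   case False
   then obtain m' where m': "m = Suc m'" "n \<le> m'" by (cases m) auto
   have "z n \<in> Z m'" using p(4)[of n] mono(1)[OF m'(2)] by auto
   then have "kap (z n) (a j) \<le> 1 / (real (Suc m') + 1)" using q(3) m m'(1) by blast
   also have "\<dots> \<le> 1 / (real n + 1)" using m'(2) by (intro divide_left_mono) auto
   finally show ?thesis .
  qed
 next
  show "(\<Union>n. F n) \<subseteq> J" using p(3,5) by blast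
 qed (use p in auto)
qed

section \<open>Norms in the quotient algebra\<close>

lemma hnorm_le: "(\<And>z. cmod z < 1 ==> cmod (f z) \<le> M) ==> hnorm f \<le> M"
 unfolding hnorm_def by (intro cSUP_least) auto

lemma hnorm_ge:
 assumes "\<And>z. cmod z < 1 ==> cmod (f z) \<le> M" "cmod z < 1"
 shows "cmod (f z) \<le> hnorm f"
 unfolding hnorm_def by (rule cSUP_upper) (use assms in \<open>auto intro!: bdd_aboveI[of _ M]\<close>)

lemma HinfI: "hol f ==> (\<And>z. cmod z < 1 ==> cmod (f z) \<le> M) ==> f \<in> Hinf"
 unfolding Hinf_def bounded_iff by (auto intro!: exI[of _ M])

lemma HinfE:
 assumes "f \<in> Hinf"
 obtains M where "hol f" "\<And>z. cmod z < 1 ==> cmod (f z) \<le> M" "0 < M"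
proof -
 obtain M where M0: "\<forall>z\<in>ball 0 1. cmod (f z) \<le> M" using assms unfolding Hinf_def bounded_iff by blast
 have M: "cmod (f z) \<le> M" if "cmod z < 1" for z using bspec[OF M0, of z] that by simp
 show ?thesis
 proof (rule that[of "max M 1"])
  show "cmod (f z) \<le> max M 1" if "cmod z < 1" for z using M[OF that] by linarith
 qed (use assms in \<open>auto simp: Hinf_def\<close>)
qed

lemma Hinf_add: "f \<in> Hinf ==> g \<in> Hinf ==> (\<lambda>z. f z + g z) \<in> Hinf"
 and Hinf_mult: "f \<in> Hinf ==> g \<in> Hinf ==> (\<lambda>z. f z * g z) \<in> Hinf"
 and Hinf_const: "(\<lambda>z. c) \<in> Hinf"
proof -
 assume f: "f \<in> Hinf" and g: "g \<in> Hinf"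
 obtain M where M: "hol f" "\<And>z. cmod z < 1 ==> cmod (f z) \<le> M" "0 < M" by (rule HinfE[OF f], rule that)
 obtain N where N: "hol g" "\<And>z. cmod z < 1 ==> cmod (g z) \<le> N" "0 < N" by (rule HinfE[OF g], rule that)
 show "(\<lambda>z. f z + g z) \<in> Hinf"
  by (rule HinfI[of _ "M + N"]) (auto intro!: holomorphic_intros M N order_trans[OF norm_triangle_ineq] add_mono)
 show "(\<lambda>z. f z * g z) \<in> Hinf"
  by (rule HinfI[of _ "M * N"]) (use M(3) in \<open>auto intro!: holomorphic_intros M N mult_mono simp: norm_mult\<close>)
next
 show "(\<lambda>z. c) \<in> Hinf" by (rule HinfI[of _ "cmod c"]) auto
qed

lemma quot_norm_le:
 assumes f: "f \<in> Hinf" and \<Phi>: "\<Phi> \<in> Hinf" and g: "g \<in> Hinf" and M: "\<And>z. cmod z < 1 ==> cmod (f z + g z * \<Phi> z) \<le> M"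
 shows "quot_norm \<Phi> f \<le> M"
proof -
 have "quot_norm \<Phi> f \<le> hnorm (\<lambda>z. f z + g z * \<Phi> z)" unfolding quot_norm_def
 proof (rule cINF_lower[OF _ g], rule bdd_belowI[of _ 0])
  fix x assume "x \<in> (\<lambda>g. hnorm (\<lambda>z. f z + g z * \<Phi> z)) ` Hinf"
  then obtain g where g: "g \<in> Hinf" "x = hnorm (\<lambda>z. f z + g z * \<Phi> z)" by auto
  have "(\<lambda>z. f z + g z * \<Phi> z) \<in> Hinf" using f \<Phi> g by (intro Hinf_add Hinf_mult)
  then obtain M where M: "\<And>z. cmod z < 1 ==> cmod (f z + g z * \<Phi> z) \<le> M" by (rule HinfE) (rule that)
  have "0 \<le> cmod (f 0 + g 0 * \<Phi> 0)" by simp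
  also have "\<dots> \<le> x" unfolding g by (rule hnorm_ge[of "\<lambda>z. f z + g z * \<Phi> z", OF M]) auto
  finally show "0 \<le> x" .
 qed
 also have "\<dots> \<le> M" by (rule hnorm_le[OF M])
 finally show ?thesis .
qed

lemma quot_norm_less:
 assumes f: "f \<in> Hinf" and \<Phi>: "\<Phi> \<in> Hinf" and M: "quot_norm \<Phi> f < M"
 obtains g where "g \<in> Hinf" "\<And>z. cmod z < 1 ==> cmod (f z + g z * \<Phi> z) \<le> M"
proof -
 have "\<exists>x \<in> (\<lambda>g. hnorm (\<lambda>z. f z + g z * \<Phi> z)) ` Hinf. x < M"
  using M Hinf_const unfolding quot_norm_def by (intro cInf_lessD) auto
 then obtain g where g: "g \<in> Hinf" "hnorm (\<lambda>z. f z + g z * \<Phi> z) < M" by auto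
 have "(\<lambda>z. f z + g z * \<Phi> z) \<in> Hinf" using f \<Phi> g by (intro Hinf_add Hinf_mult)
 then obtain B where B: "\<And>z. cmod z < 1 ==> cmod (f z + g z * \<Phi> z) \<le> B" by (rule HinfE) (rule that)
 show ?thesis
 proof (rule that[OF g(1)])
  fix z assume "cmod z < 1"
  then have "cmod (f z + g z * \<Phi> z) \<le> hnorm (\<lambda>z. f z + g z * \<Phi> z)"
   using hnorm_ge[where f = "\<lambda>z. f z + g z * \<Phi> z" and M = B and z = z] B by blast
  then show "cmod (f z + g z * \<Phi> z) \<le> M" using g(2) by linarith
 qed
qed

lemma inner_modulus_limit:
 assumes "inner_function f"
 shows "AE t in lborel. ((\<lambda>r. cmod (f (of_real r * cis t))) \<longlongrightarrow> 1) (at_left 1)"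
proof -
 have "AE t in lborel. \<exists>l. ((\<lambda>r. f (of_real r * cis t)) \<longlongrightarrow> l) (at_left 1) \<and> cmod l = 1"
  using assms unfolding inner_function_def by simp
 then show ?thesis
 proof (rule AE_mp, intro AE_I2 impI)
  fix t assume "\<exists>l. ((\<lambda>r. f (of_real r * cis t)) \<longlongrightarrow> l) (at_left 1) \<and> cmod l = 1"
  then obtain l where "((\<lambda>r. f (of_real r * cis t)) \<longlongrightarrow> l) (at_left 1)" "cmod l = 1" by blast
  then show "((\<lambda>r. cmod (f (of_real r * cis t))) \<longlongrightarrow> 1) (at_left 1)" using tendsto_norm by metis
 qed
qed

text \<open>If \<open>f w = 0\<close> and \<open>f\<close> has an inverse of norm at most \<open>M\<close> modulo \<open>\<Phi>\<close>, then \<open>f k\<close> composed with a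
 Moebius map of the disc of radius \<open>M\<close> is divisible by \<open>\<Phi>\<close>.\<close>
lemma inverse_norm_lower_bound:
 assumes \<Phi>: "inner_function \<Phi>" and H: "hol H" and G: "G \<in> Hinf"
  and M: "1 < M" and HM: "\<And>z. cmod z < 1 ==> cmod (H z) \<le> M"
  and HG: "\<And>z. cmod z < 1 ==> H z = 1 + \<Phi> z * G z" and w: "cmod w < 1" "H w = 0"
 shows "1 / M \<le> cmod (\<Phi> w)"
proof -
 obtain B where B: "hol G" "\<And>z. cmod z < 1 ==> cmod (G z) \<le> B" "0 < B" by (rule HinfE[OF G], rule that)
 let ?M = "of_real M :: complex"
 \<comment> \<open>Up to sign, \<open>\<Phi> z * Q z\<close> is \<open>disc_aut\<close> with
   parameter \<open>1 / M\<close> at \<open>H z / M\<close>, hence bounded by 1. \<open>Q\<close> is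
   bounded because \<open>M * M - M > 0\<close>, and \<open>Q w\<close> equals
   \<open>G w / M\<close>.\<close>
 define Q where "Q z = ?M * G z / (?M * ?M - H z)" for z
 have den: "M * M - M \<le> cmod (?M * ?M - H z)" if "cmod z < 1" for z
  using norm_triangle_ineq2[of "?M * ?M" "H z"] HM[OF that] M by (simp add: norm_mult)
 have MM: "0 < M * M - M" using M by simp
 have nz: "?M * ?M - H z \<noteq> 0" if "cmod z < 1" for z using den[OF that] MM by auto
 have Qh: "hol Q" unfolding Q_def[abs_def]
  using nz by (intro holomorphic_intros B H) auto
 have QB: "cmod (Q z) \<le> M * B / (M * M - M)" if "cmod z < 1" for z
  unfolding Q_def norm_divide norm_mult using den[OF that] MM B(2)[OF that] B(3) M by (intro frac_le) auto
 have PQ: "cmod (\<Phi> z * Q z) \<le> 1" if z: "cmod z < 1" for z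
 proof -
  have c: "cmod (of_real (1 / M) :: complex) < 1" unfolding norm_of_real using M by simp
  have h: "cmod (H z / ?M) \<le> 1" using HM[OF z] M by (simp add: norm_divide)
  have "\<Phi> z * Q z = ?M * (H z - 1) / (?M * ?M - H z)" unfolding Q_def using HG[OF z] by simp
  also have "\<dots> = - disc_aut (of_real (1 / M)) (H z / ?M)"
   unfolding disc_aut_def using M nz[OF z] by (simp add: divide_simps) (simp add: algebra_simps)
  finally show ?thesis using norm_disc_aut_le_1[OF c h] by simp
 qed
 have "cmod (Q w) \<le> 1" by (rule unimodular_quotient_bounded[OF Qh QB inner_modulus_limit[OF \<Phi>] PQ w(1)])
 then have Gw: "cmod (G w) \<le> M" unfolding Q_def w(2) using M by (simp add: norm_divide norm_mult)
 have "\<Phi> w * G w = - 1" using HG[OF w(1)] w(2) by (metis add_eq_0_iff)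
 then have "1 = cmod (\<Phi> w) * cmod (G w)" by (metis norm_minus_cancel norm_mult norm_one)
 also have "\<dots> \<le> cmod (\<Phi> w) * M" using Gw by (intro mult_left_mono) auto
 finally show ?thesis using M by (simp add: pos_divide_le_eq)
qed

theorem SIP_imp_bsm:
 assumes J: "bseq J a" and c: "cmod c = 1" and e: "\<And>z. cmod z < 1 ==> \<Theta> z = c * BP J a z"
  and S: "\<And>\<Phi>. inner_function \<Phi> ==> Hinf_dvd \<Phi> \<Theta> ==> SIP \<Phi>"
 shows "bsm J a"
proof (rule ccontr)
 assume nb: "\<not> bsm J a"
 obtain \<eta> where \<eta>: "\<eta> > 0" "\<And>\<tau>. \<tau> > 0 ==> \<exists>z F. far J a \<tau> z F \<and> \<eta> < (\<Sum>j\<in>F. kap z (a j))"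
  by (rule not_bsmE[OF nb], rule that)
 obtain K z F where K: "K \<subseteq> J" and z: "\<And>n::nat. cmod (z n) < 1" and F: "\<And>n. finite (F n)" "\<And>n. F n \<subseteq> K"
  "\<And>n. \<eta> / 2 \<le> (\<Sum>j\<in>F n. kap (z n) (a j))" and kK: "\<And>n j. j \<in> K ==> kap (z n) (a j) \<le> 1 / (real n + 1)"
  by (rule sparse_subsequence[OF J \<eta>(1)], rule \<eta>(2), assumption, rule that)
 have bK: "bseq K a" by (rule bseq_subset[OF J K])
 have bJK: "bseq (J - K) a" by (rule bseq_subset[OF J]) auto
 define \<Phi> where "\<Phi> = BP K a"
 have \<Phi>: "inner_function \<Phi>" by (rule BP_inner[OF bK, of 1]) (auto simp: \<Phi>_def)
 then have \<Phi>H: "\<Phi> \<in> Hinf" by (simp add: inner_function_def)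
 have "Hinf_dvd \<Phi> \<Theta>" unfolding Hinf_dvd_def
 proof (intro bexI[of _ "\<lambda>z. c * BP (J - K) a z"] ballI)
  show "(\<lambda>z. c * BP (J - K) a z) \<in> Hinf"
   by (intro Hinf_mult Hinf_const HinfI[of _ 1] BP_holomorphic norm_BP_le_1 bJK)
  fix z :: complex assume "z \<in> ball 0 1"
  then have "cmod z < 1" by simp
  then show "\<Theta> z = \<Phi> z * (c * BP (J - K) a z)" using e BP_split[OF J K] by (simp add: \<Phi>_def)
 qed
 then have SIP: "SIP \<Phi>" using S \<Phi> by blast
 \<comment> \<open>Here \<open>(1 / M)\<^sup>2\<close> is \<open>exp (- (\<eta> / 4))\<close>, which
   exceeds the bound \<open>exp (- (\<eta> / 2))\<close> for the squared modulus of \<Phi> at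
   \<open>z n\<close>. The property is applied with half of \<open>M - 1\<close>, because a quotient
   norm strictly below \<open>M\<close> is needed for a representative bounded by
   \<open>M\<close>.\<close>
 define M where "M = exp (\<eta> / 8)"
 have M: "1 < M" "1 + (M - 1) / 2 < M" using \<eta>(1) by (auto simp: M_def field_simps)
 have "(M - 1) / 2 > 0" using M by simp
 from SIP[unfolded SIP_def, rule_format, OF this] obtain \<delta> where \<delta>: "\<delta> > 0" and D: "\<forall>f\<in>Hinf. quot_norm \<Phi> f \<le> 1 \<and> (\<forall>z\<in>unit_disc. \<Phi> z = 0 \<longrightarrow> cmod (f z) \<ge> 1 - \<delta>) \<longrightarrow>
   (\<exists>k\<in>Hinf. quot_eq \<Phi> (\<lambda>z. f z * k z) (\<lambda>z. 1) \<and> quot_norm \<Phi> k \<le> 1 + (M - 1) / 2)"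
  by (elim exE conjE)
 obtain n :: nat where n: "1 / \<delta> < real n" using reals_Archimedean2 by blast
 have n': "1 / (real n + 1) \<le> \<delta>"
 proof -
  have "1 < real n * \<delta>" using n \<delta> by (simp add: pos_divide_less_eq)
  then have "1 \<le> \<delta> * (real n + 1)" using \<delta> by (simp add: algebra_simps)
  then show ?thesis by (simp add: pos_divide_le_eq)
 qed
 define f where "f = disc_aut (z n)"
 have f1: "cmod (f x) \<le> 1" if "cmod x < 1" for x unfolding f_def using norm_disc_aut_le_1[OF z] that by simp
 have fh: "hol f" unfolding f_def by (rule disc_aut_holomorphic[OF z])
 have fH: "f \<in> Hinf" by (rule HinfI[OF fh f1])
 have "quot_norm \<Phi> f \<le> 1" by (rule quot_norm_le[OF fH \<Phi>H Hinf_const[of 0]]) (use f1 in simp)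
 moreover have "\<forall>x\<in>unit_disc. \<Phi> x = 0 \<longrightarrow> cmod (f x) \<ge> 1 - \<delta>"
 proof (intro ballI impI)
  fix x assume x: "x \<in> unit_disc" "\<Phi> x = 0"
  then have x1: "cmod x < 1" by simp
  obtain j where j: "j \<in> K" "a j = x" using BP_eq_0_imp[OF bK x1] x(2) unfolding \<Phi>_def by blast
  have "1 - \<delta> \<le> 1 - kap (z n) x" using kK[OF j(1), of n] n' unfolding j(2) by linarith
  also have "\<dots> = (rho (z n) x)\<^sup>2" using rho_sq[OF z x1] by simp
  also have "\<dots> \<le> rho (z n) x" using mult_left_le[of "rho (z n) x" "rho (z n) x"] rho_nonneg[of "z n" x] rho_less_1[OF z x1, of n] by (simp add: power2_eq_square)
  also have "\<dots> = cmod (f x)" unfolding f_def norm_disc_aut[OF z x1] ..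
  finally show "1 - \<delta> \<le> cmod (f x)" .
 qed
 ultimately have "\<exists>k\<in>Hinf. quot_eq \<Phi> (\<lambda>z. f z * k z) (\<lambda>z. 1) \<and> quot_norm \<Phi> k \<le> 1 + (M - 1) / 2"
  using bspec[OF D fH] by (elim mp) (rule conjI)
 then obtain k where k: "k \<in> Hinf" "quot_eq \<Phi> (\<lambda>z. f z * k z) (\<lambda>z. 1)" "quot_norm \<Phi> k \<le> 1 + (M - 1) / 2"
  by (elim bexE conjE)
 from k(2) obtain g0 where g0: "g0 \<in> Hinf" "\<And>z. cmod z < 1 ==> f z * k z - 1 = \<Phi> z * g0 z"
  unfolding quot_eq_def Hinf_dvd_def by auto
 have q: "quot_norm \<Phi> k < M" using k(3) M by linarith
 obtain g1 where g1: "g1 \<in> Hinf" "\<And>z. cmod z < 1 ==> cmod (k z + g1 z * \<Phi> z) \<le> M"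
  by (rule quot_norm_less[OF k(1) \<Phi>H q], rule that)
 have "1 / M \<le> cmod (\<Phi> (z n))"
 proof (rule inverse_norm_lower_bound[OF \<Phi>, of "\<lambda>z. f z * (k z + g1 z * \<Phi> z)" "\<lambda>z. g0 z + f z * g1 z"])
  have "(\<lambda>z. f z * (k z + g1 z * \<Phi> z)) \<in> Hinf" by (intro Hinf_mult Hinf_add fH k g1 \<Phi>H)
  then show "hol (\<lambda>z. f z * (k z + g1 z * \<Phi> z))" by (simp add: Hinf_def)
  show "(\<lambda>z. g0 z + f z * g1 z) \<in> Hinf" by (intro Hinf_mult Hinf_add fH g0 g1)
  show "cmod (f x * (k x + g1 x * \<Phi> x)) \<le> M" if "cmod x < 1" for x
   using mult_mono[OF f1[OF that] g1(2)[OF that]] by (simp add: norm_mult)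
  show "f x * (k x + g1 x * \<Phi> x) = 1 + \<Phi> x * (g0 x + f x * g1 x)" if "cmod x < 1" for x
   using g0(2)[OF that] by (simp add: algebra_simps)
  show "f (z n) * (k (z n) + g1 (z n) * \<Phi> (z n)) = 0" by (simp add: f_def)
 qed (use M z in auto)
 moreover have "cmod (\<Phi> (z n)) \<le> cmod (BF (F n) a (z n))" unfolding \<Phi>_def by (rule norm_BP_le_BF[OF bK F(2,1) z])
 ultimately have "(1 / M)\<^sup>2 \<le> (cmod (BF (F n) a (z n)))\<^sup>2" using M by (intro power_mono) auto
 also have "\<dots> \<le> exp (- (\<Sum>j\<in>F n. kap (z n) (a j)))"
  by (rule norm_BF_sq_le_exp[OF _ z], rule bseq_lt_1[OF bK], rule subsetD[OF F(2)])
 also have "\<dots> \<le> exp (- (\<eta> / 2))" using F(3)[of n] by simp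
 finally have "(1 / M)\<^sup>2 \<le> exp (- (\<eta> / 2))" .
 moreover have "(1 / M)\<^sup>2 = exp (- (\<eta> / 4))"
 proof -
  have "M\<^sup>2 = exp (\<eta> / 4)" unfolding M_def exp_double[symmetric] by simp
  then show ?thesis unfolding power_divide by (simp only: exp_minus inverse_eq_divide power_one)
 qed
 ultimately show False using \<eta>(1) by simp
qed

section \<open>Interpolation and Gram matrices\<close>

text \<open>Strict definiteness keeps all values in the open disc, so that every step of the Schur
  algorithm can be carried out. The real part is taken because \<open>K\<close> is not assumed to be
  Hermitian.\<close>

definition spd :: "nat set \<Rightarrow> (nat \<Rightarrow> nat \<Rightarrow> complex) \<Rightarrow> bool" where
 "spd S K \<longleftrightarrow> (\<forall>c. (\<exists>i\<in>S. c i \<noteq> 0) \<longrightarrow> 0 < Re (\<Sum>i\<in>S. \<Sum>j\<in>S. c i * cnj (c j) * K i j))"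

lemma spdD: "spd S K ==> i \<in> S ==> c i \<noteq> 0 ==> 0 < Re (\<Sum>i\<in>S. \<Sum>j\<in>S. c i * cnj (c j) * K i j)"
 unfolding spd_def by blast

lemma spd_congruence:
 assumes K: "spd S K" and l: "\<And>i. i \<in> S ==> l i \<noteq> 0"
  and e: "\<And>i j. i \<in> S ==> j \<in> S ==> K' i j = l i * cnj (l j) * K i j"
 shows "spd S K'"
 unfolding spd_def
proof (intro allI impI)
 fix c :: "nat \<Rightarrow> complex" assume "\<exists>i\<in>S. c i \<noteq> 0"
 then obtain i where i: "i \<in> S" "c i \<noteq> 0" by blast
 have "0 < Re (\<Sum>i\<in>S. \<Sum>j\<in>S. (c i * l i) * cnj (c j * l j) * K i j)"
  by (rule spdD[OF K i(1), of "\<lambda>i. c i * l i"]) (use i l in simp)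
 also have "(\<Sum>i\<in>S. \<Sum>j\<in>S. (c i * l i) * cnj (c j * l j) * K i j) = (\<Sum>i\<in>S. \<Sum>j\<in>S. c i * cnj (c j) * K' i j)"
  by (intro sum.cong refl) (simp add: e mult_ac)
 finally show "0 < Re (\<Sum>i\<in>S. \<Sum>j\<in>S. c i * cnj (c j) * K' i j)" .
qed

lemma spd_diagonal:
 assumes "spd S K" "finite S" "p \<in> S"
 shows "0 < Re (K p p)"
proof -
 let ?c = "\<lambda>i. if i = p then 1 else 0 :: complex"
 have "0 < Re (\<Sum>i\<in>S. \<Sum>j\<in>S. ?c i * cnj (?c j) * K i j)" by (rule spdD[OF assms(1,3)]) simp
 also have "(\<Sum>i\<in>S. \<Sum>j\<in>S. ?c i * cnj (?c j) * K i j) = (\<Sum>i\<in>S. if i = p then (\<Sum>j\<in>S. if j = p then K p p else 0) else 0)"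
  by (intro sum.cong refl) (auto intro!: sum.cong)
 also have "\<dots> = K p p" using assms by simp
 finally show ?thesis .
qed

text \<open>One step of the Schur algorithm: after moving one node and its value to the origin, the Schur complement of
 that node is again a Pick matrix.\<close>
theorem pick_interpolation:
 assumes "finite S" "\<And>i. i \<in> S ==> cmod (z i) < 1" "inj_on z S"
  and "spd S (\<lambda>i j. (1 - cnj (w i) * w j) / (1 - cnj (z i) * z j))"
 shows "\<exists>\<phi>. hol \<phi> \<and> (\<forall>x. cmod x < 1 \<longrightarrow> cmod (\<phi> x) \<le> 1) \<and> (\<forall>i\<in>S. \<phi> (z i) = w i)"
 using assms
proof (induction S arbitrary: z w rule: finite_induct)
 case empty
 then show ?case by (intro exI[of _ "\<lambda>_. 0"]) auto
next
 case (insert n S)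
 let ?K = "\<lambda>i j. (1 - cnj (w i) * w j) / (1 - cnj (z i) * z j)"
 let ?T = "insert n S"
 have z: "cmod (z i) < 1" if "i \<in> ?T" for i using insert.prems(1) that by blast
 have w: "cmod (w i) < 1" if i: "i \<in> ?T" for i
 proof -
  have "0 < Re (?K i i)" using insert.hyps(1) by (intro spd_diagonal[OF insert.prems(3) _ i]) simp
  also have "?K i i = of_real ((1 - (cmod (w i))\<^sup>2) / (1 - (cmod (z i))\<^sup>2))"
   by (simp only: of_real_diff of_real_1 complex_norm_square of_real_divide mult.commute)
  finally have "0 < (1 - (cmod (w i))\<^sup>2) / (1 - (cmod (z i))\<^sup>2)" by (simp only: Re_complex_of_real)
  then have "0 < 1 - (cmod (w i))\<^sup>2" using one_minus_sq_bounds(3)[OF z[OF i]] by (simp add: zero_less_divide_iff)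
  then have "(cmod (w i))\<^sup>2 < 1\<^sup>2" by simp
  then show ?thesis by (rule power2_less_imp_less) simp
 qed
 have zn: "cmod (z n) < 1" and wn: "cmod (w n) < 1" using z w by auto
 define z' w' where "z' i = disc_aut (z n) (z i)" and "w' i = disc_aut (w n) (w i)" for i
 define q where "q = sqrt ((1 - (cmod (w n))\<^sup>2) / (1 - (cmod (z n))\<^sup>2))"
 have q0: "0 < q" unfolding q_def using one_minus_sq_bounds(3)[OF zn] one_minus_sq_bounds(3)[OF wn] by simp
 have q2: "of_real q * of_real q = (of_real (1 - (cmod (w n))\<^sup>2) / of_real (1 - (cmod (z n))\<^sup>2) :: complex)"
 proof -
  have "q * q = (1 - (cmod (w n))\<^sup>2) / (1 - (cmod (z n))\<^sup>2)"
   unfolding q_def using one_minus_sq_bounds(3)[OF zn] one_minus_sq_bounds(3)[OF wn] by simp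
  then show ?thesis unfolding of_real_mult[symmetric] of_real_divide[symmetric] by (rule arg_cong)
 qed
 \<comment> \<open>The congruence relating the Pick matrices before and after the nodes and values
   are moved by \<open>disc_aut (z n)\<close> and \<open>disc_aut (w n)\<close>; the common positive
   factor is shared equally by row and column, hence the square root \<open>q\<close>.\<close>
 define l where "l i = of_real q * ((1 - z n * cnj (z i)) / (1 - w n * cnj (w i)))" for i
 have den: "1 - z n * cnj (z i) \<noteq> 0" "1 - w n * cnj (w i) \<noteq> 0" "1 - cnj (z n) * z i \<noteq> 0" "1 - cnj (w n) * w i \<noteq> 0" if "i \<in> ?T" for i
  using den_nonzero[of "z n" "z i"] den_nonzero[of "w n" "w i"] den_nonzero[of "z i" "z n"] den_nonzero[of "w i" "w n"]
   z[OF that] w[OF that] zn wn by (simp_all add: mult.commute)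
 let ?K' = "\<lambda>i j. (1 - cnj (w' i) * w' j) / (1 - cnj (z' i) * z' j)"
 have "spd ?T ?K'"
 proof (rule spd_congruence[OF insert.prems(3), of l])
  fix i assume i: "i \<in> ?T"
  show "l i \<noteq> 0" unfolding l_def using den[OF i] q0 by simp
  fix j assume j: "j \<in> ?T"
  have nn: "complex_of_real (1 - (cmod (z n))\<^sup>2) \<noteq> 0" using one_minus_sq_bounds(3)[OF zn] by (simp only: of_real_eq_0_iff)
  have cl: "cnj (l j) = of_real q * ((1 - cnj (z n) * z j) / (1 - cnj (w n) * w j))" by (simp add: l_def)
  have zz: "1 - cnj (z i) * z j \<noteq> 0" using den_nonzero[of "z j" "z i"] z[OF i] z[OF j] by simp
  have "?K' i j = (of_real (1 - (cmod (w n))\<^sup>2) / of_real (1 - (cmod (z n))\<^sup>2)) *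
    ((1 - z n * cnj (z i)) / (1 - w n * cnj (w i)) * ((1 - cnj (z n) * z j) / (1 - cnj (w n) * w j)) * ?K i j)"
   unfolding z'_def w'_def disc_aut_den[OF zn z[OF i] z[OF j]] disc_aut_den[OF wn w[OF i] w[OF j]]
   using nn den[OF i] den[OF j] zz by (simp add: divide_simps)
  also have "\<dots> = l i * cnj (l j) * ?K i j" unfolding cl q2[symmetric] unfolding l_def by (simp add: mult_ac)
  finally show "?K' i j = l i * cnj (l j) * ?K i j" .
 qed
 have z'0: "z' i \<noteq> 0" if "i \<in> S" for i
 proof -
  have "z i \<noteq> z n" using insert.prems(2) insert.hyps(2) that by (auto simp: inj_on_def)
  then show ?thesis unfolding z'_def using disc_aut_eq_0_iff[OF zn] z that by auto
 qed
 have zn': "z' n = 0" "w' n = 0" by (simp_all add: z'_def w'_def)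
 have z'1: "cmod (z' i) < 1" if "i \<in> S" for i unfolding z'_def by (rule disc_aut_lt_1[OF zn]) (use z that in auto)
 define v where "v i = w' i / z' i" for i
 have "spd S (\<lambda>i j. (1 - cnj (v i) * v j) / (1 - cnj (z' i) * z' j))" (is "spd S ?L")
  unfolding spd_def
 proof (intro allI impI)
  fix c :: "nat \<Rightarrow> complex" assume "\<exists>i\<in>S. c i \<noteq> 0"
  then obtain p where p: "p \<in> S" "c p \<noteq> 0" by blast
  define e0 where "e0 i = c i / cnj (z' i)" for i
  define E where "E = (\<Sum>i\<in>S. e0 i)"
  \<comment> \<open>After the move the row and the column of \<open>n\<close> consist of ones. The
    coefficient \<open>- E\<close> at \<open>n\<close> minimises the form in that coordinate, and
    this subtracts 1 from all other entries.\<close>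
  define e where "e i = (if i = n then - E else e0 i)" for i
  have eS: "e i = e0 i" if "i \<in> S" for i using insert.hyps(2) that by (auto simp: e_def)
  have "0 < Re (\<Sum>i\<in>?T. \<Sum>j\<in>?T. e i * cnj (e j) * ?K' i j)"
   by (rule spdD[OF \<open>spd ?T ?K'\<close>, of p]) (use p eS[OF p(1)] z'0[OF p(1)] in \<open>auto simp: e0_def\<close>)
  also have "(\<Sum>i\<in>?T. \<Sum>j\<in>?T. e i * cnj (e j) * ?K' i j) = E * cnj E - E * cnj E - E * cnj E + (\<Sum>i\<in>S. \<Sum>j\<in>S. e0 i * cnj (e0 j) * ?K' i j)"
  proof -
   have 1: "(\<Sum>j\<in>?T. e n * cnj (e j) * ?K' n j) = E * cnj E - E * cnj E"
   proof -
    have "(\<Sum>j\<in>S. e n * cnj (e j) * ?K' n j) = (\<Sum>j\<in>S. - E * cnj (e0 j))"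
     by (intro sum.cong refl) (simp add: zn' eS, simp add: e_def)
    also have "\<dots> = - (E * cnj E)" unfolding sum_distrib_left[symmetric] by (simp add: E_def)
    finally show ?thesis using insert.hyps by (simp add: zn' e_def)
   qed
   have 2: "(\<Sum>j\<in>?T. e i * cnj (e j) * ?K' i j) = - e0 i * cnj E + (\<Sum>j\<in>S. e0 i * cnj (e0 j) * ?K' i j)" if i: "i \<in> S" for i
   proof -
    have "(\<Sum>j\<in>S. e i * cnj (e j) * ?K' i j) = (\<Sum>j\<in>S. e0 i * cnj (e0 j) * ?K' i j)"
     by (intro sum.cong refl) (simp add: eS i)
    moreover have "e n = - E" by (simp add: e_def)
    ultimately show ?thesis using insert.hyps by (simp add: zn' eS[OF i])
   qed
   have "(\<Sum>i\<in>S. \<Sum>j\<in>?T. e i * cnj (e j) * ?K' i j) = (\<Sum>i\<in>S. - e0 i * cnj E) + (\<Sum>i\<in>S. \<Sum>j\<in>S. e0 i * cnj (e0 j) * ?K' i j)"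
    unfolding sum.distrib[symmetric] by (intro sum.cong refl 2)
   also have "(\<Sum>i\<in>S. - e0 i * cnj E) = - (E * cnj E)" unfolding sum_distrib_right[symmetric] E_def by (simp add: sum_negf)
   finally have "(\<Sum>i\<in>S. \<Sum>j\<in>?T. e i * cnj (e j) * ?K' i j) = - (E * cnj E) + (\<Sum>i\<in>S. \<Sum>j\<in>S. e0 i * cnj (e0 j) * ?K' i j)" .
   then show ?thesis unfolding sum.insert[OF insert.hyps, of "\<lambda>i. \<Sum>j\<in>?T. e i * cnj (e j) * ?K' i j"] 1 by simp
  qed
  also have "E * cnj E - E * cnj E - E * cnj E + (\<Sum>i\<in>S. \<Sum>j\<in>S. e0 i * cnj (e0 j) * ?K' i j) = (\<Sum>i\<in>S. \<Sum>j\<in>S. e0 i * cnj (e0 j) * (?K' i j - 1))"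
  proof -
   have "E * cnj E = (\<Sum>i\<in>S. \<Sum>j\<in>S. e0 i * cnj (e0 j))" by (simp add: E_def sum_product)
   then show ?thesis by (simp add: right_diff_distrib sum_subtractf)
  qed
  also have "\<dots> = (\<Sum>i\<in>S. \<Sum>j\<in>S. c i * cnj (c j) * ?L i j)"
  proof (intro sum.cong refl)
   fix i j assume i: "i \<in> S" and j: "j \<in> S"
   have zz: "1 - cnj (z' i) * z' j \<noteq> 0" using den_nonzero[of "z' j" "z' i"] z'1[OF i] z'1[OF j] by simp
   have "?K' i j - 1 = (cnj (z' i) * z' j - cnj (w' i) * w' j) / (1 - cnj (z' i) * z' j)" using zz by (simp add: divide_simps)
   also have "cnj (z' i) * z' j - cnj (w' i) * w' j = cnj (z' i) * z' j * (1 - cnj (v i) * v j)"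
    using z'0[OF i] z'0[OF j] by (simp add: v_def divide_simps algebra_simps)
   finally show "e0 i * cnj (e0 j) * (?K' i j - 1) = c i * cnj (c j) * ?L i j"
    using z'0[OF i] z'0[OF j] by (simp add: e0_def)
  qed
  finally show "0 < Re (\<Sum>i\<in>S. \<Sum>j\<in>S. c i * cnj (c j) * ?L i j)" .
 qed
 moreover have "inj_on z' S"
 proof (rule inj_onI)
  fix i j assume ij: "i \<in> S" "j \<in> S" "z' i = z' j"
  then have "z i = z j" unfolding z'_def using disc_aut_invol[OF zn z[of i]] disc_aut_invol[OF zn z[of j]] by (metis insertCI)
  then show "i = j" using insert.prems(2) ij by (auto simp: inj_on_def)
 qed
 ultimately obtain \<phi> where \<phi>: "hol \<phi>" "\<And>x. cmod x < 1 ==> cmod (\<phi> x) \<le> 1" "\<And>i. i \<in> S ==> \<phi> (z' i) = v i"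
  using insert.IH[of z' v] z'1 by blast
 define \<phi>1 where "\<phi>1 x = x * \<phi> x" for x
 have \<phi>1: "hol \<phi>1" unfolding \<phi>1_def[abs_def] by (intro holomorphic_intros \<phi>)
 have \<phi>11: "cmod (\<phi>1 x) < 1" if "cmod x < 1" for x
 proof -
  have "cmod (\<phi>1 x) \<le> cmod x * 1" unfolding \<phi>1_def norm_mult by (intro mult_left_mono \<phi>(2) that) auto
  then show ?thesis using that by simp
 qed
 define \<psi> where "\<psi> x = disc_aut (w n) (\<phi>1 (disc_aut (z n) x))" for x
 have "hol \<psi>" unfolding \<psi>_def[abs_def]
  by (rule holomorphic_comp_disc_aut[OF holomorphic_disc_aut_comp[OF \<phi>1 zn] _ wn]) (use \<phi>11 disc_aut_lt_1[OF zn] in auto)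
 moreover have "cmod (\<psi> x) \<le> 1" if "cmod x < 1" for x
  unfolding \<psi>_def using disc_aut_lt_1[OF wn \<phi>11[OF disc_aut_lt_1[OF zn that]]] by simp
 moreover have "\<psi> (z i) = w i" if i: "i \<in> ?T" for i
 proof (cases "i = n")
  case True then show ?thesis by (simp add: \<psi>_def \<phi>1_def)
 next
  case False
  then have iS: "i \<in> S" using i by simp
  have "\<phi>1 (z' i) = w' i" unfolding \<phi>1_def \<phi>(3)[OF iS] v_def using z'0[OF iS] by simp
  then show ?thesis unfolding \<psi>_def z'_def[symmetric] w'_def using disc_aut_invol[OF wn w[OF i]] by simp
 qed
 ultimately show ?case by blast
qed

section \<open>The Carleson embedding\<close>

text \<open>A discrete form of integrating \<open>exp (- x)\<close> over an interval whose length is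
  the sum of the \<open>p i\<close>. Elements are added by decreasing \<open>r\<close>, so that the
  tail sum of the new element is the full sum.\<close>

lemma sum_exp_tail_le:
 fixes p r :: "nat \<Rightarrow> real"
 assumes "finite S" "\<And>i. i \<in> S ==> 0 \<le> p i"
 shows "(\<Sum>j\<in>S. p j * exp (- (\<Sum>i\<in>{i\<in>S. r j \<le> r i}. p i))) \<le> 1 - exp (- (\<Sum>i\<in>S. p i))"
 using assms
proof (induction S rule: finite_ranking_induct[where f = "\<lambda>i. - r i"])
 case empty then show ?case by simp
next
 case (insert x S)
 show ?case
 proof (cases "x \<in> S")
  case True
  then have "insert x S = S" by blast
  then show ?thesis using insert.IH insert.prems by simp
 next
  case False
  have p: "0 \<le> p i" if "i \<in> insert x S" for i using insert.prems that by blast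
  have xS: "{i\<in>insert x S. r x \<le> r i} = insert x S" using insert.hyps(2) by auto
  let ?s = "\<Sum>i\<in>S. p i"
  have "(\<Sum>j\<in>S. p j * exp (- (\<Sum>i\<in>{i\<in>insert x S. r j \<le> r i}. p i))) \<le> (\<Sum>j\<in>S. p j * exp (- (\<Sum>i\<in>{i\<in>S. r j \<le> r i}. p i)))"
  proof (rule sum_mono)
   fix j assume j: "j \<in> S"
   have "(\<Sum>i\<in>{i\<in>S. r j \<le> r i}. p i) \<le> (\<Sum>i\<in>{i\<in>insert x S. r j \<le> r i}. p i)"
    using insert.hyps(1) p by (intro sum_mono2) auto
   then show "p j * exp (- (\<Sum>i\<in>{i\<in>insert x S. r j \<le> r i}. p i)) \<le> p j * exp (- (\<Sum>i\<in>{i\<in>S. r j \<le> r i}. p i))"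
    using p[of j] j by (intro mult_left_mono) auto
  qed
  also have "\<dots> \<le> 1 - exp (- ?s)" by (rule insert.IH) (use p in auto)
  finally have 1: "(\<Sum>j\<in>S. p j * exp (- (\<Sum>i\<in>{i\<in>insert x S. r j \<le> r i}. p i))) \<le> 1 - exp (- ?s)" .
  have "1 + p x \<le> exp (p x)" by (rule exp_ge_add_one_self)
  then have "(1 + p x) * exp (- (p x + ?s)) \<le> exp (p x) * exp (- (p x + ?s))" by (rule mult_right_mono) simp
  also have "\<dots> = exp (- ?s)" by (simp flip: exp_add)
  finally have "p x * exp (- (p x + ?s)) \<le> exp (- ?s) - exp (- (p x + ?s))" by (simp add: algebra_simps)
  then show ?thesis
   unfolding sum.insert[OF insert.hyps(1) False, of "\<lambda>j. p j * exp (- (\<Sum>i\<in>{i\<in>insert x S. r j \<le> r i}. p i))"] xS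
    sum.insert[OF insert.hyps(1) False, of p]
   using 1 by linarith
 qed
qed

lemma Re_cayley:
 assumes "u \<noteq> 1"
 shows "Re ((1 + u) / (1 - u)) = (1 - (cmod u)\<^sup>2) / (cmod (1 - u))\<^sup>2"
proof -
 have "Re ((1 + u) / (1 - u)) = Re ((1 + u) * cnj (1 - u) / of_real ((cmod (1 - u))\<^sup>2))"
  unfolding of_real_power complex_div_cnj[of "1 + u" "1 - u"] ..
 also have "\<dots> = Re ((1 + u) * cnj (1 - u)) / (cmod (1 - u))\<^sup>2" by (rule Re_divide_of_real)
 also have "Re ((1 + u) * cnj (1 - u)) = 1 - (cmod u)\<^sup>2"
  by (simp add: cmod_power2) (simp add: algebra_simps power2_eq_square)
 finally show ?thesis .
qed

definition h2 :: "(complex \<Rightarrow> complex) \<Rightarrow> real" where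
 "h2 G = integral {-pi..pi} (\<lambda>t. (cmod (G (cis t)))\<^sup>2) / (2 * pi)"

text \<open>The Jones kernels \<open>exp (- (V j - V j (b j)) / A)\<close> make the Poisson kernels at the points \<open>b j\<close> summable.\<close>
theorem carleson_embedding:
 fixes S :: "nat set"
 assumes S: "finite S" and b: "\<And>i. i \<in> S ==> cmod (b i) < 1" and m: "\<And>i. i \<in> S ==> 0 \<le> m i" and A: "0 < A"
  and C: "\<And>z. cmod z < 1 ==> (\<Sum>i\<in>S. m i * (1 - (cmod z)\<^sup>2) / (cmod (1 - cnj (b i) * z))\<^sup>2) \<le> A"
  and g: "continuous_on (cball 0 1) g" "hol g"
 shows "(\<Sum>i\<in>S. m i * (cmod (g (b i)))\<^sup>2) \<le> exp 2 * A * h2 g"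
proof -
 define U where "U j = {i\<in>S. cmod (b j) \<le> cmod (b i)}" for j
 \<comment> \<open>On the circle the real part of \<open>V j\<close> is the weighted sum of the
   Poisson kernels over the points at least as far from the origin as \<open>b j\<close>; at
   \<open>b j\<close> it is at most \<open>2 * A\<close>. The ordering by modulus is what
   \<open>sum_exp_tail_le\<close> needs.\<close>
 define V where "V j z = (\<Sum>i\<in>U j. of_real (m i) * ((1 + cnj (b i) * z) / (1 - cnj (b i) * z)))" for j z
 have US: "U j \<subseteq> S" for j by (auto simp: U_def)
 have den: "1 - cnj (b i) * z \<noteq> 0" if "i \<in> S" "cmod z \<le> 1" for i z using den_nonzero b that by blast
 have ReV: "Re (V j z) = (\<Sum>i\<in>U j. m i * ((1 - (cmod (b i) * cmod z)\<^sup>2) / (cmod (1 - cnj (b i) * z))\<^sup>2))" if z: "cmod z \<le> 1" for j z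
  unfolding V_def Re_sum
 proof (rule sum.cong[OF refl])
  fix i assume "i \<in> U j"
  then have "cnj (b i) * z \<noteq> 1" using den[of i z] US z by auto
  from Re_cayley[OF this] show "Re (of_real (m i) * ((1 + cnj (b i) * z) / (1 - cnj (b i) * z))) =
   m i * ((1 - (cmod (b i) * cmod z)\<^sup>2) / (cmod (1 - cnj (b i) * z))\<^sup>2)"
   by (simp only: Re_complex_of_real times_complex.sel Im_complex_of_real norm_mult complex_mod_cnj mult_zero_left diff_zero)
 qed
 have Vb: "Re (V j (b j)) \<le> 2 * A" if j: "j \<in> S" for j
 proof -
  have "Re (V j (b j)) \<le> (\<Sum>i\<in>U j. 2 * (m i * (1 - (cmod (b j))\<^sup>2) / (cmod (1 - cnj (b i) * b j))\<^sup>2))"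
   unfolding ReV[OF less_imp_le[OF b[OF j]]]
  proof (rule sum_mono)
   fix i assume i: "i \<in> U j"
   then have iS: "i \<in> S" and ij: "cmod (b j) \<le> cmod (b i)" by (auto simp: U_def)
   have "cmod (b j) * cmod (b j) \<le> cmod (b i) * cmod (b j)" using ij by (intro mult_right_mono) auto
   then have "((cmod (b j))\<^sup>2)\<^sup>2 \<le> (cmod (b i) * cmod (b j))\<^sup>2" unfolding power2_eq_square[of "cmod (b j)"] by (intro power_mono) auto
   moreover have "1 - x\<^sup>2 \<le> 2 * (1 - x)" for x :: real using zero_le_power2[of "1 - x"] by (simp add: power2_eq_square algebra_simps)
   ultimately have "1 - (cmod (b i) * cmod (b j))\<^sup>2 \<le> 2 * (1 - (cmod (b j))\<^sup>2)" by (meson diff_left_mono order_trans)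
   then have "(1 - (cmod (b i) * cmod (b j))\<^sup>2) / (cmod (1 - cnj (b i) * b j))\<^sup>2 \<le> 2 * (1 - (cmod (b j))\<^sup>2) / (cmod (1 - cnj (b i) * b j))\<^sup>2"
    by (rule divide_right_mono) simp
   from mult_left_mono[OF this m[OF iS]]
   show "m i * ((1 - (cmod (b i) * cmod (b j))\<^sup>2) / (cmod (1 - cnj (b i) * b j))\<^sup>2) \<le> 2 * (m i * (1 - (cmod (b j))\<^sup>2) / (cmod (1 - cnj (b i) * b j))\<^sup>2)"
    by (simp add: mult_ac)
  qed
  also have "\<dots> \<le> (\<Sum>i\<in>S. 2 * (m i * (1 - (cmod (b j))\<^sup>2) / (cmod (1 - cnj (b i) * b j))\<^sup>2))"
   using S US m b[OF j] one_minus_sq_bounds(3)[OF b[OF j]] by (intro sum_mono2 mult_nonneg_nonneg divide_nonneg_nonneg) auto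
  also have "\<dots> \<le> 2 * A" unfolding sum_distrib_left[symmetric] using C[OF b[OF j]] by simp
  finally show ?thesis .
 qed
 \<comment> \<open>\<open>kf j\<close> has the value 1 at \<open>b j\<close>, so the value of
   \<open>g\<close> there is kept; on the circle it is exponentially small where the Poisson sum is
   large.\<close>
 define kf where "kf j z = exp (- (V j z - V j (b j)) / of_real A)" for j z
 have Vc: "continuous_on (cball 0 1) (V j)" and Vh: "hol (V j)" for j
  unfolding V_def[abs_def] using US den by (intro continuous_intros holomorphic_intros; force)+
 have G: "continuous_on (cball 0 1) (\<lambda>z. (g z)\<^sup>2 * kf j z)" "hol (\<lambda>z. (g z)\<^sup>2 * kf j z)" for j
  unfolding kf_def using A by (intro continuous_intros holomorphic_intros g Vc Vh; simp)+
 have nk: "cmod (kf j z) = exp (- (Re (V j z) - Re (V j (b j))) / A)" for j z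
  unfolding kf_def norm_exp_eq_Re by simp
 have pk: "Re (V j (cis t)) = (\<Sum>i\<in>U j. m i * pker (b i) t)" for j t
  using ReV[of "cis t" j] by (simp add: pker_def)
 have key: "(\<Sum>j\<in>S. m j * (cmod ((g (cis t))\<^sup>2 * kf j (cis t)) * pker (b j) t)) \<le> exp 2 * A * (cmod (g (cis t)))\<^sup>2" for t
 proof -
  define p where "p j = m j * pker (b j) t / A" for j
  have p0: "0 \<le> p j" if "j \<in> S" for j unfolding p_def using m pker_nonneg b that A by simp
  have "(\<Sum>j\<in>S. m j * (cmod ((g (cis t))\<^sup>2 * kf j (cis t)) * pker (b j) t)) \<le>
   (\<Sum>j\<in>S. (cmod (g (cis t)))\<^sup>2 * (exp 2 * A) * (p j * exp (- (\<Sum>i\<in>{i\<in>S. cmod (b j) \<le> cmod (b i)}. p i))))"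
  proof (rule sum_mono)
   fix j assume j: "j \<in> S"
   have "(Re (V j (b j)) - Re (V j (cis t))) / A \<le> 2 - (\<Sum>i\<in>U j. p i)"
   proof -
    have "(\<Sum>i\<in>U j. p i) = Re (V j (cis t)) / A" unfolding pk p_def by (simp add: sum_divide_distrib)
    moreover have "Re (V j (b j)) / A \<le> 2" using Vb[OF j] A by (simp add: pos_divide_le_eq)
    ultimately show ?thesis by (simp add: diff_divide_distrib)
   qed
   then have "cmod (kf j (cis t)) \<le> exp (2 - (\<Sum>i\<in>U j. p i))" unfolding nk by simp
   also have "\<dots> = exp 2 * exp (- (\<Sum>i\<in>U j. p i))" by (simp flip: exp_add)
   finally have k: "cmod (kf j (cis t)) \<le> exp 2 * exp (- (\<Sum>i\<in>U j. p i))" .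
   have "m j * (cmod ((g (cis t))\<^sup>2 * kf j (cis t)) * pker (b j) t) = (cmod (g (cis t)))\<^sup>2 * (A * p j) * cmod (kf j (cis t))"
    unfolding p_def using A by (simp add: norm_mult norm_power)
   also have "\<dots> \<le> (cmod (g (cis t)))\<^sup>2 * (A * p j) * (exp 2 * exp (- (\<Sum>i\<in>U j. p i)))"
    using k p0[OF j] A by (intro mult_left_mono) auto
   finally show "m j * (cmod ((g (cis t))\<^sup>2 * kf j (cis t)) * pker (b j) t) \<le>
    (cmod (g (cis t)))\<^sup>2 * (exp 2 * A) * (p j * exp (- (\<Sum>i\<in>{i\<in>S. cmod (b j) \<le> cmod (b i)}. p i)))"
    unfolding U_def by (simp add: mult_ac)
  qed
  also have "\<dots> = (cmod (g (cis t)))\<^sup>2 * (exp 2 * A) * (\<Sum>j\<in>S. p j * exp (- (\<Sum>i\<in>{i\<in>S. cmod (b j) \<le> cmod (b i)}. p i)))"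
   by (simp only: sum_distrib_left)
  also have "\<dots> \<le> (cmod (g (cis t)))\<^sup>2 * (exp 2 * A) * 1"
  proof (intro mult_left_mono)
   have "(\<Sum>j\<in>S. p j * exp (- (\<Sum>i\<in>{i\<in>S. cmod (b j) \<le> cmod (b i)}. p i))) \<le> 1 - exp (- (\<Sum>i\<in>S. p i))"
    by (rule sum_exp_tail_le[OF S]) (rule p0)
   also have "\<dots> \<le> 1" by simp
   finally show "(\<Sum>j\<in>S. p j * exp (- (\<Sum>i\<in>{i\<in>S. cmod (b j) \<le> cmod (b i)}. p i))) \<le> 1" .
  qed (use A in auto)
  finally show ?thesis by (simp add: mult_ac)
 qed
 let ?I = "\<lambda>f. integral {-pi..pi} f :: real"
 have ci: "(\<lambda>t. cmod ((g (cis t))\<^sup>2 * kf j (cis t)) * pker (b j) t) integrable_on {-pi..pi}" if "j \<in> S" for j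
  by (intro integrable_on_continuous continuous_intros pker_continuous b that continuous_on_circle[OF G(1)])
 have gi: "(\<lambda>t. (cmod (g (cis t)))\<^sup>2) integrable_on {-pi..pi}"
  by (intro integrable_on_continuous continuous_intros continuous_on_circle g)
 have "2 * pi * (\<Sum>j\<in>S. m j * (cmod (g (b j)))\<^sup>2) = (\<Sum>j\<in>S. m j * (2 * pi * cmod ((g (b j))\<^sup>2 * kf j (b j))))"
  by (simp add: sum_distrib_left kf_def norm_power mult_ac)
 also have "\<dots> \<le> (\<Sum>j\<in>S. m j * ?I (\<lambda>t. cmod ((g (cis t))\<^sup>2 * kf j (cis t)) * pker (b j) t))"
  by (intro sum_mono mult_left_mono poisson_norm_bound[OF G] b m)
 also have "\<dots> = ?I (\<lambda>t. \<Sum>j\<in>S. m j * (cmod ((g (cis t))\<^sup>2 * kf j (cis t)) * pker (b j) t))"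
  by (subst integral_sum[OF S]) (use ci in \<open>auto intro!: integrable_on_mult_right\<close>)
 also have "\<dots> \<le> ?I (\<lambda>t. exp 2 * A * (cmod (g (cis t)))\<^sup>2)"
  by (intro integral_le key integrable_sum S integrable_on_mult_right ci gi)
 also have "\<dots> = 2 * pi * (exp 2 * A * h2 g)" by (simp add: h2_def)
 finally show ?thesis by simp
qed

section \<open>Gram matrices of Szego kernels\<close>

definition kersum :: "nat set \<Rightarrow> (nat \<Rightarrow> complex) \<Rightarrow> (nat \<Rightarrow> complex) \<Rightarrow> complex \<Rightarrow> complex" where
 "kersum S x c z = (\<Sum>i\<in>S. c i / (1 - cnj (x i) * z))"

lemma kersum_analytic:
 assumes "\<And>i. i \<in> S ==> cmod (x i) < 1"
 shows "continuous_on (cball 0 1) (kersum S x c)" "hol (kersum S x c)"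
 unfolding kersum_def[abs_def] using den_nonzero assms by (intro continuous_intros holomorphic_intros; force)+

lemma kersum_pairing:
 assumes S: "finite S" and x: "\<And>i. i \<in> S ==> cmod (x i) < 1" and G: "continuous_on (cball 0 1) G" "hol G"
 shows "((\<lambda>t. G (cis t) * cnj (kersum S x c (cis t))) has_integral 2 * of_real pi * (\<Sum>i\<in>S. cnj (c i) * G (x i))) {-pi..pi}"
proof -
 have "((\<lambda>t. \<Sum>i\<in>S. cnj (c i) * (G (cis t) * cnj (1 / (1 - cnj (x i) * cis t)))) has_integral (\<Sum>i\<in>S. cnj (c i) * (2 * of_real pi * G (x i)))) {-pi..pi}"
  by (intro has_integral_sum S has_integral_mult_right cauchy_kernel G x)
 moreover have "(\<Sum>i\<in>S. cnj (c i) * (G (cis t) * cnj (1 / (1 - cnj (x i) * cis t)))) = G (cis t) * cnj (kersum S x c (cis t))" for t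
  by (simp add: kersum_def sum_distrib_left mult_ac)
 moreover have "(\<Sum>i\<in>S. cnj (c i) * (2 * of_real pi * G (x i))) = 2 * of_real pi * (\<Sum>i\<in>S. cnj (c i) * G (x i))"
  by (simp add: sum_distrib_left mult_ac)
 ultimately show ?thesis by simp
qed

lemma h2_kersum:
 assumes S: "finite S" and x: "\<And>i. i \<in> S ==> cmod (x i) < 1"
 shows "of_real (h2 (kersum S x c)) = (\<Sum>i\<in>S. cnj (c i) * kersum S x c (x i))"
proof -
 have "((\<lambda>t. of_real ((cmod (kersum S x c (cis t)))\<^sup>2)) has_integral 2 * of_real pi * (\<Sum>i\<in>S. cnj (c i) * kersum S x c (x i))) {-pi..pi}"
  unfolding complex_norm_square by (rule kersum_pairing[OF S]) (use x in \<open>auto intro: kersum_analytic\<close>)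
 moreover have "((\<lambda>t. complex_of_real ((cmod (kersum S x c (cis t)))\<^sup>2)) has_integral of_real (integral {-pi..pi} (\<lambda>t. (cmod (kersum S x c (cis t)))\<^sup>2))) {-pi..pi}"
  by (intro has_integral_of_real integrable_integral integrable_on_continuous continuous_intros continuous_on_circle kersum_analytic x)
 ultimately have "2 * of_real pi * (\<Sum>i\<in>S. cnj (c i) * kersum S x c (x i)) = of_real (integral {-pi..pi} (\<lambda>t. (cmod (kersum S x c (cis t)))\<^sup>2))"
  by (rule has_integral_unique)
 then show ?thesis unfolding h2_def by (simp add: divide_simps mult_ac)
qed

text \<open>The weight \<open>l\<close> keeps the constant at the main term close to 1 at the price
  of a large constant at the small term.\<close>

lemma h2_add_le:
 assumes F: "continuous_on (cball 0 1) F" and G: "continuous_on (cball 0 1) G" and l: "0 < l"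
  and H: "\<And>z. cmod z = 1 ==> H z = F z + G z"
 shows "h2 H \<le> (1 + l) * h2 F + (1 + 1 / l) * h2 G"
proof -
 have p: "(cmod (H (cis t)))\<^sup>2 \<le> (1 + l) * (cmod (F (cis t)))\<^sup>2 + (1 + 1 / l) * (cmod (G (cis t)))\<^sup>2" for t
 proof -
  define u v where "u = cmod (F (cis t))" and "v = cmod (G (cis t))"
  have "(cmod (H (cis t)))\<^sup>2 \<le> (u + v)\<^sup>2" unfolding u_def v_def using H[of "cis t"] norm_triangle_ineq by (intro power_mono) auto
  also have "(u + v)\<^sup>2 = (1 + l) * u\<^sup>2 + (1 + 1 / l) * v\<^sup>2 - (l * u - v)\<^sup>2 / l"
   using l by (simp add: power2_eq_square divide_simps) (simp add: algebra_simps)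
  also have "\<dots> \<le> (1 + l) * u\<^sup>2 + (1 + 1 / l) * v\<^sup>2" using l by simp
  finally show ?thesis unfolding u_def v_def .
 qed
 have Fi: "(\<lambda>t. (cmod (F (cis t)))\<^sup>2) integrable_on {-pi..pi}" and Gi: "(\<lambda>t. (cmod (G (cis t)))\<^sup>2) integrable_on {-pi..pi}"
  by (intro integrable_on_continuous continuous_intros continuous_on_circle F G)+
 have Hc: "continuous_on UNIV (\<lambda>t. (cmod (H (cis t)))\<^sup>2)"
 proof -
  have "(\<lambda>t. (cmod (H (cis t)))\<^sup>2) = (\<lambda>t. (cmod (F (cis t) + G (cis t)))\<^sup>2)" using H by (intro ext) simp
  then show ?thesis using F G by (simp only:) (intro continuous_intros continuous_on_circle)
 qed
 have "integral {-pi..pi} (\<lambda>t. (cmod (H (cis t)))\<^sup>2) \<le> integral {-pi..pi} (\<lambda>t. (1 + l) * (cmod (F (cis t)))\<^sup>2 + (1 + 1 / l) * (cmod (G (cis t)))\<^sup>2)"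
 proof (rule integral_le)
  show "(\<lambda>t. (cmod (H (cis t)))\<^sup>2) integrable_on {-pi..pi}" by (rule integrable_on_continuous[OF Hc])
  show "(\<lambda>t. (1 + l) * (cmod (F (cis t)))\<^sup>2 + (1 + 1 / l) * (cmod (G (cis t)))\<^sup>2) integrable_on {-pi..pi}"
   by (intro integrable_add integrable_on_mult_right Fi Gi)
 qed (rule p)
 also have "\<dots> = (1 + l) * integral {-pi..pi} (\<lambda>t. (cmod (F (cis t)))\<^sup>2) + (1 + 1 / l) * integral {-pi..pi} (\<lambda>t. (cmod (G (cis t)))\<^sup>2)"
  by (subst integral_add) (use Fi Gi in \<open>auto intro!: integrable_on_mult_right\<close>)
 finally have "integral {-pi..pi} (\<lambda>t. (cmod (H (cis t)))\<^sup>2) / (2 * pi) \<le>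
   ((1 + l) * integral {-pi..pi} (\<lambda>t. (cmod (F (cis t)))\<^sup>2) + (1 + 1 / l) * integral {-pi..pi} (\<lambda>t. (cmod (G (cis t)))\<^sup>2)) / (2 * pi)"
  by (rule divide_right_mono) simp
 then show ?thesis by (simp add: h2_def add_divide_distrib)
qed

text \<open>Duality: \<open>h2 v\<close> is the pairing of the coefficients with the values of
  \<open>v\<close> at the points. The embedding bounds these values by \<open>h2 v\<close> again,
  half of which is absorbed on the left.\<close>

lemma gram_upper_bound:
 assumes S: "finite S" and b: "\<And>i. i \<in> S ==> cmod (b i) < 1" and m: "\<And>i. i \<in> S ==> 0 \<le> m i" and A: "0 < A"
  and C: "\<And>z. cmod z < 1 ==> (\<Sum>i\<in>S. m i * (1 - (cmod z)\<^sup>2) / (cmod (1 - cnj (b i) * z))\<^sup>2) \<le> A"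
 shows "h2 (kersum S b (\<lambda>i. c i * of_real (sqrt (m i)))) \<le> exp 2 * A * (\<Sum>i\<in>S. (cmod (c i))\<^sup>2)"
proof -
 define v where "v = kersum S b (\<lambda>i. c i * of_real (sqrt (m i)))"
 define K where "K = exp 2 * A"
 have K: "0 < K" using A by (simp add: K_def)
 have "h2 v = Re (of_real (h2 v))" by simp
 also have "of_real (h2 v) = (\<Sum>i\<in>S. cnj (c i * of_real (sqrt (m i))) * v (b i))"
  unfolding v_def by (rule h2_kersum[OF S b])
 also have "Re \<dots> \<le> (\<Sum>i\<in>S. cmod (cnj (c i * of_real (sqrt (m i))) * v (b i)))"
  by (rule order_trans[OF complex_Re_le_cmod norm_sum])
 also have "\<dots> \<le> (\<Sum>i\<in>S. K / 2 * (cmod (c i))\<^sup>2 + 1 / (2 * K) * (m i * (cmod (v (b i)))\<^sup>2))"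
 proof (rule sum_mono)
  fix i assume i: "i \<in> S"
  define y where "y = sqrt (m i) * cmod (v (b i))"
  have y2: "y\<^sup>2 = m i * (cmod (v (b i)))\<^sup>2" unfolding y_def using m[OF i] by (simp add: power_mult_distrib)
  have "cmod (cnj (c i * of_real (sqrt (m i))) * v (b i)) = cmod (c i) * y" unfolding y_def using m[OF i] by (simp add: norm_mult)
  also have "\<dots> = K / 2 * (cmod (c i))\<^sup>2 + 1 / (2 * K) * y\<^sup>2 - (K * cmod (c i) - y)\<^sup>2 / (2 * K)"
   using K by (simp add: power2_eq_square divide_simps) (simp add: algebra_simps)
  also have "\<dots> \<le> K / 2 * (cmod (c i))\<^sup>2 + 1 / (2 * K) * y\<^sup>2" using K by simp
  finally show "cmod (cnj (c i * of_real (sqrt (m i))) * v (b i)) \<le> K / 2 * (cmod (c i))\<^sup>2 + 1 / (2 * K) * (m i * (cmod (v (b i)))\<^sup>2)"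
   unfolding y2 .
 qed
 also have "\<dots> = K / 2 * (\<Sum>i\<in>S. (cmod (c i))\<^sup>2) + 1 / (2 * K) * (\<Sum>i\<in>S. m i * (cmod (v (b i)))\<^sup>2)"
  by (simp only: sum.distrib sum_distrib_left)
 also have "\<dots> \<le> K / 2 * (\<Sum>i\<in>S. (cmod (c i))\<^sup>2) + 1 / (2 * K) * (K * h2 v)"
 proof (intro add_left_mono mult_left_mono)
  show "(\<Sum>i\<in>S. m i * (cmod (v (b i)))\<^sup>2) \<le> K * h2 v" unfolding K_def v_def
   by (rule carleson_embedding[OF S b m A C kersum_analytic]) (use b in auto)
 qed (use K in auto)
 also have "1 / (2 * K) * (K * h2 v) = h2 v / 2" using K by simp
 finally have "h2 v \<le> K * (\<Sum>i\<in>S. (cmod (c i))\<^sup>2)" by simp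
 then show ?thesis unfolding v_def K_def .
qed

text \<open>On the circle, conjugation takes \<open>cnj (bf a z)\<close> times the kernel at
  \<open>a\<close> back to that kernel, up to the factor \<open>z\<close> and a unimodular constant.
  This reduces the lower Gram bound to the upper one.\<close>

lemma cnj_bf_kernel:
 assumes a: "cmod a < 1" and z: "cmod z = 1"
 shows "cnj (cnj (bf a z) / (1 - cnj a * z)) = (if a = 0 then 1 else - of_real (cmod a) / a) * z / (1 - cnj a * z)"
proof -
 have zz: "z * cnj z = 1" unfolding complex_norm_square[symmetric] z by simp
 have az: "z \<noteq> a" using a z by auto
 have d: "1 - a * cnj z = cnj z * (z - a)" using zz by (simp add: algebra_simps)
 have "cnj z \<noteq> 0" using zz by auto
 show ?thesis
 proof (cases "a = 0")
  case True then show ?thesis by (simp add: bf_altdef)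
 next
  case False
  have e: "cnj (cnj (bf a z) / (1 - cnj a * z)) = of_real (cmod a) / a * ((a - z) / (1 - cnj a * z)) / (cnj z * (z - a))"
   using False unfolding d[symmetric] by (simp add: bf_altdef disc_aut_def)
  have "(a - z) / (cnj z * (z - a)) = - z"
   using az \<open>cnj z \<noteq> 0\<close> zz by (simp add: divide_simps) (simp add: algebra_simps)
  then have "of_real (cmod a) / a * ((a - z) / (1 - cnj a * z)) / (cnj z * (z - a)) = of_real (cmod a) / a / (1 - cnj a * z) * (- z)"
   by (metis (no_types, opaque_lifting) mult.commute times_divide_eq_left times_divide_eq_right)
  then show ?thesis unfolding e using False by simp
 qed
qed

text \<open>Shapiro--Shields: multiplied by \<open>cnj (BF S x)\<close>, the biorthogonal system becomes on the circle the conjugate of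
 the system of kernels itself, so that the upper Gram bound applies to it.\<close>
lemma gram_lower_bound:
 assumes S: "finite S" and x: "\<And>i. i \<in> S ==> cmod (x i) < 1" and k: "kb A S x" and A: "0 < A"
  and \<beta>: "0 < \<beta>" "\<And>j. j \<in> S ==> \<beta> \<le> (cmod (BF (S - {j}) x (x j)))\<^sup>2"
 shows "(\<Sum>i\<in>S. (cmod (c i))\<^sup>2) \<le> exp 2 * A / \<beta> * h2 (kersum S x (\<lambda>i. c i * of_real (sqrt (1 - (cmod (x i))\<^sup>2))))"
proof -
 define d where "d i = 1 - (cmod (x i))\<^sup>2" for i
 have d: "0 < d i" if "i \<in> S" for i unfolding d_def by (rule one_minus_sq_bounds(3)[OF x[OF that]])
 define v where "v = kersum S x (\<lambda>i. c i * of_real (sqrt (d i)))"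
 define \<gamma> where "\<gamma> j = c j / BF (S - {j}) x (x j)" for j
 define u where "u j = (if x j = 0 then 1 else - of_real (cmod (x j)) / x j)" for j
 have u1: "cmod (u j) = 1" for j by (simp add: u_def norm_divide)
 \<comment> \<open>The interpolating function formed with the biorthogonal system:
   \<open>g (x i) * of_real (sqrt (d i)) = c i\<close>. Dividing by the values
   \<open>BF (S - {j}) x (x j)\<close> costs the factor \<open>1 / \<beta>\<close>.\<close>
 define g where "g z = (\<Sum>j\<in>S. \<gamma> j * BF (S - {j}) x z * (of_real (sqrt (d j)) / (1 - cnj (x j) * z)))" for z
 have den: "1 - cnj (x i) * z \<noteq> 0" if "i \<in> S" "cmod z \<le> 1" for i z using den_nonzero x that by blast
 have g: "continuous_on (cball 0 1) g" "hol g" unfolding g_def[abs_def]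
  using x den by (intro continuous_intros holomorphic_intros BF_continuous BF_holomorphic; force)+
 have Bj0: "BF (S - {j}) x (x j) \<noteq> 0" if "j \<in> S" for j using \<beta>(2)[OF that] \<beta>(1) by auto
 have gx: "g (x i) * of_real (sqrt (d i)) = c i" if i: "i \<in> S" for i
 proof -
  have z0: "BF (S - {j}) x (x i) = 0" if "j \<in> S" "j \<noteq> i" for j
  proof -
   have "i \<in> S - {j}" using i that by simp
   then show ?thesis unfolding BF_def using S by (intro prod_zero) (auto intro!: bexI[of _ i])
  qed
  have "g (x i) = (\<Sum>j\<in>S. if j = i then \<gamma> i * BF (S - {i}) x (x i) * (of_real (sqrt (d i)) / (1 - cnj (x i) * x i)) else 0)"
   unfolding g_def using z0 by (intro sum.cong refl) auto
  also have "\<dots> = c i * (of_real (sqrt (d i)) / (1 - cnj (x i) * x i))" using S i Bj0[OF i] by (simp add: \<gamma>_def)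
  also have "1 - cnj (x i) * x i = of_real (d i)" unfolding d_def by (simp only: of_real_diff of_real_1 complex_norm_square mult.commute)
  finally have gg: "g (x i) = c i * (of_real (sqrt (d i)) / of_real (d i))" .
  have ss: "sqrt (d i) * sqrt (d i) = d i" using d[OF i] by simp
  have "g (x i) * of_real (sqrt (d i)) = c i * (of_real (sqrt (d i) * sqrt (d i)) / of_real (d i))" unfolding gg of_real_mult by simp
  then show ?thesis unfolding ss using d[OF i] by simp
 qed
 define c' where "c' j = cnj (\<gamma> j) * u j" for j
 define v' where "v' = kersum S x (\<lambda>i. c' i * of_real (sqrt (d i)))"
 have gv: "cmod (g z) = cmod (v' z)" if z: "cmod z = 1" for z
 proof -
  have B1: "cmod (BF S x z) = 1" by (rule norm_BF_sphere[OF x z])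
  have Bs: "BF (S - {j}) x z = BF S x z * cnj (bf (x j) z)" if j: "j \<in> S" for j
  proof -
   have "BF S x z = bf (x j) z * BF (S - {j}) x z"
    using BF_insert[of "S - {j}" j x z] S j by (simp add: insert_absorb)
   moreover have "bf (x j) z * cnj (bf (x j) z) = 1" unfolding complex_norm_square[symmetric] norm_bf_sphere[OF x[OF j] z] by simp
   moreover have "bf (x j) z * BF (S - {j}) x z * cnj (bf (x j) z) = (bf (x j) z * cnj (bf (x j) z)) * BF (S - {j}) x z"
    by (simp only: mult_ac)
   ultimately show ?thesis by simp
  qed
  have "g z = BF S x z * (\<Sum>j\<in>S. \<gamma> j * of_real (sqrt (d j)) * (cnj (bf (x j) z) / (1 - cnj (x j) * z)))"
   unfolding g_def sum_distrib_left by (intro sum.cong refl) (simp add: Bs)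
  then have "cmod (g z) = cmod (cnj (\<Sum>j\<in>S. \<gamma> j * of_real (sqrt (d j)) * (cnj (bf (x j) z) / (1 - cnj (x j) * z))))"
   by (simp only: norm_mult B1 mult_1 complex_mod_cnj)
  also have "cnj (\<Sum>j\<in>S. \<gamma> j * of_real (sqrt (d j)) * (cnj (bf (x j) z) / (1 - cnj (x j) * z))) =
    (\<Sum>j\<in>S. cnj (\<gamma> j) * of_real (sqrt (d j)) * cnj (cnj (bf (x j) z) / (1 - cnj (x j) * z)))"
   by (simp only: cnj_sum complex_cnj_mult complex_cnj_complex_of_real)
  also have "\<dots> = (\<Sum>j\<in>S. z * (c' j * of_real (sqrt (d j)) / (1 - cnj (x j) * z)))"
  proof (intro sum.cong refl)
   fix j assume j: "j \<in> S"
   show "cnj (\<gamma> j) * of_real (sqrt (d j)) * cnj (cnj (bf (x j) z) / (1 - cnj (x j) * z)) = z * (c' j * of_real (sqrt (d j)) / (1 - cnj (x j) * z))"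
    unfolding cnj_bf_kernel[OF x[OF j] z] u_def[symmetric] c'_def by (simp add: mult_ac)
  qed
  also have "\<dots> = z * v' z" by (simp add: v'_def kersum_def sum_distrib_left)
  finally show ?thesis using z by (simp add: norm_mult)
 qed
 define K where "K = exp 2 * A / \<beta>"
 have K: "0 < K" using A \<beta> by (simp add: K_def)
 have "h2 g = h2 v'" unfolding h2_def by (simp add: gv)
 also have "\<dots> \<le> exp 2 * A * (\<Sum>i\<in>S. (cmod (c' i))\<^sup>2)" unfolding v'_def
 proof (rule gram_upper_bound[OF S x less_imp_le[OF d] A])
  fix z :: complex assume z: "cmod z < 1"
  have "(\<Sum>i\<in>S. d i * (1 - (cmod z)\<^sup>2) / (cmod (1 - cnj (x i) * z))\<^sup>2) = (\<Sum>i\<in>S. kap z (x i))"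
   by (simp add: kap_def d_def mult.commute)
  also have "\<dots> \<le> A" by (rule kbD[OF k z S]) simp
  finally show "(\<Sum>i\<in>S. d i * (1 - (cmod z)\<^sup>2) / (cmod (1 - cnj (x i) * z))\<^sup>2) \<le> A" .
 qed
 also have "\<dots> \<le> exp 2 * A * (\<Sum>i\<in>S. (cmod (c i))\<^sup>2 / \<beta>)"
 proof (intro mult_left_mono sum_mono)
  fix i assume i: "i \<in> S"
  show "(cmod (c' i))\<^sup>2 \<le> (cmod (c i))\<^sup>2 / \<beta>"
   unfolding c'_def \<gamma>_def norm_mult u1 complex_mod_cnj norm_divide power_mult_distrib power_divide
   using \<beta>(2)[OF i] \<beta>(1) by (simp add: frac_le)
 qed (use A in auto)
 also have "\<dots> = K * (\<Sum>i\<in>S. (cmod (c i))\<^sup>2)" by (simp add: K_def sum_divide_distrib[symmetric])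
 finally have hg: "h2 g \<le> K * (\<Sum>i\<in>S. (cmod (c i))\<^sup>2)" .
 \<comment> \<open>Pairing \<open>g\<close> with \<open>v\<close> returns the sum of the squared
   coefficients. A weighted Cauchy-Schwarz inequality and the bound \<open>hg\<close> then give the
   claim, half of the sum being absorbed.\<close>
 let ?s = "\<Sum>i\<in>S. (cmod (c i))\<^sup>2"
 have "((\<lambda>t. g (cis t) * cnj (v (cis t))) has_integral 2 * of_real pi * (\<Sum>i\<in>S. cnj (c i * of_real (sqrt (d i))) * g (x i))) {-pi..pi}"
  unfolding v_def by (rule kersum_pairing[OF S x g])
 also have "(\<Sum>i\<in>S. cnj (c i * of_real (sqrt (d i))) * g (x i)) = of_real ?s"
  unfolding of_real_sum complex_norm_square
 proof (rule sum.cong[OF refl])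
  fix i assume "i \<in> S"
  have "cnj (c i * of_real (sqrt (d i))) * g (x i) = cnj (c i) * (g (x i) * of_real (sqrt (d i)))" by simp
  then show "cnj (c i * of_real (sqrt (d i))) * g (x i) = c i * cnj (c i)" unfolding gx[OF \<open>i \<in> S\<close>] by simp
 qed
 finally have I: "((\<lambda>t. g (cis t) * cnj (v (cis t))) has_integral of_real (2 * pi * ?s)) {-pi..pi}" by simp
 have gi: "(\<lambda>t. (cmod (g (cis t)))\<^sup>2) integrable_on {-pi..pi}"
  by (intro integrable_on_continuous continuous_intros continuous_on_circle g)
 have vi: "(\<lambda>t. (cmod (v (cis t)))\<^sup>2) integrable_on {-pi..pi}" unfolding v_def
  by (intro integrable_on_continuous continuous_intros continuous_on_circle kersum_analytic x)
 let ?b = "\<lambda>t. 1 / (2 * K) * (cmod (g (cis t)))\<^sup>2 + K / 2 * (cmod (v (cis t)))\<^sup>2"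
 have "norm (integral {-pi..pi} (\<lambda>t. g (cis t) * cnj (v (cis t)))) \<le> integral {-pi..pi} ?b"
 proof (rule integral_norm_bound_integral)
  show "(\<lambda>t. g (cis t) * cnj (v (cis t))) integrable_on {-pi..pi}" using I by blast
  show "?b integrable_on {-pi..pi}" by (intro integrable_add integrable_on_mult_right gi vi)
  fix t
  have "cmod (g (cis t)) * cmod (v (cis t)) = ?b t - (cmod (g (cis t)) - K * cmod (v (cis t)))\<^sup>2 / (2 * K)"
   using K by (simp add: power2_eq_square divide_simps) (simp add: algebra_simps)
  also have "\<dots> \<le> ?b t" using K by simp
  finally show "norm (g (cis t) * cnj (v (cis t))) \<le> ?b t" by (simp add: norm_mult)
 qed
 also have "integral {-pi..pi} ?b = 1 / (2 * K) * (2 * pi * h2 g) + K / 2 * (2 * pi * h2 v)"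
  unfolding h2_def integral_add[OF integrable_on_mult_right[OF gi] integrable_on_mult_right[OF vi]] by simp
 finally have "cmod (of_real (2 * pi * ?s)) \<le> 1 / (2 * K) * (2 * pi * h2 g) + K / 2 * (2 * pi * h2 v)"
  unfolding integral_unique[OF I] .
 moreover have "cmod (of_real (2 * pi * ?s)) = 2 * pi * ?s" unfolding norm_of_real using pi_gt_zero by (simp add: sum_nonneg)
 ultimately have "2 * pi * ?s \<le> 2 * pi * (1 / (2 * K) * h2 g + K / 2 * h2 v)" by (simp add: algebra_simps)
 then have "?s \<le> 1 / (2 * K) * h2 g + K / 2 * h2 v" by (rule mult_left_le_imp_le) simp
 also have "1 / (2 * K) * h2 g \<le> 1 / (2 * K) * (K * ?s)" using hg K by (intro mult_left_mono) auto
 also have "1 / (2 * K) * (K * ?s) = ?s / 2" using K by simp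
 finally have "?s \<le> K * h2 v" by simp
 then show ?thesis unfolding K_def v_def d_def .
qed

lemma h2_kersum_Re:
 assumes "finite S" "\<And>i. i \<in> S ==> cmod (x i) < 1"
 shows "h2 (kersum S x c) = Re (\<Sum>i\<in>S. \<Sum>j\<in>S. c i * cnj (c j) * (1 / (1 - cnj (x i) * x j)))"
proof -
 have "h2 (kersum S x c) = Re (of_real (h2 (kersum S x c)))" by simp
 also have "of_real (h2 (kersum S x c)) = (\<Sum>j\<in>S. cnj (c j) * kersum S x c (x j))" by (rule h2_kersum[OF assms])
 also have "\<dots> = (\<Sum>j\<in>S. \<Sum>i\<in>S. c i * cnj (c j) * (1 / (1 - cnj (x i) * x j)))"
  by (simp add: kersum_def sum_distrib_left mult_ac)
 also have "\<dots> = (\<Sum>i\<in>S. \<Sum>j\<in>S. c i * cnj (c j) * (1 / (1 - cnj (x i) * x j)))" by (rule sum.swap)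
 finally show ?thesis .
qed

section \<open>From Gram bounds to interpolation\<close>

text \<open>The Pick matrix is a difference of two Gram matrices. The adjoint of multiplication by
  the interpolant takes the kernel at \<open>x i\<close> to its multiple by
  \<open>cnj (w i)\<close>, and \<open>H\<close> says that this map has norm less than
  \<open>M\<close> on the span of the kernels.\<close>

lemma kersum_interpolation:
 assumes S: "finite S" and x: "\<And>i. i \<in> S ==> cmod (x i) < 1" and inj: "inj_on x S" and M: "0 < M"
  and H: "\<And>c. \<exists>i\<in>S. c i \<noteq> 0 ==> h2 (kersum S x (\<lambda>i. c i * cnj (w i))) < M\<^sup>2 * h2 (kersum S x c)"
 shows "\<exists>\<phi>. hol_le M \<phi> \<and> (\<forall>i\<in>S. \<phi> (x i) = w i)"
proof -
 let ?w = "\<lambda>i. w i / of_real M"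
 have h: "h2 (kersum S x c) = Re (\<Sum>i\<in>S. \<Sum>j\<in>S. c i * cnj (c j) * (1 / (1 - cnj (x i) * x j)))" for c
  by (rule h2_kersum_Re[OF S x])
 have "spd S (\<lambda>i j. (1 - cnj (?w i) * ?w j) / (1 - cnj (x i) * x j))"
  unfolding spd_def
 proof (intro allI impI)
  fix c :: "nat \<Rightarrow> complex" assume c: "\<exists>i\<in>S. c i \<noteq> 0"
  have "Re (\<Sum>i\<in>S. \<Sum>j\<in>S. c i * cnj (c j) * ((1 - cnj (?w i) * ?w j) / (1 - cnj (x i) * x j))) =
   Re (\<Sum>i\<in>S. \<Sum>j\<in>S. c i * cnj (c j) * (1 / (1 - cnj (x i) * x j))
    - of_real (1 / M\<^sup>2) * ((c i * cnj (w i)) * cnj (c j * cnj (w j)) * (1 / (1 - cnj (x i) * x j))))"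
   by (intro arg_cong[of _ _ Re] sum.cong refl) (use M in \<open>simp add: diff_divide_distrib right_diff_distrib power2_eq_square mult_ac\<close>)
  also have "\<dots> = h2 (kersum S x c) - 1 / M\<^sup>2 * h2 (kersum S x (\<lambda>i. c i * cnj (w i)))"
   unfolding h sum_subtractf minus_complex.sel sum_distrib_left[symmetric] by simp
  also have "\<dots> > 0" using H[OF c] M by (simp add: pos_divide_less_eq mult.commute)
  finally show "0 < Re (\<Sum>i\<in>S. \<Sum>j\<in>S. c i * cnj (c j) * ((1 - cnj (?w i) * ?w j) / (1 - cnj (x i) * x j)))" .
 qed
 from pick_interpolation[OF S x inj this] obtain \<phi> where \<phi>: "hol \<phi>"
  "\<And>z. cmod z < 1 ==> cmod (\<phi> z) \<le> 1" "\<And>i. i \<in> S ==> \<phi> (x i) = ?w i" by blast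
 show ?thesis
 proof (intro exI[of _ "\<lambda>z. of_real M * \<phi> z"] conjI allI impI ballI)
  show "hol (\<lambda>z. of_real M * \<phi> z)" by (intro holomorphic_intros \<phi>)
  show "cmod (of_real M * \<phi> z) \<le> M" if "cmod z < 1" for z using \<phi>(2)[OF that] M by (simp add: norm_mult)
  show "of_real M * \<phi> (x i) = w i" if "i \<in> S" for i using \<phi>(3)[OF that] M by simp
 qed
qed

definition separated :: "real \<Rightarrow> nat set \<Rightarrow> (nat \<Rightarrow> complex) \<Rightarrow> bool" where
 "separated q S x \<longleftrightarrow> (\<forall>i\<in>S. \<forall>j\<in>S. i \<noteq> j \<longrightarrow> kap (x i) (x j) \<le> 1 - q)"

lemma separated_inj:
 assumes "separated q S x" "0 < q" "\<And>i. i \<in> S ==> cmod (x i) < 1"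
 shows "inj_on x S"
proof (rule inj_onI, rule ccontr)
 fix i j assume ij: "i \<in> S" "j \<in> S" "x i = x j" "i \<noteq> j"
 then have "kap (x i) (x j) \<le> 1 - q" using assms(1) unfolding separated_def by blast
 then show False using kap_refl[OF assms(3)[OF ij(1)]] ij(3) assms(2) by simp
qed

lemma kersum_rescale:
 assumes "\<And>i. i \<in> S ==> cmod (x i) < 1"
 shows "kersum S x c = kersum S x (\<lambda>i. c i / of_real (sqrt (1 - (cmod (x i))\<^sup>2)) * of_real (sqrt (1 - (cmod (x i))\<^sup>2)))"
proof
 fix z
 have "sqrt (1 - (cmod (x i))\<^sup>2) \<noteq> 0" if "i \<in> S" for i using one_minus_sq_bounds(3)[OF assms[OF that]] by simp
 then show "kersum S x c z = kersum S x (\<lambda>i. c i / of_real (sqrt (1 - (cmod (x i))\<^sup>2)) * of_real (sqrt (1 - (cmod (x i))\<^sup>2))) z"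
  unfolding kersum_def by (intro sum.cong refl) simp
qed

text \<open>The constant of \<open>gram_lower_bound\<close> for \<beta> =
  \<open>exp (- A / q)\<close>, the value provided by separation.\<close>

definition gramC :: "real \<Rightarrow> real \<Rightarrow> real" where
 "gramC A q = exp 2 * A / exp (- A / q)"

lemma gramC_pos: "0 < A ==> 0 < gramC A q"
 by (simp add: gramC_def)

lemma separated_gram_lower:
 assumes S: "finite S" and x: "\<And>i. i \<in> S ==> cmod (x i) < 1" and k: "kb A S x" and A: "0 < A" and q: "0 < q" and s: "separated q S x"
 shows "(\<Sum>i\<in>S. (cmod (c i))\<^sup>2) \<le> gramC A q * h2 (kersum S x (\<lambda>i. c i * of_real (sqrt (1 - (cmod (x i))\<^sup>2))))"
 unfolding gramC_def
proof (rule gram_lower_bound[OF S x k A])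
 fix j assume j: "j \<in> S"
 have "exp (- A / q) \<le> exp (- (\<Sum>i\<in>S - {j}. kap (x j) (x i)) / q)"
  unfolding exp_le_cancel_iff using kbD[OF k x[OF j], of "S - {j}"] S q by (intro divide_right_mono) auto
 also have "\<dots> \<le> (cmod (BF (S - {j}) x (x j)))\<^sup>2"
  by (rule norm_BF_sq_ge_exp) (use x j q s in \<open>auto simp: separated_def\<close>)
 finally show "exp (- A / q) \<le> (cmod (BF (S - {j}) x (x j)))\<^sup>2" .
qed auto

lemma gram_upper_kb:
 assumes S: "finite S" and x: "\<And>i. i \<in> S ==> cmod (x i) < 1" and k: "kb A S x" and A: "0 < A"
 shows "h2 (kersum S x (\<lambda>i. c i * of_real (sqrt (1 - (cmod (x i))\<^sup>2)))) \<le> exp 2 * A * (\<Sum>i\<in>S. (cmod (c i))\<^sup>2)"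
proof (rule gram_upper_bound[OF S x _ A])
 fix z :: complex assume z: "cmod z < 1"
 have "(\<Sum>i\<in>S. (1 - (cmod (x i))\<^sup>2) * (1 - (cmod z)\<^sup>2) / (cmod (1 - cnj (x i) * z))\<^sup>2) = (\<Sum>i\<in>S. kap z (x i))"
  by (simp add: kap_def mult.commute)
 also have "\<dots> \<le> A" by (rule kbD[OF k z S]) simp
 finally show "(\<Sum>i\<in>S. (1 - (cmod (x i))\<^sup>2) * (1 - (cmod z)\<^sup>2) / (cmod (1 - cnj (x i) * z))\<^sup>2) \<le> A" .
qed (use one_minus_sq_bounds(3) x in \<open>auto intro: less_imp_le\<close>)

lemma h2_kersum_pos:
 assumes S: "finite S" and x: "\<And>i. i \<in> S ==> cmod (x i) < 1" and k: "kb A S x" and A: "0 < A" and q: "0 < q" and s: "separated q S x"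
  and c: "\<exists>i\<in>S. c i \<noteq> 0"
 shows "0 < h2 (kersum S x (\<lambda>i. c i * of_real (sqrt (1 - (cmod (x i))\<^sup>2))))"
proof -
 obtain i where i: "i \<in> S" "c i \<noteq> 0" using c by blast
 have "0 < (\<Sum>i\<in>S. (cmod (c i))\<^sup>2)" by (rule sum_pos2[OF S i(1)]) (use i in auto)
 also have "\<dots> \<le> gramC A q * h2 (kersum S x (\<lambda>i. c i * of_real (sqrt (1 - (cmod (x i))\<^sup>2))))"
  by (rule separated_gram_lower[OF S x k A q s])
 finally show ?thesis using gramC_pos[OF A, of q] by (simp add: zero_less_mult_iff)
qed

theorem carleson_interpolation:
 assumes A: "0 < A" and q: "0 < q"
 shows "\<exists>C>0. \<forall>S x w e. finite S \<and> (\<forall>i\<in>S. cmod (x i) < 1) \<and> kb A S x \<and> separated q S x \<and> 0 < e \<and> (\<forall>i\<in>S. cmod (w i) \<le> e)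
  \<longrightarrow> (\<exists>\<phi>. hol_le (C * e) \<phi> \<and> (\<forall>i\<in>S. \<phi> (x i) = w i))"
proof -
 define K where "K = exp 2 * A * gramC A q"
 have K: "0 < K" using A gramC_pos[OF A] by (simp add: K_def)
 \<comment> \<open>The summand 1 makes the comparison of norms strict, as
   \<open>kersum_interpolation\<close> demands.\<close>
 define C where "C = sqrt (K + 1)"
 have C: "0 < C" "C\<^sup>2 = K + 1" using K by (auto simp: C_def)
 have main: "\<exists>\<phi>. hol_le (C * e) \<phi> \<and> (\<forall>i\<in>S. \<phi> (x i) = w i)"
  if S: "finite S" and x: "\<And>i. i \<in> S ==> cmod (x i) < 1" and k: "kb A S x" and s: "separated q S x" and e: "0 < e"
   and w: "\<And>i. i \<in> S ==> cmod (w i) \<le> e" for S x w e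
 proof (rule kersum_interpolation[OF S x separated_inj[OF s q x]])
  fix c :: "nat \<Rightarrow> complex" assume c: "\<exists>i\<in>S. c i \<noteq> 0"
  define d where "d i = c i / of_real (sqrt (1 - (cmod (x i))\<^sup>2))" for i
  have dn: "\<exists>i\<in>S. d i \<noteq> 0" using c one_minus_sq_bounds(3)[OF x] by (force simp: d_def)
  have kc: "kersum S x c = kersum S x (\<lambda>i. d i * of_real (sqrt (1 - (cmod (x i))\<^sup>2)))"
   unfolding d_def by (rule kersum_rescale[OF x])
  have kw: "kersum S x (\<lambda>i. c i * cnj (w i)) = kersum S x (\<lambda>i. (d i * cnj (w i)) * of_real (sqrt (1 - (cmod (x i))\<^sup>2)))"
   by (subst kersum_rescale[OF x]) (auto simp: d_def)
  have V: "0 < h2 (kersum S x c)" unfolding kc by (rule h2_kersum_pos[OF S x k A q s dn])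
  have "h2 (kersum S x (\<lambda>i. c i * cnj (w i))) \<le> exp 2 * A * (\<Sum>i\<in>S. (cmod (d i * cnj (w i)))\<^sup>2)"
   unfolding kw by (rule gram_upper_kb[OF S x k A])
  also have "\<dots> \<le> exp 2 * A * (\<Sum>i\<in>S. (cmod (d i))\<^sup>2 * e\<^sup>2)"
   using A w by (intro mult_left_mono sum_mono) (auto simp: norm_mult power_mult_distrib intro!: mult_left_mono power_mono)
  also have "\<dots> = exp 2 * A * e\<^sup>2 * (\<Sum>i\<in>S. (cmod (d i))\<^sup>2)" by (simp add: sum_distrib_left[symmetric] sum_distrib_right[symmetric] mult_ac)
  also have "\<dots> \<le> exp 2 * A * e\<^sup>2 * (gramC A q * h2 (kersum S x c))"
   unfolding kc using A by (intro mult_left_mono separated_gram_lower[OF S x k A q s]) auto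
  also have "\<dots> = e\<^sup>2 * h2 (kersum S x c) * K" by (simp add: K_def)
  also have "\<dots> < e\<^sup>2 * h2 (kersum S x c) * (K + 1)" using V e by (intro mult_strict_left_mono mult_pos_pos) auto
  also have "\<dots> = (C * e)\<^sup>2 * h2 (kersum S x c)" unfolding power_mult_distrib C(2) by simp
  finally show "h2 (kersum S x (\<lambda>i. c i * cnj (w i))) < (C * e)\<^sup>2 * h2 (kersum S x c)" .
 qed (use C e in auto)
 show ?thesis by (intro exI[of _ C] conjI allI impI C(1)) (elim conjE, rule main, auto)
qed

section \<open>Differences with kernels at deeper points\<close>

lemma half_den:
 assumes "cmod w \<le> 1" "0 \<le> r" "r \<le> 1"
 shows "cmod (1 - w) / 2 \<le> cmod (1 - of_real r * w)"
proof -
 have "1 - w = (1 - of_real r * w) - of_real (1 - r) * w" by (simp add: algebra_simps)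
 then have "cmod (1 - w) \<le> cmod (1 - of_real r * w) + cmod (of_real (1 - r) * w)" by (metis norm_triangle_ineq4)
 moreover have "cmod (of_real (1 - r) * w) \<le> 1 - r" unfolding norm_mult norm_of_real using assms by (simp add: mult_left_le)
 moreover have "1 - r \<le> cmod (1 - of_real r * w)"
 proof -
  have "cmod (of_real r * w) \<le> r" unfolding norm_mult norm_of_real using assms by (simp add: mult_left_le)
  then show ?thesis using norm_triangle_ineq2[of 1 "of_real r * w"] by simp
 qed
 ultimately show ?thesis by linarith
qed

text \<open>The inner product of two differences, the kernel at \<open>x\<close> minus
  \<open>s\<close> times the kernel at \<open>y\<close> and likewise with primes. In use
  \<open>s\<close> is 0 or 1, and 0 means that the kernel is left as it is because \<open>x\<close>
  lies too far inside the disc to be moved.\<close>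

definition Qk :: "complex \<Rightarrow> complex \<Rightarrow> complex \<Rightarrow> complex \<Rightarrow> complex \<Rightarrow> complex \<Rightarrow> complex" where
 "Qk s x y s' x' y' = 1 / (1 - cnj x * x') - s / (1 - cnj y * x') - s' / (1 - cnj x * y') + s * s' / (1 - cnj y * y')"

text \<open>The numerator contains both differences \<open>p - q\<close> and \<open>u - v\<close>,
  so each of the two shifts gains its own small factor.\<close>

lemma second_difference:
 fixes p q u v :: complex
 assumes "1 - p * u \<noteq> 0" "1 - q * u \<noteq> 0" "1 - p * v \<noteq> 0" "1 - q * v \<noteq> 0"
 shows "1 / (1 - p * u) - 1 / (1 - q * u) - 1 / (1 - p * v) + 1 / (1 - q * v) =
  (p - q) * (u - v) * ((1 - p * u) + p * u * (1 - q * v)) / ((1 - p * u) * (1 - q * u) * (1 - p * v) * (1 - q * v))"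
 using assms by (simp add: divide_simps) (simp add: algebra_simps)

text \<open>Replacing each kernel by its difference with the kernel at a deeper point gains a factor \<open>kap\<close> in the Gram matrix.\<close>
lemma Qk_bound:
 assumes x: "cmod x < 1" "cmod x' < 1" and T: "0 < T"
  and d: "d = 1 - (cmod x)\<^sup>2" "d' = 1 - (cmod x')\<^sup>2"
  and s: "if T * d < 1 / 2 then s = 1 \<and> y = of_real (1 - T * d) * x else s = 0"
  and s': "if T * d' < 1 / 2 then s' = 1 \<and> y' = of_real (1 - T * d') * x' else s' = 0"
 shows "sqrt d * sqrt d' * cmod (Qk s x y s' x' y') \<le> 16 * T\<^sup>2 * (sqrt d * sqrt d' / cmod (1 - cnj x * x')) ^ 3"
proof -
 define D where "D = cmod (1 - cnj x * x')"
 define S where "S = sqrt d * sqrt d'"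
 have dp: "0 < d" "0 < d'" "d \<le> 1" "d' \<le> 1" unfolding d using one_minus_sq_bounds[OF x(1)] one_minus_sq_bounds[OF x(2)] by auto
 have S: "0 < S" "S\<^sup>2 = d * d'" unfolding S_def using dp by (auto simp: power_mult_distrib)
 have xx: "cmod (cnj x * x') \<le> 1" unfolding norm_mult using mult_mono[of "cmod x" 1 "cmod x'" 1] x by simp
 have nz: "1 - cnj x * x' \<noteq> 0" using den_nonzero[of x' x] x by simp
 then have D0: "0 < D" unfolding D_def by simp
 have D2: "D \<le> 2" unfolding D_def using norm_triangle_ineq4[of 1 "cnj x * x'"] xx by simp
 have goal: "S * B \<le> 16 * T\<^sup>2 * (S / D) ^ 3" if "B * D ^ 3 \<le> 16 * T\<^sup>2 * (d * d')" for B
 proof -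
  have "B \<le> 16 * T\<^sup>2 * (d * d') / D ^ 3" using that D0 by (simp add: pos_le_divide_eq)
  then have "S * B \<le> S * (16 * T\<^sup>2 * (d * d') / D ^ 3)" using S by (intro mult_left_mono) auto
  also have "\<dots> = 16 * T\<^sup>2 * (S / D) ^ 3" unfolding S(2)[symmetric] by (simp add: power_divide power2_eq_square power3_eq_cube)
  finally show ?thesis .
 qed
 have h: "D / 2 \<le> cmod (1 - cnj y * x') \<and> cmod (cnj x - cnj y) \<le> T * d" if sh: "T * d < 1 / 2"
 proof -
  have y: "y = of_real (1 - T * d) * x" using s sh by simp
  have r: "0 \<le> 1 - T * d" "1 - T * d \<le> 1" using sh T dp by auto
  have "cnj y * x' = of_real (1 - T * d) * (cnj x * x')" unfolding y by simp
  then have "D / 2 \<le> cmod (1 - cnj y * x')" using half_den[OF xx r] by (simp only: D_def)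
  moreover have "cnj x - cnj y = of_real (T * d) * cnj x" unfolding y by (simp add: algebra_simps)
  then have "cmod (cnj x - cnj y) = T * d * cmod x" using T dp by (simp add: norm_mult)
  then have "cmod (cnj x - cnj y) \<le> T * d" using x T dp by (simp add: mult_left_le)
  ultimately show ?thesis by blast
 qed
 have h': "D / 2 \<le> cmod (1 - cnj x * y') \<and> cmod (x' - y') \<le> T * d'" if sh: "T * d' < 1 / 2"
 proof -
  have y: "y' = of_real (1 - T * d') * x'" using s' sh by simp
  have r: "0 \<le> 1 - T * d'" "1 - T * d' \<le> 1" using sh T dp by auto
  have "cnj x * y' = of_real (1 - T * d') * (cnj x * x')" unfolding y by simp
  then have "D / 2 \<le> cmod (1 - cnj x * y')" using half_den[OF xx r] by (simp only: D_def)
  moreover have "x' - y' = of_real (T * d') * x'" unfolding y by (simp add: algebra_simps)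
  then have "cmod (x' - y') = T * d' * cmod x'" using T dp by (simp add: norm_mult)
  then have "cmod (x' - y') \<le> T * d'" using x T dp by (simp add: mult_left_le)
  ultimately show ?thesis by blast
 qed
 have DD3: "D ^ 3 = D * D\<^sup>2" by (simp add: power2_eq_square power3_eq_cube)
 have "cmod (Qk s x y s' x' y') * D ^ 3 \<le> 16 * T\<^sup>2 * (d * d')"
 proof (cases "T * d < 1 / 2")
  case sh: True
  note H = h[OF sh]
  show ?thesis
  proof (cases "T * d' < 1 / 2")
   case sh': True
   note H' = h'[OF sh']
   define D2' D3 D4 where "D2' = cmod (1 - cnj y * x')" and "D3 = cmod (1 - cnj x * y')" and "D4 = cmod (1 - cnj y * y')"
   have D4: "D / 2 \<le> D4"
   proof -
    have y: "y = of_real (1 - T * d) * x" "y' = of_real (1 - T * d') * x'" using s s' sh sh' by auto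
    have r: "0 \<le> (1 - T * d) * (1 - T * d')" "(1 - T * d) * (1 - T * d') \<le> 1"
     using sh sh' T dp by (auto intro!: mult_le_one mult_nonneg_nonneg)
    have "cnj y * y' = of_real ((1 - T * d) * (1 - T * d')) * (cnj x * x')" unfolding y by simp
    then show ?thesis using half_den[OF xx r] by (simp only: D_def D4_def)
   qed
   have pos: "0 < D2'" "0 < D3" "0 < D4" "D \<le> 2 * D2'" "D \<le> 2 * D3" "D \<le> 2 * D4"
    using H H' D4 D0 unfolding D2'_def D3_def by linarith+
   have ss: "s = 1" "s' = 1" using s s' sh sh' by auto
   have "Qk s x y s' x' y' = (cnj x - cnj y) * (x' - y') * ((1 - cnj x * x') + cnj x * x' * (1 - cnj y * y')) /
     ((1 - cnj x * x') * (1 - cnj y * x') * (1 - cnj x * y') * (1 - cnj y * y'))"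
    unfolding Qk_def ss using nz pos(1-3) unfolding D2'_def D3_def D4_def
    by (subst second_difference[symmetric]) auto
   then have "cmod (Qk s x y s' x' y') = cmod (cnj x - cnj y) * cmod (x' - y') * cmod ((1 - cnj x * x') + cnj x * x' * (1 - cnj y * y')) / (D * D2' * D3 * D4)"
    by (simp only: norm_mult norm_divide D_def D2'_def D3_def D4_def)
   also have "\<dots> \<le> (T * d) * (T * d') * (D + D4) / (D * D2' * D3 * D4)"
   proof (intro divide_right_mono mult_mono)
    have "cmod ((1 - cnj x * x') + cnj x * x' * (1 - cnj y * y')) \<le> D + cmod (cnj x * x') * D4"
     unfolding D_def D4_def norm_mult[symmetric] by (rule norm_triangle_ineq)
    also have "cmod (cnj x * x') * D4 \<le> 1 * D4" using xx pos by (intro mult_right_mono) auto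
    finally show "cmod ((1 - cnj x * x') + cnj x * x' * (1 - cnj y * y')) \<le> D + D4" by simp
   qed (use H H' T dp D0 pos in auto)
   also have "\<dots> = T\<^sup>2 * (d * d') * (1 / (D2' * D3 * D4) + 1 / (D * D2' * D3))"
    using D0 pos by (simp add: power2_eq_square divide_simps)
   finally have "cmod (Qk s x y s' x' y') * D ^ 3 \<le> T\<^sup>2 * (d * d') * (1 / (D2' * D3 * D4) + 1 / (D * D2' * D3)) * D ^ 3"
    using D0 by (intro mult_right_mono) auto
   also have "\<dots> = T\<^sup>2 * (d * d') * (D / D2' * (D / D3) * (D / D4) + D / D2' * (D / D3))"
    using D0 pos by (simp add: power3_eq_cube divide_simps) (simp add: algebra_simps)
   also have "\<dots> \<le> T\<^sup>2 * (d * d') * (2 * 2 * 2 + 2 * 2)"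
    using D0 pos dp by (intro mult_left_mono add_mono mult_mono) (auto simp: pos_divide_le_eq)
   also have "\<dots> \<le> 16 * T\<^sup>2 * (d * d')" using T dp by simp
   finally show ?thesis .
  next
   case False
   then have s0: "s = 1" "s' = 0" using s s' sh by auto
   \<comment> \<open>There is no shift at \<open>x'\<close>, so the gain \<open>T * d'\<close> is
     missing. It is supplied by the trivial bound \<open>D \<le> 2\<close>, since
     \<open>2 \<le> 8 * (T * d')\<close> here.\<close>
   have Td: "1 / 2 \<le> T * d'" using False by simp
   have nz2: "1 - cnj y * x' \<noteq> 0" using H D0 by auto
   have "Qk s x y s' x' y' = (cnj x - cnj y) * x' / ((1 - cnj x * x') * (1 - cnj y * x'))"
    unfolding Qk_def s0 using nz nz2 by (simp add: divide_simps) (simp add: algebra_simps)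
   then have "cmod (Qk s x y s' x' y') = cmod (cnj x - cnj y) * cmod x' / (D * cmod (1 - cnj y * x'))"
    by (simp only: norm_mult norm_divide D_def)
   also have "\<dots> \<le> (T * d) * 1 / (D * (D / 2))"
    using H x D0 T dp by (intro frac_le mult_mono mult_left_mono) auto
   finally have "cmod (Qk s x y s' x' y') * D ^ 3 \<le> (T * d) * 1 / (D * (D / 2)) * D ^ 3" using D0 by (intro mult_right_mono) auto
   also have "\<dots> = 2 * (T * d) * D" using D0 by (simp add: power3_eq_cube)
   also have "\<dots> \<le> 2 * (T * d) * (8 * (T * d'))" using D2 Td T dp by (intro mult_left_mono) auto
   also have "\<dots> = 16 * T\<^sup>2 * (d * d')" by (simp add: power2_eq_square)
   finally show ?thesis .
  qed
 next
  case de: False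
  then have s0: "s = 0" using s by auto
  have Td: "1 / 2 \<le> T * d" using de by simp
  show ?thesis
  proof (cases "T * d' < 1 / 2")
   case sh': True
   note H' = h'[OF sh']
   have s1: "s' = 1" using s' sh' by auto
   have nz2: "1 - cnj x * y' \<noteq> 0" using H' D0 by auto
   have "Qk s x y s' x' y' = cnj x * (x' - y') / ((1 - cnj x * x') * (1 - cnj x * y'))"
    unfolding Qk_def s0 s1 using nz nz2 by (simp add: divide_simps) (simp add: algebra_simps)
   then have "cmod (Qk s x y s' x' y') = cmod x * cmod (x' - y') / (D * cmod (1 - cnj x * y'))"
    by (simp only: norm_mult norm_divide D_def complex_mod_cnj)
   also have "\<dots> \<le> 1 * (T * d') / (D * (D / 2))"
    using H' x D0 T dp by (intro frac_le mult_mono mult_left_mono) auto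
   finally have "cmod (Qk s x y s' x' y') * D ^ 3 \<le> 1 * (T * d') / (D * (D / 2)) * D ^ 3" using D0 by (intro mult_right_mono) auto
   also have "\<dots> = 2 * (T * d') * D" using D0 by (simp add: power3_eq_cube)
   also have "\<dots> \<le> 2 * (T * d') * (8 * (T * d))" using D2 Td T dp by (intro mult_left_mono) auto
   also have "\<dots> = 16 * T\<^sup>2 * (d * d')" by (simp add: power2_eq_square)
   finally show ?thesis .
  next
   case False
   then have s1: "s' = 0" using s' by auto
   have Td': "1 / 2 \<le> T * d'" using False by simp
   have "cmod (Qk s x y s' x' y') = 1 / D" unfolding Qk_def s0 s1 D_def by (simp add: norm_divide)
   then have "cmod (Qk s x y s' x' y') * D ^ 3 = D\<^sup>2" using D0 by (simp add: power3_eq_cube power2_eq_square)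
   also have "\<dots> \<le> 2\<^sup>2" using D2 D0 by (intro power_mono) auto
   also have "\<dots> = 16 * ((1 / 2) * (1 / 2))" by simp
   also have "\<dots> \<le> 16 * ((T * d) * (T * d'))" using Td Td' by (intro mult_left_mono mult_mono) auto
   also have "\<dots> = 16 * T\<^sup>2 * (d * d')" by (simp add: power2_eq_square)
   finally show ?thesis .
  qed
 qed
 from goal[OF this] show ?thesis unfolding S_def D_def .
qed

lemma h2_diff_kersum:
 assumes S: "finite S" and x: "\<And>i. i \<in> S ==> cmod (x i) < 1" and y: "\<And>i. i \<in> S ==> cmod (y i) < 1" and s: "\<And>i. cnj (s i) = s i"
 shows "of_real (h2 (\<lambda>z. kersum S x a z - kersum S y (\<lambda>i. s i * a i) z)) =
  (\<Sum>i\<in>S. \<Sum>j\<in>S. cnj (a i) * a j * Qk (s j) (x j) (y j) (s i) (x i) (y i))"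
proof -
 let ?b = "\<lambda>i. s i * a i"
 define F where "F z = kersum S x a z - kersum S y ?b z" for z
 have F: "continuous_on (cball 0 1) F" "hol F" unfolding F_def[abs_def]
  by (intro continuous_intros holomorphic_intros kersum_analytic x y; assumption)+
 have "((\<lambda>t. F (cis t) * cnj (kersum S x a (cis t)) - F (cis t) * cnj (kersum S y ?b (cis t))) has_integral
   2 * of_real pi * (\<Sum>i\<in>S. cnj (a i) * F (x i)) - 2 * of_real pi * (\<Sum>i\<in>S. cnj (?b i) * F (y i))) {-pi..pi}"
  by (intro has_integral_diff kersum_pairing S x y F)
 moreover have "F (cis t) * cnj (kersum S x a (cis t)) - F (cis t) * cnj (kersum S y ?b (cis t)) = of_real ((cmod (F (cis t)))\<^sup>2)" for t
  unfolding complex_norm_square by (simp add: F_def right_diff_distrib)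
 moreover have "((\<lambda>t. complex_of_real ((cmod (F (cis t)))\<^sup>2)) has_integral of_real (integral {-pi..pi} (\<lambda>t. (cmod (F (cis t)))\<^sup>2))) {-pi..pi}"
  by (intro has_integral_of_real integrable_integral integrable_on_continuous continuous_intros continuous_on_circle F)
 ultimately have "of_real (integral {-pi..pi} (\<lambda>t. (cmod (F (cis t)))\<^sup>2)) =
   2 * of_real pi * (\<Sum>i\<in>S. cnj (a i) * F (x i)) - 2 * of_real pi * (\<Sum>i\<in>S. cnj (?b i) * F (y i))"
  by (metis (no_types, lifting) has_integral_unique has_integral_cong)
 then have "of_real (h2 F) = (\<Sum>i\<in>S. cnj (a i) * F (x i)) - (\<Sum>i\<in>S. cnj (?b i) * F (y i))"
  unfolding h2_def right_diff_distrib[symmetric] by simp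
 also have "\<dots> = (\<Sum>i\<in>S. cnj (a i) * (F (x i) - s i * F (y i)))"
  by (simp add: s sum_subtractf right_diff_distrib mult_ac)
 also have "\<dots> = (\<Sum>i\<in>S. \<Sum>j\<in>S. cnj (a i) * a j * Qk (s j) (x j) (y j) (s i) (x i) (y i))"
 proof (rule sum.cong[OF refl])
  fix i
  have "F (x i) - s i * F (y i) = (\<Sum>j\<in>S. a j * Qk (s j) (x j) (y j) (s i) (x i) (y i))"
   unfolding F_def kersum_def sum_distrib_left sum_subtractf[symmetric]
   by (intro sum.cong refl) (simp add: Qk_def algebra_simps)
  then show "cnj (a i) * (F (x i) - s i * F (y i)) = (\<Sum>j\<in>S. cnj (a i) * a j * Qk (s j) (x j) (y j) (s i) (x i) (y i))"
   by (simp add: sum_distrib_left mult_ac)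
 qed
 finally show ?thesis unfolding F_def .
qed

lemma schur_row_bound:
 fixes m :: "nat \<Rightarrow> nat \<Rightarrow> real" and c :: "nat \<Rightarrow> real"
 assumes "finite S" "\<And>i j. i \<in> S ==> j \<in> S ==> 0 \<le> m i j" "\<And>i. i \<in> S ==> (\<Sum>j\<in>S. m i j) \<le> G" "\<And>j. j \<in> S ==> (\<Sum>i\<in>S. m i j) \<le> G"
 shows "(\<Sum>i\<in>S. \<Sum>j\<in>S. c i * c j * m i j) \<le> G * (\<Sum>i\<in>S. (c i)\<^sup>2)"
proof -
 have "(\<Sum>i\<in>S. \<Sum>j\<in>S. c i * c j * m i j) \<le> (\<Sum>i\<in>S. \<Sum>j\<in>S. (c i)\<^sup>2 / 2 * m i j + (c j)\<^sup>2 / 2 * m i j)"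
 proof (intro sum_mono)
  fix i j assume ij: "i \<in> S" "j \<in> S"
  have "c i * c j \<le> (c i)\<^sup>2 / 2 + (c j)\<^sup>2 / 2" using zero_le_power2[of "c i - c j"] by (simp add: power2_eq_square algebra_simps)
  from mult_right_mono[OF this assms(2)[OF ij]] show "c i * c j * m i j \<le> (c i)\<^sup>2 / 2 * m i j + (c j)\<^sup>2 / 2 * m i j"
   by (simp add: distrib_right)
 qed
 also have "\<dots> = (\<Sum>i\<in>S. \<Sum>j\<in>S. (c i)\<^sup>2 / 2 * m i j) + (\<Sum>j\<in>S. \<Sum>i\<in>S. (c j)\<^sup>2 / 2 * m i j)"
  unfolding sum.distrib by (subst (2) sum.swap) simp
 also have "\<dots> = (\<Sum>i\<in>S. (c i)\<^sup>2 / 2 * (\<Sum>j\<in>S. m i j)) + (\<Sum>j\<in>S. (c j)\<^sup>2 / 2 * (\<Sum>i\<in>S. m i j))"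
  by (simp only: sum_distrib_left)
 also have "\<dots> \<le> (\<Sum>i\<in>S. (c i)\<^sup>2 / 2 * G) + (\<Sum>j\<in>S. (c j)\<^sup>2 / 2 * G)"
  by (intro add_mono sum_mono mult_left_mono assms) auto
 also have "\<dots> = G * (\<Sum>i\<in>S. (c i)\<^sup>2)"
  unfolding sum.distrib[symmetric] sum_distrib_left by (intro sum.cong refl) simp
 finally show ?thesis .
qed

section \<open>Sharp inversion modulo a Blaschke product\<close>

text \<open>The condition \<open>bsm\<close> with an explicit modulus \<tau>. Constants may then
  depend on \<tau> alone, uniformly over all finite sets and nets that share it.\<close>

definition far_small :: "(real \<Rightarrow> real) \<Rightarrow> nat set \<Rightarrow> (nat \<Rightarrow> complex) \<Rightarrow> bool" where
 "far_small \<tau> S x \<longleftrightarrow> (\<forall>\<eta>>0. \<forall>z F. far S x (\<tau> \<eta>) z F \<longrightarrow> (\<Sum>j\<in>F. kap z (x j)) \<le> \<eta>)"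

lemma far_smallD:
 assumes "far_small \<tau> S x" "\<eta> > 0" "cmod z < 1" "finite F" "F \<subseteq> S" "\<And>j. j \<in> F ==> kap z (x j) \<le> \<tau> \<eta>"
 shows "(\<Sum>j\<in>F. kap z (x j)) \<le> \<eta>"
 using assms unfolding far_small_def by blast

text \<open>The kernels at the deeper points \<open>y i\<close> form a system of small norm: the mass \<open>d i\<close> at \<open>y i\<close> is a small
 fraction of \<open>1 - |y i|\<^sup>2\<close>, which controls the few near points, and the far ones are controlled by \<open>far_small\<close>.\<close>
lemma deep_kernels_small:
 assumes S: "finite S" and x: "\<And>i. i \<in> S ==> cmod (x i) < 1" and k: "kb A S x" and fs: "far_small \<tau> S x"
  and \<eta>: "0 < \<eta>" "0 < \<tau> \<eta>" and T: "0 < T" and \<kappa>: "0 < \<kappa>" "4 * \<eta> + A / \<tau> \<eta> / T \<le> \<kappa>"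
  and d: "\<And>i. d i = 1 - (cmod (x i))\<^sup>2"
  and s: "\<And>i. s i = (if T * d i < 1 / 2 then 1 else 0)" and y: "\<And>i. y i = (if T * d i < 1 / 2 then of_real (1 - T * d i) * x i else 0)"
 shows "h2 (kersum S y (\<lambda>i. s i * (b i * of_real (sqrt (d i))))) \<le> exp 2 * \<kappa> * (\<Sum>i\<in>S. (cmod (b i))\<^sup>2)"
proof -
 define S' where "S' = {i\<in>S. T * d i < 1 / 2}"
 have S': "finite S'" "S' \<subseteq> S" using S by (auto simp: S'_def)
 have d0: "0 < d i" "d i \<le> 1" if "i \<in> S" for i unfolding d using one_minus_sq_bounds[OF x[OF that]] by auto
 have r: "0 \<le> 1 - T * d i" "1 - T * d i \<le> 1" if "i \<in> S'" for i using that d0[of i] T by (auto simp: S'_def)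
 have yy: "y i = of_real (1 - T * d i) * x i" if "i \<in> S'" for i using that by (simp add: y S'_def)
 have ny: "cmod (y i) \<le> 1 - T * d i" if "i \<in> S'" for i
 proof -
  have "i \<in> S" using that S' by blast
  have "cmod (y i) = (1 - T * d i) * cmod (x i)" unfolding yy[OF that] norm_mult norm_of_real using r[OF that] by simp
  also have "\<dots> \<le> (1 - T * d i) * 1" using x[OF \<open>i \<in> S\<close>] r[OF that] by (intro mult_left_mono) auto
  finally show ?thesis by simp
 qed
 have y1: "cmod (y i) < 1" if "i \<in> S'" for i
 proof -
  have "0 < T * d i" using that S' d0 T by auto
  then show ?thesis using ny[OF that] by linarith
 qed
 have C: "(\<Sum>i\<in>S'. d i * (1 - (cmod z)\<^sup>2) / (cmod (1 - cnj (y i) * z))\<^sup>2) \<le> \<kappa>" if z: "cmod z < 1" for z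
 proof -
  let ?t = "\<lambda>i. d i * (1 - (cmod z)\<^sup>2) / (cmod (1 - cnj (y i) * z))\<^sup>2"
  have z0: "0 < 1 - (cmod z)\<^sup>2" by (rule one_minus_sq_bounds(3)[OF z])
  have t1: "?t i \<le> 4 * kap z (x i)" if i: "i \<in> S'" for i
  proof -
   have iS: "i \<in> S" using i S' by blast
   have w1: "cmod (cnj (x i) * z) \<le> 1" unfolding norm_mult using mult_mono[of "cmod (x i)" 1 "cmod z" 1] x[OF iS] z by simp
   have "cnj (y i) * z = of_real (1 - T * d i) * (cnj (x i) * z)" unfolding yy[OF i] by simp
   then have h: "cmod (1 - cnj (x i) * z) / 2 \<le> cmod (1 - cnj (y i) * z)" using half_den[OF w1 r[OF i]] by (simp only:)
   have p: "0 < cmod (1 - cnj (x i) * z)" using den_nonzero[of z "x i"] z x[OF iS] by simp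
   have "?t i \<le> d i * (1 - (cmod z)\<^sup>2) / (cmod (1 - cnj (x i) * z) / 2)\<^sup>2"
    using h p d0[OF iS] z0 by (intro divide_left_mono power_mono mult_nonneg_nonneg mult_pos_pos) auto
   also have "\<dots> = 4 * kap z (x i)" unfolding kap_def d by (simp add: power_divide mult_ac)
   finally show ?thesis .
  qed
  have t2: "?t i \<le> 1 / T" if i: "i \<in> S'" for i
  proof -
   have iS: "i \<in> S" using i S' by blast
   have p: "0 < (cmod (1 - cnj (y i) * z))\<^sup>2" using den_nonzero[of z "y i"] z y1[OF i] by simp
   have "T * d i \<le> 1 - cmod (y i)" using ny[OF i] by linarith
   also have "\<dots> \<le> 1 - (cmod (y i))\<^sup>2" by (rule one_minus_sq_bounds(1)[OF y1[OF i]])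
   finally have "T * d i * (1 - (cmod z)\<^sup>2) \<le> (1 - (cmod (y i))\<^sup>2) * (1 - (cmod z)\<^sup>2)" using z0 by (intro mult_right_mono) auto
   moreover have "(1 - (cmod z)\<^sup>2) * (1 - (cmod (y i))\<^sup>2) / (cmod (1 - cnj (y i) * z))\<^sup>2 \<le> 1"
    using kap_le_1[OF z y1[OF i]] unfolding kap_def .
   then have "(1 - (cmod z)\<^sup>2) * (1 - (cmod (y i))\<^sup>2) \<le> (cmod (1 - cnj (y i) * z))\<^sup>2" using p by (simp add: pos_divide_le_eq)
   ultimately have "T * d i * (1 - (cmod z)\<^sup>2) \<le> (cmod (1 - cnj (y i) * z))\<^sup>2" by (simp only: mult.commute[of "1 - (cmod z)\<^sup>2"])
   then have "T * ?t i \<le> 1" using p by (simp add: mult.assoc)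
   then show ?thesis using T by (simp add: pos_le_divide_eq mult.commute)
  qed
  define N where "N = {i\<in>S'. \<tau> \<eta> \<le> kap z (x i)}"
  have N: "finite N" "N \<subseteq> S'" using S' by (auto simp: N_def)
  have k': "kb A S' x" by (rule kb_subset[OF k S'(2)])
  have "(\<Sum>i\<in>S'. ?t i) = (\<Sum>i\<in>S' - N. ?t i) + (\<Sum>i\<in>N. ?t i)" by (rule sum.subset_diff[OF N(2) S'(1)])
  also have "\<dots> \<le> (\<Sum>i\<in>S' - N. 4 * kap z (x i)) + (\<Sum>i\<in>N. 1 / T)"
   using N by (intro add_mono sum_mono t1 t2) auto
  also have "\<dots> = 4 * (\<Sum>i\<in>S' - N. kap z (x i)) + real (card N) / T" by (simp add: sum_distrib_left)
  also have "\<dots> \<le> 4 * \<eta> + A / \<tau> \<eta> / T"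
  proof (intro add_mono mult_left_mono divide_right_mono)
   show "(\<Sum>i\<in>S' - N. kap z (x i)) \<le> \<eta>"
    by (rule far_smallD[OF fs \<eta>(1) z]) (use S' in \<open>auto simp: N_def\<close>)
   show "real (card N) \<le> A / \<tau> \<eta>" unfolding N_def by (rule card_near_zeros(2)[OF k' z \<eta>(2)])
  qed (use T in auto)
  finally show ?thesis using \<kappa>(2) by linarith
 qed
 have "kersum S y (\<lambda>i. s i * (b i * of_real (sqrt (d i)))) = kersum S' y (\<lambda>i. b i * of_real (sqrt (d i)))"
  unfolding kersum_def by (rule ext, rule sum.mono_neutral_cong_right) (use S in \<open>auto simp: S'_def s\<close>)
 then have "h2 (kersum S y (\<lambda>i. s i * (b i * of_real (sqrt (d i))))) \<le> exp 2 * \<kappa> * (\<Sum>i\<in>S'. (cmod (b i))\<^sup>2)"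
 proof (simp only:)
  show "h2 (kersum S' y (\<lambda>i. b i * of_real (sqrt (d i)))) \<le> exp 2 * \<kappa> * (\<Sum>i\<in>S'. (cmod (b i))\<^sup>2)"
  proof (rule gram_upper_bound[OF S'(1) _ _ \<kappa>(1)])
   show "cmod (y i) < 1" if "i \<in> S'" for i by (rule y1[OF that])
   show "0 \<le> d i" if "i \<in> S'" for i using d0[of i] S' that by auto
  qed (rule C)
 qed
 also have "\<dots> \<le> exp 2 * \<kappa> * (\<Sum>i\<in>S. (cmod (b i))\<^sup>2)"
  using S S' \<kappa> by (intro mult_left_mono sum_mono2) auto
 finally show ?thesis .
qed

abbreviation sharp_data :: "real \<Rightarrow> real \<Rightarrow> (real \<Rightarrow> real) \<Rightarrow> real \<Rightarrow> nat set \<Rightarrow> (nat \<Rightarrow> complex) \<Rightarrow> (complex \<Rightarrow> complex) \<Rightarrow> bool" where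
 "sharp_data A q \<tau> \<delta> S x f \<equiv> finite S \<and> (\<forall>i\<in>S. cmod (x i) < 1) \<and> kb A S x \<and> separated q S x \<and> far_small \<tau> S x \<and>
   hol f \<and> (\<forall>z. cmod z < 1 \<longrightarrow> cmod (f z) < 1) \<and> (\<forall>i\<in>S. 1 - \<delta> \<le> cmod (f (x i)))"

text \<open>What has to be shown is \<open>h2 v < M\<^sup>2 * h2 w\<close>, where the coefficients
  of \<open>w\<close> are those of \<open>v\<close> times \<open>cnj (f (x i))\<close>. Removing the
  deep kernels \<open>sv\<close> and \<open>sw\<close> changes both norms little, and the norms of
  the remainders \<open>qv\<close> and \<open>qw\<close> are compared entry by entry.\<close>

theorem sharp_inverse_interpolation:
 assumes A: "0 < A" and q: "0 < q" and M: "1 < M" and \<tau>: "\<And>\<eta>. \<eta> > 0 ==> \<tau> \<eta> > 0"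
 shows "\<exists>\<delta>>0. \<forall>S x f. sharp_data A q \<tau> \<delta> S x f \<longrightarrow>
   (\<exists>\<phi>. hol_le M \<phi> \<and> (\<forall>i\<in>S. f (x i) * \<phi> (x i) = 1))"
proof -
 have M2: "1 < M\<^sup>2" using M by (simp add: one_less_power)
 \<comment> \<open>The final estimate is
   \<open>(1 - lam) * h2 v \<le> (1 + lam)\<^sup>2 * h2 w\<close>, so \<open>lam\<close> is chosen
   to satisfy \<open>lamM\<close>.\<close>
 define lam where "lam = min (1 / 2) ((M\<^sup>2 - 1) / (2 * (3 + M\<^sup>2)))"
 have lam: "0 < lam" "lam \<le> 1 / 2" using M2 by (auto simp: lam_def)
 have lamM: "(1 + lam)\<^sup>2 < M\<^sup>2 * (1 - lam)"
 proof -
  define m where "m = M\<^sup>2"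
  have m: "1 < m" using M2 by (simp add: m_def)
  have "lam \<le> (m - 1) / (2 * (3 + m))" by (simp add: lam_def m_def)
  then have "lam * (2 * (3 + m)) \<le> m - 1" using m by (simp add: pos_le_divide_eq)
  then have 1: "2 * (3 * lam + lam * m) \<le> m - 1" by (simp add: algebra_simps)
  have gen: "1 + x < m - y" if "2 * (x + y) \<le> m - 1" "0 < x + y" for x y :: real using that by argo
  have 2: "0 < 3 * lam + lam * m" using lam m by (intro add_pos_pos mult_pos_pos) auto
  have "lam * lam \<le> lam * 1" using lam by (intro mult_left_mono) auto
  then have "(1 + lam)\<^sup>2 \<le> 1 + 3 * lam" by (simp add: power2_eq_square algebra_simps)
  also have "\<dots> < m - lam * m" by (rule gen[OF 1 2])
  also have "\<dots> = m * (1 - lam)" by (simp add: algebra_simps)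
  finally show ?thesis unfolding m_def .
 qed
 define G where "G = gramC A q"
 have G: "0 < G" unfolding G_def by (rule gramC_pos[OF A])
 \<comment> \<open>The parameters are fixed in the order \<kappa>, \<eta>, \<open>T\<close>,
   \<delta>. With \<kappa> the deep kernels cost \<open>lam\<^sup>2 / 12\<close> of
   \<open>h2 v\<close>; \<eta> and \<open>T\<close> each use up half of \<kappa>; \<delta> comes
   last because it has to compensate \<open>T\<^sup>2\<close>.\<close>
 define \<kappa> where "\<kappa> = lam\<^sup>2 / (12 * exp 2 * G)"
 have \<kappa>: "0 < \<kappa>" "exp 2 * \<kappa> * G = lam\<^sup>2 / 12" using lam G by (auto simp: \<kappa>_def)
 define \<eta> where "\<eta> = \<kappa> / 8"
 have \<eta>: "0 < \<eta>" using \<kappa> by (simp add: \<eta>_def)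
 have t: "0 < \<tau> \<eta>" by (rule \<tau>[OF \<eta>])
 define T where "T = 2 * A / (\<tau> \<eta> * \<kappa>)"
 have T: "0 < T" unfolding T_def using A t \<kappa> by simp
 have T\<kappa>: "4 * \<eta> + A / \<tau> \<eta> / T \<le> \<kappa>" unfolding T_def \<eta>_def using A t[unfolded \<eta>_def] \<kappa> by simp
 define \<delta> where "\<delta> = min (1 / 2) (lam / (4 * G * (32 * T\<^sup>2 * A)))"
 have \<delta>: "0 < \<delta>" "\<delta> \<le> 1 / 2" using lam G T A by (auto simp: \<delta>_def)
 have \<delta>G: "32 * T\<^sup>2 * \<delta> * A * G \<le> lam / 4"
 proof -
  have p: "0 < 4 * G * (32 * T\<^sup>2 * A)" using G T A by simp
  have "\<delta> \<le> lam / (4 * G * (32 * T\<^sup>2 * A))" by (simp add: \<delta>_def)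
  then have "\<delta> * (4 * G * (32 * T\<^sup>2 * A)) \<le> lam" using p by (simp only: pos_le_divide_eq)
  then show ?thesis by (simp add: mult_ac)
 qed
 have main: "\<exists>\<phi>. hol_le M \<phi> \<and> (\<forall>i\<in>S. \<phi> (x i) = 1 / f (x i))"
  if S: "finite S" and x: "\<And>i. i \<in> S ==> cmod (x i) < 1" and k: "kb A S x" and sep: "separated q S x" and fs: "far_small \<tau> S x"
   and f: "hol f" "\<And>z. cmod z < 1 ==> cmod (f z) < 1" and fx: "\<And>i. i \<in> S ==> 1 - \<delta> \<le> cmod (f (x i))"
  for S x f
 proof (rule kersum_interpolation[OF S x separated_inj[OF sep q x]])
  fix c :: "nat \<Rightarrow> complex" assume c: "\<exists>i\<in>S. c i \<noteq> 0"
  have f0: "f (x i) \<noteq> 0" if "i \<in> S" for i using fx[OF that] \<delta> by auto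
  define d where "d i = 1 - (cmod (x i))\<^sup>2" for i
  have d0: "0 < d i" if "i \<in> S" for i unfolding d_def by (rule one_minus_sq_bounds(3)[OF x[OF that]])
  define b where "b i = c i * cnj (1 / f (x i)) / of_real (sqrt (d i))" for i
  define b' where "b' i = b i * cnj (f (x i))" for i
  define s :: "nat \<Rightarrow> complex" where "s i = (if T * d i < 1 / 2 then 1 else 0)" for i
  define y where "y i = (if T * d i < 1 / 2 then of_real (1 - T * d i) * x i else 0)" for i
  have y1: "cmod (y i) < 1" if i: "i \<in> S" for i
  proof (cases "T * d i < 1 / 2")
   case True
   have "0 < T * d i" using d0[OF i] T by simp
   have "cmod (y i) = (1 - T * d i) * cmod (x i)" unfolding y_def using True \<open>0 < T * d i\<close> by (simp add: norm_mult del: of_real_diff of_real_mult)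
   also have "\<dots> \<le> 1 * cmod (x i)" using True \<open>0 < T * d i\<close> by (intro mult_right_mono) auto
   finally show ?thesis using x[OF i] by simp
  qed (simp add: y_def)
  let ?a = "\<lambda>i. b i * of_real (sqrt (d i))" and ?a' = "\<lambda>i. b' i * of_real (sqrt (d i))"
  define v w where "v = kersum S x ?a" and "w = kersum S x ?a'"
  define sv sw where "sv = kersum S y (\<lambda>i. s i * ?a i)" and "sw = kersum S y (\<lambda>i. s i * ?a' i)"
  define qv qw where "qv z = v z - sv z" and "qw z = w z - sw z" for z
  have vc: "v = kersum S x (\<lambda>i. c i * cnj (1 / f (x i)))"
  proof (unfold v_def kersum_def, rule ext, rule sum.cong[OF refl])
   fix z i assume "i \<in> S"
   then have "sqrt (d i) \<noteq> 0" using d0 by fastforce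
   then show "b i * of_real (sqrt (d i)) / (1 - cnj (x i) * z) = c i * cnj (1 / f (x i)) / (1 - cnj (x i) * z)" by (simp add: b_def)
  qed
  have wc: "w = kersum S x c"
  proof (unfold w_def kersum_def, rule ext, rule sum.cong[OF refl])
   fix z i assume i: "i \<in> S"
   then have "sqrt (d i) \<noteq> 0" using d0 by fastforce
   then show "b' i * of_real (sqrt (d i)) / (1 - cnj (x i) * z) = c i / (1 - cnj (x i) * z)" using f0[OF i] by (simp add: b_def b'_def)
  qed
  have cont: "continuous_on (cball 0 1) v" "continuous_on (cball 0 1) w" "continuous_on (cball 0 1) sv" "continuous_on (cball 0 1) sw"
   unfolding v_def w_def sv_def sw_def using x y1 by (auto intro: kersum_analytic)
  have contq: "continuous_on (cball 0 1) qv" "continuous_on (cball 0 1) qw"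
   unfolding qv_def[abs_def] qw_def[abs_def] by (intro continuous_intros cont)+
  define \<Sigma> where "\<Sigma> = (\<Sum>i\<in>S. (cmod (b i))\<^sup>2)"
  have \<Sigma>0: "0 \<le> \<Sigma>" unfolding \<Sigma>_def by (intro sum_nonneg) auto
  have bn: "\<exists>i\<in>S. b i \<noteq> 0" using c f0 d0 unfolding b_def by (force simp: d_def)
  have \<Sigma>V: "\<Sigma> \<le> G * h2 v" unfolding \<Sigma>_def G_def v_def d_def by (rule separated_gram_lower[OF S x k A q sep])
  have V: "0 < h2 v" unfolding v_def d_def by (rule h2_kersum_pos[OF S x k A q sep bn])
  have small: "exp 2 * \<kappa> * \<Sigma> \<le> lam\<^sup>2 / 12 * h2 v"
   using mult_left_mono[OF \<Sigma>V, of "exp 2 * \<kappa>"] \<kappa> by (simp add: mult.assoc[symmetric])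
  have svb: "h2 sv \<le> lam\<^sup>2 / 12 * h2 v"
  proof -
   have "h2 sv \<le> exp 2 * \<kappa> * \<Sigma>" unfolding sv_def \<Sigma>_def
    by (rule deep_kernels_small[OF S x k fs \<eta> t T \<kappa>(1) T\<kappa> d_def s_def y_def])
   then show ?thesis using small by linarith
  qed
  have swb: "h2 sw \<le> lam\<^sup>2 / 12 * h2 v"
  proof -
   have "h2 sw \<le> exp 2 * \<kappa> * (\<Sum>i\<in>S. (cmod (b' i))\<^sup>2)" unfolding sw_def
    by (rule deep_kernels_small[OF S x k fs \<eta> t T \<kappa>(1) T\<kappa> d_def s_def y_def])
   also have "(\<Sum>i\<in>S. (cmod (b' i))\<^sup>2) \<le> \<Sigma>" unfolding \<Sigma>_def
   proof (rule sum_mono)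
    fix i assume i: "i \<in> S"
    have "cmod (b' i) \<le> cmod (b i) * 1" unfolding b'_def norm_mult using f(2)[OF x[OF i]] by (intro mult_left_mono) auto
    then show "(cmod (b' i))\<^sup>2 \<le> (cmod (b i))\<^sup>2" by (intro power_mono) auto
   qed
   then have "exp 2 * \<kappa> * (\<Sum>i\<in>S. (cmod (b' i))\<^sup>2) \<le> exp 2 * \<kappa> * \<Sigma>" using \<kappa> by (intro mult_left_mono) auto
   finally show ?thesis using small by linarith
  qed
  have diff: "h2 qv - h2 qw \<le> lam / 4 * h2 v"
  proof -
   let ?Q = "\<lambda>i j. Qk (s j) (x j) (y j) (s i) (x i) (y i)"
   have cs: "cnj (s i) = s i" for i by (simp add: s_def)
   have "qv = (\<lambda>z. kersum S x ?a z - kersum S y (\<lambda>i. s i * ?a i) z)" by (rule ext) (simp only: qv_def v_def sv_def)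
   then have q1: "of_real (h2 qv) = (\<Sum>i\<in>S. \<Sum>j\<in>S. cnj (?a i) * ?a j * ?Q i j)"
    using h2_diff_kersum[OF S _ _ cs, where x = x and y = y and a = ?a] x y1 by simp
   have "qw = (\<lambda>z. kersum S x ?a' z - kersum S y (\<lambda>i. s i * ?a' i) z)" by (rule ext) (simp only: qw_def w_def sw_def)
   then have q2: "of_real (h2 qw) = (\<Sum>i\<in>S. \<Sum>j\<in>S. cnj (?a' i) * ?a' j * ?Q i j)"
    using h2_diff_kersum[OF S _ _ cs, where x = x and y = y and a = ?a'] x y1 by simp
   note qq = q1 q2
   have "h2 qv - h2 qw = Re (of_real (h2 qv) - of_real (h2 qw))" by simp
   also have "of_real (h2 qv) - of_real (h2 qw) = (\<Sum>i\<in>S. \<Sum>j\<in>S. cnj (?a i) * ?a j * (1 - f (x i) * cnj (f (x j))) * ?Q i j)"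
    unfolding qq sum_subtractf[symmetric] by (intro sum.cong refl) (simp add: b'_def algebra_simps)
   also have "Re \<dots> \<le> (\<Sum>i\<in>S. \<Sum>j\<in>S. cmod (cnj (?a i) * ?a j * (1 - f (x i) * cnj (f (x j))) * ?Q i j))"
    by (rule order_trans[OF complex_Re_le_cmod sum_norm_le[OF norm_sum]])
   also have "\<dots> \<le> (\<Sum>i\<in>S. \<Sum>j\<in>S. cmod (b i) * cmod (b j) * (32 * T\<^sup>2 * \<delta> * kap (x i) (x j)))"
   proof (intro sum_mono)
    fix i j assume i: "i \<in> S" and j: "j \<in> S"
    have fi: "cmod (f (x i)) < 1" "cmod (f (x j)) < 1" using f(2) x i j by auto
    define D where "D = cmod (1 - cnj (x j) * x i)"
    define r where "r = sqrt (d j) * sqrt (d i) / D"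
    define E where "E = cmod (1 - cnj (f (x j)) * f (x i))"
    have D0: "0 < D" unfolding D_def using den_nonzero[of "x i" "x j"] x[OF i] x[OF j] by simp
    have E0: "0 < E" unfolding E_def using den_nonzero[of "f (x i)" "f (x j)"] fi by simp
    have r0: "0 \<le> r" unfolding r_def using D0 d0[OF i] d0[OF j] by simp
    have r2: "r\<^sup>2 = kap (x i) (x j)"
     unfolding r_def kap_def D_def power_divide power_mult_distrib using d0[OF i] d0[OF j] by (simp add: d_def[symmetric] mult.commute)
    \<comment> \<open>Schwarz-Pick for \<open>f\<close> gives
      \<open>r * E \<le> 2 * \<delta>\<close>. Of the three factors \<open>r\<close> in
      \<open>Qk_bound\<close>, one pays for \<open>E\<close>, and the remaining
      \<open>r\<^sup>2\<close> is \<open>kap\<close>, whose row sums are bounded.\<close>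
    have "(rho (f (x i)) (f (x j)))\<^sup>2 \<le> (rho (x i) (x j))\<^sup>2"
     using schwarz_pick[OF f(1) _ x[OF i] x[OF j]] f(2) rho_nonneg by (intro power_mono) auto
    then have "r\<^sup>2 \<le> kap (f (x i)) (f (x j))" unfolding rho_sq[OF fi] rho_sq[OF x[OF i] x[OF j]] r2 by simp
    also have "\<dots> = (1 - (cmod (f (x i)))\<^sup>2) * (1 - (cmod (f (x j)))\<^sup>2) / E\<^sup>2" by (simp add: kap_def E_def)
    finally have "(r * E)\<^sup>2 \<le> (1 - (cmod (f (x i)))\<^sup>2) * (1 - (cmod (f (x j)))\<^sup>2)" using E0 by (simp add: power_mult_distrib pos_le_divide_eq)
    also have "\<dots> \<le> (2 * \<delta>) * (2 * \<delta>)"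
     using one_minus_sq_bounds(2,3)[OF fi(1)] one_minus_sq_bounds(2,3)[OF fi(2)] fx[OF i] fx[OF j] by (intro mult_mono) auto
    finally have "(r * E)\<^sup>2 \<le> (2 * \<delta>)\<^sup>2" by (simp add: power2_eq_square)
    then have rE: "r * E \<le> 2 * \<delta>" by (rule power2_le_imp_le) (use \<delta> in simp)
    have Q: "sqrt (d j) * sqrt (d i) * cmod (?Q i j) \<le> 16 * T\<^sup>2 * r ^ 3" unfolding r_def D_def
     by (rule Qk_bound[OF x[OF j] x[OF i] T d_def d_def]) (auto simp: s_def y_def)
    have "cmod (cnj (?a i) * ?a j * (1 - f (x i) * cnj (f (x j))) * ?Q i j) = cmod (b i) * cmod (b j) * (E * (sqrt (d j) * sqrt (d i) * cmod (?Q i j)))"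
     using d0[OF i] d0[OF j] by (simp add: norm_mult E_def mult_ac)
    also have "\<dots> \<le> cmod (b i) * cmod (b j) * (E * (16 * T\<^sup>2 * r ^ 3))" using Q E0 by (intro mult_left_mono) auto
    also have "\<dots> = cmod (b i) * cmod (b j) * (16 * T\<^sup>2 * r\<^sup>2 * (r * E))" by (simp add: power2_eq_square power3_eq_cube)
    also have "\<dots> \<le> cmod (b i) * cmod (b j) * (16 * T\<^sup>2 * r\<^sup>2 * (2 * \<delta>))" using rE by (intro mult_left_mono) auto
    finally show "cmod (cnj (?a i) * ?a j * (1 - f (x i) * cnj (f (x j))) * ?Q i j) \<le> cmod (b i) * cmod (b j) * (32 * T\<^sup>2 * \<delta> * kap (x i) (x j))"
     unfolding r2 by (simp add: mult_ac)
   qed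
   also have "\<dots> \<le> (32 * T\<^sup>2 * \<delta> * A) * (\<Sum>i\<in>S. (cmod (b i))\<^sup>2)"
   proof (rule schur_row_bound[OF S])
    have row: "(\<Sum>j\<in>S. 32 * T\<^sup>2 * \<delta> * kap (x i) (x j)) \<le> 32 * T\<^sup>2 * \<delta> * A" if "i \<in> S" for i
     unfolding sum_distrib_left[symmetric] using kbD[OF k x[OF that] S] \<delta> by (intro mult_left_mono) auto
    show "(\<Sum>j\<in>S. 32 * T\<^sup>2 * \<delta> * kap (x i) (x j)) \<le> 32 * T\<^sup>2 * \<delta> * A" if "i \<in> S" for i by (rule row[OF that])
    show "(\<Sum>i\<in>S. 32 * T\<^sup>2 * \<delta> * kap (x i) (x j)) \<le> 32 * T\<^sup>2 * \<delta> * A" if "j \<in> S" for j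
     using row[OF that] by (simp only: kap_sym[of _ "x j"])
    show "0 \<le> 32 * T\<^sup>2 * \<delta> * kap (x i) (x j)" if "i \<in> S" "j \<in> S" for i j
     using kap_pos[OF x[OF that(1)] x[OF that(2)]] \<delta>(1) by (intro mult_nonneg_nonneg) auto
   qed
   also have "\<dots> \<le> (32 * T\<^sup>2 * \<delta> * A) * (G * h2 v)" using \<Sigma>V \<delta> A unfolding \<Sigma>_def by (intro mult_left_mono) auto
   also have "\<dots> = 32 * T\<^sup>2 * \<delta> * A * G * h2 v" by simp
   also have "\<dots> \<le> lam / 4 * h2 v" using \<delta>G V by (intro mult_right_mono) auto
   finally show ?thesis .
  qed
  define W where "W = h2 w"
  have e1: "h2 v \<le> (1 + lam) * h2 qv + (1 + 1 / lam) * h2 sv"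
   by (rule h2_add_le[OF contq(1) cont(3) lam(1)]) (simp add: qv_def)
  have e2: "h2 qw \<le> (1 + lam) * W + (1 + 1 / lam) * h2 (\<lambda>z. - sw z)" unfolding W_def
   by (rule h2_add_le[OF cont(2) continuous_on_minus[OF cont(4)] lam(1)]) (simp add: qw_def)
  have neg: "h2 (\<lambda>z. - sw z) = h2 sw" by (simp add: h2_def)
  have l1: "(1 + 1 / lam) * (lam\<^sup>2 / 12 * h2 v) \<le> lam / 6 * h2 v"
  proof -
   have "(1 + 1 / lam) * (lam\<^sup>2 / 12) = (lam * lam + lam) / 12" using lam by (simp add: power2_eq_square distrib_right)
   also have "\<dots> \<le> lam / 6"
   proof -
    have "lam * lam \<le> lam * 1" using lam by (intro mult_left_mono) auto
    then show ?thesis by simp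
   qed
   finally have "(1 + 1 / lam) * (lam\<^sup>2 / 12) * h2 v \<le> lam / 6 * h2 v" using V by (intro mult_right_mono) auto
   then show ?thesis by (simp add: mult.assoc)
  qed
  have pl: "0 \<le> 1 + 1 / lam" using lam by simp
  have a1: "(1 + 1 / lam) * h2 sv \<le> lam / 6 * h2 v" by (rule order_trans[OF mult_left_mono[OF svb pl] l1])
  have a2: "(1 + 1 / lam) * h2 sw \<le> lam / 6 * h2 v" by (rule order_trans[OF mult_left_mono[OF swb pl] l1])
  define \<mu> where "\<mu> = lam * h2 v"
  have \<mu>: "0 < \<mu>" using lam V by (simp add: \<mu>_def)
  \<comment> \<open>\<open>5 / 12\<close> is \<open>1 / 4\<close> from \<open>diff\<close> plus
    \<open>1 / 6\<close> from \<open>a2\<close>. In total \<open>(3 / 2) * (5 / 12) + 1 / 6\<close>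
    is still below 1, so a single \<mu> covers all errors.\<close>
  have "h2 qv \<le> (1 + lam) * W + (5 / 12) * \<mu>" using e2 diff a2 unfolding neg \<mu>_def by linarith
  then have "(1 + lam) * h2 qv \<le> (1 + lam) * ((1 + lam) * W + (5 / 12) * \<mu>)" using lam by (intro mult_left_mono) auto
  also have "\<dots> = (1 + lam)\<^sup>2 * W + (1 + lam) * ((5 / 12) * \<mu>)" by (simp add: power2_eq_square algebra_simps)
  also have "(1 + lam) * ((5 / 12) * \<mu>) \<le> (3 / 2) * ((5 / 12) * \<mu>)" using lam \<mu> by (intro mult_right_mono) auto
  finally have "(1 + lam) * h2 qv \<le> (1 + lam)\<^sup>2 * W + (3 / 2) * ((5 / 12) * \<mu>)" by simp
  moreover have "(1 + 1 / lam) * h2 sv \<le> 1 / 6 * \<mu>" using a1 by (simp add: \<mu>_def)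
  moreover have "u \<le> p + \<mu>" if "r \<le> p + (3 / 2) * ((5 / 12) * \<mu>)" "t \<le> 1 / 6 * \<mu>" "u \<le> r + t" for u r t p :: real
   using that \<mu> by linarith
  ultimately have "h2 v \<le> (1 + lam)\<^sup>2 * W + \<mu>" using e1 by blast
  then have e3: "(1 - lam) * h2 v \<le> (1 + lam)\<^sup>2 * W" unfolding \<mu>_def left_diff_distrib by simp
  have W0: "0 < W"
  proof -
   have "0 < (1 - lam) * h2 v" using lam V by simp
   then have "0 < (1 + lam)\<^sup>2 * W" using e3 by (rule less_le_trans)
   then show ?thesis using zero_le_power2[of "1 + lam"] by (simp add: zero_less_mult_iff)
  qed
  have "(1 - lam) * h2 v < (M\<^sup>2 * (1 - lam)) * W" by (rule le_less_trans[OF e3 mult_strict_right_mono[OF lamM W0]])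
  then have "(1 - lam) * h2 v < (1 - lam) * (M\<^sup>2 * W)" by (simp add: mult_ac)
  then have "h2 v < M\<^sup>2 * W" using lam by (simp add: mult_less_cancel_left_pos)
  then show "h2 (kersum S x (\<lambda>i. c i * cnj (1 / f (x i)))) < M\<^sup>2 * h2 (kersum S x c)" unfolding W_def vc wc .
 qed (use M in auto)
 show ?thesis
 proof (intro exI[of _ \<delta>] conjI allI impI \<delta>(1))
  fix S x f
  assume *: "sharp_data A q \<tau> \<delta> S x f"
  then have "\<exists>\<phi>. hol_le M \<phi> \<and> (\<forall>i\<in>S. \<phi> (x i) = 1 / f (x i))"
   by (intro main) auto
  then obtain \<phi> where \<phi>: "hol \<phi>" "\<forall>z. cmod z < 1 \<longrightarrow> cmod (\<phi> z) \<le> M" "\<And>i. i\<in>S ==> \<phi> (x i) = 1 / f (x i)"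
   by blast
  have "f (x i) * \<phi> (x i) = 1" if "i \<in> S" for i
  proof -
   have "1 - \<delta> \<le> cmod (f (x i))" using * that by blast
   then have "f (x i) \<noteq> 0" using \<delta> by auto
   then show ?thesis using \<phi>(3)[OF that] by simp
  qed
  then show "\<exists>\<phi>. hol_le M \<phi> \<and> (\<forall>i\<in>S. f (x i) * \<phi> (x i) = 1)" using \<phi>(1,2) by blast
 qed
qed

section \<open>Correction of errors that are small near the zeros\<close>

text \<open>With \<open>y\<close> moved to the origin the claim concerns two points of moduli
  \<open>a\<close> and \<open>b\<close>, whose distance is even at most
  \<open>(a + b) / (1 + a * b)\<close>.\<close>

lemma rho_triangle:
 assumes "cmod x < 1" "cmod y < 1" "cmod z < 1"
 shows "rho x z \<le> rho x y + rho y z"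
proof -
 define p q where "p = disc_aut y x" and "q = disc_aut y z"
 have pq: "cmod p < 1" "cmod q < 1" unfolding p_def q_def by (intro disc_aut_lt_1 assms)+
 define a b where "a = cmod p" and "b = cmod q"
 have ab: "0 \<le> a" "0 \<le> b" "a < 1" "b < 1" using pq by (auto simp: a_def b_def)
 have e: "a = rho x y" "b = rho y z" unfolding a_def b_def p_def q_def
  using norm_disc_aut[OF assms(2,1)] norm_disc_aut[OF assms(2,3)] rho_sym[OF assms(1,2)] by auto
 have ab0: "0 \<le> a * b" using ab by simp
 have D: "cmod (1 - cnj q * p) \<le> 1 + a * b"
  using norm_triangle_ineq4[of 1 "cnj q * p"] by (simp add: norm_mult a_def b_def mult.commute)
 have D0: "0 < cmod (1 - cnj q * p)" using den_nonzero[of p q] pq by simp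
 have m: "0 \<le> (1 - a\<^sup>2) * (1 - b\<^sup>2)" using ab by (intro mult_nonneg_nonneg) (auto simp: power_le_one)
 have "(1 - a\<^sup>2) * (1 - b\<^sup>2) / (1 + a * b)\<^sup>2 \<le> kap p q"
  unfolding kap_def a_def[symmetric] b_def[symmetric] using D D0 m by (intro divide_left_mono power_mono mult_pos_pos) auto
 then have "(rho p q)\<^sup>2 \<le> 1 - (1 - a\<^sup>2) * (1 - b\<^sup>2) / (1 + a * b)\<^sup>2" unfolding rho_sq[OF pq] by simp
 also have "\<dots> = ((a + b) / (1 + a * b))\<^sup>2"
 proof -
  have "(1 + a * b)\<^sup>2 \<noteq> 0" using ab0 by simp
  then have "1 - (1 - a\<^sup>2) * (1 - b\<^sup>2) / (1 + a * b)\<^sup>2 = ((1 + a * b)\<^sup>2 - (1 - a\<^sup>2) * (1 - b\<^sup>2)) / (1 + a * b)\<^sup>2"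
   by (simp add: diff_divide_distrib)
  also have "(1 + a * b)\<^sup>2 - (1 - a\<^sup>2) * (1 - b\<^sup>2) = (a + b)\<^sup>2" by (simp add: power2_eq_square algebra_simps)
  finally show ?thesis by (simp add: power_divide)
 qed
 finally have "rho p q \<le> (a + b) / (1 + a * b)" by (rule power2_le_imp_le) (use ab ab0 in simp)
 also have "\<dots> \<le> (a + b) / 1" using ab ab0 by (intro divide_left_mono mult_pos_pos add_pos_nonneg) auto
 finally have "rho p q \<le> a + b" by simp
 moreover have "rho p q = rho x z" unfolding p_def q_def by (rule rho_disc_aut[OF assms(2,1,3)])
 ultimately show ?thesis unfolding e by simp
qed

lemma greedy_colouring:
 assumes "finite G" and sym: "\<And>i j. R i j ==> R j i" and "\<And>i. i \<in> G ==> card {j\<in>G. R i j} < N"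
 shows "\<exists>col. (\<forall>i\<in>G. col i < N) \<and> (\<forall>i\<in>G. \<forall>j\<in>G. i \<noteq> j \<and> R i j \<longrightarrow> col i \<noteq> (col j :: nat))"
 using assms(1,3)
proof (induction G rule: finite_induct)
 case empty
 show ?case by simp
next
 case (insert x G)
 have cG: "card {j\<in>G. R i j} < N" if "i \<in> G" for i
 proof -
  have "card {j\<in>G. R i j} \<le> card {j\<in>insert x G. R i j}" using insert.hyps(1) by (intro card_mono) auto
  then show ?thesis using insert.prems[of i] that by simp
 qed
 have "\<exists>col. (\<forall>i\<in>G. col i < N) \<and> (\<forall>i\<in>G. \<forall>j\<in>G. i \<noteq> j \<and> R i j \<longrightarrow> col i \<noteq> (col j :: nat))"
  by (rule insert.IH) (rule cG)
 then obtain col where col: "\<forall>i\<in>G. col i < N" "\<forall>i\<in>G. \<forall>j\<in>G. i \<noteq> j \<and> R i j \<longrightarrow> col i \<noteq> (col j :: nat)"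
  by (elim exE conjE)
 have "card (col ` {j\<in>G. R x j}) \<le> card {j\<in>G. R x j}" using insert.hyps(1) by (intro card_image_le) auto
 also have "\<dots> \<le> card {j\<in>insert x G. R x j}" using insert.hyps(1) by (intro card_mono) auto
 also have "\<dots> < card {..<N}" using insert.prems[of x] by simp
 finally have "\<not> {..<N} \<subseteq> col ` {j\<in>G. R x j}"
  using card_mono[of "col ` {j\<in>G. R x j}" "{..<N}"] insert.hyps(1) by auto
 then obtain c where c: "c < N" "c \<notin> col ` {j\<in>G. R x j}" by auto
 have ne: "c \<noteq> col j" if "j \<in> G" "R x j" for j using c(2) that by auto
 show ?case
 proof (intro exI[of _ "col(x := c)"] conjI ballI impI)
  fix i assume "i \<in> insert x G"
  then show "(col(x := c)) i < N" using c col by auto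
 next
  fix i j assume i: "i \<in> insert x G" "j \<in> insert x G" "i \<noteq> j \<and> R i j"
  show "(col(x := c)) i \<noteq> (col(x := c)) j"
  proof (cases "i = x")
   case True
   then show ?thesis using i ne[of j] by auto
  next
   case iG: False
   show ?thesis
   proof (cases "j = x")
    case True
    then show ?thesis using i iG ne[of i] sym[of i x] by auto
   next
    case False
    then show ?thesis using i iG col(2) by auto
   qed
  qed
 qed
qed

abbreviation divisible :: "real \<Rightarrow> real \<Rightarrow> nat set \<Rightarrow> (nat \<Rightarrow> complex) \<Rightarrow> complex \<Rightarrow> (complex \<Rightarrow> complex) \<Rightarrow> real \<Rightarrow> bool" where
 "divisible A r H a p h e \<equiv> finite H \<and> (\<forall>i\<in>H. cmod (a i) < 1) \<and> kb A H a \<and> separated (1 / 4) H a \<and> cmod p < 1 \<and>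
  hol h \<and> (\<forall>z. cmod z < 1 \<and> rho p z \<le> r \<longrightarrow> cmod (BF H a z * h z) \<le> e)"

text \<open>A separated family has at most one zero in a small disc, so that one of two concentric circles stays away from
 all zeros.\<close>
lemma separated_division:
 assumes A: "0 < A" and r: "0 < r" "r \<le> 1 / 4"
 shows "\<exists>c>0. \<forall>H a p h e. divisible A r H a p h e \<longrightarrow>
  (\<forall>z. cmod z < 1 \<and> rho p z \<le> r / 2 \<longrightarrow> cmod (h z) \<le> e / c)"
proof -
 define c where "c = exp (- A / (r / 8)\<^sup>2 / 2)"
 have c: "0 < c" "c\<^sup>2 = exp (- A / (r / 8)\<^sup>2)" unfolding c_def by (simp_all flip: exp_double)
 have main: "cmod (h z) \<le> e / c"
  if H: "finite H" "\<And>i. i \<in> H ==> cmod (a i) < 1" and k: "kb A H a" and s: "separated (1 / 4) H a" and p: "cmod p < 1"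
   and h: "hol h" and e: "\<And>z. cmod z < 1 ==> rho p z \<le> r ==> cmod (BF H a z * h z) \<le> e"
   and z: "cmod z < 1" "rho p z \<le> r / 2" for H a p h e z
 proof -
  have sep: "1 / 2 \<le> rho (a i) (a j)" if "i \<in> H" "j \<in> H" "i \<noteq> j" for i j
  proof -
   have "kap (a i) (a j) \<le> 1 - (1 / 2)\<^sup>2" using s that unfolding separated_def by (auto simp: power2_eq_square)
   then show ?thesis using rho_ge_iff_kap[OF H(2)[OF that(1)] H(2)[OF that(2)], of "1 / 2"] by simp
  qed
  obtain t where t: "r / 2 < t" "t < r" "\<And>i. i \<in> H ==> r / 8 \<le> \<bar>t - rho p (a i)\<bar>"
  proof (cases "\<exists>i\<in>H. rho p (a i) < r")
   case False
   show ?thesis by (rule that[of "7 * r / 8"]) (use r False in force)+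
  next
   case True
   then obtain i where i: "i \<in> H" "rho p (a i) < r" by blast
   \<comment> \<open>Mutual distances of at least 1/2 and \<open>r \<le> 1 / 4\<close> leave only
     one zero at distance below \<open>r\<close> from \<open>p\<close>.\<close>
   have far: "r \<le> rho p (a j)" if j: "j \<in> H" "j \<noteq> i" for j
   proof -
    have "1 / 2 \<le> rho (a i) (a j)" using sep i j by simp
    also have "\<dots> \<le> rho (a i) p + rho p (a j)" by (intro rho_triangle H p i j)
    also have "rho (a i) p = rho p (a i)" by (intro rho_sym H p i)
    finally show ?thesis using i(2) r by linarith
   qed
   \<comment> \<open>Of the radii \<open>5 * r / 8\<close> and \<open>7 * r / 8\<close>, both above
     \<open>r / 2\<close>, the one farther from this zero keeps the distance
     \<open>r / 8\<close>.\<close>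
   define t where "t = (if 3 * r / 4 \<le> rho p (a i) then 5 * r / 8 else 7 * r / 8)"
   have ti: "r / 8 \<le> \<bar>t - rho p (a i)\<bar>" by (auto simp: t_def abs_if)
   show ?thesis
   proof (rule that[of t])
    show t1: "r / 2 < t" "t < r" using r by (auto simp: t_def)
    have t2: "t \<le> 7 * r / 8" using r by (simp add: t_def)
    show "r / 8 \<le> \<bar>t - rho p (a j)\<bar>" if "j \<in> H" for j
    proof (cases "j = i")
     case True then show ?thesis using ti by simp
    next
     case False then show ?thesis using far[OF that False] t2 by linarith
    qed
   qed
  qed
  have t1: "0 < t" "t < 1" using t r by linarith+
  have circ: "cmod (h (disc_aut p w)) \<le> e / c" if w: "cmod w = t" for w
  proof -
   define x where "x = disc_aut p w"
   have w1: "cmod w < 1" using w t1 by simp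
   have x1: "cmod x < 1" unfolding x_def by (rule disc_aut_lt_1[OF p w1])
   have px: "rho p x = t" using norm_disc_aut[OF p x1] disc_aut_invol[OF p w1] w by (simp add: x_def)
   have kx: "kap x (a i) \<le> 1 - (r / 8)\<^sup>2" if i: "i \<in> H" for i
   proof -
    have "rho p x \<le> rho p (a i) + rho (a i) x" by (intro rho_triangle p x1 H i)
    moreover have "rho p (a i) \<le> rho p x + rho x (a i)" by (intro rho_triangle p x1 H i)
    moreover have "rho (a i) x = rho x (a i)" by (intro rho_sym H i x1)
    ultimately have "r / 8 \<le> rho x (a i)" using t(3)[OF i] px by linarith
    then show ?thesis using rho_ge_iff_kap[OF x1 H(2)[OF i], of "r / 8"] r by simp
   qed
   have "c\<^sup>2 \<le> exp (- (\<Sum>i\<in>H. kap x (a i)) / (r / 8)\<^sup>2)"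
    unfolding c(2) exp_le_cancel_iff using kbD[OF k x1 H(1)] r by (intro divide_right_mono) auto
   also have "\<dots> \<le> (cmod (BF H a x))\<^sup>2" by (rule norm_BF_sq_ge_exp) (use H x1 r kx in auto)
   finally have "c \<le> cmod (BF H a x)" by (rule power2_le_imp_le) simp
   then have "c * cmod (h x) \<le> cmod (BF H a x) * cmod (h x)" by (intro mult_right_mono) auto
   also have "\<dots> \<le> e" using e[OF x1] px t(2) by (simp add: norm_mult)
   finally show ?thesis unfolding x_def using c(1) by (simp add: pos_le_divide_eq mult.commute)
  qed
  have "cmod (h (disc_aut p (disc_aut p z))) \<le> e / c"
   by (rule max_modulus_disc[OF holomorphic_disc_aut_comp[OF h p] t1(2) _ circ])
     (use norm_disc_aut[OF p z(1)] z(2) t in auto)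
  then show ?thesis using disc_aut_invol[OF p z(1)] by simp
 qed
 show ?thesis
 proof (intro exI[of _ c] conjI allI impI c(1))
  fix H a p h e z
  assume *: "divisible A r H a p h e"
   and z: "cmod z < 1 \<and> rho p z \<le> r / 2"
  show "cmod (h z) \<le> e / c" by (rule main[of H a p h e z]) (use * z in auto)
 qed
qed

abbreviation coloured :: "real \<Rightarrow> real \<Rightarrow> nat \<Rightarrow> (nat \<Rightarrow> complex) \<Rightarrow> nat set \<Rightarrow> nat set \<Rightarrow> (nat \<Rightarrow> nat) \<Rightarrow> real \<Rightarrow> (complex \<Rightarrow> complex) \<Rightarrow> bool" where
 "coloured A r n a G H col e u \<equiv> finite G \<and> (\<forall>j\<in>G. cmod (a j) < 1) \<and> kb A G a \<and> H \<subseteq> G \<and> (\<forall>i\<in>H. col i < n) \<and>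
  (\<forall>c. separated (1 / 4) {i\<in>H. col i = c} a) \<and> hol u \<and> 0 < e \<and>
  (\<forall>j\<in>G. \<forall>z. cmod z < 1 \<and> rho (a j) z \<le> r \<longrightarrow> cmod (u z) \<le> e)"

abbreviation correctable :: "(nat \<Rightarrow> complex) \<Rightarrow> nat set \<Rightarrow> (complex \<Rightarrow> complex) \<Rightarrow> real \<Rightarrow> bool" where
 "correctable a H u M \<equiv> \<exists>E h. hol E \<and> hol h \<and> (\<forall>z. cmod z < 1 \<longrightarrow> cmod (E z) \<le> M \<and> u z = E z + BF H a z * h z)"

text \<open>Induction on the number of colours: the values of \<open>u\<close> on one separated
  class are interpolated with norm of order \<open>e\<close>, the difference is divided by the
  product over that class, and the quotient is again small on discs of half the radius. Smallness is
  carried along around all of \<open>G\<close>, while only \<open>H\<close> is divided out.\<close>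

lemma bounded_correction_coloured:
 assumes A: "0 < A"
 shows "0 < r ==> r \<le> 1 / 4 ==> \<exists>C>0. \<forall>a G H col e u. coloured A r n a G H col e u \<longrightarrow>
  (correctable a H u (C * e))"
proof (induction n arbitrary: r)
 case 0
 show ?case
 proof (intro exI[of _ 1] conjI allI impI)
  fix a :: "nat \<Rightarrow> complex" and G H :: "nat set" and col :: "nat \<Rightarrow> nat" and e :: real and u :: "complex \<Rightarrow> complex"
  assume *: "coloured A r 0 a G H col e u"
  then have "H = {}" by auto
  then show "correctable a H u (1 * e)"
   using * by - (rule exI[of _ "\<lambda>_. 0"], rule exI[of _ u], auto)
 qed auto
next
 case (Suc n)
 have r: "0 < r" "r \<le> 1 / 4" using Suc.prems by auto
 have r2: "0 < r / 2" "r / 2 \<le> 1 / 4" using r by auto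
 obtain C0 where C0: "C0 > 0" and C0': "\<forall>S x w e. finite S \<and> (\<forall>i\<in>S. cmod (x i) < 1) \<and> kb A S x \<and> separated (1 / 4) S x \<and> 0 < e \<and> (\<forall>i\<in>S. cmod (w i) \<le> e)
  \<longrightarrow> (\<exists>\<phi>. hol_le (C0 * e) \<phi> \<and> (\<forall>i\<in>S. \<phi> (x i) = w i))"
 proof -
  have "0 < (1 / 4 :: real)" by simp
  from carleson_interpolation[OF A this] show ?thesis by (elim exE conjE) (rule that)
 qed
 obtain c where c: "c > 0" and c': "\<forall>H a p h e. divisible A r H a p h e \<longrightarrow>
  (\<forall>z. cmod z < 1 \<and> rho p z \<le> r / 2 \<longrightarrow> cmod (h z) \<le> e / c)"
  using separated_division[OF A r] by (elim exE conjE)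
 obtain C' where C': "C' > 0" and C'': "\<forall>a G H col e u. coloured A (r / 2) n a G H col e u \<longrightarrow>
  (correctable a H u (C' * e))"
  using Suc.IH[OF r2] by (elim exE conjE)
 \<comment> \<open>\<open>C0\<close> is the cost of the interpolant; the second term is the
   induction hypothesis applied to the quotient, which is bounded by
   \<open>(1 + C0) * e / c\<close>.\<close>
 define C where "C = C0 + C' * ((1 + C0) / c)"
 have C: "0 < C" unfolding C_def using C0 C' c by (intro add_pos_pos mult_pos_pos divide_pos_pos) auto
 show ?case
 proof (intro exI[of _ C] conjI allI impI C)
  fix a :: "nat \<Rightarrow> complex" and G H :: "nat set" and col :: "nat \<Rightarrow> nat" and e :: real and u :: "complex \<Rightarrow> complex"
  assume *: "coloured A r (Suc n) a G H col e u"
  have G: "finite G" "\<And>j. j \<in> G ==> cmod (a j) < 1" "kb A G a" and H: "H \<subseteq> G" "\<And>i. i \<in> H ==> col i < Suc n"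
   and sp: "\<And>c. separated (1 / 4) {i\<in>H. col i = c} a" and u: "hol u" and e: "0 < e"
   and ub: "\<And>j z. j \<in> G ==> cmod z < 1 ==> rho (a j) z \<le> r ==> cmod (u z) \<le> e" using * by auto
  define H1 where "H1 = {i\<in>H. col i = n}"
  have H1: "finite H1" "H1 \<subseteq> G" "H1 \<subseteq> H" using G H by (auto simp: H1_def intro: finite_subset)
  have a1: "cmod (a i) < 1" if "i \<in> H1" for i using G(2) H1(2) that by blast
  have s1: "separated (1 / 4) H1 a" unfolding H1_def by (rule sp)
  have k1: "kb A H1 a" by (rule kb_subset[OF G(3) H1(2)])
  have "cmod (u (a i)) \<le> e" if "i \<in> H1" for i
   using ub[of i "a i"] that H1(2) a1 r by (auto simp: rho_def)
  then have "\<exists>\<phi>. hol_le (C0 * e) \<phi> \<and> (\<forall>i\<in>H1. \<phi> (a i) = u (a i))"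
   using C0'[rule_format, of H1 a e "\<lambda>i. u (a i)"] H1 a1 s1 k1 e by simp
  then obtain E1 where E1: "hol E1" "\<And>z. cmod z < 1 ==> cmod (E1 z) \<le> C0 * e" "\<And>i. i \<in> H1 ==> E1 (a i) = u (a i)" by blast
  have "\<exists>h. hol h \<and> (\<forall>z\<in>ball 0 1. u z - E1 z = BF H1 a z * h z)"
   by (rule BF_factor_out[OF H1(1) a1]) (use separated_inj[OF s1 _ a1] E1 u in \<open>auto intro!: holomorphic_intros\<close>)
  then obtain h1 where h1: "hol h1" "\<And>z. cmod z < 1 ==> u z - E1 z = BF H1 a z * h1 z" by auto
  define e' where "e' = (1 + C0) * e / c"
  have e': "0 < e'" unfolding e'_def using C0 c e by simp
  have hb: "cmod (h1 z) \<le> e'" if j: "j \<in> G" and z: "cmod z < 1" "rho (a j) z \<le> r / 2" for j z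
  proof -
   have b: "cmod (BF H1 a x * h1 x) \<le> (1 + C0) * e" if x: "cmod x < 1" "rho (a j) x \<le> r" for x
   proof -
    have "cmod (u x - E1 x) \<le> cmod (u x) + cmod (E1 x)" by (rule norm_triangle_ineq4)
    also have "\<dots> \<le> e + C0 * e" by (intro add_mono ub[OF j x] E1(2) x)
    finally show ?thesis unfolding h1(2)[OF x(1)] by (simp add: algebra_simps)
   qed
   show ?thesis unfolding e'_def
    using c'[rule_format, of H1 a "a j" h1 "(1 + C0) * e" z] b H1 a1 k1 s1 G(2)[OF j] h1(1) z by auto
  qed
  have "correctable a (H - H1) h1 (C' * e')"
  proof (rule C''[rule_format, of G a "H - H1" col h1 e'])
   have "col i < n" if "i \<in> H - H1" for i using H(2)[of i] that by (auto simp: H1_def less_Suc_eq)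
   moreover have "separated (1 / 4) {i\<in>H - H1. col i = c} a" for c using sp[of c] unfolding separated_def by blast
   ultimately show "finite G \<and> (\<forall>j\<in>G. cmod (a j) < 1) \<and> kb A G a \<and> H - H1 \<subseteq> G \<and> (\<forall>i\<in>H - H1. col i < n) \<and>
    (\<forall>c. separated (1 / 4) {i\<in>H - H1. col i = c} a) \<and> hol h1 \<and> 0 < e' \<and>
    (\<forall>j\<in>G. \<forall>z. cmod z < 1 \<and> rho (a j) z \<le> r / 2 \<longrightarrow> cmod (h1 z) \<le> e')"
    using G H h1(1) e' hb by blast
  qed
  then obtain E2 h2 where E2: "hol E2" "hol h2"
   "\<And>z. cmod z < 1 ==> cmod (E2 z) \<le> C' * e'" "\<And>z. cmod z < 1 ==> h1 z = E2 z + BF (H - H1) a z * h2 z" by blast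
  show "correctable a H u (C * e)"
  proof (rule exI[of _ "\<lambda>z. E1 z + BF H1 a z * E2 z"], rule exI[of _ h2], intro conjI allI impI)
   show "hol (\<lambda>z. E1 z + BF H1 a z * E2 z)" by (intro holomorphic_intros E1 E2 BF_holomorphic a1)
   fix z :: complex assume z: "cmod z < 1"
   have "cmod (BF H1 a z * E2 z) \<le> 1 * (C' * e')" unfolding norm_mult
    using norm_BF_le_1[OF a1] z E2(3)[OF z] by (intro mult_mono) auto
   then have "cmod (E1 z + BF H1 a z * E2 z) \<le> C0 * e + C' * e'"
    using norm_triangle_ineq[of "E1 z" "BF H1 a z * E2 z"] E1(2)[OF z] by linarith
   also have "\<dots> = C * e" unfolding C_def e'_def by (simp add: algebra_simps)
   finally show "cmod (E1 z + BF H1 a z * E2 z) \<le> C * e" .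
   have "BF H a z = BF H1 a z * BF (H - H1) a z"
    using BF_union[of H1 "H - H1" a z] H1 finite_subset[OF H(1) G(1)] by (simp add: Un_absorb1)
   moreover have "u z = E1 z + BF H1 a z * h1 z" using h1(2)[OF z] by (simp add: algebra_simps)
   ultimately show "u z = E1 z + BF H1 a z * E2 z + BF H a z * h2 z" using E2(4)[OF z] by (simp add: algebra_simps)
  qed (rule E2(2))
 qed
qed

text \<open>Repeated or clustered zeros cannot be interpolated at once. Joining zeros with
  \<open>3 / 4 \<le> kap\<close> gives a graph in which each zero has at most
  \<open>A / (3 / 4)\<close> neighbours, itself included, so boundedly many colours produce
  separated classes.\<close>

theorem bounded_correction:
 assumes A: "0 < A"
 shows "\<exists>C>0. \<forall>a G e u. finite G \<and> (\<forall>j\<in>G. cmod (a j) < 1) \<and> kb A G a \<and> hol u \<and> 0 < e \<and>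
  (\<forall>j\<in>G. \<forall>z. cmod z < 1 \<and> rho (a j) z \<le> 1 / 4 \<longrightarrow> cmod (u z) \<le> e) \<longrightarrow>
  (correctable a G u (C * e))"
proof -
 define N where "N = nat \<lceil>A / (3 / 4)\<rceil> + 1"
 have N: "A / (3 / 4) < real N" unfolding N_def by linarith
 obtain C where C: "C > 0" and C': "\<forall>a G H col e u. coloured A (1 / 4) N a G H col e u \<longrightarrow>
  (correctable a H u (C * e))"
 proof -
  have "0 < (1 / 4 :: real)" "1 / 4 \<le> (1 / 4 :: real)" by simp_all
  from bounded_correction_coloured[OF A this, of N] show ?thesis by (elim exE conjE) (rule that)
 qed
 show ?thesis
 proof (intro exI[of _ C] conjI allI impI C)
  fix a :: "nat \<Rightarrow> complex" and G :: "nat set" and e :: real and u :: "complex \<Rightarrow> complex"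
  assume *: "finite G \<and> (\<forall>j\<in>G. cmod (a j) < 1) \<and> kb A G a \<and> hol u \<and> 0 < e \<and>
   (\<forall>j\<in>G. \<forall>z. cmod z < 1 \<and> rho (a j) z \<le> 1 / 4 \<longrightarrow> cmod (u z) \<le> e)"
  have "\<exists>col. (\<forall>i\<in>G. col i < N) \<and> (\<forall>i\<in>G. \<forall>j\<in>G. i \<noteq> j \<and> 3 / 4 \<le> kap (a i) (a j) \<longrightarrow> col i \<noteq> (col j :: nat))"
  proof (rule greedy_colouring)
   fix i assume i: "i \<in> G"
   have "real (card {j\<in>G. 3 / 4 \<le> kap (a i) (a j)}) \<le> A / (3 / 4)" by (rule card_near_zeros(2)) (use * i in auto)
   then show "card {j\<in>G. 3 / 4 \<le> kap (a i) (a j)} < N" using N by linarith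
  next
   fix i j assume "3 / 4 \<le> kap (a i) (a j)"
   then show "3 / 4 \<le> kap (a j) (a i)" by (simp only: kap_sym[of "a j"])
  qed (use * in auto)
  then obtain col where col: "\<forall>i\<in>G. col i < N" "\<forall>i\<in>G. \<forall>j\<in>G. i \<noteq> j \<and> 3 / 4 \<le> kap (a i) (a j) \<longrightarrow> col i \<noteq> (col j :: nat)"
   by (elim exE conjE)
  have sp: "separated (1 / 4) {i\<in>G. col i = c} a" for c
   unfolding separated_def
  proof (intro ballI impI)
   fix i j assume "i \<in> {i\<in>G. col i = c}" "j \<in> {i\<in>G. col i = c}" "i \<noteq> j"
   then have "i \<in> G" "j \<in> G" "col i = col j" "i \<noteq> j" by auto
   then have "\<not> 3 / 4 \<le> kap (a i) (a j)" using col(2)[rule_format, of i j] by blast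
   then show "kap (a i) (a j) \<le> 1 - 1 / 4" by simp
  qed
  show "correctable a G u (C * e)"
   by (rule C'[rule_format, of G a G col u e]) (use * col(1) sp in auto)
 qed
qed

section \<open>Inversion modulo finite Blaschke products\<close>

lemma bsm_far_small:
 assumes "bsm J a"
 obtains \<tau> where "\<And>\<eta>. \<eta> > 0 ==> \<tau> \<eta> > 0" "far_small \<tau> J a"
proof -
 have "\<forall>\<eta>. \<exists>\<tau>. \<eta> > 0 \<longrightarrow> \<tau> > 0 \<and> (\<forall>z F. far J a \<tau> z F \<longrightarrow> (\<Sum>j\<in>F. kap z (a j)) \<le> \<eta>)"
  using assms unfolding bsm_def by blast
 from choice[OF this] obtain \<tau> where \<tau>: "\<forall>\<eta>. \<eta> > 0 \<longrightarrow> \<tau> \<eta> > 0 \<and> (\<forall>z F. far J a (\<tau> \<eta>) z F \<longrightarrow> (\<Sum>j\<in>F. kap z (a j)) \<le> \<eta>)" ..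
 show ?thesis by (rule that[of \<tau>]) (use \<tau> in \<open>simp_all add: far_small_def\<close>)
qed

lemma net_of_disc:
 assumes e: "0 < e"
 obtains g :: "nat \<Rightarrow> complex" and L where "0 < L" "\<And>l. l < L ==> cmod (g l) \<le> 1 / 4"
  "\<And>w. cmod w \<le> 1 / 4 ==> \<exists>l<L. rho w (g l) \<le> e"
proof -
 have "compact (cball (0::complex) (1 / 4))" by simp
 moreover have "open (ball x (e / 2))" for x :: complex by simp
 moreover have "cball (0::complex) (1 / 4) \<subseteq> (\<Union>x\<in>cball 0 (1 / 4). ball x (e / 2))" using e by (auto intro!: bexI)
 ultimately obtain k where k: "k \<subseteq> cball (0::complex) (1 / 4)" "finite k" "cball 0 (1 / 4) \<subseteq> (\<Union>x\<in>k. ball x (e / 2))"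
  by (rule compactE_image)
 obtain L and g :: "nat \<Rightarrow> complex" where g: "k = g ` {i. i < L}" using finite_imp_nat_seg_image_inj_on[OF k(2)] by blast
 have net: "\<exists>l<L. rho w (g l) \<le> e" if w: "cmod w \<le> 1 / 4" for w
 proof -
  have "w \<in> cball 0 (1 / 4)" using w by simp
  then have "w \<in> (\<Union>x\<in>k. ball x (e / 2))" by (rule subsetD[OF k(3)])
  then obtain l where l: "l < L" "cmod (w - g l) < e / 2" unfolding g by (auto simp: dist_norm norm_minus_commute)
  have gl: "cmod (g l) \<le> 1 / 4" using k(1) l(1) unfolding g by auto
  have "cmod (cnj (g l) * w) \<le> (1 / 4) * (1 / 4)" unfolding norm_mult using w gl by (intro mult_mono) auto
  then have D: "1 / 2 \<le> cmod (1 - cnj (g l) * w)" using norm_triangle_ineq2[of 1 "cnj (g l) * w"] by simp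
  have "rho w (g l) = cmod (w - g l) / cmod (1 - cnj (g l) * w)" by (simp add: rho_def norm_divide)
  also have "\<dots> \<le> (e / 2) / (1 / 2)" using l D e by (intro frac_le) auto
  finally show ?thesis using l(1) by auto
 qed
 show ?thesis
 proof (rule that[OF _ _ net])
  show "0 < L" using net[of 0] by auto
  show "cmod (g l) \<le> 1 / 4" if "l < L" for l using k(1) that unfolding g by auto
 qed
qed

text \<open>Schwarz-Pick followed by Harnack with third point 0, since \<open>kap (f w) 0\<close> is
  \<open>1 - (cmod (f w))\<^sup>2\<close>.\<close>

lemma near_boundary_value:
 assumes f: "hol f" "\<And>z. cmod z < 1 ==> cmod (f z) < 1"
  and z: "cmod z < 1" and w: "cmod w < 1" and zw: "rho z w \<le> s" "s < 1" and d: "1 - \<delta> \<le> cmod (f z)"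
 shows "1 - 2 * hC s * \<delta> \<le> cmod (f w)"
proof -
 have s: "0 \<le> s" using zw(1) rho_nonneg[of z w] by linarith
 have "rho (f z) (f w) \<le> rho z w" by (rule schwarz_pick[OF f(1) _ z w]) (use f(2) in auto)
 then have "rho (f z) (f w) \<le> s" using zw(1) by linarith
 then have "kap (f w) 0 \<le> hC s * kap (f z) 0" by (intro kap_harnack f(2) z w zw(2)) auto
 also have "\<dots> \<le> hC s * (2 * \<delta>)" using one_minus_sq_bounds(2)[OF f(2)[OF z]] d hC_ge_1[OF s zw(2)] by (intro mult_left_mono) auto
 finally have "1 - (cmod (f w))\<^sup>2 \<le> 2 * hC s * \<delta>" by simp
 then show ?thesis using one_minus_sq_bounds(1)[OF f(2)[OF w]] by linarith
qed

abbreviation near_unimodular :: "real \<Rightarrow> nat set \<Rightarrow> (nat \<Rightarrow> complex) \<Rightarrow> (complex \<Rightarrow> complex) \<Rightarrow> nat set \<Rightarrow> bool" where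
 "near_unimodular \<delta> J a f G \<equiv> hol f \<and> (\<forall>z. cmod z < 1 \<longrightarrow> cmod (f z) < 1) \<and> finite G \<and> G \<subseteq> J \<and> (\<forall>j\<in>G. 1 - \<delta> \<le> cmod (f (a j)))"

text \<open>The sharp interpolant on a separated net of the discs around the zeros inverts \<open>f\<close> up to an error that is small
 near all zeros; the error is corrected by \<open>bounded_correction\<close>, at the cost of a factor close to one.\<close>
theorem inverse_modulo_finite:
 assumes J: "\<And>j. j \<in> J ==> cmod (a j) < 1" and k: "kb A J a" and A: "0 < A" and b: "bsm J a" and M': "1 < M'"
 shows "\<exists>\<delta>>0. \<forall>f G. near_unimodular \<delta> J a f G \<longrightarrow>
  (\<exists>k g. hol k \<and> hol g \<and>
   (\<forall>z. cmod z < 1 \<longrightarrow> cmod (k z) \<le> M' \<and> cmod (g z) \<le> 1 + M' \<and> f z * k z = 1 + BF G a z * g z))"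
proof -
 obtain \<tau> where \<tau>: "\<And>\<eta>. \<eta> > 0 ==> \<tau> \<eta> > 0" "far_small \<tau> J a" by (rule bsm_far_small[OF b], rule that)
 define M where "M = (1 + M') / 2"
 have M: "1 < M" "M < M'" using M' by (auto simp: M_def)
 \<comment> \<open>The room between \<open>M\<close> and \<open>M'\<close> pays for the final
   division by \<open>1 + E\<close> with \<open>cmod (E z) \<le> e'\<close>.\<close>
 define e' where "e' = 1 - M / M'"
 have e': "0 < e'" "e' < 1" "M / (1 - e') = M'" using M M' by (auto simp: e'_def)
 obtain C0 where C0: "C0 > 0" and corr: "\<forall>a G e u. finite G \<and> (\<forall>j\<in>G. cmod (a j) < 1) \<and> kb A G a \<and> hol u \<and> 0 < e \<and>
  (\<forall>j\<in>G. \<forall>z. cmod z < 1 \<and> rho (a j) z \<le> 1 / 4 \<longrightarrow> cmod (u z) \<le> e) \<longrightarrow>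
  (correctable a G u (C0 * e))"
  using bounded_correction[OF A] by (elim exE conjE)
 define e where "e = e' / C0"
 have e: "0 < e" "C0 * e = e'" using e' C0 by (auto simp: e_def)
 \<comment> \<open>The error vanishes on the separated set. A point near a zero reaches that set in
   two steps of length \<open>e1\<close>, first to the net and then to the set, and each step costs
   at most \<open>2 * (M + 1) * e1\<close>.\<close>
 define e1 where "e1 = e / (4 * (M + 1))"
 have e1: "0 < e1" "2 * (M + 1) * e1 + 2 * (M + 1) * e1 = e"
 proof -
  show "0 < e1" using e M by (simp add: e1_def)
  have "2 * (M + 1) * e1 + 2 * (M + 1) * e1 = e1 * (4 * (M + 1))" by (simp add: algebra_simps)
  also have "\<dots> = e" unfolding e1_def using M by simp
  finally show "2 * (M + 1) * e1 + 2 * (M + 1) * e1 = e" .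
 qed
 obtain g :: "nat \<Rightarrow> complex" and L where L: "0 < L" and g: "\<And>l. l < L ==> cmod (g l) \<le> 1 / 4"
  and net: "\<And>w. cmod w \<le> 1 / 4 ==> \<exists>l<L. rho w (g l) \<le> e1" by (rule net_of_disc[OF e1(1)], rule that)
 \<comment> \<open>The index \<open>n = j * L + l\<close> stands for the \<open>l\<close>-th net
   point of the disc around \<open>a j\<close>. Repetitions are allowed here and disappear when a
   separated subset is chosen.\<close>
 define p where "p n = disc_aut (a (n div L)) (g (n mod L))" for n
 have gm: "cmod (g (n mod L)) \<le> 1 / 4" "cmod (g (n mod L)) < 1" for n using g[of "n mod L"] L by auto
 define C where "C = hC (1 / 4)"
 have C: "1 \<le> C" unfolding C_def by (rule hC_ge_1) auto
 have p1: "cmod (p n) < 1" and ap: "rho (a (n div L)) (p n) \<le> 1 / 4" if "n div L \<in> J" for n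
 proof -
  show p1: "cmod (p n) < 1" unfolding p_def by (rule disc_aut_lt_1[OF J[OF that] gm(2)])
  have "rho (a (n div L)) (p n) = cmod (disc_aut (a (n div L)) (p n))" using norm_disc_aut[OF J[OF that] p1] by simp
  also have "disc_aut (a (n div L)) (p n) = g (n mod L)" unfolding p_def by (rule disc_aut_invol[OF J[OF that] gm(2)])
  finally show "rho (a (n div L)) (p n) \<le> 1 / 4" using gm by simp
 qed
 have h1: "kap z (p n) \<le> C * kap z (a (n div L))" and h2: "kap z (a (n div L)) \<le> C * kap z (p n)" if "n div L \<in> J" "cmod z < 1" for n z
  unfolding C_def kap_sym[of z]
  by (rule kap_harnack[OF J[OF that(1)] p1[OF that(1)] that(2) ap[OF that(1)]], simp)
    (rule kap_harnack'[OF J[OF that(1)] p1[OF that(1)] that(2) ap[OF that(1)]], simp)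
 \<comment> \<open>At most \<open>L\<close> indices belong to one zero, and Harnack compares each
   net point with its zero. So the Carleson bound and the smallness of far sums pass to the net,
   with the losses recorded in \<open>AX\<close> and \<tau>X.\<close>
 have fibre: "(\<Sum>n\<in>F. kap z (p n)) \<le> C * (real L * (\<Sum>j\<in>(\<lambda>n. n div L) ` F. kap z (a j)))"
  if F: "finite F" "(\<lambda>n. n div L) ` F \<subseteq> J" and z: "cmod z < 1" for F z
 proof -
  have "(\<Sum>n\<in>F. kap z (p n)) \<le> (\<Sum>n\<in>F. C * kap z (a (n div L)))" using F z by (intro sum_mono h1) auto
  also have "\<dots> = C * (\<Sum>n\<in>F. kap z (a (n div L)))" by (simp add: sum_distrib_left)
  also have "(\<Sum>n\<in>F. kap z (a (n div L))) = (\<Sum>j\<in>(\<lambda>n. n div L) ` F. \<Sum>n\<in>{n\<in>F. n div L = j}. kap z (a (n div L)))"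
   by (rule sum.image_gen[OF F(1)])
  also have "\<dots> \<le> (\<Sum>j\<in>(\<lambda>n. n div L) ` F. real L * kap z (a j))"
  proof (rule sum_mono)
   fix j assume j: "j \<in> (\<lambda>n. n div L) ` F"
   have "{n\<in>F. n div L = j} \<subseteq> (\<lambda>l. j * L + l) ` {..<L}"
   proof
    fix n assume "n \<in> {n\<in>F. n div L = j}"
    then have "n = j * L + n mod L" "n mod L < L" using L div_mult_mod_eq[of n L] by auto
    then show "n \<in> (\<lambda>l. j * L + l) ` {..<L}" by (intro image_eqI[of _ _ "n mod L"]) auto
   qed
   then have "card {n\<in>F. n div L = j} \<le> card ((\<lambda>l. j * L + l) ` {..<L})" by (intro card_mono) auto
   also have "\<dots> \<le> L" using card_image_le[of "{..<L}" "\<lambda>l. j * L + l"] by simp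
   finally have c: "card {n\<in>F. n div L = j} \<le> L" .
   have "(\<Sum>n\<in>{n\<in>F. n div L = j}. kap z (a (n div L))) = (\<Sum>n\<in>{n\<in>F. n div L = j}. kap z (a j))" by (intro sum.cong) auto
   also have "\<dots> = real (card {n\<in>F. n div L = j}) * kap z (a j)" by simp
   also have "\<dots> \<le> real L * kap z (a j)"
   proof (rule mult_right_mono)
    have "cmod (a j) < 1" using J F j by auto
    then show "0 \<le> kap z (a j)" by (rule less_imp_le[OF kap_pos[OF z]])
   qed (use c in simp)
   finally show "(\<Sum>n\<in>{n\<in>F. n div L = j}. kap z (a (n div L))) \<le> real L * kap z (a j)" .
  qed
  finally show ?thesis using C by (simp add: sum_distrib_left mult_left_mono)
 qed
 define AX where "AX = C * (real L * A)"
 have AX: "0 < AX" using C L A by (simp add: AX_def)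
 define \<tau>X where "\<tau>X \<eta> = \<tau> (\<eta> / (C * real L)) / C" for \<eta>
 have CL: "0 < C * real L" using C L by simp
 have \<tau>X: "0 < \<tau>X \<eta>" if "0 < \<eta>" for \<eta> unfolding \<tau>X_def using \<tau>(1)[of "\<eta> / (C * real L)"] that CL C by simp
 \<comment> \<open>The inequality \<open>1 - e1\<^sup>2 < kap\<close> means \<open>rho < e1\<close>,
   so a maximal set separated in this sense is \<open>e1\<close>-dense in the net.\<close>
 define q where "q = e1\<^sup>2"
 have q: "0 < q" using e1 by (simp add: q_def)
 obtain \<delta>0 where \<delta>0: "\<delta>0 > 0" and sharp: "\<forall>S x f. sharp_data AX q \<tau>X \<delta>0 S x f \<longrightarrow>
   (\<exists>\<phi>. hol_le M \<phi> \<and> (\<forall>i\<in>S. f (x i) * \<phi> (x i) = 1))"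
 proof -
  have "\<exists>\<delta>>0. \<forall>S x f. sharp_data AX q \<tau>X \<delta> S x f \<longrightarrow>
   (\<exists>\<phi>. hol_le M \<phi> \<and> (\<forall>i\<in>S. f (x i) * \<phi> (x i) = 1))"
   by (rule sharp_inverse_interpolation[OF AX q M(1)]) (rule \<tau>X)
  then show ?thesis by (elim exE conjE) (rule that)
 qed
 define \<delta> where "\<delta> = \<delta>0 / (2 * C)"
 have \<delta>: "0 < \<delta>" "2 * C * \<delta> = \<delta>0" using \<delta>0 C by (auto simp: \<delta>_def)
 show ?thesis
 proof (intro exI[of _ \<delta>] conjI allI impI \<delta>(1))
  fix f G assume *: "near_unimodular \<delta> J a f G"
  have f: "hol f" "\<And>z. cmod z < 1 ==> cmod (f z) < 1" and G: "finite G" "G \<subseteq> J"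
   and fa: "\<And>j. j \<in> G ==> 1 - \<delta> \<le> cmod (f (a j))" using * by auto
  have aG: "cmod (a j) < 1" if "j \<in> G" for j using J G that by auto
  define P where "P = {n. n div L \<in> G}"
  have Pd: "n div L \<in> J" if "n \<in> P" for n using that G by (auto simp: P_def)
  have "P \<subseteq> (\<lambda>(j, l). j * L + l) ` (G \<times> {..<L})"
  proof
   fix n assume "n \<in> P"
   then show "n \<in> (\<lambda>(j, l). j * L + l) ` (G \<times> {..<L})" using L
    by (intro image_eqI[of _ _ "(n div L, n mod L)"]) (auto simp: P_def)
  qed
  then have fP: "finite P" by (rule finite_subset) (use G in simp)
  define Fam where "Fam = {X. X \<subseteq> P \<and> separated q X p}"
  have "Fam \<subseteq> Pow P" by (auto simp: Fam_def)
  then have fF: "finite Fam" by (rule finite_subset) (use fP in simp)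
  have "{} \<in> Fam" by (simp add: Fam_def separated_def)
  then have "Fam \<noteq> {}" by blast
  from finite_has_maximal[OF fF this] obtain X where X: "X \<in> Fam" and Xm: "\<forall>Y\<in>Fam. X \<subseteq> Y \<longrightarrow> X = Y" by (elim bexE)
  note X = X Xm[rule_format]
  have XP: "X \<subseteq> P" and Xs: "separated q X p" using X(1) by (auto simp: Fam_def)
  have fX: "finite X" by (rule finite_subset[OF XP fP])
  have dX: "(\<lambda>n. n div L) ` F \<subseteq> J" if "F \<subseteq> X" for F using that XP Pd by auto
  have dense: "\<exists>m\<in>X. rho (p n) (p m) \<le> e1" if n: "n \<in> P" for n
  proof (cases "n \<in> X")
   case True
   then show ?thesis using e1 by (intro bexI[of _ n]) (auto simp: rho_def)
  next
   case False
   then have "insert n X \<notin> Fam" using X(2)[of "insert n X"] by auto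
   then have "\<not> separated q (insert n X) p" using n XP by (auto simp: Fam_def)
   then obtain i j where ij: "i \<in> insert n X" "j \<in> insert n X" "i \<noteq> j" "1 - q < kap (p i) (p j)"
    unfolding separated_def by (auto simp: not_le)
   have "\<exists>m\<in>X. 1 - q < kap (p n) (p m)"
   proof (cases "i = n")
    case True then show ?thesis using ij by auto
   next
    case iX: False
    show ?thesis
    proof (cases "j = n")
     case True
     then show ?thesis using ij iX kap_sym[of "p i" "p j"] by (intro bexI[of _ i]) auto
    next
     case False
     then have "kap (p i) (p j) \<le> 1 - q" using Xs ij iX unfolding separated_def by auto
     then show ?thesis using ij(4) by simp
    qed
   qed
   then obtain m where m: "m \<in> X" "1 - q < kap (p n) (p m)" by blast
   have "m \<in> P" using m XP by auto
   then have "rho (p n) (p m) \<le> e1"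
    using rho_le_iff_kap[OF p1[OF Pd[OF n]] p1[OF Pd], of m e1] m(2) e1(1) by (simp add: q_def)
   then show ?thesis using m(1) by blast
  qed
  have kX: "kb AX X p" unfolding kb_def
  proof (intro allI impI)
   fix z F assume zF: "cmod z < 1 \<and> finite F \<and> F \<subseteq> X"
   have "(\<Sum>n\<in>F. kap z (p n)) \<le> C * (real L * (\<Sum>j\<in>(\<lambda>n. n div L) ` F. kap z (a j)))" by (rule fibre) (use zF dX in auto)
   also have "\<dots> \<le> AX" unfolding AX_def using zF dX[of F] C L by (intro mult_left_mono kbD[OF k]) auto
   finally show "(\<Sum>n\<in>F. kap z (p n)) \<le> AX" .
  qed
  have sX: "far_small \<tau>X X p" unfolding far_small_def
  proof (intro allI impI)
   fix \<eta> :: real and z F assume \<eta>: "0 < \<eta>" and zF: "cmod z < 1 \<and> finite F \<and> F \<subseteq> X \<and> (\<forall>n\<in>F. kap z (p n) \<le> \<tau>X \<eta>)"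
   have "(\<Sum>n\<in>F. kap z (p n)) \<le> C * (real L * (\<Sum>j\<in>(\<lambda>n. n div L) ` F. kap z (a j)))" by (rule fibre) (use zF dX in auto)
   also have "\<dots> \<le> C * (real L * (\<eta> / (C * real L)))"
   proof (intro mult_left_mono far_smallD[OF \<tau>(2)])
    fix j assume "j \<in> (\<lambda>n. n div L) ` F"
    then obtain n where n: "n \<in> F" "j = n div L" by blast
    have nJ: "n div L \<in> J" using n zF dX[of F] by auto
    have "kap z (a j) \<le> C * kap z (p n)" unfolding n(2) using h2[OF nJ] zF by simp
    also have "\<dots> \<le> C * \<tau>X \<eta>" using n(1) zF C by (intro mult_left_mono) auto
    also have "\<dots> = \<tau> (\<eta> / (C * real L))" using C by (simp add: \<tau>X_def)
    finally show "kap z (a j) \<le> \<tau> (\<eta> / (C * real L))" .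
   qed (use zF dX[of F] \<eta> CL C L in auto)
   also have "\<dots> = \<eta>" using C L by simp
   finally show "(\<Sum>n\<in>F. kap z (p n)) \<le> \<eta>" .
  qed
  have fp: "1 - \<delta>0 \<le> cmod (f (p n))" if n: "n \<in> X" for n
  proof -
   have nG: "n div L \<in> G" using n XP by (auto simp: P_def)
   have nJ: "n div L \<in> J" using nG G by auto
   have "1 - 2 * hC (1 / 4) * \<delta> \<le> cmod (f (p n))"
    by (rule near_boundary_value[OF f J[OF nJ] p1[OF nJ] ap[OF nJ] _ fa[OF nG]]) auto
   then show ?thesis using \<delta>(2) by (simp add: C_def)
  qed
  have "\<exists>\<phi>. hol_le M \<phi> \<and> (\<forall>i\<in>X. f (p i) * \<phi> (p i) = 1)"
   by (rule sharp[rule_format]) (use fX kX sX Xs f fp p1 Pd XP in auto)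
  then obtain k1 where k1: "hol k1" "\<And>z. cmod z < 1 ==> cmod (k1 z) \<le> M" "\<And>i. i \<in> X ==> f (p i) * k1 (p i) = 1" by blast
  define F where "F z = f z * k1 z - 1" for z
  have Fh: "hol F" unfolding F_def[abs_def] by (intro holomorphic_intros f k1)
  have FM: "cmod (F z) \<le> M + 1" if "z \<in> ball 0 1" for z
  proof -
   have z: "cmod z < 1" using that by simp
   have "cmod (f z * k1 z) \<le> 1 * M" unfolding norm_mult using f(2)[OF z] k1(2)[OF z] by (intro mult_mono) auto
   then show ?thesis unfolding F_def using norm_triangle_ineq4[of "f z * k1 z" 1] by simp
  qed
  have Fsmall: "cmod (F z) \<le> e" if j: "j \<in> G" and z: "cmod z < 1" "rho (a j) z \<le> 1 / 4" for j z
  proof -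
   define w where "w = disc_aut (a j) z"
   have w: "cmod w \<le> 1 / 4" "cmod w < 1" unfolding w_def using norm_disc_aut[OF aG[OF j] z(1)] z(2) by auto
   obtain l where l: "l < L" "rho w (g l) \<le> e1" using net[OF w(1)] by blast
   define n where "n = j * L + l"
   have n: "n div L = j" "n mod L = l" using l(1) by (auto simp: n_def)
   have nP: "n \<in> P" using n j by (simp add: P_def)
   have pn: "p n = disc_aut (a j) (g l)" by (simp add: p_def n)
   have gl1: "cmod (g l) < 1" using g[OF l(1)] by simp
   have zz: "z = disc_aut (a j) w" unfolding w_def disc_aut_invol[OF aG[OF j] z(1)] ..
   have r1: "rho z (p n) \<le> e1" unfolding zz pn rho_disc_aut[OF aG[OF j] w(2) gl1] by (rule l(2))
   obtain m where m: "m \<in> X" "rho (p n) (p m) \<le> e1" using dense[OF nP] by blast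
   have pn1: "cmod (p n) < 1" by (rule p1[OF Pd[OF nP]])
   have pm1: "cmod (p m) < 1" by (rule p1[OF Pd]) (use m XP in auto)
   have Fm: "F (p m) = 0" using k1(3)[OF m(1)] by (simp add: F_def)
   have a1: "cmod (F z - F (p n)) \<le> 2 * (M + 1) * rho z (p n)" by (rule near_constant[OF Fh FM z(1) pn1])
   have a2: "cmod (F (p n) - F (p m)) \<le> 2 * (M + 1) * rho (p n) (p m)" by (rule near_constant[OF Fh FM pn1 pm1])
   have M0: "0 \<le> 2 * (M + 1)" using M by simp
   have "cmod (F z) = cmod ((F z - F (p n)) + (F (p n) - F (p m)))" using Fm by simp
   also have "\<dots> \<le> cmod (F z - F (p n)) + cmod (F (p n) - F (p m))" by (rule norm_triangle_ineq)
   also have "\<dots> \<le> 2 * (M + 1) * e1 + 2 * (M + 1) * e1"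
    by (rule add_mono[OF order_trans[OF a1 mult_left_mono[OF r1 M0]] order_trans[OF a2 mult_left_mono[OF m(2) M0]]])
   finally show ?thesis unfolding e1(2) .
  qed
  have "correctable a G F (C0 * e)"
   by (rule corr[rule_format]) (use G aG kb_subset[OF k G(2)] Fh e Fsmall in auto)
  then obtain E h where E: "hol E" "hol h"
   "\<And>z. cmod z < 1 ==> cmod (E z) \<le> e'" "\<And>z. cmod z < 1 ==> F z = E z + BF G a z * h z" unfolding e(2) by blast
  have den: "1 - e' \<le> cmod (1 + E z)" if "cmod z < 1" for z
   using norm_triangle_ineq2[of 1 "- E z"] E(3)[OF that] by simp
  have nz: "1 + E z \<noteq> 0" if "cmod z < 1" for z using den[OF that] e' by auto
  \<comment> \<open>Dividing the identity \<open>f z * k1 z = 1 + E z + BF G a z * h z\<close> by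
    \<open>1 + E z\<close> absorbs the bounded error.\<close>
  define kk gg where "kk z = k1 z / (1 + E z)" and "gg z = h z / (1 + E z)" for z
  have hol: "hol kk" "hol gg" unfolding kk_def[abs_def] gg_def[abs_def]
   using nz by (intro holomorphic_intros k1 E; force)+
  have kb': "cmod (kk z) \<le> M'" if z: "cmod z < 1" for z
  proof -
   have "cmod (kk z) \<le> M / (1 - e')" unfolding kk_def norm_divide using k1(2)[OF z] den[OF z] e' M by (intro frac_le) auto
   then show ?thesis unfolding e'(3) .
  qed
  have id: "f z * kk z = 1 + BF G a z * gg z" if z: "cmod z < 1" for z
  proof -
   have "f z * k1 z = 1 + E z + BF G a z * h z" using E(4)[OF z] by (simp add: F_def algebra_simps)
   then have "f z * k1 z / (1 + E z) = (1 + E z) / (1 + E z) + BF G a z * h z / (1 + E z)" by (simp add: add_divide_distrib)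
   then show ?thesis using nz[OF z] by (simp add: kk_def gg_def)
  qed
  have gb: "cmod (gg z) \<le> 1 + M'" if z: "cmod z < 1" for z
  proof (rule div_bound[OF G(1) aG hol(2) _ z])
   fix w :: complex assume w: "cmod w < 1"
   have "BF G a w * gg w = f w * kk w - 1" using id[OF w] by simp
   then have "cmod (BF G a w * gg w) \<le> cmod (f w * kk w) + 1" using norm_triangle_ineq4[of "f w * kk w" 1] by simp
   also have "cmod (f w * kk w) \<le> 1 * M'" unfolding norm_mult using f(2)[OF w] kb'[OF w] by (intro mult_mono) auto
   finally show "cmod (BF G a w * gg w) \<le> 1 + M'" by simp
  qed
  show "\<exists>k g. hol k \<and> hol g \<and>
   (\<forall>z. cmod z < 1 \<longrightarrow> cmod (k z) \<le> M' \<and> cmod (g z) \<le> 1 + M' \<and> f z * k z = 1 + BF G a z * g z)"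
   using hol kb' gb id by - (rule exI[of _ kk], rule exI[of _ gg], simp)
 qed
qed

section \<open>Passage to arbitrary inner divisors\<close>

lemma montel_disc:
 fixes h :: "nat \<Rightarrow> complex \<Rightarrow> complex"
 assumes h: "\<And>n. hol (h n)" "\<And>n z. cmod z < 1 ==> cmod (h n z) \<le> B"
 obtains g s where "hol g" "strict_mono (s :: nat \<Rightarrow> nat)" "\<And>x. cmod x < 1 ==> (\<lambda>n. h (s n) x) \<longlonglongrightarrow> g x"
  "\<And>x. cmod x < 1 ==> cmod (g x) \<le> B"
proof -
 obtain g s where g: "hol g" "strict_mono (s :: nat \<Rightarrow> nat)"
  "\<And>x. x \<in> ball 0 1 ==> ((\<lambda>n. h (s n) x) \<longlongrightarrow> g x) sequentially"
 proof (rule Montel[of "ball 0 1" "{h. hol h \<and> (\<forall>z\<in>ball 0 1. cmod (h z) \<le> B)}" h])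
  fix K :: "complex set" assume "compact K" "K \<subseteq> ball 0 1"
  then show "\<exists>B'. \<forall>h\<in>{h. hol h \<and> (\<forall>z\<in>ball 0 1. cmod (h z) \<le> B)}. \<forall>z\<in>K. cmod (h z) \<le> B'"
   by (intro exI[of _ B]) auto
 qed (use h in auto)
 show ?thesis
 proof (rule that[OF g(1,2)])
  show lim: "(\<lambda>n. h (s n) x) \<longlonglongrightarrow> g x" if "cmod x < 1" for x using g(3)[of x] that by simp
  show "cmod (g x) \<le> B" if "cmod x < 1" for x
   by (rule LIMSEQ_le_const2[OF tendsto_norm[OF lim[OF that]]]) (use h(2)[OF that] in auto)
 qed
qed

lemma cancel_bf:
 assumes a: "cmod a < 1" and u: "hol u" and v: "hol v"
  and e: "\<And>z. cmod z < 1 ==> bf a z * u z = bf a z * v z" and z: "cmod z < 1"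
 shows "u z = v z"
proof -
 have "cmod (u z - v z) \<le> 0"
  by (rule div_bound_single[OF holomorphic_on_diff[OF u v] a _ z]) (simp add: right_diff_distrib e)
 then show ?thesis by simp
qed

text \<open>The zeros of \<open>BP J a\<close> are distributed, one at a time, over two factors.\<close>
lemma divisor_splitting:
 assumes J: "bseq J a" and \<Phi>: "hol \<Phi>" and \<Psi>: "hol \<Psi>"
  and e: "\<And>z. cmod z < 1 ==> \<Phi> z * \<Psi> z = c * BP J a z"
 shows "\<exists>G G' h k. G \<subseteq> J \<inter> {..<n} \<and> G' \<subseteq> J \<inter> {..<n} \<and> hol h \<and> hol k \<and>
  (\<forall>z. cmod z < 1 \<longrightarrow> \<Phi> z = BF G a z * h z \<and> \<Psi> z = BF G' a z * k z \<and> h z * k z = c * BP (J \<inter> {n..}) a z)"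
proof (induction n)
 case 0
 show ?case by (rule exI[of _ "{}"], rule exI[of _ "{}"], rule exI[of _ \<Phi>], rule exI[of _ \<Psi>]) (use \<Phi> \<Psi> e in auto)
next
 case (Suc n)
 then obtain G G' h k where GG: "G \<subseteq> J \<inter> {..<n}" "G' \<subseteq> J \<inter> {..<n}" and hk: "hol h" "hol k"
  and H: "\<forall>z. cmod z < 1 \<longrightarrow> \<Phi> z = BF G a z * h z \<and> \<Psi> z = BF G' a z * k z \<and> h z * k z = c * BP (J \<inter> {n..}) a z"
  by (elim exE conjE)
 have fin: "finite G" "finite G'" using GG by (auto intro: finite_subset)
 show ?case
 proof (cases "n \<in> J")
  case False
  then have "J \<inter> {n..} = J \<inter> {Suc n..}" by (auto simp: Suc_le_eq le_less)
  moreover have "G \<subseteq> J \<inter> {..<Suc n}" "G' \<subseteq> J \<inter> {..<Suc n}" using GG by auto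
  ultimately show ?thesis using hk H by - (rule exI[of _ G], rule exI[of _ G'], rule exI[of _ h], rule exI[of _ k], simp)
 next
  case True
  have an: "cmod (a n) < 1" by (rule bseq_lt_1[OF J True])
  let ?K = "J \<inter> {Suc n..}"
  have Jn: "bseq (J \<inter> {n..}) a" and JK: "bseq ?K a" by (rule bseq_subset[OF J]; simp)+
  have rest: "J \<inter> {n..} - {n} = ?K" by (auto simp: Suc_le_eq)
  have sp: "BP (J \<inter> {n..}) a z = bf (a n) z * BP ?K a z" if "cmod z < 1" for z
   using BP_split_finite[OF Jn, of "{n}" z] that True unfolding rest by (simp add: BF_def)
  have z0: "h (a n) * k (a n) = 0" using H an sp[OF an] by simp
  have nG: "n \<notin> G" "n \<notin> G'" using GG by auto
  have BPh: "hol (\<lambda>z. c * BP ?K a z)" by (intro holomorphic_intros BP_holomorphic JK)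
  consider "h (a n) = 0" | "k (a n) = 0" using z0 by auto
  then show ?thesis
  proof cases
   case 1
   then obtain h' where h': "hol h'" "\<And>z. cmod z < 1 ==> h z = bf (a n) z * h' z"
    using bf_factor_out[OF hk(1) an] by auto
   have "h' z * k z = c * BP ?K a z" if "cmod z < 1" for z
   proof (rule cancel_bf[OF an holomorphic_on_mult[OF h'(1) hk(2)] BPh _ that])
    fix w :: complex assume w: "cmod w < 1"
    have "bf (a n) w * (h' w * k w) = h w * k w" using h'(2)[OF w] by simp
    also have "\<dots> = c * BP (J \<inter> {n..}) a w" using H w by blast
    finally show "bf (a n) w * (h' w * k w) = bf (a n) w * (c * BP ?K a w)" using sp[OF w] by simp
   qed
   then show ?thesis using GG True hk h' H fin nG
    by - (rule exI[of _ "insert n G"], rule exI[of _ G'], rule exI[of _ h'], rule exI[of _ k], auto simp: BF_insert mult_ac)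
  next
   case 2
   then obtain k' where k': "hol k'" "\<And>z. cmod z < 1 ==> k z = bf (a n) z * k' z"
    using bf_factor_out[OF hk(2) an] by auto
   have "h z * k' z = c * BP ?K a z" if "cmod z < 1" for z
   proof (rule cancel_bf[OF an holomorphic_on_mult[OF hk(1) k'(1)] BPh _ that])
    fix w :: complex assume w: "cmod w < 1"
    have "bf (a n) w * (h w * k' w) = h w * k w" using k'(2)[OF w] by simp
    also have "\<dots> = c * BP (J \<inter> {n..}) a w" using H w by blast
    finally show "bf (a n) w * (h w * k' w) = bf (a n) w * (c * BP ?K a w)" using sp[OF w] by simp
   qed
   then show ?thesis using GG True hk k' H fin nG
    by - (rule exI[of _ G], rule exI[of _ "insert n G'"], rule exI[of _ h], rule exI[of _ k'], auto simp: BF_insert mult_ac)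
  qed
 qed
qed

text \<open>Finite products \<open>BF (G n) a\<close> are split off from \<Phi>. The product of the
  cofactors \<open>h n\<close> and \<open>kk n\<close> is a unimodular constant times a tail of the
  Blaschke product, so \<open>cmod (h n)\<close> tends to 1 and a subsequence of \<open>h n\<close>
  tends to a unimodular constant. Since the inverses modulo \<open>BF (G n) a\<close> are uniformly
  bounded, they have limits, which are inverses modulo \<Phi>.\<close>

theorem bsm_imp_SIP:
 assumes J: "bseq J a" and b: "bsm J a" and c: "cmod c = 1" and e: "\<And>z. cmod z < 1 ==> \<Theta> z = c * BP J a z"
  and \<Phi>: "inner_function \<Phi>" and dvd: "Hinf_dvd \<Phi> \<Theta>"
 shows "SIP \<Phi>"
proof -
 have aj: "cmod (a j) < 1" if "j \<in> J" for j by (rule bseq_lt_1[OF J that])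
 have "\<exists>A. kb A J a" by (rule csm_kb[OF bsm_imp_csm[OF b J]]) (rule aj)
 then obtain A0 where k0: "kb A0 J a" ..
 define A where "A = max A0 1"
 have A: "0 < A" by (simp add: A_def)
 have k: "kb A J a" unfolding kb_def
 proof (intro allI impI)
  fix z F assume "cmod z < 1 \<and> finite F \<and> F \<subseteq> J"
  then have "(\<Sum>j\<in>F. kap z (a j)) \<le> A0" by (intro kbD[OF k0]) auto
  then show "(\<Sum>j\<in>F. kap z (a j)) \<le> A" by (simp add: A_def)
 qed
 have \<Phi>H: "\<Phi> \<in> Hinf" using \<Phi> by (simp add: inner_function_def)
 obtain B where \<Phi>h: "hol \<Phi>" and \<Phi>B: "\<And>z. cmod z < 1 ==> cmod (\<Phi> z) \<le> B" by (rule HinfE[OF \<Phi>H], rule that)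
 have \<Phi>1: "cmod (\<Phi> z) \<le> 1" if "cmod z < 1" for z
  by (rule AE_unimodular_imp_bounded[OF \<Phi>h \<Phi>B inner_modulus_limit[OF \<Phi>] that])
 obtain \<Psi> where \<Psi>: "\<Psi> \<in> Hinf" "\<And>z. cmod z < 1 ==> \<Theta> z = \<Phi> z * \<Psi> z" using dvd unfolding Hinf_dvd_def by auto
 obtain B' where \<Psi>h: "hol \<Psi>" and \<Psi>B: "\<And>z. cmod z < 1 ==> cmod (\<Psi> z) \<le> B'" by (rule HinfE[OF \<Psi>(1)], rule that)
 have prod: "\<Phi> z * \<Psi> z = c * BP J a z" if "cmod z < 1" for z using \<Psi>(2)[OF that] e[OF that] by simp
 have \<Psi>1: "cmod (\<Psi> z) \<le> 1" if "cmod z < 1" for z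
 proof (rule unimodular_quotient_bounded[OF \<Psi>h \<Psi>B inner_modulus_limit[OF \<Phi>] _ that])
  fix w :: complex assume "cmod w < 1"
  then show "cmod (\<Phi> w * \<Psi> w) \<le> 1" using prod norm_BP_le_1[OF J] c by (simp add: norm_mult)
 qed
 have "\<forall>n. \<exists>G G' h k. G \<subseteq> J \<inter> {..<n} \<and> G' \<subseteq> J \<inter> {..<n} \<and> hol h \<and> hol k \<and>
  (\<forall>z. cmod z < 1 \<longrightarrow> \<Phi> z = BF G a z * h z \<and> \<Psi> z = BF G' a z * k z \<and> h z * k z = c * BP (J \<inter> {n..}) a z)"
  by (intro allI divisor_splitting[OF J \<Phi>h \<Psi>h prod])
 from choice[OF this] obtain G where "\<forall>n. \<exists>G' h k. G n \<subseteq> J \<inter> {..<n} \<and> G' \<subseteq> J \<inter> {..<n} \<and> hol h \<and> hol k \<and>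
  (\<forall>z. cmod z < 1 \<longrightarrow> \<Phi> z = BF (G n) a z * h z \<and> \<Psi> z = BF G' a z * k z \<and> h z * k z = c * BP (J \<inter> {n..}) a z)" ..
 from choice[OF this] obtain G' where "\<forall>n. \<exists>h k. G n \<subseteq> J \<inter> {..<n} \<and> G' n \<subseteq> J \<inter> {..<n} \<and> hol h \<and> hol k \<and>
  (\<forall>z. cmod z < 1 \<longrightarrow> \<Phi> z = BF (G n) a z * h z \<and> \<Psi> z = BF (G' n) a z * k z \<and> h z * k z = c * BP (J \<inter> {n..}) a z)" ..
 from choice[OF this] obtain h where "\<forall>n. \<exists>k. G n \<subseteq> J \<inter> {..<n} \<and> G' n \<subseteq> J \<inter> {..<n} \<and> hol (h n) \<and> hol k \<and>
  (\<forall>z. cmod z < 1 \<longrightarrow> \<Phi> z = BF (G n) a z * h n z \<and> \<Psi> z = BF (G' n) a z * k z \<and> h n z * k z = c * BP (J \<inter> {n..}) a z)" ..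
 from choice[OF this] obtain kk where all: "\<forall>n. G n \<subseteq> J \<inter> {..<n} \<and> G' n \<subseteq> J \<inter> {..<n} \<and> hol (h n) \<and> hol (kk n) \<and>
  (\<forall>z. cmod z < 1 \<longrightarrow> \<Phi> z = BF (G n) a z * h n z \<and> \<Psi> z = BF (G' n) a z * kk n z \<and> h n z * kk n z = c * BP (J \<inter> {n..}) a z)" ..
 have GJ: "G n \<subseteq> J" "G' n \<subseteq> J" "finite (G n)" "finite (G' n)" for n using all[rule_format, of n] by (auto intro: finite_subset[of _ "{..<n}"])
 have hh: "hol (h n)" "hol (kk n)" for n using all by auto
 have fac: "\<Phi> z = BF (G n) a z * h n z" "\<Psi> z = BF (G' n) a z * kk n z" "h n z * kk n z = c * BP (J \<inter> {n..}) a z" if "cmod z < 1" for n z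
  using all[rule_format, of n] that by auto
 have aG: "cmod (a j) < 1" if "j \<in> G n" for j n using aj GJ(1)[of n] that by blast
 have aG': "cmod (a j) < 1" if "j \<in> G' n" for j n using aj GJ(2)[of n] that by blast
 have h1: "cmod (h n z) \<le> 1" if "cmod z < 1" for n z
  by (rule div_bound[OF GJ(3) aG hh(1) _ that]) (use \<Phi>1 fac(1)[of _ n] in auto)
 have k1: "cmod (kk n z) \<le> 1" if "cmod z < 1" for n z
  by (rule div_bound[OF GJ(4) aG' hh(2) _ that]) (use \<Psi>1 fac(2)[of _ n] in auto)
 have hlim: "(\<lambda>n. cmod (h n z)) \<longlonglongrightarrow> 1" if z: "cmod z < 1" for z
 proof (rule real_tendsto_sandwich)
  have "(\<lambda>n. cmod (BP (J \<inter> {n..}) a z)) \<longlonglongrightarrow> cmod 1" by (rule tendsto_norm[OF BP_tail_tendsto[OF J z]])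
  then show "(\<lambda>n. cmod (BP (J \<inter> {n..}) a z)) \<longlonglongrightarrow> 1" by simp
  show "eventually (\<lambda>n. cmod (BP (J \<inter> {n..}) a z) \<le> cmod (h n z)) sequentially"
  proof (intro always_eventually allI)
   fix n
   have "cmod (BP (J \<inter> {n..}) a z) = cmod (h n z * kk n z)" unfolding fac(3)[OF z] using c by (simp add: norm_mult)
   also have "\<dots> \<le> cmod (h n z) * 1" unfolding norm_mult using k1[OF z] by (intro mult_left_mono) auto
   finally show "cmod (BP (J \<inter> {n..}) a z) \<le> cmod (h n z)" by simp
  qed
  show "eventually (\<lambda>n. cmod (h n z) \<le> 1) sequentially" using h1[OF z] by (intro always_eventually allI)
 qed simp
 have \<Phi>0: "\<Phi> (a j) = 0" if j: "j \<in> G n" for j n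
 proof -
  have "BF (G n) a (a j) = 0" unfolding BF_def using GJ(3) j by (intro prod_zero) (auto intro!: bexI[of _ j])
  then show ?thesis using fac(1)[OF aG[OF j], of n] by simp
 qed
 show ?thesis unfolding SIP_def
 proof (intro allI impI)
  fix \<epsilon> :: real assume \<epsilon>: "\<epsilon> > 0"
  have M: "1 < 1 + \<epsilon>" using \<epsilon> by simp
  obtain \<delta>0 where \<delta>0: "\<delta>0 > 0" and U: "\<forall>f G. near_unimodular \<delta>0 J a f G \<longrightarrow>
   (\<exists>k g. hol k \<and> hol g \<and>
    (\<forall>z. cmod z < 1 \<longrightarrow> cmod (k z) \<le> 1 + \<epsilon> \<and> cmod (g z) \<le> 1 + (1 + \<epsilon>) \<and> f z * k z = 1 + BF G a z * g z))"
  proof -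
   have "\<exists>\<delta>>0. \<forall>f G. near_unimodular \<delta> J a f G \<longrightarrow>
    (\<exists>k g. hol k \<and> hol g \<and>
     (\<forall>z. cmod z < 1 \<longrightarrow> cmod (k z) \<le> 1 + \<epsilon> \<and> cmod (g z) \<le> 1 + (1 + \<epsilon>) \<and> f z * k z = 1 + BF G a z * g z))"
    by (rule inverse_modulo_finite[OF _ k A b M]) (rule aj)
   then show ?thesis by (elim exE conjE) (rule that)
  qed
  define \<delta> where "\<delta> = \<delta>0 / 3"
  have \<delta>: "0 < \<delta>" "3 * \<delta> = \<delta>0" using \<delta>0 by (auto simp: \<delta>_def)
  show "\<exists>\<delta>>0. \<forall>f\<in>Hinf. quot_norm \<Phi> f \<le> 1 \<and> (\<forall>z\<in>unit_disc. \<Phi> z = 0 \<longrightarrow> cmod (f z) \<ge> 1 - \<delta>) \<longrightarrow>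
   (\<exists>k\<in>Hinf. quot_eq \<Phi> (\<lambda>z. f z * k z) (\<lambda>z. 1) \<and> quot_norm \<Phi> k \<le> 1 + \<epsilon>)"
  proof (intro exI[of _ \<delta>] conjI ballI impI \<delta>(1))
   fix f assume fH: "f \<in> Hinf" and *: "quot_norm \<Phi> f \<le> 1 \<and> (\<forall>z\<in>unit_disc. \<Phi> z = 0 \<longrightarrow> cmod (f z) \<ge> 1 - \<delta>)"
   have qn: "quot_norm \<Phi> f < 1 + \<delta>" using * \<delta> by linarith
   obtain p where p: "p \<in> Hinf" "\<And>z. cmod z < 1 ==> cmod (f z + p z * \<Phi> z) \<le> 1 + \<delta>" by (rule quot_norm_less[OF fH \<Phi>H qn], rule that)
   \<comment> \<open>The quotient norm only provides a representative bounded by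
     \<open>1 + \<delta>\<close>. Dividing by the larger \<open>s\<close> makes the bound strict,
     and on the zeros it leaves \<open>(1 - \<delta>) / s \<ge> 1 - 3 * \<delta>\<close>.\<close>
   define s where "s = 1 + 2 * \<delta>"
   have s: "1 < s" using \<delta> by (simp add: s_def)
   define f2 where "f2 z = (f z + p z * \<Phi> z) / of_real s" for z
   have "(\<lambda>z. f z + p z * \<Phi> z) \<in> Hinf" by (intro Hinf_add Hinf_mult fH p \<Phi>H)
   then have f2h: "hol f2" unfolding f2_def[abs_def] Hinf_def using s by (auto intro!: holomorphic_intros)
   have f21: "cmod (f2 z) < 1" if z: "cmod z < 1" for z
   proof -
    have "cmod (f2 z) \<le> (1 + \<delta>) / s" unfolding f2_def norm_divide using p(2)[OF z] s by (simp add: divide_right_mono)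
    also have "\<dots> < 1" using \<delta> by (simp add: s_def)
    finally show ?thesis .
   qed
   have f2a: "1 - \<delta>0 \<le> cmod (f2 (a j))" if j: "j \<in> G n" for j n
   proof -
    have "1 - \<delta> \<le> cmod (f (a j))" using * \<Phi>0[OF j] aG[OF j] by simp
    then have "(1 - \<delta>) / s \<le> cmod (f2 (a j))" unfolding f2_def \<Phi>0[OF j] norm_divide using s by (simp add: divide_right_mono)
    moreover have "1 - 3 * \<delta> \<le> (1 - \<delta>) / s"
    proof -
     have "0 \<le> \<delta> * \<delta>" by simp
     then have "(1 - 3 * \<delta>) * s \<le> 1 - \<delta>" unfolding s_def by (simp add: algebra_simps)
     then show ?thesis using s by (simp add: pos_le_divide_eq)
    qed
    ultimately show ?thesis using \<delta>(2) by linarith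
   qed
   have "\<forall>n. \<exists>k g. hol k \<and> hol g \<and>
    (\<forall>z. cmod z < 1 \<longrightarrow> cmod (k z) \<le> 1 + \<epsilon> \<and> cmod (g z) \<le> 1 + (1 + \<epsilon>) \<and> f2 z * k z = 1 + BF (G n) a z * g z)"
    by (intro allI U[rule_format]) (use f2h f21 f2a GJ in auto)
   from choice[OF this] obtain K where "\<forall>n. \<exists>g. hol (K n) \<and> hol g \<and>
    (\<forall>z. cmod z < 1 \<longrightarrow> cmod (K n z) \<le> 1 + \<epsilon> \<and> cmod (g z) \<le> 1 + (1 + \<epsilon>) \<and> f2 z * K n z = 1 + BF (G n) a z * g z)" ..
   from choice[OF this] obtain g where Kg: "\<forall>n. hol (K n) \<and> hol (g n) \<and>
    (\<forall>z. cmod z < 1 \<longrightarrow> cmod (K n z) \<le> 1 + \<epsilon> \<and> cmod (g n z) \<le> 1 + (1 + \<epsilon>) \<and> f2 z * K n z = 1 + BF (G n) a z * g n z)" ..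
   have K: "hol (K n)" "\<And>z. cmod z < 1 ==> cmod (K n z) \<le> 1 + \<epsilon>" for n using Kg by auto
   have g: "hol (g n)" "\<And>z. cmod z < 1 ==> cmod (g n z) \<le> 1 + (1 + \<epsilon>)" for n using Kg by auto
   have eq: "f2 z * K n z = 1 + BF (G n) a z * g n z" if "cmod z < 1" for n z using Kg that by auto
   obtain H s1 where H: "hol H" "strict_mono (s1 :: nat \<Rightarrow> nat)" "\<And>x. cmod x < 1 ==> (\<lambda>n. h (s1 n) x) \<longlonglongrightarrow> H x"
    "\<And>x. cmod x < 1 ==> cmod (H x) \<le> 1" by (rule montel_disc[of h 1, OF hh(1) h1], assumption, rule that)
   have Hn: "cmod (H z) = 1" if z: "cmod z < 1" for z
    using LIMSEQ_unique[OF tendsto_norm[OF H(3)[OF z]] LIMSEQ_subseq_LIMSEQ[OF hlim[OF z] H(2), unfolded o_def]] .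
   obtain c' where c': "cmod c' = 1" "\<And>z. cmod z < 1 ==> H z = c'" by (rule norm_1_imp_const[OF H(1)], rule Hn, assumption, rule that)
   have c0: "c' \<noteq> 0" using c'(1) by auto
   obtain K' s2 where K': "hol K'" "strict_mono (s2 :: nat \<Rightarrow> nat)" "\<And>x. cmod x < 1 ==> (\<lambda>n. K (s1 (s2 n)) x) \<longlonglongrightarrow> K' x"
    "\<And>x. cmod x < 1 ==> cmod (K' x) \<le> 1 + \<epsilon>" by (rule montel_disc[of "\<lambda>n. K (s1 n)" "1 + \<epsilon>"], rule K, rule K, assumption, rule that)
   obtain g' s3 where g': "hol g'" "strict_mono (s3 :: nat \<Rightarrow> nat)" "\<And>x. cmod x < 1 ==> (\<lambda>n. g (s1 (s2 (s3 n))) x) \<longlonglongrightarrow> g' x"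
    "\<And>x. cmod x < 1 ==> cmod (g' x) \<le> 1 + (1 + \<epsilon>)" by (rule montel_disc[of "\<lambda>n. g (s1 (s2 n))" "1 + (1 + \<epsilon>)"], rule g, rule g, assumption, rule that)
   define r where "r n = s1 (s2 (s3 n))" for n
   have lim: "f2 z * K' z = 1 + \<Phi> z / c' * g' z" if z: "cmod z < 1" for z
   proof -
    have hl: "(\<lambda>n. h (r n) z) \<longlonglongrightarrow> c'"
     using LIMSEQ_subseq_LIMSEQ[OF LIMSEQ_subseq_LIMSEQ[OF H(3)[OF z] K'(2)] g'(2)] c'(2)[OF z] by (simp add: o_def r_def)
    have Kl: "(\<lambda>n. K (r n) z) \<longlonglongrightarrow> K' z" using LIMSEQ_subseq_LIMSEQ[OF K'(3)[OF z] g'(2)] by (simp add: o_def r_def)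
    have gl: "(\<lambda>n. g (r n) z) \<longlonglongrightarrow> g' z" using g'(3)[OF z] by (simp add: r_def)
    \<comment> \<open>Multiplication by \<open>h (r n) z\<close> turns
      \<open>BF (G (r n)) a z\<close> into \<open>\<Phi> z\<close>, which does not depend on
      \<open>n\<close>.\<close>
    have "(\<lambda>n. h (r n) z * (f2 z * K (r n) z)) \<longlonglongrightarrow> c' * (f2 z * K' z)" by (intro tendsto_intros hl Kl)
    moreover have "h (r n) z * (f2 z * K (r n) z) = h (r n) z + \<Phi> z * g (r n) z" for n
     unfolding eq[OF z] fac(1)[OF z, of "r n"] by (simp add: algebra_simps)
    moreover have "(\<lambda>n. h (r n) z + \<Phi> z * g (r n) z) \<longlonglongrightarrow> c' + \<Phi> z * g' z" by (intro tendsto_intros hl gl)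
    ultimately have "c' * (f2 z * K' z) = c' + \<Phi> z * g' z" using LIMSEQ_unique by simp
    then show ?thesis using c0 by (simp add: field_simps)
   qed
   define k where "k z = K' z / of_real s" for z
   have kb: "cmod (k z) \<le> 1 + \<epsilon>" if z: "cmod z < 1" for z
   proof -
    have "cmod (k z) = cmod (K' z) / s" unfolding k_def norm_divide using s by simp
    also have "\<dots> \<le> cmod (K' z) / 1" using s by (intro divide_left_mono) auto
    finally show ?thesis using K'(4)[OF z] by simp
   qed
   have kh: "hol k" unfolding k_def[abs_def] using s by (intro holomorphic_intros K') auto
   have kH: "k \<in> Hinf" by (rule HinfI[OF kh kb])
   have g'H: "g' \<in> Hinf" by (rule HinfI[OF g'(1,4)])
   have "quot_eq \<Phi> (\<lambda>z. f z * k z) (\<lambda>z. 1)" unfolding quot_eq_def Hinf_dvd_def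
   proof (intro bexI[of _ "\<lambda>z. (1 / c') * g' z + (- 1) * (p z * k z)"] ballI)
    fix z :: complex assume "z \<in> ball 0 1"
    then have z: "cmod z < 1" by simp
    have "(f z + p z * \<Phi> z) * k z = f2 z * K' z" using s by (simp add: f2_def k_def)
    then have "f z * k z + p z * \<Phi> z * k z = 1 + \<Phi> z / c' * g' z" unfolding lim[OF z] by (simp add: distrib_right)
    then have "f z * k z - 1 = \<Phi> z / c' * g' z - p z * \<Phi> z * k z" by (simp add: algebra_simps)
    then show "f z * k z - 1 = \<Phi> z * (1 / c' * g' z + - 1 * (p z * k z))" by (simp add: algebra_simps)
   next
    show "(\<lambda>z. (1 / c') * g' z + (- 1) * (p z * k z)) \<in> Hinf" by (intro Hinf_add Hinf_mult Hinf_const g'H p(1) kH)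
   qed
   moreover have "quot_norm \<Phi> k \<le> 1 + \<epsilon>" by (rule quot_norm_le[OF kH \<Phi>H Hinf_const[of 0]]) (use kb in simp)
   ultimately show "\<exists>k\<in>Hinf. quot_eq \<Phi> (\<lambda>z. f z * k z) (\<lambda>z. 1) \<and> quot_norm \<Phi> k \<le> 1 + \<epsilon>" using kH by blast
  qed
 qed
qed

section \<open>The geometric conditions\<close>

text \<open>Testing with finite real bounds \<eta> reduces the limits of suprema to the inequalities
  treated by \<open>infsum_ennreal_le_iff\<close>.\<close>

lemma ennreal_tendsto_0_iff:
 fixes f :: "'a \<Rightarrow> ennreal"
 shows "(f \<longlongrightarrow> 0) F \<longleftrightarrow> (\<forall>\<eta>>0. eventually (\<lambda>x. f x \<le> ennreal \<eta>) F)"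
proof
 assume f: "(f \<longlongrightarrow> 0) F"
 show "\<forall>\<eta>>0. eventually (\<lambda>x. f x \<le> ennreal \<eta>) F"
 proof (intro allI impI)
  fix \<eta> :: real assume "\<eta> > 0"
  then have "0 < ennreal \<eta>" by simp
  from order_tendstoD(2)[OF f this] show "eventually (\<lambda>x. f x \<le> ennreal \<eta>) F" by (rule eventually_mono) simp
 qed
next
 assume H: "\<forall>\<eta>>0. eventually (\<lambda>x. f x \<le> ennreal \<eta>) F"
 show "(f \<longlongrightarrow> 0) F"
 proof (rule order_tendstoI)
  fix e :: ennreal assume "0 < e"
  then obtain y where y: "0 < y" "y < e" using dense by blast
  obtain \<eta> where \<eta>: "y = ennreal \<eta>" "0 \<le> \<eta>" using y(2) by (cases y) auto
  have "\<eta> > 0" using y(1) \<eta> by (simp add: ennreal_less_zero_iff)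
  then have "eventually (\<lambda>x. f x \<le> ennreal \<eta>) F" using H by blast
  then show "eventually (\<lambda>x. f x < e) F" by (rule eventually_mono) (use y \<eta> in auto)
 qed auto
qed

lemma S_sum_limit_iff_bsm:
 assumes J: "bseq J a"
 shows "((\<lambda>t. SUP z\<in>unit_disc. S_sum J a t z) \<longlongrightarrow> 0) (at_left 1) \<longleftrightarrow> bsm J a"
proof -
 have aj: "cmod (a j) < 1" if "j \<in> J" for j by (rule bseq_lt_1[OF J that])
 have S: "S_sum J a t z \<le> ennreal \<eta> \<longleftrightarrow> (\<forall>F. finite F \<and> F \<subseteq> {j\<in>J. t \<le> rho z (a j)} \<longrightarrow> (\<Sum>j\<in>F. 1 - rho z (a j)) \<le> \<eta>)"
  if "cmod z < 1" "0 \<le> \<eta>" for t z \<eta>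
  unfolding S_sum_def by (rule infsum_ennreal_le_iff) (use rho_less_1[OF that(1) aj] that(2) in \<open>auto intro: less_imp_le\<close>)
 have sup: "(SUP z\<in>unit_disc. S_sum J a t z) \<le> ennreal \<eta> \<longleftrightarrow>
  (\<forall>z F. cmod z < 1 \<and> finite F \<and> F \<subseteq> {j\<in>J. t \<le> rho z (a j)} \<longrightarrow> (\<Sum>j\<in>F. 1 - rho z (a j)) \<le> \<eta>)" if "0 \<le> \<eta>" for t \<eta>
  unfolding SUP_le_iff using S[OF _ that] by auto
 show ?thesis unfolding ennreal_tendsto_0_iff bsm_def
 proof (intro iffI allI impI)
  fix \<eta> :: real assume H: "\<forall>\<eta>>0. eventually (\<lambda>t. (SUP z\<in>unit_disc. S_sum J a t z) \<le> ennreal \<eta>) (at_left 1)" and \<eta>: "\<eta> > 0"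
  \<comment> \<open>Half of \<eta>, because \<open>kap\<close> is at most twice
    \<open>1 - rho\<close>. The threshold \<open>1 - t\<^sup>2\<close> for \<open>kap\<close> then
    corresponds to \<open>t\<close> for \<open>rho\<close>.\<close>
  have "\<eta> / 2 > 0" using \<eta> by simp
  then obtain b where b: "b < 1" "\<And>t. b < t ==> t < 1 ==> (SUP z\<in>unit_disc. S_sum J a t z) \<le> ennreal (\<eta> / 2)"
   using H unfolding eventually_at_left_field by blast
  define t where "t = (max b 0 + 1) / 2"
  have t: "b < t" "0 < t" "t < 1" using b(1) by (auto simp: t_def)
  have T: "(SUP z\<in>unit_disc. S_sum J a t z) \<le> ennreal (\<eta> / 2)" by (rule b(2)[OF t(1,3)])
  have "t * t < 1 * 1" using t by (intro mult_strict_mono) auto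
  then have "0 < 1 - t\<^sup>2" by (simp add: power2_eq_square)
  moreover have "(\<Sum>j\<in>F. kap z (a j)) \<le> \<eta>" if zF: "far J a (1 - t\<^sup>2) z F" for z F
  proof -
   have z: "cmod z < 1" using zF by simp
   have aF: "cmod (a j) < 1" if "j \<in> F" for j using zF aj that by auto
   have "t \<le> rho z (a j)" if "j \<in> F" for j using rho_ge_iff_kap[OF z aF[OF that], of t] zF that t by simp
   then have "F \<subseteq> {j\<in>J. t \<le> rho z (a j)}" using zF by auto
   moreover have "\<forall>z F. cmod z < 1 \<and> finite F \<and> F \<subseteq> {j\<in>J. t \<le> rho z (a j)} \<longrightarrow> (\<Sum>j\<in>F. 1 - rho z (a j)) \<le> \<eta> / 2"
    using T unfolding sup[OF less_imp_le[OF \<open>\<eta> / 2 > 0\<close>]] .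
   from spec[OF spec[OF this, of z], of F] have "F \<subseteq> {j\<in>J. t \<le> rho z (a j)} \<longrightarrow> (\<Sum>j\<in>F. 1 - rho z (a j)) \<le> \<eta> / 2" using zF by simp
   ultimately have "(\<Sum>j\<in>F. 1 - rho z (a j)) \<le> \<eta> / 2" by simp
   moreover have "(\<Sum>j\<in>F. kap z (a j)) \<le> (\<Sum>j\<in>F. 2 * (1 - rho z (a j)))" by (intro sum_mono kap_rho_bounds(2) z aF)
   then have "(\<Sum>j\<in>F. kap z (a j)) \<le> 2 * (\<Sum>j\<in>F. 1 - rho z (a j))" unfolding sum_distrib_left .
   ultimately show ?thesis by linarith
  qed
  ultimately show "\<exists>\<tau>>0. \<forall>z F. far J a \<tau> z F \<longrightarrow> (\<Sum>j\<in>F. kap z (a j)) \<le> \<eta>" by blast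
 next
  fix \<eta> :: real assume H: "\<forall>\<eta>>0. \<exists>\<tau>>0. \<forall>z F. far J a \<tau> z F \<longrightarrow> (\<Sum>j\<in>F. kap z (a j)) \<le> \<eta>" and \<eta>: "\<eta> > 0"
  from H[rule_format, OF \<eta>] obtain \<tau> where \<tau>: "\<tau> > 0" "\<forall>z F. far J a \<tau> z F \<longrightarrow> (\<Sum>j\<in>F. kap z (a j)) \<le> \<eta>"
   by (elim exE conjE)
  show "eventually (\<lambda>t. (SUP z\<in>unit_disc. S_sum J a t z) \<le> ennreal \<eta>) (at_left 1)"
   unfolding eventually_at_left_field
  proof (intro exI[of _ "max 0 (1 - \<tau> / 2)"] conjI allI impI)
   fix t :: real assume t: "max 0 (1 - \<tau> / 2) < t" "t < 1"
   have "t * 1 \<le> t * t + (1 - t)" using mult_nonneg_nonneg[of "1 - t" "1 - t"] t by (simp add: algebra_simps)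
   then have t2: "1 - t\<^sup>2 \<le> \<tau>" using t by (simp add: power2_eq_square)
   show "(SUP z\<in>unit_disc. S_sum J a t z) \<le> ennreal \<eta>" unfolding sup[OF less_imp_le[OF \<eta>]]
   proof (intro allI impI)
    fix z F assume zF: "cmod z < 1 \<and> finite F \<and> F \<subseteq> {j\<in>J. t \<le> rho z (a j)}"
    have z: "cmod z < 1" using zF by simp
    have aF: "cmod (a j) < 1" if "j \<in> F" for j using zF aj that by auto
    have "kap z (a j) \<le> \<tau>" if "j \<in> F" for j
    proof -
     have "t \<le> rho z (a j)" using zF that by auto
     then have "kap z (a j) \<le> 1 - t\<^sup>2" using rho_ge_iff_kap[OF z aF[OF that], of t] t by simp
     then show ?thesis using t2 by linarith
    qed
    then have "(\<Sum>j\<in>F. kap z (a j)) \<le> \<eta>" using spec[OF spec[OF \<tau>(2), of z], of F] zF by auto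
    moreover have "(\<Sum>j\<in>F. 1 - rho z (a j)) \<le> (\<Sum>j\<in>F. kap z (a j))" by (intro sum_mono kap_rho_bounds(1) z aF)
    ultimately show "(\<Sum>j\<in>F. 1 - rho z (a j)) \<le> \<eta>" by linarith
   qed
  qed (use \<tau> in auto)
 qed
qed

lemma thin_box_limit_iff_csm:
 assumes J: "bseq J a"
 shows "((\<lambda>\<delta>. SUP \<theta>. SUP h\<in>{0<..}. ennreal (1 / h) * (\<Sum>\<^sub>\<infinity>k\<in>{k\<in>J. a k \<in> thin_box \<theta> h \<delta>}. ennreal (1 - cmod (a k)))) \<longlongrightarrow> 0) (at_right 0)
  \<longleftrightarrow> csm J a"
proof -
 let ?I = "\<lambda>\<theta> h \<delta>. \<Sum>\<^sub>\<infinity>k\<in>{k\<in>J. a k \<in> thin_box \<theta> h \<delta>}. ennreal (1 - cmod (a k))"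
 let ?S = "\<lambda>\<delta>. SUP \<theta>. SUP h\<in>{0<..}. ennreal (1 / h) * ?I \<theta> h \<delta>"
 have aj: "cmod (a j) < 1" if "j \<in> J" for j by (rule bseq_lt_1[OF J that])
 have scale: "ennreal (1 / h) * X \<le> ennreal \<eta> \<longleftrightarrow> X \<le> ennreal (\<eta> * h)" if h: "0 < h" and \<eta>: "0 \<le> \<eta>" for h \<eta> :: real and X
 proof
  assume "ennreal (1 / h) * X \<le> ennreal \<eta>"
  then have "ennreal h * (ennreal (1 / h) * X) \<le> ennreal h * ennreal \<eta>" by (rule mult_left_mono) simp
  moreover have "ennreal h * (ennreal (1 / h) * X) = X"
   using h by (simp add: mult.assoc[symmetric] ennreal_mult[symmetric])
  moreover have "ennreal h * ennreal \<eta> = ennreal (\<eta> * h)" using h \<eta> by (simp add: ennreal_mult[symmetric] mult.commute)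
  ultimately show "X \<le> ennreal (\<eta> * h)" by simp
 next
  assume "X \<le> ennreal (\<eta> * h)"
  then have "ennreal (1 / h) * X \<le> ennreal (1 / h) * ennreal (\<eta> * h)" by (rule mult_left_mono) simp
  also have "\<dots> = ennreal \<eta>" using h \<eta> by (simp add: ennreal_mult[symmetric])
  finally show "ennreal (1 / h) * X \<le> ennreal \<eta>" .
 qed
 have I: "?I \<theta> h \<delta> \<le> ennreal c \<longleftrightarrow> (\<forall>F. finite F \<and> F \<subseteq> {k\<in>J. a k \<in> thin_box \<theta> h \<delta>} \<longrightarrow> (\<Sum>k\<in>F. 1 - cmod (a k)) \<le> c)" if "0 \<le> c" for \<theta> h \<delta> c
  by (rule infsum_ennreal_le_iff) (use aj that in \<open>auto intro: less_imp_le\<close>)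
 have sup: "?S \<delta> \<le> ennreal \<eta> \<longleftrightarrow> (\<forall>\<theta> h F. 0 < h \<and> finite F \<and> F \<subseteq> J \<and> (\<forall>k\<in>F. a k \<in> thin_box \<theta> h \<delta>) \<longrightarrow> (\<Sum>k\<in>F. 1 - cmod (a k)) \<le> \<eta> * h)"
  if \<eta>: "0 \<le> \<eta>" for \<delta> \<eta>
 proof -
  have "?S \<delta> \<le> ennreal \<eta> \<longleftrightarrow> (\<forall>\<theta>. \<forall>h\<in>{0<..}. ennreal (1 / h) * ?I \<theta> h \<delta> \<le> ennreal \<eta>)" by (simp add: SUP_le_iff)
  also have "\<dots> \<longleftrightarrow> (\<forall>\<theta>. \<forall>h\<in>{0<..}. \<forall>F. finite F \<and> F \<subseteq> {k\<in>J. a k \<in> thin_box \<theta> h \<delta>} \<longrightarrow> (\<Sum>k\<in>F. 1 - cmod (a k)) \<le> \<eta> * h)"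
  proof (rule all_cong1, rule ball_cong[OF refl])
   fix \<theta> h :: real assume "h \<in> {0<..}"
   then have h: "0 < h" by simp
   have c: "0 \<le> \<eta> * h" using h \<eta> by simp
   show "ennreal (1 / h) * ?I \<theta> h \<delta> \<le> ennreal \<eta> \<longleftrightarrow> (\<forall>F. finite F \<and> F \<subseteq> {k\<in>J. a k \<in> thin_box \<theta> h \<delta>} \<longrightarrow> (\<Sum>k\<in>F. 1 - cmod (a k)) \<le> \<eta> * h)"
    unfolding scale[OF h \<eta>] I[OF c] ..
  qed
  also have "\<dots> \<longleftrightarrow> (\<forall>\<theta> h F. 0 < h \<and> finite F \<and> F \<subseteq> J \<and> (\<forall>k\<in>F. a k \<in> thin_box \<theta> h \<delta>) \<longrightarrow> (\<Sum>k\<in>F. 1 - cmod (a k)) \<le> \<eta> * h)"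
  proof -
   have sb: "F \<subseteq> {k\<in>J. a k \<in> thin_box \<theta> h \<delta>} \<longleftrightarrow> F \<subseteq> J \<and> (\<forall>k\<in>F. a k \<in> thin_box \<theta> h \<delta>)" for F \<theta> h by auto
   show ?thesis unfolding sb Ball_def greaterThan_iff by meson
  qed
  finally show ?thesis .
 qed
 \<comment> \<open>A thinner box is contained in a thicker one, so a bound for one \<delta>0 holds
   for all smaller \<delta>, as a limit at 0 requires.\<close>
 have mono: "x \<in> thin_box \<theta> h \<delta>'" if "x \<in> thin_box \<theta> h \<delta>" "\<delta> \<le> \<delta>'" "0 < h" for x \<theta> h \<delta> \<delta>'
 proof -
  have "\<delta> * h \<le> \<delta>' * h" using that by (intro mult_right_mono) auto
  then show ?thesis using that(1) unfolding thin_box_def by force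
 qed
 show ?thesis unfolding ennreal_tendsto_0_iff csm_def
 proof (intro iffI allI impI)
  fix \<eta> :: real assume H: "\<forall>\<eta>>0. eventually (\<lambda>\<delta>. ?S \<delta> \<le> ennreal \<eta>) (at_right 0)" and \<eta>: "\<eta> > 0"
  from H[rule_format, OF \<eta>] obtain b where b: "0 < b" "\<And>t. 0 < t ==> t < b ==> ?S t \<le> ennreal \<eta>"
   unfolding eventually_at_right_field by blast
  have "?S (b / 2) \<le> ennreal \<eta>" using b by simp
  then show "\<exists>\<delta>>0. \<forall>\<theta> h F. 0 < h \<and> finite F \<and> F \<subseteq> J \<and> (\<forall>k\<in>F. a k \<in> thin_box \<theta> h \<delta>) \<longrightarrow> (\<Sum>k\<in>F. 1 - cmod (a k)) \<le> \<eta> * h"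
   unfolding sup[OF less_imp_le[OF \<eta>]] using b(1) by (intro exI[of _ "b / 2"] conjI) simp_all
 next
  fix \<eta> :: real assume H: "\<forall>\<eta>>0. \<exists>\<delta>>0. \<forall>\<theta> h F. 0 < h \<and> finite F \<and> F \<subseteq> J \<and> (\<forall>k\<in>F. a k \<in> thin_box \<theta> h \<delta>) \<longrightarrow> (\<Sum>k\<in>F. 1 - cmod (a k)) \<le> \<eta> * h" and \<eta>: "\<eta> > 0"
  from H[rule_format, OF \<eta>] obtain \<delta>0 where \<delta>0: "\<delta>0 > 0" "\<forall>\<theta> h F. 0 < h \<and> finite F \<and> F \<subseteq> J \<and> (\<forall>k\<in>F. a k \<in> thin_box \<theta> h \<delta>0) \<longrightarrow> (\<Sum>k\<in>F. 1 - cmod (a k)) \<le> \<eta> * h"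
   by (elim exE conjE)
  show "eventually (\<lambda>\<delta>. ?S \<delta> \<le> ennreal \<eta>) (at_right 0)" unfolding eventually_at_right_field
  proof (intro exI[of _ \<delta>0] conjI allI impI \<delta>0(1))
   fix \<delta> :: real assume \<delta>: "0 < \<delta>" "\<delta> < \<delta>0"
   show "?S \<delta> \<le> ennreal \<eta>" unfolding sup[OF less_imp_le[OF \<eta>]]
   proof (intro allI impI)
    fix \<theta> h F assume *: "0 < h \<and> finite F \<and> F \<subseteq> J \<and> (\<forall>k\<in>F. a k \<in> thin_box \<theta> h \<delta>)"
    then have "\<forall>k\<in>F. a k \<in> thin_box \<theta> h \<delta>0" using mono[of _ \<theta> h \<delta> \<delta>0] \<delta> by simp
    then show "(\<Sum>k\<in>F. 1 - cmod (a k)) \<le> \<eta> * h" using spec[OF spec[OF spec[OF \<delta>0(2), of \<theta>], of h], of F] * by simp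
   qed
  qed
 qed
qed

theorem theorem1p7:
 fixes \<Theta> :: "complex \<Rightarrow> complex" and J :: "nat set" and a :: "nat \<Rightarrow> complex"
 assumes "blaschke_product \<Theta> J a"
 defines "cond_a \<equiv> \<Theta> \<in> P_class"
  and "cond_b \<equiv> ((\<lambda>t. SUP z\<in>unit_disc. S_sum J a t z) \<longlongrightarrow> 0) (at_left 1)"
  and "cond_c \<equiv> ((\<lambda>\<delta>. SUP \<theta>. SUP h\<in>{0<..}.
      ennreal (1 / h) * (\<Sum>\<^sub>\<infinity>k\<in>{k\<in>J. a k \<in> thin_box \<theta> h \<delta>}. ennreal (1 - cmod (a k)))) \<longlongrightarrow> 0)
      (at_right 0)"
  and "cond_d \<equiv> (\<forall>\<Phi>. inner_function \<Phi> \<and> Hinf_dvd \<Phi> \<Theta> \<longrightarrow> SIP \<Phi>)"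
 shows "(cond_a \<longleftrightarrow> cond_b) \<and> (cond_b \<longleftrightarrow> cond_c) \<and> (cond_c \<longleftrightarrow> cond_d)"
proof -
 have "bseq J a \<and> (\<exists>c. cmod c = 1 \<and> (\<forall>z\<in>unit_disc. \<Theta> z = c * BP J a z))"
  using assms(1) unfolding blaschke_product_iff .
 then obtain c where J: "bseq J a" and c: "cmod c = 1" and e0: "\<forall>z\<in>unit_disc. \<Theta> z = c * BP J a z" by (elim conjE exE)
 have e: "\<Theta> z = c * BP J a z" if "cmod z < 1" for z using e0 that by simp
 have aj: "cmod (a j) < 1" if "j \<in> J" for j by (rule bseq_lt_1[OF J that])
 have 1: "cond_a \<longleftrightarrow> bsm J a" unfolding cond_a_def
  using P_class_imp_bsm[OF J c e] bsm_imp_P_class[OF J _ c e] by blast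
 have 2: "cond_b \<longleftrightarrow> bsm J a" unfolding cond_b_def by (rule S_sum_limit_iff_bsm[OF J])
 have "bsm J a" if "csm J a" by (rule csm_imp_bsm[OF that]) (rule aj)
 moreover have "csm J a" if "bsm J a" by (rule bsm_imp_csm[OF that J])
 ultimately have "csm J a \<longleftrightarrow> bsm J a" by blast
 then have 3: "cond_c \<longleftrightarrow> bsm J a" unfolding cond_c_def thin_box_limit_iff_csm[OF J] .
 have 4: "cond_d \<longleftrightarrow> bsm J a" unfolding cond_d_def
  using SIP_imp_bsm[OF J c e] bsm_imp_SIP[OF J _ c e] by blast
 show ?thesis using 1 2 3 4 by blast
qed

end
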